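(* Let $\nu>0$ and let $D\subset\mathbb{R}^2$ be a bounded domain with smooth boundary. Let $u_0\in H(D)$ and let $u\in C^0([0,\infty);H_w(D))\cap L^2((0,\infty);V(D))$ be the unique weak solution of the $2\frac12$-dimensional incompressible Navier--Stokes equations with viscosity $\nu$, zero forcing and initial data $u_0$. Fix $L>0$ and set $C=D\times(0,L)$. Let $v_0\in H(C)$ and let $v\in L^\infty((0,\infty);H(C))\cap L^2((0,\infty);V(C))$ be a Leray--Hopf weak solution of the three-dimensional incompressible Navier--Stokes equations in $C$ with viscosity $\nu$, zero forcing and initial data $v_0$. Then, regarding $u$ and $u_0$ as $x_3$-independent vector fields on $C$, $$\|v-u\|_{L^2(C)}^2(t)\le \|v_0-u_0\|_{L^2(C)}^2\,\exp\left(\frac{27}{64\nu^4}\|u_0\|_{L^2(D)}^4\right)\quad\text{for all } t\ge 0.$$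
   Context: The Navier--Stokes equations with viscosity $\nu>0$ and zero forcing are $\partial_t u+(u\cdot\nabla)u=-\nabla p+\nu\Delta u$, $\operatorname{div}u=0$. Spaces on the periodic cylinder $C=D\times(0,L)$: let $\mathcal{D}(C)$ be the space of $C^\infty$ $\mathbb{R}^3$-valued fields that are $L$-periodic in the vertical variable $x_3$ and compactly supported in $D$ in the horizontal variables $(x_1,x_2)$. $H(C)$ and $V(C)$ are the closures of the divergence-free fields in $\mathcal{D}(C)$ in the $L^2(C)$ and $H^1(C)$ norms, respectively. (So elements of $V(C)$ satisfy the no-slip condition on $\partial D\times(0,L)$ and are periodic in $x_3$.) $H_w$ denotes $H$ endowed with the weak $L^2$ topology. Spaces on $D$: $H(D)$ and $V(D)$ are the closures in the $L^2(D)$ and $H^1(D)$ norms of the fields $\phi=(\phi_1,\phi_2,\phi_3)\in C_c^\infty(D;\mathbb{R}^3)$ with $\partial_{x_1}\phi_1+\partial_{x_2}\phi_2=0$. These are the $x_3$-independent counterparts of $H(C)$, $V(C)$. Leray--Hopf weak solution on $\Omega=C$ with initial data $v_0\in H(\Omega)$ and zero forcing: a field $v\in C^0([0,\infty);H_w(\Omega))\cap L^\infty((0,\infty);H(\Omega))\cap L^2_{\mathrm{loc}}([0,\infty);V(\Omega))$ such that (1) for every $\phi\in C_c^\infty([0,\infty);\mathcal{D}(\Omega))$ with $\operatorname{div}\phi=0$, $$\int_0^\infty\!\!\int_\Omega\{-\partial_t\phi\cdot v-[(v\cdot\nabla)\phi]\cdot v+\nu\nabla v:\nabla\phi\}\,dx\,dt-\int_\Omega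 v_0\cdot\phi(0,x)\,dx=0,$$ where $A:B=\sum_{i,j}a_{ij}b_{ij}$; (2) for every $t>0$, $\|v(t,\cdot)\|_{L^2(\Omega)}^2+2\nu\int_0^t\|\nabla v(s,\cdot)\|_{L^2(\Omega)}^2\,ds\le\|v_0\|_{L^2(\Omega)}^2$. A weak solution of the $2\frac12$-dimensional Navier--Stokes equations with data $u_0\in H(D)$ is a three-component field $u=u(t,x_1,x_2)$, independent of $x_3$, satisfying the analogues of (1) and (2) on $D$ with $x_3$-independent test fields (and $\partial_{x_3}\equiv 0$). Existence and uniqueness of this solution are known. *)

theory Defs
  imports "HOL-Analysis.Analysis"
begin

section \<open>Smooth functions and smooth bounded domains\<close>

text \<open>Derivatives are taken within \<open>S\<close>, so that smoothness up to the initial time can be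
  expressed with \<open>S = {0..} \<times> UNIV\<close>. Only open sets and this half space are used below; there the
  derivative within \<open>S\<close> is unique.\<close>

fun Ck_on :: "nat \<Rightarrow> ('a::euclidean_space \<Rightarrow> 'b::real_normed_vector) \<Rightarrow> 'a set \<Rightarrow> bool" where
  "Ck_on 0 f S \<longleftrightarrow> continuous_on S f"
| "Ck_on (Suc k) f S \<longleftrightarrow> f differentiable_on S \<and>
     (\<forall>h. Ck_on k (\<lambda>x. frechet_derivative f (at x within S) h) S)"

definition smooth_on :: "('a::euclidean_space \<Rightarrow> 'b::real_normed_vector) \<Rightarrow> 'a set \<Rightarrow> bool" where
  "smooth_on f S \<longleftrightarrow> (\<forall>k. Ck_on k f S)"

text \<open>The boundary is smooth if, locally, the domain is the strict sublevel set of a smooth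
  function without critical points.\<close>

definition smooth_boundary :: "'a::euclidean_space set \<Rightarrow> bool" where
  "smooth_boundary D \<longleftrightarrow>
     (\<forall>p \<in> frontier D. \<exists>U (\<rho> :: 'a \<Rightarrow> real). open U \<and> p \<in> U \<and> smooth_on \<rho> U \<and>
        (\<forall>x \<in> U. \<exists>h. frechet_derivative \<rho> (at x) h \<noteq> 0) \<and>
        D \<inter> U = {x \<in> U. \<rho> x < 0})"

definition bounded_smooth_domain :: "'a::euclidean_space set \<Rightarrow> bool" where
  "bounded_smooth_domain D \<longleftrightarrow>
     D \<noteq> {} \<and> open D \<and> connected D \<and> bounded D \<and> smooth_boundary D"

section \<open>\<open>L\<^sup>2\<close> and \<open>H\<^sup>1\<close>\<close>

text \<open>Elements of the function spaces are represented by functions, not by classes modulo null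
  sets; every notion below depends only on the values almost everywhere in \<open>\<Omega>\<close>.\<close>

definition L2 :: "(real^'n) set \<Rightarrow> (real^'n \<Rightarrow> 'b::euclidean_space) set" where
  "L2 \<Omega> = {f. f \<in> borel_measurable (lebesgue_on \<Omega>) \<and>
              integrable (lebesgue_on \<Omega>) (\<lambda>x. (norm (f x))\<^sup>2)}"

definition L2_norm :: "(real^'n) set \<Rightarrow> (real^'n \<Rightarrow> 'b::euclidean_space) \<Rightarrow> real" where
  "L2_norm \<Omega> f = sqrt (\<integral>x. (norm (f x))\<^sup>2 \<partial>lebesgue_on \<Omega>)"

definition test_functions :: "(real^'n) set \<Rightarrow> (real^'n \<Rightarrow> real) set" where
  "test_functions \<Omega> =
     {\<psi>. smooth_on \<psi> UNIV \<and> (\<exists>K. compact K \<and> K \<subseteq> \<Omega> \<and> (\<forall>x. x \<notin> K \<longrightarrow> \<psi> x = 0))}"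

text \<open>As for \<^const>\<open>jacobian\<close>, the entry \<open>G x $ i $ j\<close> is the \<open>j\<close>-th partial derivative of the
  \<open>i\<close>-th component.\<close>

definition has_weak_gradient ::
    "(real^'n) set \<Rightarrow> (real^'n \<Rightarrow> real^'m) \<Rightarrow> (real^'n \<Rightarrow> real^'n^'m) \<Rightarrow> bool" where
  "has_weak_gradient \<Omega> f G \<longleftrightarrow> G \<in> L2 \<Omega> \<and>
     (\<forall>\<psi> \<in> test_functions \<Omega>. \<forall>i j.
        (\<integral>x. f x $ i * frechet_derivative \<psi> (at x) (axis j 1) \<partial>lebesgue_on \<Omega>)
        = - (\<integral>x. G x $ i $ j * \<psi> x \<partial>lebesgue_on \<Omega>))"

text \<open>Unique up to null sets whenever it exists.\<close>

definition weak_gradient :: "(real^'n) set \<Rightarrow> (real^'n \<Rightarrow> real^'m) \<Rightarrow> real^'n \<Rightarrow> real^'n^'m" where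
  "weak_gradient \<Omega> f = (SOME G. has_weak_gradient \<Omega> f G)"

definition H1 :: "(real^'n) set \<Rightarrow> (real^'n \<Rightarrow> real^'m) set" where
  "H1 \<Omega> = {f \<in> L2 \<Omega>. \<exists>G. has_weak_gradient \<Omega> f G}"

text \<open>The norm of \<^typ>\<open>real^'n^'m\<close> is the Frobenius norm.\<close>

definition H1_norm :: "(real^'n) set \<Rightarrow> (real^'n \<Rightarrow> real^'m) \<Rightarrow> real" where
  "H1_norm \<Omega> f = sqrt ((L2_norm \<Omega> f)\<^sup>2 + (L2_norm \<Omega> (weak_gradient \<Omega> f))\<^sup>2)"

definition L2_closure :: "(real^'n) set \<Rightarrow> (real^'n \<Rightarrow> real^'m) set \<Rightarrow> (real^'n \<Rightarrow> real^'m) set" where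
  "L2_closure \<Omega> S = {f \<in> L2 \<Omega>. \<forall>\<epsilon>>0. \<exists>\<phi>\<in>S. L2_norm \<Omega> (\<lambda>x. \<phi> x - f x) < \<epsilon>}"

definition H1_closure :: "(real^'n) set \<Rightarrow> (real^'n \<Rightarrow> real^'m) set \<Rightarrow> (real^'n \<Rightarrow> real^'m) set" where
  "H1_closure \<Omega> S = {f \<in> H1 \<Omega>. \<forall>\<epsilon>>0. \<exists>\<phi>\<in>S. H1_norm \<Omega> (\<lambda>x. \<phi> x - f x) < \<epsilon>}"

section \<open>Function spaces on the cross section and on the periodic cylinder\<close>

definition horiz :: "real^3 \<Rightarrow> real^2" where
  "horiz x = vector [x $ 1, x $ 2]"

definition cylinder :: "(real^2) set \<Rightarrow> real \<Rightarrow> (real^3) set" where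
  "cylinder D L = {x. horiz x \<in> D \<and> 0 < x $ 3 \<and> x $ 3 < L}"

text \<open>Fields whose (horizontal) support lies in the set \<open>K\<close>. Periodic fields are defined on the
  whole space and later restricted to the cylinder.\<close>

definition cyl_fields :: "real \<Rightarrow> (real^2) set \<Rightarrow> (real^3 \<Rightarrow> real^3) set" where
  "cyl_fields L K =
     {\<phi>. smooth_on \<phi> UNIV \<and> (\<forall>x. \<phi> (x + L *\<^sub>R axis 3 1) = \<phi> x) \<and> (\<forall>x. horiz x \<notin> K \<longrightarrow> \<phi> x = 0)}"

definition plane_fields :: "(real^2) set \<Rightarrow> (real^2 \<Rightarrow> real^3) set" where
  "plane_fields K = {\<phi>. smooth_on \<phi> UNIV \<and> (\<forall>x. x \<notin> K \<longrightarrow> \<phi> x = 0)}"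

definition div_free3 :: "(real^3 \<Rightarrow> real^3) \<Rightarrow> bool" where
  "div_free3 \<phi> \<longleftrightarrow> (\<forall>x. trace (jacobian \<phi> (at x)) = 0)"

definition div_free2 :: "(real^2 \<Rightarrow> real^3) \<Rightarrow> bool" where
  "div_free2 \<phi> \<longleftrightarrow> (\<forall>x. jacobian \<phi> (at x) $ 1 $ 1 + jacobian \<phi> (at x) $ 2 $ 2 = 0)"

definition smooth_C :: "(real^2) set \<Rightarrow> real \<Rightarrow> (real^3 \<Rightarrow> real^3) set" where
  "smooth_C D L = {\<phi>. \<exists>K. compact K \<and> K \<subseteq> D \<and> \<phi> \<in> cyl_fields L K}"

definition smooth_D :: "(real^2) set \<Rightarrow> (real^2 \<Rightarrow> real^3) set" where
  "smooth_D D = {\<phi>. \<exists>K. compact K \<and> K \<subseteq> D \<and> \<phi> \<in> plane_fields K}"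

definition H_C :: "(real^2) set \<Rightarrow> real \<Rightarrow> (real^3 \<Rightarrow> real^3) set" where
  "H_C D L = L2_closure (cylinder D L) {\<phi> \<in> smooth_C D L. div_free3 \<phi>}"

definition V_C :: "(real^2) set \<Rightarrow> real \<Rightarrow> (real^3 \<Rightarrow> real^3) set" where
  "V_C D L = H1_closure (cylinder D L) {\<phi> \<in> smooth_C D L. div_free3 \<phi>}"

definition H_D :: "(real^2) set \<Rightarrow> (real^2 \<Rightarrow> real^3) set" where
  "H_D D = L2_closure D {\<phi> \<in> smooth_D D. div_free2 \<phi>}"

definition V_D :: "(real^2) set \<Rightarrow> (real^2 \<Rightarrow> real^3) set" where
  "V_D D = H1_closure D {\<phi> \<in> smooth_D D. div_free2 \<phi>}"

section \<open>Spaces of time-dependent fields\<close>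

text \<open>A time-dependent field is a curve \<open>v\<close> of (representatives of) elements of \<open>L\<^sup>2\<close>. As \<open>L\<^sup>2\<close>
  and its closed subspaces are separable, Bochner measurability amounts, by Pettis' theorem, to
  measurability of all pairings with \<open>L\<^sup>2\<close> functions; since these are dense in the dual of
  \<open>V\<close>, this also covers curves in \<open>V\<close>.\<close>

definition bochner_meas ::
    "(real^'n) set \<Rightarrow> real set \<Rightarrow> (real \<Rightarrow> real^'n \<Rightarrow> real^3) \<Rightarrow> bool" where
  "bochner_meas \<Omega> I v \<longleftrightarrow>
     (\<forall>w \<in> L2 \<Omega>. (\<lambda>t. \<integral>x. v t x \<bullet> w x \<partial>lebesgue_on \<Omega>) \<in> borel_measurable (lebesgue_on I))"

definition C0_weak ::
    "(real^'n) set \<Rightarrow> (real^'n \<Rightarrow> real^3) set \<Rightarrow> (real \<Rightarrow> real^'n \<Rightarrow> real^3) set" where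
  "C0_weak \<Omega> H = {v. (\<forall>t\<ge>0. v t \<in> H) \<and>
     (\<forall>w \<in> L2 \<Omega>. continuous_on {0..} (\<lambda>t. \<integral>x. v t x \<bullet> w x \<partial>lebesgue_on \<Omega>))}"

definition Linf_time ::
    "(real^'n) set \<Rightarrow> real set \<Rightarrow> (real^'n \<Rightarrow> real^3) set \<Rightarrow> (real \<Rightarrow> real^'n \<Rightarrow> real^3) set" where
  "Linf_time \<Omega> I H = {v. bochner_meas \<Omega> I v \<and> (AE t in lebesgue_on I. v t \<in> H) \<and>
     (\<exists>M. AE t in lebesgue_on I. L2_norm \<Omega> (v t) \<le> M)}"

definition L2_time ::
    "(real^'n) set \<Rightarrow> real set \<Rightarrow> (real^'n \<Rightarrow> real^3) set \<Rightarrow> (real \<Rightarrow> real^'n \<Rightarrow> real^3) set" where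
  "L2_time \<Omega> I V = {v. bochner_meas \<Omega> I v \<and> (AE t in lebesgue_on I. v t \<in> V) \<and>
     integrable (lebesgue_on I) (\<lambda>t. (H1_norm \<Omega> (v t))\<^sup>2)}"

definition L2_loc_time ::
    "(real^'n) set \<Rightarrow> (real^'n \<Rightarrow> real^3) set \<Rightarrow> (real \<Rightarrow> real^'n \<Rightarrow> real^3) set" where
  "L2_loc_time \<Omega> V = {v. \<forall>T>0. v \<in> L2_time \<Omega> {0<..<T} V}"

text \<open>The smooth, compactly supported curves from \<open>[0,\<infinity>)\<close> into the union of the spaces \<open>X K\<close>, where
  \<open>K\<close> ranges over the compact subsets of \<open>D\<close>. The support need not avoid the time \<open>0\<close>, and it
  lies in one compact \<open>K\<close> for all times.\<close>

definition Cc_inf_time ::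
    "(real^2) set \<Rightarrow> ((real^2) set \<Rightarrow> (real^'n \<Rightarrow> real^3) set) \<Rightarrow> (real \<Rightarrow> real^'n \<Rightarrow> real^3) set" where
  "Cc_inf_time D X =
     {\<phi>. smooth_on (\<lambda>(t, x). \<phi> t x) ({0..} \<times> UNIV) \<and>
         (\<exists>K. compact K \<and> K \<subseteq> D \<and> (\<forall>t\<ge>0. \<phi> t \<in> X K)) \<and>
         (\<exists>T. \<forall>t\<ge>T. \<forall>x. \<phi> t x = 0)}"

section \<open>Weak solutions\<close>

text \<open>In both weak formulations \<open>jacobian \<phi> *v v\<close> is \<open>(v \<cdot> \<nabla>)\<phi>\<close>, and the inner product of
  matrices is \<open>A : B\<close>. On the cross section, \<open>\<partial>\<^sub>3 = 0\<close> leaves only the horizontal components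
  of the advecting field.\<close>

definition weak_form_C ::
    "(real^2) set \<Rightarrow> real \<Rightarrow> real \<Rightarrow> (real^3 \<Rightarrow> real^3) \<Rightarrow> (real \<Rightarrow> real^3 \<Rightarrow> real^3) \<Rightarrow> bool" where
  "weak_form_C D L \<nu> v0 v \<longleftrightarrow>
     (\<forall>\<phi> \<in> Cc_inf_time D (cyl_fields L). (\<forall>t\<ge>0. div_free3 (\<phi> t)) \<longrightarrow>
        (\<integral>t. (\<integral>x.
            - (vector_derivative (\<lambda>s. \<phi> s x) (at t within {0..}) \<bullet> v t x)
            - (jacobian (\<phi> t) (at x) *v v t x) \<bullet> v t x
            + \<nu> * (weak_gradient (cylinder D L) (v t) x \<bullet> jacobian (\<phi> t) (at x))
          \<partial>lebesgue_on (cylinder D L)) \<partial>lebesgue_on {0<..})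
        - (\<integral>x. v0 x \<bullet> \<phi> 0 x \<partial>lebesgue_on (cylinder D L)) = 0)"

definition weak_form_D ::
    "(real^2) set \<Rightarrow> real \<Rightarrow> (real^2 \<Rightarrow> real^3) \<Rightarrow> (real \<Rightarrow> real^2 \<Rightarrow> real^3) \<Rightarrow> bool" where
  "weak_form_D D \<nu> u0 u \<longleftrightarrow>
     (\<forall>\<phi> \<in> Cc_inf_time D plane_fields. (\<forall>t\<ge>0. div_free2 (\<phi> t)) \<longrightarrow>
        (\<integral>t. (\<integral>x.
            - (vector_derivative (\<lambda>s. \<phi> s x) (at t within {0..}) \<bullet> u t x)
            - (jacobian (\<phi> t) (at x) *v horiz (u t x)) \<bullet> u t x
            + \<nu> * (weak_gradient D (u t) x \<bullet> jacobian (\<phi> t) (at x))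
          \<partial>lebesgue_on D) \<partial>lebesgue_on {0<..})
        - (\<integral>x. u0 x \<bullet> \<phi> 0 x \<partial>lebesgue_on D) = 0)"

definition energy_inequality ::
    "(real^'n) set \<Rightarrow> real \<Rightarrow> (real^'n \<Rightarrow> real^3) \<Rightarrow> (real \<Rightarrow> real^'n \<Rightarrow> real^3) \<Rightarrow> bool" where
  "energy_inequality \<Omega> \<nu> v0 v \<longleftrightarrow>
     (\<forall>t>0. (L2_norm \<Omega> (v t))\<^sup>2
        + 2 * \<nu> * (\<integral>s. (L2_norm \<Omega> (weak_gradient \<Omega> (v s)))\<^sup>2 \<partial>lebesgue_on {0..t})
        \<le> (L2_norm \<Omega> v0)\<^sup>2)"

definition leray_hopf_solution ::
    "(real^2) set \<Rightarrow> real \<Rightarrow> real \<Rightarrow> (real^3 \<Rightarrow> real^3) \<Rightarrow> (real \<Rightarrow> real^3 \<Rightarrow> real^3) \<Rightarrow> bool" where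
  "leray_hopf_solution D L \<nu> v0 v \<longleftrightarrow>
     v \<in> C0_weak (cylinder D L) (H_C D L) \<and>
     v \<in> Linf_time (cylinder D L) {0<..} (H_C D L) \<and>
     v \<in> L2_loc_time (cylinder D L) (V_C D L) \<and>
     weak_form_C D L \<nu> v0 v \<and>
     energy_inequality (cylinder D L) \<nu> v0 v"

text \<open>Weak solutions of the \<open>2\<close>-and-a-half-dimensional equations.\<close>

definition weak_solution_2half ::
    "(real^2) set \<Rightarrow> real \<Rightarrow> (real^2 \<Rightarrow> real^3) \<Rightarrow> (real \<Rightarrow> real^2 \<Rightarrow> real^3) \<Rightarrow> bool" where
  "weak_solution_2half D \<nu> u0 u \<longleftrightarrow>
     u \<in> C0_weak D (H_D D) \<and>
     u \<in> L2_time D {0<..} (V_D D) \<and>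
     weak_form_D D \<nu> u0 u \<and>
     energy_inequality D \<nu> u0 u"

end

theory Submission
  imports Defs
begin

text \<open>The difference \<open>w = v - u\<close> formally satisfies \<open>d/dt |w|\<^sup>2 + 2 \<nu> |\<nabla>w|\<^sup>2 \<le> 2 |b(w, w, u)|\<close>. Since \<open>u\<close> does
  not depend on \<open>x\<^sub>3\<close>, Ladyzhenskaya's inequality in the plane, applied to vertical integrals of \<open>|w|\<^sup>2\<close>,
  gives \<open>|b(w, w, u)|\<^sup>2 \<le> 2 |w| |\<nabla>w|\<^sup>3 |u| |\<nabla>u|\<close>. Young's and
  Gronwall's inequalities conclude, as the energy inequality bounds the integral of
  \<open>|u|\<^sup>2 |\<nabla>u|\<^sup>2\<close> by \<open>|u\<^sub>0|\<^sup>4 / (2 \<nu>)\<close>.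

  To justify this, \<open>u\<close> has to be used as a test field in the equation of \<open>v\<close> and conversely. Against
  fields independent of \<open>x\<^sub>3\<close> only the vertical average of \<open>v \<otimes> v\<close> matters, which is square integrable in
  space and time. Each equation can thus be tested with the other solution at a fixed time; integrating
  over the strip \<open>s < \<tau> < s + h\<close> of pairs of times and letting \<open>h\<close> tend to \<open>0\<close> yields the formula for the
  derivative of the inner product of \<open>v\<close> and \<open>u\<close>.\<close>

text \<open>The two equations can be tested with each other because integrating a divergence-free
  periodic field over the height gives a field that is divergence-free in the plane: periodicity
  removes the x_3-derivative. So \<open>u\<close> is tested with the vertical integral of
  \<open>v\<close>, and \<open>v\<close> with the lift of \<open>u\<close>. The energy inequalities
  control |v|^2 and |u|^2; only the cross term <v, u> needs an identity. Antisymmetry of the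
  trilinear form puts the derivative on \<open>w\<close>. The norms of \<open>u\<close> are taken on
  \<open>D\<close> and those of \<open>w\<close> on the cylinder, so no power of \<open>L\<close>
  survives. With X = |grad w| and a = |w| |u| |grad u|, Young's inequality splits 2 sqrt 2 X^(3/2)
  a^(1/2) into 2 \<nu> X^2, exactly the dissipation, and 27/(32 \<nu>^3) a^2. The factor 1/(2 \<nu>)
  from the energy of \<open>u\<close> turns 27/32 into 27/64. Fields are functions rather than
  classes, and curves are only weakly measurable in time. One family of finite-rank projections of
  L^2 serves for joint measurability, for the limit h -> 0, for density of continuous functions and
  for the fundamental lemma of the calculus of variations.\<close>

abbreviation (input) limseq :: "(nat => 'a::topological_space) => 'a => bool" (infixr "---->" 60) where
 "X ----> l \<equiv> X \<longlonglongrightarrow> l"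

abbreviation (input) grad :: "(real^'n => real^'m) => real^'n => real^'n^'m" where
 "grad f x \<equiv> jacobian f (at x)"

abbreviation (input) pd :: "'n => (real^'n => 'b::real_normed_vector) => real^'n => 'b" where
 "pd j f x \<equiv> frechet_derivative f (at x) (axis j 1)"

abbreviation (input) lift :: "(real^2 => 'b) => real^3 => 'b" where
 "lift g x \<equiv> g (horiz x)"

section \<open>Smooth functions\<close>

lemma Ck_on_cong:
 assumes "\<And>x. x \<in> S ==> f x = g x"
 shows "Ck_on k f S \<longleftrightarrow> Ck_on k g S"
 using assms
proof (induction k arbitrary: f g)
 case 0
 then show ?case by (simp cong: continuous_on_cong)
next
 case (Suc k)
 have hd: "(f has_derivative D) (at x within S) \<longleftrightarrow> (g has_derivative D) (at x within S)"
  if "x \<in> S" for x D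
  using that Suc.prems by (metis has_derivative_transform)
 then have fd: "frechet_derivative f (at x within S) = frechet_derivative g (at x within S)"
  if "x \<in> S" for x
  using that unfolding frechet_derivative_def by simp
 have "f differentiable_on S \<longleftrightarrow> g differentiable_on S"
  using hd unfolding differentiable_on_def differentiable_def by simp
 moreover have "Ck_on k (\<lambda>x. frechet_derivative f (at x within S) h) S \<longleftrightarrow>
   Ck_on k (\<lambda>x. frechet_derivative g (at x within S) h) S" for h
  by (rule Suc.IH) (simp add: fd)
 ultimately show ?case by simp
qed

text \<open>The derivative on the whole space is unique, so any explicit formula \<open>f'\<close>
  may stand for \<open>frechet_derivative\<close>. The closure rules below are inductions on
  \<open>k\<close> through this rule and never unfold the chosen derivative.\<close>

lemma Ck_on_SucI:
 assumes "\<And>x. (f has_derivative f' x) (at x)" and "\<And>h. Ck_on k (\<lambda>x. f' x h) UNIV"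
 shows "Ck_on (Suc k) f UNIV"
proof -
 have "frechet_derivative f (at x) = f' x" for x
  using frechet_derivative_at[OF assms(1)] by simp
 then show ?thesis
  using assms by (auto simp: differentiable_on_def differentiable_def)
qed

lemma Ck_on_SucD:
 assumes "Ck_on (Suc k) f UNIV"
 shows "(f has_derivative frechet_derivative f (at x)) (at x)"
  and "Ck_on k (\<lambda>x. frechet_derivative f (at x) h) UNIV"
 using assms frechet_derivative_works by (auto simp: differentiable_on_def)

lemma Ck_on_Suc_le: "Ck_on (Suc k) f UNIV ==> Ck_on k f UNIV"
proof (induction k arbitrary: f)
 case 0
 then show ?case
  by (simp add: differentiable_imp_continuous_on)
next
 case (Suc k)
 show ?case
 proof (rule Ck_on_SucI)
  show "(f has_derivative frechet_derivative f (at x)) (at x)" for x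
   by (rule Ck_on_SucD(1)[OF Suc.prems])
  show "Ck_on k (\<lambda>x. frechet_derivative f (at x) h) UNIV" for h
   by (rule Suc.IH) (rule Ck_on_SucD(2)[OF Suc.prems])
 qed
qed

lemma Ck_on_const: "Ck_on k (\<lambda>x. c) UNIV"
proof (induction k arbitrary: c)
 case (Suc k)
 show ?case
  by (rule Ck_on_SucI[where f' = "\<lambda>x h. 0"]) (use Suc in auto)
qed simp

lemma Ck_on_add:
 assumes "Ck_on k f UNIV" "Ck_on k g UNIV"
 shows "Ck_on k (\<lambda>x. f x + g x) UNIV"
 using assms
proof (induction k arbitrary: f g)
 case 0
 then show ?case by (simp add: continuous_on_add)
next
 case (Suc k)
 note f = Ck_on_SucD[OF Suc.prems(1)] and g = Ck_on_SucD[OF Suc.prems(2)]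
 show ?case
  by (rule Ck_on_SucI[OF has_derivative_add[OF f(1) g(1)] Suc.IH[OF f(2) g(2)]])
qed

text \<open>One product rule for multiplication, scaling and inner products. The Leibniz rule pairs
  one factor with the derivative of the other; the undifferentiated factor is needed at level
  \<open>k\<close>, which \<open>Ck_on_Suc_le\<close> provides.\<close>

lemma Ck_on_bilinear:
 assumes "bounded_bilinear B" "Ck_on k f UNIV" "Ck_on k g UNIV"
 shows "Ck_on k (\<lambda>x. B (f x) (g x)) UNIV"
 using assms(2,3)
proof (induction k arbitrary: f g)
 case 0
 then show ?case using assms(1) by (simp add: bounded_bilinear.continuous_on)
next
 case (Suc k)
 note f = Ck_on_SucD[OF Suc.prems(1)] and g = Ck_on_SucD[OF Suc.prems(2)]
 note fk = Ck_on_Suc_le[OF Suc.prems(1)] and gk = Ck_on_Suc_le[OF Suc.prems(2)]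
 show ?case
  by (rule Ck_on_SucI[OF bounded_bilinear.FDERIV[OF assms(1) f(1) g(1)]])
    (intro Ck_on_add Suc.IH fk gk f(2) g(2))
qed

lemma Ck_on_linear_comp:
 assumes "bounded_linear A" "Ck_on k f UNIV"
 shows "Ck_on k (\<lambda>x. A (f x)) UNIV"
 using assms(2)
proof (induction k arbitrary: f)
 case 0
 then show ?case
  using assms(1) by (simp add: bounded_linear.continuous_on)
next
 case (Suc k)
 note f = Ck_on_SucD[OF Suc.prems]
 show ?case
  by (rule Ck_on_SucI[OF bounded_linear.has_derivative[OF assms(1) f(1)] Suc.IH[OF f(2)]])
qed

lemma Ck_on_comp_affine:
 assumes "bounded_linear A" "Ck_on k f UNIV"
 shows "Ck_on k (\<lambda>x. f (A x + c)) UNIV"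
 using assms(2)
proof (induction k arbitrary: f)
 case 0
 then show ?case
  using continuous_on_compose2[of UNIV f UNIV "\<lambda>x. A x + c"] linear_continuous_on[OF assms(1)]
  by (simp add: continuous_on_add)
next
 case (Suc k)
 note f = Ck_on_SucD[OF Suc.prems]
 have "((\<lambda>x. A x + c) has_derivative A) (at x)" for x
  using assms(1) by (auto intro!: derivative_eq_intros bounded_linear_imp_has_derivative)
 from has_derivative_compose[OF this f(1)]
 show ?case
  by (rule Ck_on_SucI) (rule Suc.IH[OF f(2)])
qed

lemma Ck_on_comp_linear:
 assumes "bounded_linear A" "Ck_on k f UNIV"
 shows "Ck_on k (\<lambda>x. f (A x)) UNIV"
 using Ck_on_comp_affine[OF assms, of 0] by simp

text \<open>The derivative of 1/g is -(1/g) g' (1/g), in which 1/g occurs undifferentiated; the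
  induction on \<open>k\<close> therefore closes by the product rule.\<close>

lemma Ck_on_inverse:
 fixes g :: "'a::euclidean_space => real"
 assumes "Ck_on k g UNIV" "\<And>x. g x \<noteq> 0"
 shows "Ck_on k (\<lambda>x. inverse (g x)) UNIV"
 using assms(1)
proof (induction k)
 case 0
 then show ?case using assms(2) by (simp add: continuous_on_inverse)
next
 case (Suc k)
 note g = Ck_on_SucD[OF Suc.prems]
 have i: "Ck_on k (\<lambda>x. inverse (g x)) UNIV"
  by (rule Suc.IH) (rule Ck_on_Suc_le[OF Suc.prems])
 have "((\<lambda>x. inverse (g x)) has_derivative
   (\<lambda>h. (- 1) * (inverse (g x) * frechet_derivative g (at x) h * inverse (g x)))) (at x)" for x
  by (rule has_derivative_eq_rhs[OF Deriv.has_derivative_inverse[OF assms(2) g(1)]]) simp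
 then show ?case
  by (rule Ck_on_SucI)
    (intro Ck_on_bilinear[OF bounded_bilinear_mult] Ck_on_const i g(2))
qed

lemma Ck_on_prod:
 fixes g :: "'i => 'a::euclidean_space => real"
 assumes "finite I" "\<And>i. i \<in> I ==> Ck_on k (g i) UNIV"
 shows "Ck_on k (\<lambda>x. \<Prod>i\<in>I. g i x) UNIV"
 using assms
proof (induction I rule: finite_induct)
 case empty
 then show ?case by (simp add: Ck_on_const)
next
 case (insert i I)
 then show ?case
  by (simp del: Ck_on.simps add: Ck_on_bilinear[OF bounded_bilinear_mult])
qed

text \<open>Test fields in time are smooth within a half space, which is not open. If every point of
  \<open>S\<close> admits arbitrarily small moves along each basis direction inside
  \<open>S\<close>, the derivative within \<open>S\<close> is unique and equals that of the globally
  smooth function.\<close>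

lemma Ck_on_subset:
 assumes S: "\<And>x i e. x \<in> S ==> i \<in> Basis ==> 0 < e ==> \<exists>d. 0 < \<bar>d\<bar> \<and> \<bar>d\<bar> < e \<and> x + d *\<^sub>R i \<in> S"
  and f: "Ck_on k f UNIV"
 shows "Ck_on k f S"
 using f
proof (induction k arbitrary: f)
 case 0
 then show ?case using continuous_on_subset by auto
next
 case (Suc k)
 note f = Ck_on_SucD[OF Suc.prems]
 have w: "(f has_derivative frechet_derivative f (at x)) (at x within S)" for x
  by (rule has_derivative_at_withinI[OF f(1)])
 have "frechet_derivative f (at x within S) = frechet_derivative f (at x)" if "x \<in> S" for x
  using w[of x] frechet_derivative_works
  by (intro frechet_derivative_unique_within[OF _ w[of x] S[OF that]]) (auto simp: differentiable_def)
 then have "Ck_on k (\<lambda>x. frechet_derivative f (at x within S) h) S" for h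
  by (subst Ck_on_cong[where g = "\<lambda>x. frechet_derivative f (at x) h"])
    (auto intro: Suc.IH[OF f(2)])
 then show ?case
  using w by (auto simp: differentiable_on_def differentiable_def)
qed

lemma smooth_on_Ck: "smooth_on f S ==> Ck_on k f S"
 by (simp add: smooth_on_def)

lemma smooth_has_derivative:
 "smooth_on f UNIV ==> (f has_derivative frechet_derivative f (at x)) (at x)"
 using Ck_on_SucD(1)[of 0 f x] smooth_on_Ck[of f UNIV "Suc 0"] by blast

lemma smooth_frechet_derivative:
 "smooth_on f UNIV ==> smooth_on (\<lambda>x. frechet_derivative f (at x) h) UNIV"
 unfolding smooth_on_def using Ck_on_SucD(2)[of _ f h] by blast

lemma smooth_continuous_on: "smooth_on f UNIV ==> continuous_on S f"
 using smooth_on_Ck[of f UNIV 0] continuous_on_subset by auto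

lemma smooth_const: "smooth_on (\<lambda>x. c) UNIV"
 by (simp add: smooth_on_def Ck_on_const)

lemma smooth_add: "smooth_on f UNIV ==> smooth_on g UNIV ==> smooth_on (\<lambda>x. f x + g x) UNIV"
 by (simp add: smooth_on_def Ck_on_add)

lemma smooth_bilinear:
 "bounded_bilinear B ==> smooth_on f UNIV ==> smooth_on g UNIV ==> smooth_on (\<lambda>x. B (f x) (g x)) UNIV"
 by (simp add: smooth_on_def Ck_on_bilinear)

lemmas smooth_mult = smooth_bilinear[OF bounded_bilinear_mult]
lemmas smooth_scaleR = smooth_bilinear[OF bounded_bilinear_scaleR]

lemma smooth_diff:
 assumes "smooth_on f UNIV" "smooth_on g UNIV"
 shows "smooth_on (\<lambda>x. f x - g x) UNIV"
 using smooth_add[OF assms(1) smooth_scaleR[OF smooth_const assms(2)], of "-1"] by simp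

lemma smooth_linear_comp:
 "bounded_linear A ==> smooth_on f UNIV ==> smooth_on (\<lambda>x. A (f x)) UNIV"
 by (simp add: smooth_on_def Ck_on_linear_comp)

lemma smooth_comp_affine:
 "bounded_linear A ==> smooth_on f UNIV ==> smooth_on (\<lambda>x. f (A x + c)) UNIV"
 by (simp add: smooth_on_def Ck_on_comp_affine)

lemma smooth_comp_linear:
 "bounded_linear A ==> smooth_on f UNIV ==> smooth_on (\<lambda>x. f (A x)) UNIV"
 by (simp add: smooth_on_def Ck_on_comp_linear)

lemma smooth_prod:
 fixes g :: "'i => 'a::euclidean_space => real"
 shows "finite I ==> (\<And>i. i \<in> I ==> smooth_on (g i) UNIV) ==> smooth_on (\<lambda>x. \<Prod>i\<in>I. g i x) UNIV"
 by (simp add: smooth_on_def Ck_on_prod)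

text \<open>The functions \<open>exp (- 1 / x) / x ^ n\<close> are closed under differentiation up to linear
 combinations, which yields smoothness at \<open>0\<close> without computing higher derivatives.\<close>

definition flat_exp :: "nat => real => real" where
 "flat_exp n x = (if x \<le> 0 then 0 else exp (- (1 / x)) / x ^ n)"

text \<open>From the right, y = 1/x turns the claim into y^n / exp y -> 0; from the left the
  function is 0.\<close>

lemma flat_exp_tendsto_0: "(flat_exp n \<longlongrightarrow> 0) (at 0)"
proof -
 have "((\<lambda>y::real. y ^ n / exp y) \<longlongrightarrow> 0) at_top"
  by (rule tendsto_power_div_exp_0)
 then have "((\<lambda>x::real. (inverse x) ^ n / exp (inverse x)) \<longlongrightarrow> 0) (at_right 0)"
  by (rule filterlim_compose) (rule filterlim_inverse_at_top_right)
 then have r: "(flat_exp n \<longlongrightarrow> 0) (at_right 0)"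
  by (rule Lim_transform_eventually)
    (auto simp: flat_exp_def eventually_at_filter exp_minus field_simps inverse_eq_divide
     intro!: always_eventually)
 have l: "(flat_exp n \<longlongrightarrow> 0) (at_left 0)"
  by (rule Lim_transform_eventually[OF tendsto_const])
    (auto simp: flat_exp_def eventually_at_filter)
 show ?thesis
  using l r by (simp add: filterlim_split_at_real)
qed

lemma flat_exp_deriv:
 "(flat_exp n has_real_derivative (flat_exp (n + 2) x - n * flat_exp (n + 1) x)) (at x)"
proof (cases x "0::real" rule: linorder_cases)
 case less
 have "((\<lambda>x. 0) has_real_derivative 0) (at x)" by simp
 then have "(flat_exp n has_real_derivative 0) (at x)"
  by (rule has_field_derivative_transform_within_open[where S = "{..<0}"])
    (use less in \<open>auto simp: flat_exp_def\<close>)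
 then show ?thesis using less by (simp add: flat_exp_def)
next
 case greater
 have "((\<lambda>x. exp (- (1 / x)) / x ^ n) has_real_derivative
   (flat_exp (n + 2) x - n * flat_exp (n + 1) x)) (at x)"
  using greater
  apply (cases n)
   apply (auto intro!: derivative_eq_intros simp: flat_exp_def field_simps power2_eq_square)
  subgoal for m by (cases m) auto
  done
 then show ?thesis
  by (rule has_field_derivative_transform_within_open[where S = "{0<..}"])
    (use greater in \<open>auto simp: flat_exp_def\<close>)
next
 case equal
 \<comment> \<open>The difference quotient at 0 is \<open>flat_exp (Suc n)\<close> itself, whose
   limit is known.\<close>
 have "((\<lambda>h. (flat_exp n (0 + h) - flat_exp n 0) / h) \<longlongrightarrow> 0) (at 0)"
  by (rule Lim_transform_eventually[OF flat_exp_tendsto_0[of "Suc n"]])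
    (auto simp: flat_exp_def eventually_at_filter)
 then have "(flat_exp n has_real_derivative 0) (at 0)"
  by (simp add: DERIV_def)
 then show ?thesis by (simp add: equal flat_exp_def)
qed

lemma smooth_flat_exp: "smooth_on (flat_exp n) UNIV"
proof -
 have "Ck_on k (flat_exp n) UNIV" for k
 proof (induction k arbitrary: n)
  case 0
  then show ?case
   using DERIV_continuous_on[of UNIV "flat_exp n", OF DERIV_subset[OF flat_exp_deriv]] by simp
 next
  case (Suc k)
  have "(flat_exp n has_derivative
    (\<lambda>h. (flat_exp (n + 2) x + (- real n) * flat_exp (n + 1) x) * h)) (at x)" for x
   using flat_exp_deriv[of n x] by (simp add: has_field_derivative_def)
  then show ?case
   by (rule Ck_on_SucI)
     (intro Ck_on_bilinear[OF bounded_bilinear_mult] Ck_on_add Ck_on_const Suc)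
 qed
 then show ?thesis by (simp add: smooth_on_def)
qed

text \<open>The standard transition function between 0 and 1. At least one of x and 1 - x is
  positive, so the denominator never vanishes.\<close>

definition smooth_step :: "real => real" where
 "smooth_step x = flat_exp 0 x * inverse (flat_exp 0 x + flat_exp 0 (1 - x))"

lemma smooth_step_eq_0: "x \<le> 0 ==> smooth_step x = 0"
 and smooth_step_eq_1: "x \<ge> 1 ==> smooth_step x = 1"
 and smooth_step_nonneg: "smooth_step x \<ge> 0"
 and smooth_step_le_1: "smooth_step x \<le> 1"
 by (auto simp: smooth_step_def flat_exp_def field_simps add_pos_pos)

lemma smooth_smooth_step: "smooth_on smooth_step UNIV"
proof -
 have "flat_exp 0 x + flat_exp 0 (1 - x) > 0" for x
  by (auto simp: flat_exp_def add_pos_pos)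
 then have ne: "flat_exp 0 x + flat_exp 0 (1 - x) \<noteq> 0" for x
  by (metis less_irrefl)
 have a: "smooth_on (\<lambda>x. flat_exp 0 (1 - x)) UNIV"
  using smooth_comp_affine[OF bounded_linear_minus[OF bounded_linear_ident] smooth_flat_exp, of 0 1]
  by (simp add: algebra_simps)
 have "smooth_on (\<lambda>x. inverse (flat_exp 0 x + flat_exp 0 (1 - x))) UNIV"
  unfolding smooth_on_def
  by (intro allI Ck_on_inverse ne smooth_on_Ck smooth_add smooth_flat_exp a)
 then show ?thesis
  unfolding smooth_step_def[abs_def] by (intro smooth_mult smooth_flat_exp)
qed

text \<open>A smooth approximation, from below, of the indicator of the box with corners \<open>a\<close> and \<open>b\<close>;
 the shift by \<open>1\<close> makes its support a compact subset of the open box.\<close>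

definition box_bump :: "real => 'a::euclidean_space => 'a => 'a => real" where
 "box_bump m a b x =
   (\<Prod>i\<in>Basis. smooth_step (m * (x \<bullet> i - a \<bullet> i) - 1) * smooth_step (m * (b \<bullet> i - x \<bullet> i) - 1))"

lemma smooth_box_bump: "smooth_on (box_bump m a b) UNIV"
proof -
 have 1: "smooth_on (\<lambda>x. smooth_step (m * (x \<bullet> i - a \<bullet> i) - 1)) UNIV" for i
  using smooth_comp_affine[OF bounded_linear_const_mult[OF bounded_linear_inner_left] smooth_smooth_step,
   of m i "- m * (a \<bullet> i) - 1"]
  by (simp add: algebra_simps)
 have 2: "smooth_on (\<lambda>x. smooth_step (m * (b \<bullet> i - x \<bullet> i) - 1)) UNIV" for i
  using smooth_comp_affine[OF bounded_linear_const_mult[OF bounded_linear_inner_left] smooth_smooth_step,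
   of "- m" i "m * (b \<bullet> i) - 1"]
  by (simp add: algebra_simps)
 show ?thesis
  unfolding box_bump_def[abs_def] by (intro smooth_prod smooth_mult 1 2) simp
qed

lemma box_bump_nonneg: "0 \<le> box_bump m a b x"
 unfolding box_bump_def by (intro prod_nonneg) (simp add: smooth_step_nonneg)

lemma box_bump_le_1: "box_bump m a b x \<le> 1"
 unfolding box_bump_def
 by (intro prod_le_1) (simp add: smooth_step_nonneg smooth_step_le_1 mult_le_one)

lemma box_bump_support:
 assumes "x \<notin> cbox (a + (1 / m) *\<^sub>R One) (b - (1 / m) *\<^sub>R One)" "m > 0"
 shows "box_bump m a b x = 0"
proof -
 obtain i where i: "i \<in> Basis" "x \<bullet> i < a \<bullet> i + 1 / m \<or> b \<bullet> i - 1 / m < x \<bullet> i"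
  using assms(1) by (force simp: mem_box not_le inner_add_left inner_diff_left)
 then have "m * (x \<bullet> i - a \<bullet> i) - 1 \<le> 0 \<or> m * (b \<bullet> i - x \<bullet> i) - 1 \<le> 0"
  using assms(2) by (auto simp: field_simps)
 then have "smooth_step (m * (x \<bullet> i - a \<bullet> i) - 1) * smooth_step (m * (b \<bullet> i - x \<bullet> i) - 1) = 0"
  by (auto simp: smooth_step_eq_0)
 then show ?thesis unfolding box_bump_def using i(1) by (intro prod_zero) auto
qed

lemma shrunk_box_subset:
 assumes "m > 0"
 shows "cbox (a + (1 / m) *\<^sub>R One) (b - (1 / m) *\<^sub>R One) \<subseteq> box a (b :: 'a::euclidean_space)"
proof
 fix x :: 'a assume x: "x \<in> cbox (a + (1 / m) *\<^sub>R One) (b - (1 / m) *\<^sub>R One)"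
 have "a \<bullet> i < x \<bullet> i \<and> x \<bullet> i < b \<bullet> i" if "i \<in> Basis" for i
 proof -
  have "a \<bullet> i + 1 / m \<le> x \<bullet> i" "x \<bullet> i \<le> b \<bullet> i - 1 / m"
   using x that by (auto simp: mem_box inner_add_left inner_diff_left)
  moreover have "1 / m > 0" using assms by simp
  ultimately show ?thesis by linarith
 qed
 then show "x \<in> box a b" by (simp add: mem_box)
qed

lemma box_bump_eventually_1:
 assumes "x \<in> box a b"
 shows "eventually (\<lambda>n. box_bump (real (Suc n)) a b x = 1) sequentially"
proof -
 have ev: "eventually (\<lambda>n. smooth_step (real (Suc n) * c - 1) = 1) sequentially" if "c > 0" for c
 proof -
  \<comment> \<open>The value 1 is reached as soon as m c - 1 \<ge> 1, that is for m \<ge> 2 /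
    c.\<close>
  obtain k :: nat where k: "2 / c < real k" using reals_Archimedean2 by blast
  have "smooth_step (real (Suc n) * c - 1) = 1" if "n \<ge> k" for n
  proof (rule smooth_step_eq_1)
   have "2 / c \<le> real (Suc n)" using k that by linarith
   then show "1 \<le> real (Suc n) * c - 1" using \<open>c > 0\<close> by (simp add: field_simps)
  qed
  then show ?thesis unfolding eventually_sequentially by blast
 qed
 have "eventually (\<lambda>n. \<forall>i\<in>Basis. smooth_step (real (Suc n) * (x \<bullet> i - a \<bullet> i) - 1) = 1 \<and>
   smooth_step (real (Suc n) * (b \<bullet> i - x \<bullet> i) - 1) = 1) sequentially"
  using assms by (intro eventually_ball_finite ballI eventually_conj ev) (auto simp: mem_box)
 then show ?thesis
  by eventually_elim (simp add: box_bump_def)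
qed

section \<open>Square integrable functions\<close>

text \<open>Stated for an arbitrary measure, since the same calculus serves the cylinder, the cross
  section, time intervals and pairs of times. Functions are not identified modulo null sets, so the
  Hilbert space inequalities are derived directly for \<open>nrm\<close> and
  \<open>ip\<close>.\<close>

definition sq_int :: "'a measure => ('a => 'b::euclidean_space) => bool" where
 "sq_int M f \<longleftrightarrow> f \<in> borel_measurable M \<and> integrable M (\<lambda>x. (norm (f x))\<^sup>2)"

definition nrm :: "'a measure => ('a => 'b::euclidean_space) => real" where
 "nrm M f = sqrt (LINT x|M. (norm (f x))\<^sup>2)"

abbreviation ip :: "'a measure => ('a => 'b::euclidean_space) => ('a => 'b) => real" where
 "ip M f g \<equiv> (LINT x|M. f x \<bullet> g x)"

lemma L2_iff: "f \<in> L2 \<Omega> \<longleftrightarrow> sq_int (lebesgue_on \<Omega>) f"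
 by (simp add: L2_def sq_int_def)

lemma L2_norm_eq: "L2_norm \<Omega> f = nrm (lebesgue_on \<Omega>) f"
 by (simp add: L2_norm_def nrm_def)

abbreviation (input) dst :: "'a measure => ('a => 'b::euclidean_space) => ('a => 'b) => real" where
 "dst M f g \<equiv> nrm M (\<lambda>x. f x - g x)"

lemma nrm_nonneg: "0 \<le> nrm M f"
 by (simp add: nrm_def)

lemma nrm_sq: "(nrm M f)\<^sup>2 = (LINT x|M. (norm (f x))\<^sup>2)"
 by (simp add: nrm_def)

lemma sq_int_measurable: "sq_int M f ==> f \<in> borel_measurable M"
 and sq_int_integrable: "sq_int M f ==> integrable M (\<lambda>x. (norm (f x))\<^sup>2)"
 by (simp_all add: sq_int_def)

lemma sq_int_zero: "sq_int M (\<lambda>x. 0)"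
 by (simp add: sq_int_def)

lemma tendsto_zero_squeeze:
 fixes a b :: "nat => real"
 assumes "b ----> 0" "\<And>n. 0 \<le> a n" "\<And>n. a n \<le> b n"
 shows "a ----> 0"
 by (rule tendsto_sandwich[OF always_eventually always_eventually tendsto_const assms(1)])
   (use assms(2,3) in blast)+

lemma tendsto_zero_less:
 fixes a :: "nat => real"
 assumes "a ----> 0" "e > 0"
 shows "\<exists>K. \<forall>k\<ge>K. a k < e"
 using order_tendstoD(2)[OF assms] by (simp add: eventually_sequentially)

lemma two_mult_le_squares: "2 * (a * b) \<le> a\<^sup>2 + b\<^sup>2" for a b :: real
 using sum_squares_ge_zero[of "a - b" 0] by (simp add: power2_eq_square algebra_simps)

lemma sq_int_mult_norm:
 assumes "sq_int M f" "sq_int M g"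
 shows "integrable M (\<lambda>x. norm (f x) * norm (g x))"
proof (rule Bochner_Integration.integrable_bound)
 show "integrable M (\<lambda>x. (norm (f x))\<^sup>2 + (norm (g x))\<^sup>2)"
  using assms by (simp add: sq_int_def)
 show "(\<lambda>x. norm (f x) * norm (g x)) \<in> borel_measurable M"
  using assms by (intro borel_measurable_times) (auto simp: sq_int_def)
 have "norm (f x) * norm (g x) \<le> (norm (f x))\<^sup>2 + (norm (g x))\<^sup>2" for x
  using two_mult_le_squares[of "norm (f x)" "norm (g x)"]
   mult_nonneg_nonneg[OF norm_ge_zero[of "f x"] norm_ge_zero[of "g x"]] by linarith
 then show "AE x in M. norm (norm (f x) * norm (g x)) \<le> norm ((norm (f x))\<^sup>2 + (norm (g x))\<^sup>2)"
  by (intro AE_I2) (simp add: abs_mult)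
qed

lemma sq_int_inner:
 assumes "sq_int M f" "sq_int M g"
 shows "integrable M (\<lambda>x. f x \<bullet> g x)"
 by (rule Bochner_Integration.integrable_bound[OF sq_int_mult_norm[OF assms]])
   (use assms in \<open>auto simp: sq_int_def abs_mult Cauchy_Schwarz_ineq2 intro!: AE_I2\<close>)

lemma sq_int_scaleR: "sq_int M f ==> sq_int M (\<lambda>x. c *\<^sub>R f x)"
 by (auto simp: sq_int_def power_mult_distrib)

lemma sq_int_bound:
 assumes "sq_int M g" "f \<in> borel_measurable M" "AE x in M. norm (f x) \<le> C * norm (g x)"
 shows "sq_int M f"
proof -
 have "integrable M (\<lambda>x. (norm (f x))\<^sup>2)"
 proof (rule Bochner_Integration.integrable_bound)
  show "integrable M (\<lambda>x. C\<^sup>2 * (norm (g x))\<^sup>2)" using assms(1) by (simp add: sq_int_def)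
  show "AE x in M. norm ((norm (f x))\<^sup>2) \<le> norm (C\<^sup>2 * (norm (g x))\<^sup>2)"
   using assms(3)
  proof eventually_elim
   case (elim x)
   from power_mono[OF elim norm_ge_zero, of 2] show ?case by (simp add: power_mult_distrib)
  qed
 qed (use assms(2) in simp)
 then show ?thesis using assms(2) by (simp add: sq_int_def)
qed

lemma sq_int_add:
 assumes "sq_int M f" "sq_int M g"
 shows "sq_int M (\<lambda>x. f x + g x)"
proof -
 have [measurable]: "f \<in> borel_measurable M" "g \<in> borel_measurable M"
  using assms by (auto simp: sq_int_def)
 have "integrable M (\<lambda>x. (norm (f x + g x))\<^sup>2)"
 proof (rule Bochner_Integration.integrable_bound)
  show "integrable M (\<lambda>x. 2 * (norm (f x))\<^sup>2 + 2 * (norm (g x))\<^sup>2)"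
   using assms by (simp add: sq_int_def)
  have "(norm (f x + g x))\<^sup>2 \<le> 2 * (norm (f x))\<^sup>2 + 2 * (norm (g x))\<^sup>2" for x
  proof -
   have "(norm (f x + g x))\<^sup>2 \<le> (norm (f x) + norm (g x))\<^sup>2"
    by (intro power_mono norm_triangle_ineq) simp
   also have "\<dots> \<le> 2 * (norm (f x))\<^sup>2 + 2 * (norm (g x))\<^sup>2"
    using two_mult_le_squares[of "norm (f x)" "norm (g x)"] by (simp add: power2_sum)
   finally show ?thesis .
  qed
  then show "AE x in M. norm ((norm (f x + g x))\<^sup>2) \<le> norm (2 * (norm (f x))\<^sup>2 + 2 * (norm (g x))\<^sup>2)"
   by (intro AE_I2) (simp del: norm_power)
 qed simp
 then show ?thesis by (simp add: sq_int_def)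
qed

lemma sq_int_diff:
 assumes "sq_int M f" "sq_int M g"
 shows "sq_int M (\<lambda>x. f x - g x)"
 using sq_int_add[OF assms(1) sq_int_scaleR[OF assms(2), of "-1"]] by simp

lemma sq_int_sum:
 "finite I ==> (\<And>i. i \<in> I ==> sq_int M (f i)) ==> sq_int M (\<lambda>x. \<Sum>i\<in>I. f i x)"
 by (induction I rule: finite_induct) (auto simp: sq_int_zero sq_int_add)

lemma nrm_cong_AE:
 assumes "f \<in> borel_measurable M" "g \<in> borel_measurable M" "AE x in M. f x = g x"
 shows "nrm M f = nrm M g"
proof -
 have "(LINT x|M. (norm (f x))\<^sup>2) = (LINT x|M. (norm (g x))\<^sup>2)"
  by (rule integral_cong_AE) (use assms in auto)
 then show ?thesis by (simp add: nrm_def)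
qed

lemma nrm_eq_0_AE:
 assumes "sq_int M f" "nrm M f = 0"
 shows "AE x in M. f x = 0"
 using assms integral_nonneg_eq_0_iff_AE[OF sq_int_integrable[OF assms(1)]]
 by (auto simp: nrm_def)

text \<open>Integrate 2 s t \<le> (b/a) s^2 + (a/b) t^2, where a and b are the two norms; these
  weights make the right side exactly 2 a b. If one norm vanishes, the integrand vanishes almost
  everywhere.\<close>

lemma CS_norm:
 assumes f: "sq_int M f" and g: "sq_int M g"
 shows "(LINT x|M. norm (f x) * norm (g x)) \<le> nrm M f * nrm M g"
proof (cases "nrm M f = 0 \<or> nrm M g = 0")
 case True
 then have "AE x in M. norm (f x) * norm (g x) = 0"
  using nrm_eq_0_AE[OF f] nrm_eq_0_AE[OF g] by auto
 then have "(LINT x|M. norm (f x) * norm (g x)) = 0"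
  by (rule integral_eq_zero_AE)
 then show ?thesis by (simp add: nrm_nonneg)
next
 case False
 define a b where "a = nrm M f" and "b = nrm M g"
 have ab: "a > 0" "b > 0" using False nrm_nonneg[of M f] nrm_nonneg[of M g] by (auto simp: a_def b_def)
 have "(LINT x|M. 2 * (norm (f x) * norm (g x))) \<le>
   (LINT x|M. (b / a) * (norm (f x))\<^sup>2 + (a / b) * (norm (g x))\<^sup>2)"
 proof (rule integral_mono)
  show "integrable M (\<lambda>x. 2 * (norm (f x) * norm (g x)))"
   using sq_int_mult_norm[OF f g] by simp
  show "integrable M (\<lambda>x. (b / a) * (norm (f x))\<^sup>2 + (a / b) * (norm (g x))\<^sup>2)"
   using f g by (simp add: sq_int_def)
  fix x
  have "2 * ((b * norm (f x)) * (a * norm (g x))) \<le> (b * norm (f x))\<^sup>2 + (a * norm (g x))\<^sup>2"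
   by (rule two_mult_le_squares)
  then show "2 * (norm (f x) * norm (g x)) \<le> (b / a) * (norm (f x))\<^sup>2 + (a / b) * (norm (g x))\<^sup>2"
   using ab by (simp add: field_simps power2_eq_square)
 qed
 also have "\<dots> = (b / a) * a\<^sup>2 + (a / b) * b\<^sup>2"
  using f g by (simp add: sq_int_def a_def b_def nrm_sq)
 also have "\<dots> = 2 * (a * b)" using ab by (simp add: power2_eq_square)
 finally show ?thesis by (simp add: a_def b_def)
qed

lemma CS_inner:
 assumes f: "sq_int M f" and g: "sq_int M g"
 shows "\<bar>ip M f g\<bar> \<le> nrm M f * nrm M g"
proof -
 have "\<bar>ip M f g\<bar> \<le> (LINT x|M. \<bar>f x \<bullet> g x\<bar>)" by (rule integral_abs_bound)
 also have "\<dots> \<le> (LINT x|M. norm (f x) * norm (g x))"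
  by (intro integral_mono integrable_abs sq_int_inner sq_int_mult_norm f g Cauchy_Schwarz_ineq2)
 also have "\<dots> \<le> nrm M f * nrm M g" by (rule CS_norm[OF f g])
 finally show ?thesis .
qed

lemma nrm_sq_ip: "(nrm M f)\<^sup>2 = ip M f f"
 by (simp add: nrm_sq power2_norm_eq_inner)

lemma ip_commute: "ip M f g = ip M g f"
 by (simp add: inner_commute)

lemma ip_diff_left: "sq_int M f ==> sq_int M g ==> sq_int M h ==> ip M (\<lambda>x. f x - g x) h = ip M f h - ip M g h"
 by (simp add: inner_diff_left sq_int_inner)

lemma ip_diff_right: "sq_int M f ==> sq_int M g ==> sq_int M h ==> ip M h (\<lambda>x. f x - g x) = ip M h f - ip M h g"
 by (simp add: inner_diff_right sq_int_inner)

lemma nrm_add_sq: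
 assumes f: "sq_int M f" and g: "sq_int M g"
 shows "(nrm M (\<lambda>x. f x + g x))\<^sup>2 = (nrm M f)\<^sup>2 + (nrm M g)\<^sup>2 + 2 * ip M f g"
proof -
 have "(norm (f x + g x))\<^sup>2 = (norm (f x))\<^sup>2 + (norm (g x))\<^sup>2 + 2 * (f x \<bullet> g x)" for x
  by (simp add: power2_norm_eq_inner inner_add_left inner_add_right inner_commute)
 then show ?thesis
  using sq_int_integrable[OF f] sq_int_integrable[OF g] sq_int_inner[OF f g] by (simp add: nrm_sq)
qed

lemma nrm_diff_sq:
 assumes f: "sq_int M f" and g: "sq_int M g"
 shows "(dst M f g)\<^sup>2 = (nrm M f)\<^sup>2 + (nrm M g)\<^sup>2 - 2 * ip M f g"
proof -
 have "(norm (f x - g x))\<^sup>2 = (norm (f x))\<^sup>2 + (norm (g x))\<^sup>2 - 2 * (f x \<bullet> g x)" for x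
  by (simp add: power2_norm_eq_inner inner_diff_left inner_diff_right inner_commute)
 then show ?thesis
  using sq_int_integrable[OF f] sq_int_integrable[OF g] sq_int_inner[OF f g] by (simp add: nrm_sq)
qed

lemma nrm_triangle:
 assumes f: "sq_int M f" and g: "sq_int M g"
 shows "nrm M (\<lambda>x. f x + g x) \<le> nrm M f + nrm M g"
proof (rule power2_le_imp_le)
 show "(nrm M (\<lambda>x. f x + g x))\<^sup>2 \<le> (nrm M f + nrm M g)\<^sup>2"
  using CS_inner[OF f g] by (simp add: nrm_add_sq[OF f g] power2_sum)
qed (simp add: nrm_nonneg)

lemma nrm_scaleR: "nrm M (\<lambda>x. c *\<^sub>R f x) = \<bar>c\<bar> * nrm M f"
 by (simp add: nrm_def power_mult_distrib real_sqrt_mult)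

lemma nrm_minus_commute: "dst M f g = dst M g f"
 by (simp add: nrm_def norm_minus_commute)

lemma nrm_triangle_diff:
 assumes f: "sq_int M f" and g: "sq_int M g"
 shows "dst M f g \<le> nrm M f + nrm M g"
 using nrm_triangle[OF f sq_int_scaleR[OF g, of "-1"]] nrm_scaleR[of M "-1" g] by simp

lemma nrm_triangle3:
 assumes f: "sq_int M f" and g: "sq_int M g" and h: "sq_int M h"
 shows "dst M f h \<le> dst M f g + dst M g h"
 using nrm_triangle[OF sq_int_diff[OF f g] sq_int_diff[OF g h]] by simp

lemma nrm_diff_abs:
 assumes f: "sq_int M f" and g: "sq_int M g"
 shows "\<bar>nrm M f - nrm M g\<bar> \<le> dst M f g"
 using nrm_triangle[OF sq_int_diff[OF f g] g] nrm_triangle[OF sq_int_diff[OF g f] f]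
  nrm_minus_commute[of M f g] by simp

lemma nrm_tendsto:
 assumes "\<And>n. sq_int M (f n)" "sq_int M g" "(\<lambda>n. dst M (f n) g) ----> 0"
 shows "(\<lambda>n. nrm M (f n)) ----> nrm M g"
proof (rule LIM_zero_cancel)
 show "(\<lambda>n. nrm M (f n) - nrm M g) ----> 0"
  by (rule tendsto_rabs_zero_cancel, rule tendsto_zero_squeeze[OF assms(3)])
    (simp_all add: nrm_diff_abs assms)
qed

text \<open>Joint continuity in norm, from the splitting <f_n - f', g_n> + <f', g_n - g'>.
  Identities for smooth fields pass to the closures through it.\<close>

lemma ip_tendsto:
 assumes f: "\<And>n. sq_int M (f n)" "sq_int M f'" "(\<lambda>n. dst M (f n) f') ----> 0"
  and g: "\<And>n. sq_int M (g n)" "sq_int M g'" "(\<lambda>n. dst M (g n) g') ----> 0"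
 shows "(\<lambda>n. ip M (f n) (g n)) ----> ip M f' g'"
proof (rule LIM_zero_cancel, rule tendsto_rabs_zero_cancel)
 have b: "\<bar>ip M (f n) (g n) - ip M f' g'\<bar> \<le>
   dst M (f n) f' * nrm M (g n) + nrm M f' * dst M (g n) g'" for n
 proof -
  have "ip M (f n) (g n) - ip M f' g' = ip M (\<lambda>x. f n x - f' x) (g n) + ip M f' (\<lambda>x. g n x - g' x)"
   using f g by (simp add: ip_diff_left ip_diff_right)
  then show ?thesis
   using CS_inner[OF sq_int_diff[OF f(1) f(2)] g(1), of n n] CS_inner[OF f(2) sq_int_diff[OF g(1) g(2)], of n]
   by linarith
 qed
 have "(\<lambda>n. dst M (f n) f' * nrm M (g n) + nrm M f' * dst M (g n) g')
   ----> 0 * nrm M g' + nrm M f' * 0"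
  by (intro tendsto_intros f(3) g(3) nrm_tendsto g)
 then show "(\<lambda>n. \<bar>ip M (f n) (g n) - ip M f' g'\<bar>) ----> 0"
  by (intro tendsto_zero_squeeze[OF _ _ b]) simp_all
qed

lemma sq_int_bounded:
 assumes "finite_measure M" "f \<in> borel_measurable M" "\<And>x. x \<in> space M ==> norm (f x) \<le> C"
 shows "sq_int M f"
proof -
 interpret finite_measure M by fact
 have "integrable M (\<lambda>x. (norm (f x))\<^sup>2)"
  by (rule integrable_const_bound[where B = "C\<^sup>2"])
    (use assms in \<open>auto intro!: AE_I2 power_mono\<close>)
 then show ?thesis using assms by (simp add: sq_int_def)
qed

lemma nrm_tendsto_bounded:
 assumes M: "finite_measure M" and f: "\<And>n. f n \<in> borel_measurable M" and g: "g \<in> borel_measurable M"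
  and lim: "\<And>x. x \<in> space M ==> (\<lambda>n. f n x) ----> g x"
  and bd: "\<And>n x. x \<in> space M ==> norm (f n x) \<le> C" "\<And>x. x \<in> space M ==> norm (g x) \<le> C"
 shows "(\<lambda>n. dst M (f n) g) ----> 0"
proof -
 interpret finite_measure M by fact
 note [measurable] = f g
 have "(\<lambda>n. \<integral>x. (norm (f n x - g x))\<^sup>2 \<partial>M) ----> (LINT x|M. 0)"
 proof (rule integral_dominated_convergence[where w = "\<lambda>x. (2 * C)\<^sup>2"])
  show "AE x in M. (\<lambda>n. (norm (f n x - g x))\<^sup>2) ----> 0"
  proof (rule AE_I2)
   fix x assume "x \<in> space M"
   then have "(\<lambda>n. (norm (f n x - g x))\<^sup>2) ----> (norm (g x - g x))\<^sup>2"
    by (intro tendsto_intros lim)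
   then show "(\<lambda>n. (norm (f n x - g x))\<^sup>2) ----> 0" by simp
  qed
  show "AE x in M. norm ((norm (f n x - g x))\<^sup>2) \<le> (2 * C)\<^sup>2" for n
  proof (rule AE_I2)
   fix x assume "x \<in> space M"
   then have "norm (f n x - g x) \<le> 2 * C"
    using bd(1)[of x n] bd(2)[of x] norm_triangle_ineq4[of "f n x" "g x"] by linarith
   then show "norm ((norm (f n x - g x))\<^sup>2) \<le> (2 * C)\<^sup>2"
    using power_mono[of "norm (f n x - g x)" "2 * C" 2] by simp
  qed
 qed simp_all
 then show ?thesis
  unfolding nrm_def using tendsto_real_sqrt by fastforce
qed

text \<open>A multiple of the limit serves as majorant, as is needed for simple functions with |s_n|
  \<le> 2 |f|, which have no common constant bound.\<close>

lemma nrm_tendsto_dominated: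
 assumes f: "\<And>n. f n \<in> borel_measurable M" and g: "sq_int M g"
  and lim: "\<And>x. x \<in> space M ==> (\<lambda>n. f n x) ----> g x"
  and bd: "\<And>n x. x \<in> space M ==> norm (f n x) \<le> C * norm (g x)"
 shows "(\<lambda>n. dst M (f n) g) ----> 0"
proof -
 note [measurable] = f sq_int_measurable[OF g]
 have "(\<lambda>n. \<integral>x. (norm (f n x - g x))\<^sup>2 \<partial>M) ----> (LINT x|M. 0)"
 proof (rule integral_dominated_convergence[where w = "\<lambda>x. (C + 1)\<^sup>2 * (norm (g x))\<^sup>2"])
  show "AE x in M. (\<lambda>n. (norm (f n x - g x))\<^sup>2) ----> 0"
  proof (rule AE_I2)
   fix x assume "x \<in> space M"
   then have "(\<lambda>n. (norm (f n x - g x))\<^sup>2) ----> (norm (g x - g x))\<^sup>2"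
    by (intro tendsto_intros lim)
   then show "(\<lambda>n. (norm (f n x - g x))\<^sup>2) ----> 0" by simp
  qed
  show "AE x in M. norm ((norm (f n x - g x))\<^sup>2) \<le> (C + 1)\<^sup>2 * (norm (g x))\<^sup>2" for n
  proof (rule AE_I2)
   fix x assume "x \<in> space M"
   then have "norm (f n x - g x) \<le> (C + 1) * norm (g x)"
    using bd[of x n] norm_triangle_ineq4[of "f n x" "g x"] by (simp add: algebra_simps)
   then show "norm ((norm (f n x - g x))\<^sup>2) \<le> (C + 1)\<^sup>2 * (norm (g x))\<^sup>2"
    using power_mono[of "norm (f n x - g x)" "(C + 1) * norm (g x)" 2] by (simp add: power_mult_distrib)
  qed
 qed (use sq_int_integrable[OF g] in simp_all)
 then show ?thesis
  unfolding nrm_def using tendsto_real_sqrt by fastforce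
qed

section \<open>Finite-rank approximation in \<open>L\<^sup>2\<close>\<close>

text \<open>Averaging over the atoms of the algebra generated by the first \<open>k\<close> members of a countable
 basis of open sets gives finite-rank contractions of \<open>L\<^sup>2\<close> that converge strongly to the identity.
 They replace an orthonormal basis: weakly measurable curves become limits of finite sums.\<close>

definition bseq :: "nat => 'a::euclidean_space set" where
 "bseq = from_nat_into (SOME B. countable B \<and> topological_basis B)"

lemma basis_bseq: "topological_basis (range (bseq :: nat => 'a::euclidean_space set))"
proof -
 define B :: "'a set set" where "B = (SOME B. countable B \<and> topological_basis B)"
 have B: "countable B" "topological_basis B"
  using someI_ex[OF ex_countable_basis] by (auto simp: B_def)
 have "B \<noteq> {}"
 proof
  assume "B = {}"
  from topological_basisE[OF B(2) open_UNIV UNIV_I] obtain B' where "B' \<in> B" by metis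
  with \<open>B = {}\<close> show False by simp
 qed
 then have "range (from_nat_into B) = B"
  using B(1) by (rule range_from_nat_into)
 then show ?thesis
  using B(2) by (simp add: bseq_def B_def)
qed

lemma open_bseq: "open (bseq i)"
 by (rule topological_basis_open[OF basis_bseq]) (rule rangeI)

lemma bseq_Union:
 assumes "open U" shows "\<exists>I. U = (\<Union>i\<in>I. bseq i)"
proof -
 obtain B' where B': "B' \<subseteq> range bseq" "\<Union>B' = U"
  using conjunct2[OF basis_bseq[unfolded topological_basis_def], rule_format, OF assms] by auto
 have "U = (\<Union>i\<in>{i. bseq i \<in> B'}. bseq i)"
 proof (intro equalityI subsetI)
  fix x assume "x \<in> U"
  then obtain b where "b \<in> B'" "x \<in> b" using B'(2) by auto
  moreover obtain i where "b = bseq i" using B'(1) \<open>b \<in> B'\<close> by auto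
  ultimately show "x \<in> (\<Union>i\<in>{i. bseq i \<in> B'}. bseq i)" by auto
 qed (use B'(2) in auto)
 show ?thesis
  by (rule exI[where x = "{i. bseq i \<in> B'}"]) fact
qed

text \<open>Indexing by membership patterns \<open>S\<close> makes the atoms for
  \<open>S \<in> Pow {..<k}\<close> a partition of the space by construction; some of them may be
  empty.\<close>

definition atom :: "nat => nat set => 'a::euclidean_space set" where
 "atom k S = {x. \<forall>i<k. x \<in> bseq i \<longleftrightarrow> i \<in> S}"

lemma atom_unique:
 assumes "S \<in> Pow {..<k}" "x \<in> atom k S"
 shows "S = {i. i < k \<and> x \<in> bseq i}"
proof (rule set_eqI)
 fix i
 show "i \<in> S \<longleftrightarrow> i \<in> {i. i < k \<and> x \<in> bseq i}"
  using assms unfolding atom_def by (cases "i < k") fastforce+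
qed

lemma atom_mem: "x \<in> atom k {i. i < k \<and> x \<in> bseq i}"
 by (simp add: atom_def)

lemma atom_eq: "atom k S = (\<Inter>i\<in>{..<k} \<inter> S. bseq i) - (\<Union>i\<in>{..<k} - S. bseq i)"
 unfolding atom_def by blast

lemma atom_borel: "atom k S \<in> sets borel"
proof -
 have "open (\<Inter>i\<in>{..<k} \<inter> S. bseq i)" by (intro open_INT ballI open_bseq) simp
 moreover have "open (\<Union>i\<in>{..<k} - S. bseq i)" by (intro open_UN ballI open_bseq)
 ultimately show ?thesis unfolding atom_eq by (intro sets.Diff borel_open)
qed

lemma sum_atoms:
 "(\<Sum>S\<in>Pow {..<k}. indicator (atom k S) x *\<^sub>R c S) = c {i. i < k \<and> x \<in> bseq i}"
 for c :: "nat set => 'b::real_vector"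
proof -
 let ?S = "{i. i < k \<and> x \<in> bseq i}"
 have "indicator (atom k S) x *\<^sub>R c S = (if S = ?S then c ?S else 0)" if "S \<in> Pow {..<k}" for S
 proof (cases "x \<in> atom k S")
  case True
  from atom_unique[OF that this] have "S = ?S" .
  then show ?thesis using True by simp
 next
  case False
  then have "S \<noteq> ?S" using atom_mem[of x k] by metis
  then show ?thesis using False by simp
 qed
 then have "(\<Sum>S\<in>Pow {..<k}. indicator (atom k S) x *\<^sub>R c S) =
   (\<Sum>S\<in>Pow {..<k}. if S = ?S then c ?S else 0)"
  by (rule sum.cong[OF refl])
 also have "\<dots> = c ?S"
 proof -
  have "finite (Pow {..<k})" "?S \<in> Pow {..<k}" by blast+
  then show ?thesis using sum.delta[of "Pow {..<k}" ?S "\<lambda>_. c ?S"] by presburger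
 qed
 finally show ?thesis .
qed

lemma sum_atoms_1: "(\<Sum>S\<in>Pow {..<k}. indicator (atom k S) x) = (1::real)"
 using sum_atoms[where c = "\<lambda>S. 1::real"] by simp

definition atom_int :: "'a::euclidean_space set => nat => nat set => ('a => 'b::euclidean_space) => 'b" where
 "atom_int \<Omega> k S f = (LINT y|lebesgue_on \<Omega>. indicator (atom k S) y *\<^sub>R f y)"

abbreviation atom_measure :: "'a::euclidean_space set => nat => nat set => real" where
 "atom_measure \<Omega> k S \<equiv> measure (lebesgue_on \<Omega>) (atom k S \<inter> \<Omega>)"

text \<open>The conditional expectation with respect to the algebra of atoms. On an atom of measure
  zero the convention 1 / 0 = 0 gives the value 0, which matters on a null set only.\<close>

definition proj :: "'a::euclidean_space set => nat => ('a => 'b::euclidean_space) => 'a => 'b" where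
 "proj \<Omega> k f x = (\<Sum>S\<in>Pow {..<k}. indicator (atom k S) x *\<^sub>R
   ((1 / atom_measure \<Omega> k S) *\<^sub>R atom_int \<Omega> k S f))"

lemma open_sets_lebesgue: "open U ==> U \<in> sets lebesgue"
 by (rule sets_completionI_sets) simp

lemma sets_lebesgue_on_Int: "A \<in> sets lebesgue ==> A \<inter> \<Omega> \<in> sets (lebesgue_on \<Omega>)"
 unfolding sets_restrict_space by (metis Int_commute image_eqI)

context
 fixes \<Omega> :: "'a::euclidean_space set"
 assumes \<Omega>: "\<Omega> \<in> lmeasurable"
begin

lemmas fin_\<Omega> = finite_measure_lebesgue_on[OF \<Omega>]

lemma atom_measurable[measurable]: "(indicator (atom k S) :: 'a => real) \<in> borel_measurable (lebesgue_on \<Omega>)"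
proof -
 have "(indicator (atom k S) :: 'a => real) \<in> borel_measurable borel"
  using atom_borel by (rule borel_measurable_indicator)
 then have "(indicator (atom k S) :: 'a => real) \<in> borel_measurable lborel"
  by simp
 then show ?thesis
  by (rule measurable_restrict_space1[OF measurable_completion])
qed

lemma atom_sets: "atom k S \<inter> \<Omega> \<in> sets (lebesgue_on \<Omega>)"
 by (intro sets_lebesgue_on_Int sets_completionI_sets) (simp add: atom_borel)

lemma sq_int_integrable_fm:
 fixes f :: "'a => 'b::euclidean_space"
 assumes "sq_int (lebesgue_on \<Omega>) f" shows "integrable (lebesgue_on \<Omega>) f"
proof -
 interpret finite_measure "lebesgue_on \<Omega>" by (rule fin_\<Omega>)
 show ?thesis
 proof (rule Bochner_Integration.integrable_bound)
  show "integrable (lebesgue_on \<Omega>) (\<lambda>x. (norm (f x))\<^sup>2 + 1)"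
   using assms by (simp add: sq_int_def)
  have "norm (f x) \<le> (norm (f x))\<^sup>2 + 1" for x
   using two_mult_le_squares[of "norm (f x)" 1] norm_ge_zero[of "f x"]
   unfolding power_one mult_1_right by linarith
  then show "AE x in lebesgue_on \<Omega>. norm (f x) \<le> norm ((norm (f x))\<^sup>2 + 1)"
   by (intro AE_I2) (simp add: add_nonneg_nonneg)
 qed (use assms in \<open>simp add: sq_int_def\<close>)
qed

lemma atom_integrable:
 fixes f :: "'a => 'b::euclidean_space"
 assumes "sq_int (lebesgue_on \<Omega>) f"
 shows "integrable (lebesgue_on \<Omega>) (\<lambda>y. indicator (atom k S) y *\<^sub>R f y)"
 by (rule Bochner_Integration.integrable_bound[OF sq_int_integrable_fm[OF assms]])
   (use sq_int_measurable[OF assms] in \<open>auto split: split_indicator\<close>)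

lemma atom_int_diff:
 fixes f :: "'a => 'b::euclidean_space"
 assumes "sq_int (lebesgue_on \<Omega>) f" "sq_int (lebesgue_on \<Omega>) g"
 shows "atom_int \<Omega> k S (\<lambda>x. f x - g x) = atom_int \<Omega> k S f - atom_int \<Omega> k S g"
 unfolding atom_int_def scaleR_diff_right
 by (rule Bochner_Integration.integral_diff) (rule atom_integrable[OF assms(1)] atom_integrable[OF assms(2)])+

lemma atom_int_add:
 fixes f :: "'a => 'b::euclidean_space"
 assumes "sq_int (lebesgue_on \<Omega>) f" "sq_int (lebesgue_on \<Omega>) g"
 shows "atom_int \<Omega> k S (\<lambda>x. f x + g x) = atom_int \<Omega> k S f + atom_int \<Omega> k S g"
 unfolding atom_int_def scaleR_add_right
 by (rule Bochner_Integration.integral_add) (rule atom_integrable[OF assms(1)] atom_integrable[OF assms(2)])+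

lemma proj_diff:
 fixes f :: "'a => 'b::euclidean_space"
 assumes "sq_int (lebesgue_on \<Omega>) f" "sq_int (lebesgue_on \<Omega>) g"
 shows "proj \<Omega> k (\<lambda>x. f x - g x) y = proj \<Omega> k f y - proj \<Omega> k g y"
 unfolding proj_def atom_int_diff[OF assms] by (simp add: scaleR_diff_right sum_subtractf)

lemma proj_add:
 fixes f :: "'a => 'b::euclidean_space"
 assumes "sq_int (lebesgue_on \<Omega>) f" "sq_int (lebesgue_on \<Omega>) g"
 shows "proj \<Omega> k (\<lambda>x. f x + g x) y = proj \<Omega> k f y + proj \<Omega> k g y"
 unfolding proj_def atom_int_add[OF assms] by (simp add: scaleR_add_right sum.distrib)

lemma proj_measurable: "proj \<Omega> k f \<in> borel_measurable (lebesgue_on \<Omega>)"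
 unfolding proj_def[abs_def]
 by (intro borel_measurable_sum borel_measurable_scaleR atom_measurable borel_measurable_const)

lemma sq_int_proj: "sq_int (lebesgue_on \<Omega>) (proj \<Omega> k f)"
proof (rule sq_int_bounded[OF fin_\<Omega> proj_measurable])
 fix x
 show "norm (proj \<Omega> k f x) \<le> (\<Sum>S\<in>Pow {..<k}. norm ((1 / atom_measure \<Omega> k S) *\<^sub>R atom_int \<Omega> k S f))"
  unfolding proj_def
  by (rule order_trans[OF norm_sum], rule sum_mono) (simp split: split_indicator)
qed

text \<open>The pairing depends on finitely many numbers, and symmetrically on \<open>f\<close> and
  \<open>g\<close>. The first property yields measurability in time, the second makes the projection
  self-adjoint.\<close>

lemma ip_proj:
 fixes f g :: "'a => 'b::euclidean_space"
 assumes "sq_int (lebesgue_on \<Omega>) g"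
 shows "ip (lebesgue_on \<Omega>) (proj \<Omega> k f) g =
  (\<Sum>S\<in>Pow {..<k}. (atom_int \<Omega> k S f \<bullet> atom_int \<Omega> k S g) / atom_measure \<Omega> k S)"
proof -
 have i: "integrable (lebesgue_on \<Omega>) (\<lambda>x. c \<bullet> (indicator (atom k S) x *\<^sub>R g x))" for c S
  by (rule integrable_inner_right) (rule atom_integrable[OF assms])
 have "ip (lebesgue_on \<Omega>) (proj \<Omega> k f) g = (LINT x|lebesgue_on \<Omega>. (\<Sum>S\<in>Pow {..<k}.
   ((1 / atom_measure \<Omega> k S) *\<^sub>R atom_int \<Omega> k S f) \<bullet> (indicator (atom k S) x *\<^sub>R g x)))"
  unfolding proj_def by (simp add: inner_sum_left)
 also have "\<dots> = (\<Sum>S\<in>Pow {..<k}. \<integral>x.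
   ((1 / atom_measure \<Omega> k S) *\<^sub>R atom_int \<Omega> k S f) \<bullet> (indicator (atom k S) x *\<^sub>R g x) \<partial>lebesgue_on \<Omega>)"
  by (rule Bochner_Integration.integral_sum) (rule i)
 also have "\<dots> = (\<Sum>S\<in>Pow {..<k}. (atom_int \<Omega> k S f \<bullet> atom_int \<Omega> k S g) / atom_measure \<Omega> k S)"
  unfolding atom_int_def
  by (intro sum.cong refl)
    (subst integral_inner_right, auto intro!: atom_integrable assms)
 finally show ?thesis .
qed

text \<open>Jensen's inequality on one atom: Cauchy-Schwarz against its indicator. On an atom of
  measure zero the left side is 0 by the convention for division.\<close>

lemma atom_int_sq:
 fixes f :: "'a => 'b::euclidean_space"
 assumes f: "sq_int (lebesgue_on \<Omega>) f"
 shows "(norm (atom_int \<Omega> k S f))\<^sup>2 / atom_measure \<Omega> k S \<le>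
  (LINT x|lebesgue_on \<Omega>. indicator (atom k S) x * (norm (f x))\<^sup>2)"
proof -
 let ?M = "lebesgue_on \<Omega>"
 let ?i = "\<lambda>x. indicator (atom k S) x :: real"
 interpret finite_measure ?M by (rule fin_\<Omega>)
 have i: "sq_int ?M ?i" by (rule sq_int_bounded[OF fin_\<Omega>, of _ 1]) auto
 have fi: "sq_int ?M (\<lambda>x. ?i x *\<^sub>R f x)"
  by (rule sq_int_bound[OF f, of _ 1]) (use sq_int_measurable[OF f] in \<open>auto split: split_indicator\<close>)
 have mm: "(nrm ?M ?i)\<^sup>2 = atom_measure \<Omega> k S"
 proof -
  have "(nrm ?M ?i)\<^sup>2 = (LINT x|?M. indicator (atom k S \<inter> \<Omega>) x)"
   unfolding nrm_sq by (rule Bochner_Integration.integral_cong) (auto split: split_indicator)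
  also have "\<dots> = atom_measure \<Omega> k S"
   using atom_sets[of k S] by (simp add: Int_assoc)
  finally show ?thesis .
 qed
 have "norm (atom_int \<Omega> k S f) \<le> (LINT x|?M. norm (?i x *\<^sub>R f x))"
  unfolding atom_int_def by (rule integral_norm_bound)
 also have "\<dots> = (LINT x|?M. norm (?i x) * norm (?i x *\<^sub>R f x))"
  by (rule Bochner_Integration.integral_cong) (auto split: split_indicator)
 also have "\<dots> \<le> nrm ?M ?i * nrm ?M (\<lambda>x. ?i x *\<^sub>R f x)" by (rule CS_norm[OF i fi])
 finally have "(norm (atom_int \<Omega> k S f))\<^sup>2 \<le> (nrm ?M ?i * nrm ?M (\<lambda>x. ?i x *\<^sub>R f x))\<^sup>2"
  by (intro power_mono) auto
 also have "\<dots> = atom_measure \<Omega> k S * (LINT x|?M. ?i x * (norm (f x))\<^sup>2)"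
 proof -
  have "(nrm ?M (\<lambda>x. ?i x *\<^sub>R f x))\<^sup>2 = (LINT x|?M. ?i x * (norm (f x))\<^sup>2)"
   unfolding nrm_sq by (rule Bochner_Integration.integral_cong) (auto split: split_indicator)
  then show ?thesis by (simp add: power_mult_distrib mm)
 qed
 finally have *: "(norm (atom_int \<Omega> k S f))\<^sup>2 \<le> atom_measure \<Omega> k S * (LINT x|?M. ?i x * (norm (f x))\<^sup>2)" .
 show ?thesis
 proof (cases "atom_measure \<Omega> k S = 0")
  case True
  then show ?thesis by (auto intro!: integral_nonneg_AE)
 next
  case False
  then have "atom_measure \<Omega> k S > 0" using measure_nonneg[of ?M] by (simp add: less_le)
  then show ?thesis using * by (simp add: divide_le_eq mult.commute)
 qed
qed

lemma ip_proj_le: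
 fixes f :: "'a => 'b::euclidean_space"
 assumes f: "sq_int (lebesgue_on \<Omega>) f"
 shows "ip (lebesgue_on \<Omega>) (proj \<Omega> k f) f \<le> (nrm (lebesgue_on \<Omega>) f)\<^sup>2"
proof -
 let ?M = "lebesgue_on \<Omega>"
 have "ip ?M (proj \<Omega> k f) f \<le> (\<Sum>S\<in>Pow {..<k}. \<integral>x. indicator (atom k S) x * (norm (f x))\<^sup>2 \<partial>?M)"
  unfolding ip_proj[OF f] using atom_int_sq[OF f]
  by (intro sum_mono) (simp add: power2_norm_eq_inner)
 also have "\<dots> = (LINT x|?M. (\<Sum>S\<in>Pow {..<k}. indicator (atom k S) x * (norm (f x))\<^sup>2))"
 proof (rule Bochner_Integration.integral_sum[symmetric])
  fix S
  show "integrable ?M (\<lambda>x. indicator (atom k S) x * (norm (f x))\<^sup>2)"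
   by (rule Bochner_Integration.integrable_bound[OF sq_int_integrable[OF f]])
     (use sq_int_measurable[OF f] in \<open>auto split: split_indicator\<close>)
 qed
 also have "\<dots> = (nrm ?M f)\<^sup>2"
  by (simp add: sum_distrib_right[symmetric] sum_atoms_1 nrm_sq)
 finally show ?thesis .
qed

text \<open>A function constant on each atom is its own average there; the exceptional set is the
  union of the finitely many atoms of measure zero.\<close>

lemma proj_atomwise:
 fixes g :: "'a => 'b::euclidean_space"
 assumes g: "\<And>x y. (\<And>i. i < k ==> x \<in> bseq i \<longleftrightarrow> y \<in> bseq i) ==> g x = g y"
  and i: "g \<in> borel_measurable (lebesgue_on \<Omega>)"
 shows "AE x in lebesgue_on \<Omega>. proj \<Omega> k g x = g x"
proof -
 let ?M = "lebesgue_on \<Omega>"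
 interpret finite_measure ?M by (rule fin_\<Omega>)
 have null: "AE x in ?M. \<forall>S\<in>Pow {..<k}. atom_measure \<Omega> k S = 0 \<longrightarrow> x \<notin> atom k S"
 proof (rule AE_finite_allI)
  fix S
  show "AE x in ?M. atom_measure \<Omega> k S = 0 \<longrightarrow> x \<notin> atom k S"
  proof (cases "atom_measure \<Omega> k S = 0")
   case True
   then have "atom k S \<inter> \<Omega> \<in> null_sets ?M"
    using atom_sets by (simp add: null_sets_def emeasure_eq_measure)
   then have "AE x in ?M. x \<notin> atom k S \<inter> \<Omega>" by (rule AE_not_in)
   moreover have "AE x in ?M. x \<in> \<Omega>" by (rule AE_I2) simp
   ultimately show ?thesis by eventually_elim auto
  qed simp
 qed simp
 moreover have "AE x in ?M. x \<in> \<Omega>" by (rule AE_I2) simp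
 ultimately show ?thesis
 proof eventually_elim
  case (elim x)
  let ?S = "{i. i < k \<and> x \<in> bseq i}"
  have "atom_measure \<Omega> k ?S \<noteq> 0" using elim(1) atom_mem[of x k] by auto
  moreover have "atom_int \<Omega> k ?S g = atom_measure \<Omega> k ?S *\<^sub>R g x"
  proof -
   have "atom_int \<Omega> k ?S g = (LINT y|?M. indicator (atom k ?S \<inter> \<Omega>) y *\<^sub>R g x)"
    unfolding atom_int_def
   proof (rule Bochner_Integration.integral_cong[OF refl])
    fix y assume "y \<in> space ?M"
    moreover have "g y = g x" if "y \<in> atom k ?S"
     by (rule g) (use that in \<open>auto simp: atom_def\<close>)
    ultimately show "indicator (atom k ?S) y *\<^sub>R g y = indicator (atom k ?S \<inter> \<Omega>) y *\<^sub>R g x"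
     by (auto split: split_indicator)
   qed
   also have "\<dots> = (LINT y|?M. indicator (atom k ?S \<inter> \<Omega>) y) *\<^sub>R g x"
    using integrable_real_indicator[OF atom_sets[of k ?S]]
    by (intro integral_scaleR_left) (simp add: less_top[symmetric])
   also have "\<dots> = atom_measure \<Omega> k ?S *\<^sub>R g x"
    by (simp add: Int_assoc)
   finally show ?thesis .
  qed
  ultimately show ?case
   unfolding proj_def sum_atoms by simp
 qed
qed

lemma proj_sum_rep:
 fixes f :: "'a => 'b::euclidean_space"
 shows "AE x in lebesgue_on \<Omega>. proj \<Omega> k (proj \<Omega> k f) x = proj \<Omega> k f x"
proof (rule proj_atomwise[where g = "proj \<Omega> k f"])
 fix x y :: 'a assume xy: "\<And>i. i < k ==> x \<in> bseq i \<longleftrightarrow> y \<in> bseq i"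
 have "{i. i < k \<and> x \<in> bseq i} = {i. i < k \<and> y \<in> bseq i}" using xy by auto
 then show "proj \<Omega> k f x = proj \<Omega> k f y" unfolding proj_def sum_atoms by simp
qed (rule proj_measurable)

text \<open>The projection P is self-adjoint and idempotent, so |Pf|^2 = <PPf, f> = <Pf, f> \<le>
  |f|^2.\<close>

lemma nrm_proj_le:
 fixes f :: "'a => 'b::euclidean_space"
 assumes f: "sq_int (lebesgue_on \<Omega>) f"
 shows "nrm (lebesgue_on \<Omega>) (proj \<Omega> k f) \<le> nrm (lebesgue_on \<Omega>) f"
proof -
 let ?M = "lebesgue_on \<Omega>" and ?P = "proj \<Omega> k f"
 have cong: "ip ?M (proj \<Omega> k ?P) g = ip ?M ?P g" if "g \<in> borel_measurable ?M" for g
  by (rule integral_cong_AE; (intro borel_measurable_inner proj_measurable that)?)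
    (use proj_sum_rep[of k f] in eventually_elim, simp)
 have "(nrm ?M ?P)\<^sup>2 = ip ?M ?P ?P" by (rule nrm_sq_ip)
 also have "ip ?M (proj \<Omega> k f) ?P = ip ?M (proj \<Omega> k ?P) f"
  unfolding ip_proj[OF sq_int_proj] ip_proj[OF f] by (simp add: inner_commute)
 also have "\<dots> = ip ?M ?P f"
  by (rule cong[OF sq_int_measurable[OF f]])
 also have "\<dots> \<le> (nrm ?M f)\<^sup>2" by (rule ip_proj_le[OF f])
 finally show ?thesis by (rule power2_le_imp_le) (rule nrm_nonneg)
qed

text \<open>Let \<open>G\<close> be the class of functions on which the projections converge to the
  identity. It is closed under sums and, the projections being contractions, under L^2 limits. It
  contains multiples of indicators of finite unions of basis sets, which are eventually fixed, hence
  those of open sets by exhaustion, of measurable sets by outer regularity, then simple functions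
  and finally all of L^2.\<close>

lemma proj_tendsto:
 fixes f :: "'a => 'b::euclidean_space"
 assumes f: "sq_int (lebesgue_on \<Omega>) f"
 shows "(\<lambda>k. dst (lebesgue_on \<Omega>) (proj \<Omega> k f) f) ----> 0"
proof -
 let ?M = "lebesgue_on \<Omega>"
 interpret finite_measure ?M by (rule fin_\<Omega>)
 note fin = fin_\<Omega>
 define G where "G = {f :: 'a => 'b. sq_int ?M f \<and> (\<lambda>k. dst ?M (proj \<Omega> k f) f) ----> 0}"
 have G_add: "(\<lambda>x. f x + g x) \<in> G" if "f \<in> G" "g \<in> G" for f g
 proof -
  have fg: "sq_int ?M f" "sq_int ?M g" using that by (auto simp: G_def)
  have "(\<lambda>k. dst ?M (proj \<Omega> k f) f) ----> 0"
   "(\<lambda>k. dst ?M (proj \<Omega> k g) g) ----> 0"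
   using that unfolding G_def by blast+
  from tendsto_add[OF this]
  have lim: "(\<lambda>k. dst ?M (proj \<Omega> k f) f + dst ?M (proj \<Omega> k g) g) ----> 0"
   by simp
  have le: "nrm ?M (\<lambda>x. proj \<Omega> k (\<lambda>x. f x + g x) x - (f x + g x)) \<le>
    dst ?M (proj \<Omega> k f) f + dst ?M (proj \<Omega> k g) g" for k
   using nrm_triangle[OF sq_int_diff[OF sq_int_proj fg(1)] sq_int_diff[OF sq_int_proj fg(2)], of k f k g]
   by (simp add: proj_add[OF fg] algebra_simps)
  have "(\<lambda>k. nrm ?M (\<lambda>x. proj \<Omega> k (\<lambda>x. f x + g x) x - (f x + g x))) ----> 0"
   by (rule tendsto_zero_squeeze[OF lim nrm_nonneg le])
  then show ?thesis using sq_int_add[OF fg] by (simp add: G_def)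
 qed
 have G_sum: "(\<lambda>x. \<Sum>i\<in>I. h i x) \<in> G" if "finite I" "\<And>i. i \<in> I ==> h i \<in> G" for I :: "'b set" and h
  using that
 proof (induction I rule: finite_induct)
  case empty
  have "proj \<Omega> k (\<lambda>x. 0::'b) y = 0" for k y by (simp add: proj_def atom_int_def)
  then show ?case by (simp add: G_def sq_int_zero nrm_def)
 next
  case (insert i I)
  then show ?case using G_add[of "h i"] by simp
 qed
 have G_lim: "f \<in> G" if h: "\<And>n. h n \<in> G" and f: "sq_int ?M f"
  and lim: "(\<lambda>n. dst ?M (h n) f) ----> 0" for h f
 proof -
  have hs: "sq_int ?M (h n)" for n using h by (auto simp: G_def)
  have b: "dst ?M (proj \<Omega> k f) f \<le>
    2 * dst ?M (h n) f + dst ?M (proj \<Omega> k (h n)) (h n)" for k n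
  proof -
   have 1: "dst ?M (proj \<Omega> k f) f \<le>
     dst ?M (proj \<Omega> k f) (proj \<Omega> k (h n)) + dst ?M (proj \<Omega> k (h n)) f"
    by (rule nrm_triangle3[OF sq_int_proj sq_int_proj f])
   have 2: "dst ?M (proj \<Omega> k (h n)) f \<le>
     dst ?M (proj \<Omega> k (h n)) (h n) + dst ?M (h n) f"
    by (rule nrm_triangle3[OF sq_int_proj hs f])
   have 3: "dst ?M (proj \<Omega> k f) (proj \<Omega> k (h n)) \<le> dst ?M (h n) f"
    using nrm_proj_le[OF sq_int_diff[OF f hs], of k n] nrm_minus_commute[of ?M "h n" f]
    by (simp add: proj_diff[OF f hs, abs_def])
   show ?thesis using 1 2 3 by linarith
  qed
  have "(\<lambda>k. dst ?M (proj \<Omega> k f) f) ----> 0"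
  proof (rule LIMSEQ_I)
   fix e :: real assume "e > 0"
   then have "e / 4 > 0" by simp
   obtain n where n: "dst ?M (h n) f < e / 4"
    using tendsto_zero_less[OF lim \<open>e / 4 > 0\<close>] by blast
   have "(\<lambda>k. dst ?M (proj \<Omega> k (h n)) (h n)) ----> 0" using h by (auto simp: G_def)
   then obtain K where K: "\<And>k. k \<ge> K ==> dst ?M (proj \<Omega> k (h n)) (h n) < e / 4"
    using tendsto_zero_less[OF _ \<open>e / 4 > 0\<close>] by blast
   show "\<exists>K. \<forall>k\<ge>K. norm (dst ?M (proj \<Omega> k f) f - 0) < e"
   proof (intro exI allI impI)
    fix k assume "k \<ge> K"
    from b[of k n] K[OF this] n \<open>e > 0\<close>
    show "norm (dst ?M (proj \<Omega> k f) f - 0) < e" by (simp add: nrm_nonneg)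
   qed
  qed
  then show ?thesis using f by (simp add: G_def)
 qed
 have bm: "(\<lambda>x. indicator A x *\<^sub>R y) \<in> borel_measurable ?M" if "A \<in> sets lebesgue" for A and y :: 'b
  by (rule measurable_restrict_space1)
    (rule borel_measurable_scaleR[OF borel_measurable_indicator[OF that] borel_measurable_const])
 have bd: "norm (indicator A x *\<^sub>R y) \<le> norm y" for A :: "'a set" and x and y :: 'b
  by (cases "x \<in> A") simp_all
 have G_fin: "(\<lambda>x. indicator (\<Union>i\<in>I \<inter> {..<n}. bseq i) x *\<^sub>R y) \<in> G" for n I and y :: 'b
 proof -
  let ?g = "\<lambda>x. indicator (\<Union>i\<in>I \<inter> {..<n}. bseq i) x *\<^sub>R y"
  have U: "(\<Union>i\<in>I \<inter> {..<n}. bseq i) \<in> sets lebesgue"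
   by (intro open_sets_lebesgue open_UN ballI open_bseq)
  have s: "sq_int ?M ?g" by (rule sq_int_bounded[OF fin bm[OF U] bd])
  have "dst ?M (proj \<Omega> k ?g) ?g = 0" if "k \<ge> n" for k
  proof -
   have "?g x = ?g z" if "\<And>i. i < k ==> x \<in> bseq i \<longleftrightarrow> z \<in> bseq i" for x z
   proof -
    have "x \<in> (\<Union>i\<in>I \<inter> {..<n}. bseq i) \<longleftrightarrow> z \<in> (\<Union>i\<in>I \<inter> {..<n}. bseq i)"
     using that \<open>k \<ge> n\<close> by fastforce
    then show ?thesis unfolding indicator_def by (simp only:)
   qed
   then have "AE x in ?M. proj \<Omega> k ?g x = ?g x"
    by (rule proj_atomwise[OF _ bm[OF U]])
   then have "dst ?M (proj \<Omega> k ?g) ?g = nrm ?M (\<lambda>x. 0::'b)"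
    by (intro nrm_cong_AE borel_measurable_diff proj_measurable bm[OF U] borel_measurable_const)
      (simp only: right_minus_eq)
   then show ?thesis by (simp add: nrm_def)
  qed
  then have "eventually (\<lambda>k. dst ?M (proj \<Omega> k ?g) ?g = 0) sequentially"
   unfolding eventually_sequentially by blast
  then have "(\<lambda>k. dst ?M (proj \<Omega> k ?g) ?g) ----> 0"
   by (rule tendsto_eventually)
  then show ?thesis using s by (simp add: G_def)
 qed
 have G_open: "(\<lambda>x. indicator U x *\<^sub>R y) \<in> G" if opU: "open U" for U and y :: 'b
 proof -
  obtain I where I: "U = (\<Union>i\<in>I. bseq i)" using bseq_Union[OF opU] by blast
  have UL: "U \<in> sets lebesgue" by (rule open_sets_lebesgue[OF opU])
  have V: "(\<Union>i\<in>I \<inter> {..<n}. bseq i) \<in> sets lebesgue" for n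
   by (intro open_sets_lebesgue open_UN ballI open_bseq)
  show ?thesis
  proof (rule G_lim[OF G_fin])
   show "sq_int ?M (\<lambda>x. indicator U x *\<^sub>R y)" by (rule sq_int_bounded[OF fin bm[OF UL] bd])
   show "(\<lambda>n. nrm ?M (\<lambda>x. indicator (\<Union>i\<in>I \<inter> {..<n}. bseq i) x *\<^sub>R y - indicator U x *\<^sub>R y)) ----> 0"
   proof (rule nrm_tendsto_bounded[OF fin bm[OF V] bm[OF UL] _ bd bd])
    fix x
    show "(\<lambda>n. indicator (\<Union>i\<in>I \<inter> {..<n}. bseq i) x *\<^sub>R y) ----> indicator U x *\<^sub>R y"
    proof (cases "x \<in> U")
     case True
     then obtain j where j: "j \<in> I" "x \<in> bseq j" using I by auto
     have "x \<in> (\<Union>i\<in>I \<inter> {..<n}. bseq i)" if "n \<ge> Suc j" for n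
      using j that by auto
     then have "eventually (\<lambda>n. indicator (\<Union>i\<in>I \<inter> {..<n}. bseq i) x *\<^sub>R y = indicator U x *\<^sub>R y) sequentially"
      unfolding eventually_sequentially using True
      by (intro exI[of _ "Suc j"] allI impI) (simp only: indicator_simps)
     then show ?thesis by (rule tendsto_eventually)
    next
     case False
     then have nx: "x \<notin> (\<Union>i\<in>I \<inter> {..<n}. bseq i)" for n using I by blast
     have "indicator (\<Union>i\<in>I \<inter> {..<n}. bseq i) x *\<^sub>R y = indicator U x *\<^sub>R y" for n
      by (simp only: indicator_simps(2)[OF nx] indicator_simps(2)[OF False])
     then show ?thesis by (simp only: tendsto_const)
    qed
   qed
  qed
 qed
 have G_set: "(\<lambda>x. indicator A x *\<^sub>R y) \<in> G" if A: "A \<in> sets lebesgue" for A and y :: 'b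
 proof -
  have "\<exists>T. open T \<and> A \<subseteq> T \<and> emeasure lebesgue (T - A) < ennreal (1 / real (Suc n))" for n
   using sets_lebesgue_outer_open[OF A, of "1 / real (Suc n)"] by (metis divide_pos_pos of_nat_0_less_iff zero_less_Suc zero_less_one)
  then obtain T where T: "\<And>n. open (T n)" "\<And>n. A \<subseteq> T n"
   "\<And>n. emeasure lebesgue (T n - A) < ennreal (1 / real (Suc n))" by metis
  have TL: "T n \<in> sets lebesgue" for n by (rule open_sets_lebesgue[OF T(1)])
  show ?thesis
  proof (rule G_lim[OF G_open[OF T(1)]])
   show "sq_int ?M (\<lambda>x. indicator A x *\<^sub>R y)" by (rule sq_int_bounded[OF fin bm[OF A] bd])
   have n2: "(nrm ?M (\<lambda>x. indicator (T n) x *\<^sub>R y - indicator A x *\<^sub>R y))\<^sup>2 \<le> 1 / real (Suc n) * (norm y)\<^sup>2" for n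
   proof -
    have sub: "(T n - A) \<inter> \<Omega> \<in> sets ?M"
     by (intro sets_lebesgue_on_Int sets.Diff TL A)
    have "(nrm ?M (\<lambda>x. indicator (T n) x *\<^sub>R y - indicator A x *\<^sub>R y))\<^sup>2 =
      (LINT x|?M. indicator ((T n - A) \<inter> \<Omega>) x * (norm y)\<^sup>2)"
     unfolding nrm_sq
     by (rule Bochner_Integration.integral_cong) (use T(2)[of n] in \<open>auto split: split_indicator\<close>)
    also have "\<dots> = measure ?M ((T n - A) \<inter> \<Omega>) * (norm y)\<^sup>2"
     using sub by (simp add: Int_assoc)
    also have "measure ?M ((T n - A) \<inter> \<Omega>) \<le> 1 / real (Suc n)"
    proof -
     have "emeasure ?M ((T n - A) \<inter> \<Omega>) = emeasure lebesgue ((T n - A) \<inter> \<Omega>)"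
      using fmeasurableD[OF \<Omega>] by (intro emeasure_restrict_space) simp_all
     also have "\<dots> \<le> emeasure lebesgue (T n - A)"
      by (intro emeasure_mono sets.Diff TL A) simp
     also have "\<dots> \<le> ennreal (1 / real (Suc n))" using T(3)[of n] by (rule less_imp_le)
     finally show ?thesis
      by (simp add: emeasure_eq_measure)
    qed
    finally show ?thesis by (simp add: mult_right_mono)
   qed
   have "(\<lambda>n. 1 / real (Suc n) * (norm y)\<^sup>2) ----> 0 * (norm y)\<^sup>2"
    by (intro tendsto_mult tendsto_const) (use LIMSEQ_inverse_real_of_nat in \<open>simp add: inverse_eq_divide\<close>)
   then have "(\<lambda>n. (nrm ?M (\<lambda>x. indicator (T n) x *\<^sub>R y - indicator A x *\<^sub>R y))\<^sup>2) ----> 0"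
    by (intro tendsto_zero_squeeze[OF _ _ n2]) simp_all
   from tendsto_real_sqrt[OF this]
   show "(\<lambda>n. nrm ?M (\<lambda>x. indicator (T n) x *\<^sub>R y - indicator A x *\<^sub>R y)) ----> 0"
    by (simp add: nrm_nonneg)
  qed
 qed
 have "f \<in> G"
 proof -
  from borel_measurable_implies_sequence_metric[OF sq_int_measurable[OF f], of 0]
  obtain s where s0: "\<forall>i. simple_function ?M (s i)" "\<forall>x\<in>space ?M. (\<lambda>i. s i x) ----> f x"
   "\<forall>i. \<forall>x\<in>space ?M. dist (s i x) 0 \<le> 2 * dist (f x) 0" by blast
  then have s: "\<And>i. simple_function ?M (s i)" "\<And>x. x \<in> \<Omega> ==> (\<lambda>i. s i x) ----> f x"
   "\<And>i x. x \<in> \<Omega> ==> norm (s i x) \<le> 2 * norm (f x)"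
   by simp_all
  have sm: "s i \<in> borel_measurable ?M" for i by (rule borel_measurable_simple_function[OF s(1)])
  have sG: "s i \<in> G" for i
  proof -
   let ?Y = "s i ` \<Omega>"
   let ?h = "\<lambda>y x. indicator (s i -` {y} \<inter> \<Omega>) x *\<^sub>R y"
   have fin: "finite ?Y" using simple_functionD(1)[OF s(1)[of i]] by simp
   have "s i -` {y} \<inter> \<Omega> \<in> sets lebesgue" for y
    using simple_functionD(2)[OF s(1)[of i], of "{y}"] fmeasurableD[OF \<Omega>]
     sets_restrict_space_iff[of \<Omega> lebesgue] by simp
   then have "?h y \<in> G" for y by (rule G_set)
   then have *: "(\<lambda>x. \<Sum>y\<in>?Y. ?h y x) \<in> G" by (rule G_sum[OF fin])
   have eq: "(\<Sum>y\<in>?Y. ?h y x) = s i x" if "x \<in> \<Omega>" for x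
   proof -
    have "(\<Sum>y\<in>?Y. ?h y x) = (\<Sum>y\<in>?Y. if y = s i x then s i x else 0)"
     by (intro sum.cong refl) (use that in \<open>auto split: split_indicator\<close>)
    also have "\<dots> = s i x" using that fin by (subst sum.delta) auto
    finally show ?thesis .
   qed
   show ?thesis
   proof (rule G_lim[OF *])
    show "sq_int ?M (s i)"
     by (rule sq_int_bound[OF f sm, where C = 2]) (use s(3) in auto)
    show "(\<lambda>n. nrm ?M (\<lambda>x. (\<Sum>y\<in>?Y. ?h y x) - s i x)) ----> 0"
    proof -
     have "nrm ?M (\<lambda>x. (\<Sum>y\<in>?Y. ?h y x) - s i x) = nrm ?M (\<lambda>x. 0::'b)"
      unfolding nrm_def
      by (intro arg_cong[where f = sqrt] Bochner_Integration.integral_cong) (auto simp: eq)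
     then show ?thesis by (simp add: nrm_def)
    qed
   qed
  qed
  show ?thesis
   by (rule G_lim[OF sG f nrm_tendsto_dominated[OF sm f, where C = 2]]) (use s in auto)
 qed
 then show ?thesis by (simp add: G_def)
qed

end

section \<open>Weak gradients\<close>

lemma borel_measurable_nth:
 "f \<in> borel_measurable M ==> (\<lambda>x. f x $ i) \<in> borel_measurable M"
 for f :: "'a => 'b::euclidean_space^'n"
 by (rule borel_measurable_continuous_on[where f = "\<lambda>v. v $ i"])
   (rule linear_continuous_on[OF bounded_linear_vec_nth])

lemma sq_int_nth: "sq_int M f ==> sq_int M (\<lambda>x. f x $ i)"
 for f :: "'a => 'b::euclidean_space^'n"
 by (rule sq_int_bound[where C = 1], assumption, simp add: borel_measurable_nth sq_int_measurable,
   rule AE_I2)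
   (simp_all add: borel_measurable_nth sq_int_measurable Finite_Cartesian_Product.norm_nth_le)

lemma continuous_on_bounded_set:
 fixes f :: "'a::euclidean_space => 'b::real_normed_vector"
 assumes "continuous_on UNIV f" "bounded S"
 obtains B where "B > 0" "\<And>x. x \<in> S ==> norm (f x) \<le> B"
proof -
 have "compact (f ` closure S)"
  using assms by (intro compact_continuous_image) (auto simp: compact_closure intro: continuous_on_subset)
 then obtain B where "B > 0" "\<forall>y\<in>f ` closure S. norm y \<le> B"
  using compact_imp_bounded bounded_pos by metis
 then show ?thesis using that closure_subset[of S] by blast
qed

lemma borel_measurable_continuous_lebesgue_on:
 fixes f :: "'a::euclidean_space => 'b::euclidean_space"
 assumes "continuous_on UNIV f"
 shows "f \<in> borel_measurable (lebesgue_on S)"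
proof -
 have "f \<in> borel_measurable lborel" using borel_measurable_continuous_onI[OF assms] by simp
 then show ?thesis by (rule measurable_restrict_space1[OF measurable_completion])
qed

lemma sq_int_continuous:
 fixes f :: "'a::euclidean_space => 'b::euclidean_space"
 assumes "continuous_on UNIV f" "bounded \<Omega>" "\<Omega> \<in> lmeasurable"
 shows "sq_int (lebesgue_on \<Omega>) f"
proof -
 obtain B where "B > 0" "\<And>x. x \<in> \<Omega> ==> norm (f x) \<le> B"
  using continuous_on_bounded_set[OF assms(1,2)] by metis
 then show ?thesis
  by (intro sq_int_bounded[OF finite_measure_lebesgue_on[OF assms(3)], of _ B]
    borel_measurable_continuous_lebesgue_on assms) simp
qed

lemma jacobian_nth: "jacobian f F $ i $ j = frechet_derivative f F (axis j 1) $ i"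
 by (simp add: jacobian_def matrix_def)

lemma smooth_nth: "smooth_on \<phi> UNIV ==> smooth_on (\<lambda>x. \<phi> x $ i) UNIV"
 for \<phi> :: "'a::euclidean_space => 'b::euclidean_space^'n"
 by (rule smooth_linear_comp[OF bounded_linear_vec_nth])

lemma smooth_jacobian_nth:
 fixes \<phi> :: "real^'n => real^'m"
 assumes "smooth_on \<phi> UNIV"
 shows "smooth_on (\<lambda>x. grad \<phi> x $ i $ j) UNIV"
 unfolding jacobian_nth by (rule smooth_nth[OF smooth_frechet_derivative[OF assms]])

lemma continuous_jacobian:
 fixes \<phi> :: "real^'n => real^'m"
 assumes "smooth_on \<phi> UNIV"
 shows "continuous_on UNIV (grad \<phi>)"
proof -
 have "continuous_on UNIV (\<lambda>x. \<chi> i j. grad \<phi> x $ i $ j)"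
  by (intro continuous_on_vec_lambda smooth_continuous_on smooth_jacobian_nth assms)
 then show ?thesis by simp
qed

lemma frechet_derivative_nth:
 fixes \<phi> :: "'a::euclidean_space => 'b::euclidean_space^'m"
 assumes "smooth_on \<phi> UNIV"
 shows "frechet_derivative (\<lambda>x. \<phi> x $ i) (at x) h = frechet_derivative \<phi> (at x) h $ i"
proof -
 have "((\<lambda>x. \<phi> x $ i) has_derivative (\<lambda>h. frechet_derivative \<phi> (at x) h $ i)) (at x)"
  by (rule bounded_linear.has_derivative[OF bounded_linear_vec_nth smooth_has_derivative[OF assms]])
 from fun_cong[OF frechet_derivative_at[OF this], of h] show ?thesis by simp
qed

lemma frechet_derivative_mult_real:
 fixes f g :: "'a::euclidean_space => real"
 assumes "smooth_on f UNIV" "smooth_on g UNIV"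
 shows "frechet_derivative (\<lambda>x. f x * g x) (at x) h =
  f x * frechet_derivative g (at x) h + frechet_derivative f (at x) h * g x"
proof -
 have "((\<lambda>x. f x * g x) has_derivative
   (\<lambda>h. f x * frechet_derivative g (at x) h + frechet_derivative f (at x) h * g x)) (at x)"
  by (rule has_derivative_mult[OF smooth_has_derivative[OF assms(1)] smooth_has_derivative[OF assms(2)]])
 from fun_cong[OF frechet_derivative_at[OF this], of h] show ?thesis by simp
qed

lemma frechet_derivative_outside:
 fixes h :: "'a::euclidean_space => 'b::real_normed_vector"
 assumes "closed K" "\<And>x. x \<notin> K ==> h x = 0" "x \<notin> K"
 shows "frechet_derivative h (at x) e = 0"
proof -
 have "(h has_derivative (\<lambda>e. 0)) (at x)"
  by (rule has_derivative_transform_within_open[OF has_derivative_const open_Compl[OF assms(1)]])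
    (use assms in auto)
 then show ?thesis using frechet_derivative_at by metis
qed

text \<open>By translation invariance, every difference quotient of \<open>h\<close> has integral \<open>0\<close>.\<close>

lemma integral_frechet_derivative_lborel:
 fixes h :: "'a::euclidean_space => real"
 assumes h: "smooth_on h UNIV" and K: "compact K" and supp: "\<And>x. x \<notin> K ==> h x = 0"
 shows "(LINT x|lborel. frechet_derivative h (at x) e) = 0"
proof -
 let ?d = "\<lambda>x. frechet_derivative h (at x) e"
 have cd: "continuous_on UNIV ?d" and ch: "continuous_on UNIV h"
  using smooth_continuous_on[OF smooth_frechet_derivative[OF h]] smooth_continuous_on[OF h] by auto
 have d0: "?d x = 0" if "x \<notin> K" for x
  using frechet_derivative_outside[OF compact_imp_closed[OF K] supp that] .
 obtain B where B: "B > 0" "\<And>x. x \<in> K ==> norm (?d x) \<le> B"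
  using continuous_on_bounded_set[OF cd compact_imp_bounded[OF K]] by metis
 have Bd: "\<bar>?d x\<bar> \<le> B" for x using B d0[of x] by (cases "x \<in> K") auto
 obtain R where R: "\<And>x. x \<in> K ==> norm x \<le> R"
  using compact_imp_bounded[OF K] by (auto simp: bounded_iff)
 \<comment> \<open>The shifts below have length at most that of \<open>e\<close>, so all difference
   quotients vanish outside this larger ball; it carries the integrable majorant.\<close>
 let ?C = "cball 0 (R + norm e) :: 'a set"
 have dh: "((\<lambda>t. h (x + t *\<^sub>R e)) has_real_derivative ?d (x + t *\<^sub>R e)) (at t)" for x t
 proof -
  have "((\<lambda>t. x + t *\<^sub>R e) has_derivative (\<lambda>t. t *\<^sub>R e)) (at t)"
   by (auto intro!: derivative_eq_intros)
  from has_derivative_compose[OF this smooth_has_derivative[OF h]]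
  have "((\<lambda>t. h (x + t *\<^sub>R e)) has_derivative (\<lambda>s. frechet_derivative h (at (x + t *\<^sub>R e)) (s *\<^sub>R e))) (at t)" .
  moreover have "frechet_derivative h (at y) (s *\<^sub>R e) = ?d y * s" for y s
   using linear_scale[OF has_derivative_linear[OF smooth_has_derivative[OF h, of y]], of s e] by simp
  ultimately show ?thesis by (simp add: has_field_derivative_def)
 qed
 have lip: "\<bar>h (x + t *\<^sub>R e) - h x\<bar> \<le> B * t" if "t \<ge> 0" for x t
 proof -
  have "norm (h (x + t *\<^sub>R e) - h (x + 0 *\<^sub>R e)) \<le> B * norm (t - 0)"
   by (rule field_differentiable_bound[where S = UNIV and f' = "\<lambda>t. ?d (x + t *\<^sub>R e)"])
     (use dh Bd in auto)
  then show ?thesis using that by simp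
 qed
 define q where "q n x = real (Suc n) * (h (x + (1 / real (Suc n)) *\<^sub>R e) - h x)" for n x
 have qz: "q n x = 0" if "x \<notin> ?C" for n x
 proof -
  have nx: "norm x > R + norm e" using that by simp
  have "norm x \<le> norm (x + (1 / real (Suc n)) *\<^sub>R e) + norm ((1 / real (Suc n)) *\<^sub>R e)"
   using norm_triangle_ineq4[of "x + (1 / real (Suc n)) *\<^sub>R e" "(1 / real (Suc n)) *\<^sub>R e"] by simp
  moreover have "norm ((1 / real (Suc n)) *\<^sub>R e) \<le> norm e"
   by (simp add: mult_left_le_one_le field_simps)
  ultimately have "norm (x + (1 / real (Suc n)) *\<^sub>R e) > R" using nx by linarith
  then have "x + (1 / real (Suc n)) *\<^sub>R e \<notin> K" "x \<notin> K"
   using R nx norm_ge_zero[of e] by (fastforce simp: not_le)+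
  then show ?thesis by (simp add: q_def supp)
 qed
 have qB: "\<bar>q n x\<bar> \<le> B" for n x
 proof -
  have "\<bar>q n x\<bar> = real (Suc n) * \<bar>h (x + (1 / real (Suc n)) *\<^sub>R e) - h x\<bar>"
   unfolding q_def abs_mult by simp
  also have "\<dots> \<le> real (Suc n) * (B * (1 / real (Suc n)))"
   by (intro mult_left_mono lip) simp_all
  also have "\<dots> = B" by simp
  finally show ?thesis .
 qed
 have hi: "integrable lborel h"
 proof -
  obtain B' where "B' > 0" "\<And>x. x \<in> K ==> norm (h x) \<le> B'"
   using continuous_on_bounded_set[OF ch compact_imp_bounded[OF K]] by metis
  then show ?thesis
  proof (intro Bochner_Integration.integrable_bound[of lborel "\<lambda>x. indicator K x * B'" h])
   show "integrable lborel (\<lambda>x. indicator K x * B')"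
    using emeasure_compact_finite[OF K] borel_compact[OF K]
    by (intro integrable_mult_left integrable_real_indicator) simp_all
  qed (use supp borel_measurable_continuous_onI[OF ch] in \<open>auto split: split_indicator\<close>)
 qed
 have "(LINT x|lborel. h (x + c)) = (LINT x|lborel. h x)" "integrable lborel (\<lambda>x. h (x + c))" for c
 proof -
  have d: "distr lborel borel (\<lambda>x. x + c) = lborel"
  proof -
   have "(\<lambda>x. x + c) = (+) c" by (rule ext) (rule add.commute)
   then show ?thesis using lborel_distr_plus[of c] by (simp only:)
  qed
  have "(\<integral>x. h x \<partial>distr lborel borel (\<lambda>x. x + c)) = (LINT x|lborel. h (x + c))"
   using borel_measurable_continuous_onI[OF ch] by (intro integral_distr) auto
  then show "(LINT x|lborel. h (x + c)) = (LINT x|lborel. h x)" by (simp add: d)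
  have "integrable (distr lborel borel (\<lambda>x. x + c)) h \<longleftrightarrow> integrable lborel (\<lambda>x. h (x + c))"
   using borel_measurable_continuous_onI[OF ch] by (intro integrable_distr_eq) auto
  then show "integrable lborel (\<lambda>x. h (x + c))" using hi by (simp add: d)
 qed
 then have q0: "(LINT x|lborel. q n x) = 0" for n
  unfolding q_def using hi by (simp add: Bochner_Integration.integral_diff)
 have qm: "q n \<in> borel_measurable lborel" for n
 proof -
  have "continuous_on UNIV (q n)"
   unfolding q_def[abs_def]
   by (intro continuous_intros continuous_on_compose2[OF ch] ch) auto
  then show ?thesis using borel_measurable_continuous_onI by simp
 qed
 have "(\<lambda>n. \<integral>x. q n x \<partial>lborel) ----> (LINT x|lborel. ?d x)"
 proof (rule integral_dominated_convergence[where w = "\<lambda>x. indicator ?C x * B"])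
  show "?d \<in> borel_measurable lborel" using borel_measurable_continuous_onI[OF cd] by simp
  show "integrable lborel (\<lambda>x. indicator ?C x * B)"
   using emeasure_compact_finite[of ?C]
   by (intro integrable_mult_left integrable_real_indicator) simp_all
  show "AE x in lborel. norm (q n x) \<le> indicator ?C x * B" for n
  proof (rule AE_I2)
   fix x
   show "norm (q n x) \<le> indicator ?C x * B"
    using qB[of n x] qz[of x n] by (cases "x \<in> ?C") (simp_all only: indicator_simps, simp_all)
  qed
  show "AE x in lborel. (\<lambda>n. q n x) ----> ?d x"
  proof (rule AE_I2)
   fix x
   have "((\<lambda>s. (h (x + s *\<^sub>R e) - h x) / s) \<longlongrightarrow> ?d x) (at 0)"
    using dh[of x 0] by (simp add: has_field_derivative_iff)
   moreover have "filterlim (\<lambda>n. 1 / real (Suc n)) (at 0) sequentially"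
    using LIMSEQ_inverse_real_of_nat by (simp add: filterlim_at inverse_eq_divide)
   ultimately have "(\<lambda>n. (h (x + (1 / real (Suc n)) *\<^sub>R e) - h x) / (1 / real (Suc n))) ----> ?d x"
    by (rule filterlim_compose)
   then show "(\<lambda>n. q n x) ----> ?d x"
    by (simp add: q_def[abs_def] mult.commute)
  qed
 qed (rule qm)
 then show ?thesis using q0 by (simp add: LIMSEQ_const_iff)
qed

lemma integral_lebesgue_on_lborel:
 fixes f :: "'a::euclidean_space => real"
 assumes "f \<in> borel_measurable borel" "\<And>x. x \<notin> S ==> f x = 0" "S \<in> sets lebesgue"
 shows "(LINT x|lebesgue_on S. f x) = (LINT x|lborel. f x)"
proof -
 have "(LINT x|lebesgue_on S. f x) = (LINT x|lebesgue. indicator S x *\<^sub>R f x)"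
  using assms(3) by (intro integral_restrict_space) simp
 also have "\<dots> = (LINT x|lebesgue. f x)"
  by (rule Bochner_Integration.integral_cong) (use assms(2) in \<open>auto split: split_indicator\<close>)
 also have "\<dots> = (LINT x|lborel. f x)"
  using assms(1) by (intro integral_completion) simp
 finally show ?thesis .
qed

lemma integral_frechet_derivative_zero:
 fixes h :: "'a::euclidean_space => real"
 assumes h: "smooth_on h UNIV" and K: "compact K" "K \<subseteq> S" "\<And>x. x \<notin> K ==> h x = 0"
  and S: "S \<in> sets lebesgue"
 shows "(LINT x|lebesgue_on S. frechet_derivative h (at x) e) = 0"
proof -
 have "(LINT x|lebesgue_on S. frechet_derivative h (at x) e) = (LINT x|lborel. frechet_derivative h (at x) e)"
 proof (rule integral_lebesgue_on_lborel[OF _ _ S])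
  show "(\<lambda>x. frechet_derivative h (at x) e) \<in> borel_measurable borel"
   by (intro borel_measurable_continuous_onI smooth_continuous_on smooth_frechet_derivative h)
  fix x assume "x \<notin> S"
  then have "x \<notin> K" using K(2) by blast
  then show "frechet_derivative h (at x) e = 0"
   using K by (intro frechet_derivative_outside[of K]) (auto intro: compact_imp_closed)
 qed
 also have "\<dots> = 0" by (rule integral_frechet_derivative_lborel[OF h K(1) K(3)])
 finally show ?thesis .
qed

section \<open>Test functions, the fundamental lemma and uniqueness of weak gradients\<close>

lemma test_functionsD:
 assumes "\<psi> \<in> test_functions \<Omega>"
 shows "smooth_on \<psi> UNIV" "\<exists>K. compact K \<and> K \<subseteq> \<Omega> \<and> (\<forall>x. x \<notin> K \<longrightarrow> \<psi> x = 0)"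
 using assms by (simp_all add: test_functions_def)

text \<open>An open set is a countable union of open boxes. The function 1 - prod (1 - bump_i) over
  the first n boxes is a smooth substitute for the maximum of the bumps: it lies between 0 and 1, is
  1 wherever one bump is 1, and is supported in finitely many shrunken boxes.\<close>

lemma open_test_approx:
 fixes U :: "(real^'n) set"
 assumes "open U" "U \<subseteq> \<Omega>"
 obtains \<psi> where "\<And>n::nat. \<psi> n \<in> test_functions \<Omega>" "\<And>n x. \<bar>\<psi> n x\<bar> \<le> 1"
  "\<And>x. (\<lambda>n. \<psi> n x) ----> indicator U x"
proof (cases "U = {}")
 case True
 have "(\<lambda>x. 0) \<in> test_functions \<Omega>"
  unfolding test_functions_def by (auto simp: smooth_const intro!: exI[of _ "{}"])
 then show ?thesis using that[of "\<lambda>n x. 0"] True by simp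
next
 case False
 obtain \<D> where D: "countable \<D>" "\<D> \<subseteq> Pow U" "\<And>X. X \<in> \<D> ==> \<exists>a b. X = box a b" "\<Union>\<D> = U"
  using open_countable_Union_open_box[OF assms(1)] by metis
 have "\<D> \<noteq> {}" using D(4) False by auto
 define X where "X = from_nat_into \<D>"
 have X: "X i \<in> \<D>" for i unfolding X_def by (rule from_nat_into[OF \<open>\<D> \<noteq> {}\<close>])
 have rX: "range X = \<D>" unfolding X_def by (rule range_from_nat_into[OF \<open>\<D> \<noteq> {}\<close> D(1)])
 obtain a b where ab: "\<And>i. X i = box (a i) (b i)" using D(3)[OF X] by metis
 define \<psi> where "\<psi> n x = 1 - (\<Prod>i<n. 1 - box_bump (real (Suc n)) (a i) (b i) x)" for n x
 have fac: "0 \<le> 1 - box_bump (real (Suc n)) (a i) (b i) x" "1 - box_bump (real (Suc n)) (a i) (b i) x \<le> 1" for n i x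
  using box_bump_nonneg box_bump_le_1 by (simp_all add: algebra_simps)
 have P: "0 \<le> (\<Prod>i<n. 1 - box_bump (real (Suc n)) (a i) (b i) x)"
  "(\<Prod>i<n. 1 - box_bump (real (Suc n)) (a i) (b i) x) \<le> 1" for n x
  using fac by (auto intro!: prod_nonneg prod_le_1)
 have "\<psi> n \<in> test_functions \<Omega>" for n
 proof -
  define K where "K = (\<Union>i<n. cbox (a i + (1 / real (Suc n)) *\<^sub>R One) (b i - (1 / real (Suc n)) *\<^sub>R One))"
  have "smooth_on (\<psi> n) UNIV"
   unfolding \<psi>_def[abs_def] by (intro smooth_diff smooth_const smooth_prod smooth_box_bump) simp
  moreover have "compact K" unfolding K_def by (intro compact_UN compact_cbox) simp
  moreover have "K \<subseteq> \<Omega>"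
  proof -
   have "cbox (a i + (1 / real (Suc n)) *\<^sub>R One) (b i - (1 / real (Suc n)) *\<^sub>R One) \<subseteq> \<Omega>" for i
   proof -
    have "box (a i) (b i) \<subseteq> U" using X[of i] ab[of i] D(2) by (metis PowD subsetD)
    then show ?thesis using shrunk_box_subset[of "real (Suc n)" "a i" "b i"] assms(2) by fastforce
   qed
   then show ?thesis unfolding K_def by blast
  qed
  moreover have "\<psi> n x = 0" if "x \<notin> K" for x
  proof -
   have "box_bump (real (Suc n)) (a i) (b i) x = 0" if "i < n" for i
    by (rule box_bump_support) (use that \<open>x \<notin> K\<close> in \<open>auto simp: K_def\<close>)
   then show ?thesis by (simp add: \<psi>_def)
  qed
  ultimately show ?thesis unfolding test_functions_def by blast
 qed
 moreover have "\<bar>\<psi> n x\<bar> \<le> 1" for n x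
  using P[of n x] unfolding \<psi>_def by linarith
 moreover have "(\<lambda>n. \<psi> n x) ----> indicator U x" for x
 proof (cases "x \<in> U")
  case True
  then obtain j where j: "x \<in> box (a j) (b j)" using D(4) rX ab by auto
  have "eventually (\<lambda>n. \<psi> n x = 1) sequentially"
   using box_bump_eventually_1[OF j] eventually_gt_at_top[of j]
  proof eventually_elim
   case (elim n)
   then have "(\<Prod>i<n. 1 - box_bump (real (Suc n)) (a i) (b i) x) = 0"
    by (intro prod_zero) auto
   then show ?case by (simp add: \<psi>_def)
  qed
  then show ?thesis using True by (simp add: tendsto_eventually)
 next
  case False
  have "box_bump (real (Suc n)) (a i) (b i) x = 0" for n i
  proof (rule box_bump_support)
   have "box (a i) (b i) \<subseteq> U" using X[of i] ab[of i] D(2) by (metis PowD subsetD)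
   then have "x \<notin> box (a i) (b i)" using False by blast
   then show "x \<notin> cbox (a i + (1 / real (Suc n)) *\<^sub>R One) (b i - (1 / real (Suc n)) *\<^sub>R One)"
    using shrunk_box_subset[of "real (Suc n)" "a i" "b i"] by auto
  qed simp
  then show ?thesis using False by (simp add: \<psi>_def)
 qed
 ultimately show ?thesis by (rule that)
qed

text \<open>An atom is a difference of two nested open sets, whose indicators are bounded limits of
  test functions. The two sequences are chosen before \<open>G\<close>: for a curve of functions
  they do not depend on time, so measurability of the pairings with test functions passes to the
  atom integrals.\<close>

lemma atom_int_approx:
 fixes \<Omega> :: "(real^'n) set"
 assumes \<Omega>: "open \<Omega>" "\<Omega> \<in> lmeasurable"
 shows "\<exists>\<psi> \<psi>'. (\<forall>n::nat. \<psi> n \<in> test_functions \<Omega> \<and> \<psi>' n \<in> test_functions \<Omega>) \<and>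
  (\<forall>G :: real^'n => real. sq_int (lebesgue_on \<Omega>) G \<longrightarrow>
   (\<lambda>n. (LINT x|lebesgue_on \<Omega>. G x * \<psi> n x) - (LINT x|lebesgue_on \<Omega>. G x * \<psi>' n x)) ----> atom_int \<Omega> k S G)"
proof -
 let ?M = "lebesgue_on \<Omega>"
 define V where "V = (\<Inter>i\<in>{..<k} \<inter> S. bseq i) \<inter> \<Omega>"
 define W where "W = (\<Union>i\<in>{..<k} - S. bseq i) \<inter> V"
 have oV: "open V" unfolding V_def by (intro open_Int open_INT ballI open_bseq \<Omega>) simp
 have oW: "open W" unfolding W_def by (intro open_Int open_UN ballI open_bseq oV)
 have VO: "V \<subseteq> \<Omega>" and WO: "W \<subseteq> \<Omega>" by (auto simp: V_def W_def)
 have at: "indicator (atom k S) x = indicator V x - (indicator W x :: real)" if "x \<in> \<Omega>" for x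
 proof -
  have "x \<in> atom k S \<longleftrightarrow> x \<in> V \<and> x \<notin> W" "x \<in> W \<longrightarrow> x \<in> V"
   using that unfolding atom_eq V_def W_def by blast+
  then show ?thesis unfolding indicator_def by (cases "x \<in> V"; cases "x \<in> W") simp_all
 qed
 obtain \<psi> where \<psi>: "\<And>n::nat. \<psi> n \<in> test_functions \<Omega>" "\<And>n x. \<bar>\<psi> n x\<bar> \<le> 1"
  "\<And>x. (\<lambda>n. \<psi> n x) ----> indicator V x" using open_test_approx[OF oV VO] by metis
 obtain \<psi>' where \<psi>': "\<And>n::nat. \<psi>' n \<in> test_functions \<Omega>" "\<And>n x. \<bar>\<psi>' n x\<bar> \<le> 1"
  "\<And>x. (\<lambda>n. \<psi>' n x) ----> indicator W x" using open_test_approx[OF oW WO] by metis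
 have lim: "(\<lambda>n. \<integral>x. G x * \<xi> n x \<partial>?M) ----> (LINT x|?M. G x * indicator X x)"
  and int: "integrable ?M (\<lambda>x. G x * indicator X x)"
  if G: "sq_int ?M G" and X: "open X" and \<xi>: "\<And>n::nat. \<xi> n \<in> test_functions \<Omega>" "\<And>n x. \<bar>\<xi> n x\<bar> \<le> 1"
  "\<And>x. (\<lambda>n. \<xi> n x) ----> indicator X x" for G :: "real^'n => real" and \<xi> X
 proof -
  have Gi: "integrable ?M G" by (rule sq_int_integrable_fm[OF \<Omega>(2) G])
  have Gm: "G \<in> borel_measurable ?M" by (rule sq_int_measurable[OF G])
  have im: "(\<lambda>x. indicator X x :: real) \<in> borel_measurable ?M"
   by (rule measurable_restrict_space1) (rule borel_measurable_indicator[OF open_sets_lebesgue[OF X]])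
  show "integrable ?M (\<lambda>x. G x * indicator X x)"
   by (rule Bochner_Integration.integrable_bound[OF Gi borel_measurable_times[OF Gm im]])
     (rule AE_I2, simp add: indicator_def)
  show "(\<lambda>n. \<integral>x. G x * \<xi> n x \<partial>?M) ----> (LINT x|?M. G x * indicator X x)"
  proof (rule integral_dominated_convergence[where w = "\<lambda>x. \<bar>G x\<bar>"])
   show "(\<lambda>x. G x * indicator X x) \<in> borel_measurable ?M" by (rule borel_measurable_times[OF Gm im])
   show "(\<lambda>x. G x * \<xi> n x) \<in> borel_measurable ?M" for n
    by (intro borel_measurable_times Gm borel_measurable_continuous_lebesgue_on
      smooth_continuous_on test_functionsD(1)[OF \<xi>(1)])
   show "integrable ?M (\<lambda>x. \<bar>G x\<bar>)" using Gi by simp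
   show "AE x in ?M. (\<lambda>n. G x * \<xi> n x) ----> G x * indicator X x"
    by (intro AE_I2 tendsto_intros \<xi>(3))
   show "AE x in ?M. norm (G x * \<xi> n x) \<le> \<bar>G x\<bar>" for n
    by (intro AE_I2) (simp add: abs_mult mult_left_le \<xi>(2))
  qed
 qed
 have "(\<lambda>n. (LINT x|?M. G x * \<psi> n x) - (LINT x|?M. G x * \<psi>' n x)) ----> atom_int \<Omega> k S G"
  if G: "sq_int ?M G" for G
 proof -
  have "atom_int \<Omega> k S G = (LINT x|?M. G x * indicator V x - G x * indicator W x)"
   unfolding atom_int_def
   by (rule Bochner_Integration.integral_cong) (simp_all add: at algebra_simps)
  also have "\<dots> = (LINT x|?M. G x * indicator V x) - (LINT x|?M. G x * indicator W x)"
   by (rule Bochner_Integration.integral_diff)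
     (rule int[OF G oV \<psi>] int[OF G oW \<psi>'])+
  finally show ?thesis
   using tendsto_diff[OF lim[OF G oV \<psi>] lim[OF G oW \<psi>']] by simp
 qed
 then show ?thesis using \<psi>(1) \<psi>'(1) by blast
qed

text \<open>The fundamental lemma of the calculus of variations: all atom integrals of
  \<open>G\<close> vanish, hence all its projections, and these converge to
  \<open>G\<close>.\<close>

lemma test_null_AE:
 fixes \<Omega> :: "(real^'n) set" and G :: "real^'n => real"
 assumes \<Omega>: "open \<Omega>" "\<Omega> \<in> lmeasurable" and G: "sq_int (lebesgue_on \<Omega>) G"
  and 0: "\<And>\<psi>. \<psi> \<in> test_functions \<Omega> ==> (LINT x|lebesgue_on \<Omega>. G x * \<psi> x) = 0"
 shows "AE x in lebesgue_on \<Omega>. G x = 0"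
proof -
 have "atom_int \<Omega> k S G = 0" for k S
 proof -
  obtain \<psi> \<psi>' where *: "\<forall>n::nat. \<psi> n \<in> test_functions \<Omega> \<and> \<psi>' n \<in> test_functions \<Omega>"
   "\<forall>G :: real^'n => real. sq_int (lebesgue_on \<Omega>) G \<longrightarrow>
    (\<lambda>n. (LINT x|lebesgue_on \<Omega>. G x * \<psi> n x) - (LINT x|lebesgue_on \<Omega>. G x * \<psi>' n x)) ----> atom_int \<Omega> k S G"
   using atom_int_approx[OF \<Omega>, of k S] by blast
  have "(\<lambda>n. (LINT x|lebesgue_on \<Omega>. G x * \<psi> n x) - (LINT x|lebesgue_on \<Omega>. G x * \<psi>' n x)) ----> atom_int \<Omega> k S G"
   using *(2) G by blast
  then have "(\<lambda>n::nat. 0 - 0) ----> atom_int \<Omega> k S G"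
   using *(1) 0 by simp
  then show ?thesis by (simp add: LIMSEQ_const_iff)
 qed
 then have "proj \<Omega> k G x = 0" for k x by (simp add: proj_def)
 then have "(\<lambda>k::nat. nrm (lebesgue_on \<Omega>) (\<lambda>x. 0 - G x)) ----> 0"
  using proj_tendsto[OF \<Omega>(2) G] by simp
 then have "nrm (lebesgue_on \<Omega>) (\<lambda>x. 0 - G x) = 0"
  by (simp only: LIMSEQ_const_iff)
 then have "nrm (lebesgue_on \<Omega>) G = 0" by (simp add: nrm_def)
 then show ?thesis by (rule nrm_eq_0_AE[OF G])
qed

lemma smooth_integration_by_parts:
 fixes \<phi> :: "real^'n => real^'m"
 assumes \<phi>: "smooth_on \<phi> UNIV" and \<psi>: "\<psi> \<in> test_functions \<Omega>" and \<Omega>: "bounded \<Omega>" "\<Omega> \<in> lmeasurable"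
 shows "(LINT x|lebesgue_on \<Omega>. \<phi> x $ i * pd j \<psi> x)
    = - (LINT x|lebesgue_on \<Omega>. grad \<phi> x $ i $ j * \<psi> x)"
proof -
 let ?M = "lebesgue_on \<Omega>"
 obtain K where K: "compact K" "K \<subseteq> \<Omega>" "\<And>x. x \<notin> K ==> \<psi> x = 0"
  using test_functionsD(2)[OF \<psi>] by blast
 note s\<psi> = test_functionsD(1)[OF \<psi>]
 have i1: "integrable ?M (\<lambda>x. \<phi> x $ i * pd j \<psi> x)"
  by (intro sq_int_integrable_fm[OF \<Omega>(2)] sq_int_continuous \<Omega> smooth_continuous_on smooth_mult
    smooth_nth \<phi> smooth_frechet_derivative s\<psi>)
 have i2: "integrable ?M (\<lambda>x. grad \<phi> x $ i $ j * \<psi> x)"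
  by (intro sq_int_integrable_fm[OF \<Omega>(2)] sq_int_continuous \<Omega> smooth_continuous_on smooth_mult
    smooth_jacobian_nth \<phi> s\<psi>)
 have "(LINT x|?M. pd j (\<lambda>x. \<phi> x $ i * \<psi> x) x) = 0"
  by (rule integral_frechet_derivative_zero[OF _ K(1,2)])
    (simp_all add: K(3) smooth_mult smooth_nth \<phi> s\<psi> fmeasurableD[OF \<Omega>(2)])
 then have "(LINT x|?M. \<phi> x $ i * pd j \<psi> x + grad \<phi> x $ i $ j * \<psi> x) = 0"
  by (simp add: frechet_derivative_mult_real[OF smooth_nth[OF \<phi>] s\<psi>] frechet_derivative_nth[OF \<phi>] jacobian_nth)
 then show ?thesis
  using Bochner_Integration.integral_add[OF i1 i2] by linarith
qed

lemma smooth_has_weak_gradient: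
 fixes \<phi> :: "real^'n => real^'m"
 assumes \<phi>: "smooth_on \<phi> UNIV" and \<Omega>: "bounded \<Omega>" "\<Omega> \<in> lmeasurable"
 shows "has_weak_gradient \<Omega> \<phi> (grad \<phi>)"
 unfolding has_weak_gradient_def L2_iff
 using smooth_integration_by_parts[OF \<phi> _ \<Omega>] sq_int_continuous[OF continuous_jacobian[OF \<phi>] \<Omega>] by blast

lemma integrable_mult_continuous:
 fixes f g :: "'a::euclidean_space => real"
 assumes "sq_int (lebesgue_on \<Omega>) f" "continuous_on UNIV g" "bounded \<Omega>" "\<Omega> \<in> lmeasurable"
 shows "integrable (lebesgue_on \<Omega>) (\<lambda>x. f x * g x)"
 using sq_int_inner[OF assms(1) sq_int_continuous[OF assms(2-4)]] by simp

lemma has_weak_gradient_diff: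
 fixes f g :: "real^'n => real^'m"
 assumes f: "has_weak_gradient \<Omega> f F" "f \<in> L2 \<Omega>" and g: "has_weak_gradient \<Omega> g G" "g \<in> L2 \<Omega>"
  and \<Omega>: "bounded \<Omega>" "\<Omega> \<in> lmeasurable"
 shows "has_weak_gradient \<Omega> (\<lambda>x. f x - g x) (\<lambda>x. F x - G x)"
 unfolding has_weak_gradient_def
proof (intro conjI ballI allI)
 have sq: "sq_int (lebesgue_on \<Omega>) F" "sq_int (lebesgue_on \<Omega>) G" "sq_int (lebesgue_on \<Omega>) f" "sq_int (lebesgue_on \<Omega>) g"
  using f g by (simp_all add: has_weak_gradient_def L2_iff)
 then show "(\<lambda>x. F x - G x) \<in> L2 \<Omega>" by (simp add: L2_iff sq_int_diff)
 fix \<psi> i j assume \<psi>: "\<psi> \<in> test_functions \<Omega>"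
 note s\<psi> = test_functionsD(1)[OF \<psi>]
 have c: "continuous_on UNIV \<psi>" "continuous_on UNIV (\<lambda>x. pd j \<psi> x)"
  by (intro smooth_continuous_on smooth_frechet_derivative s\<psi>)+
 note i = integrable_mult_continuous[OF sq_int_nth[OF sq_int_nth[OF sq(1)]] c(1) \<Omega>, of i j]
  integrable_mult_continuous[OF sq_int_nth[OF sq_int_nth[OF sq(2)]] c(1) \<Omega>, of i j]
  integrable_mult_continuous[OF sq_int_nth[OF sq(3)] c(2) \<Omega>, of i]
  integrable_mult_continuous[OF sq_int_nth[OF sq(4)] c(2) \<Omega>, of i]
 have e: "(LINT x|lebesgue_on \<Omega>. f x $ i * pd j \<psi> x)
    = - (LINT x|lebesgue_on \<Omega>. F x $ i $ j * \<psi> x)"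
  "(LINT x|lebesgue_on \<Omega>. g x $ i * pd j \<psi> x)
    = - (LINT x|lebesgue_on \<Omega>. G x $ i $ j * \<psi> x)"
  using f(1) g(1) \<psi> unfolding has_weak_gradient_def by blast+
 show "(LINT x|lebesgue_on \<Omega>. (f x - g x) $ i * pd j \<psi> x)
    = - (LINT x|lebesgue_on \<Omega>. (F x - G x) $ i $ j * \<psi> x)"
  by (simp add: left_diff_distrib Bochner_Integration.integral_diff[OF i(3,4)]
    Bochner_Integration.integral_diff[OF i(1,2)] e)
qed

text \<open>\<open>weak_gradient\<close> is an arbitrary choice among the weak gradients; this
  uniqueness lets a computation with a concrete gradient be transferred to it.\<close>

lemma has_weak_gradient_unique:
 fixes f :: "real^'n => real^'m"
 assumes F: "has_weak_gradient \<Omega> f F" and G: "has_weak_gradient \<Omega> f G"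
  and \<Omega>: "open \<Omega>" "bounded \<Omega>" "\<Omega> \<in> lmeasurable"
 shows "AE x in lebesgue_on \<Omega>. F x = G x"
proof -
 have sq: "sq_int (lebesgue_on \<Omega>) F" "sq_int (lebesgue_on \<Omega>) G"
  using F G by (simp_all add: has_weak_gradient_def L2_iff)
 have "AE x in lebesgue_on \<Omega>. F x $ i $ j - G x $ i $ j = 0" for i j
 proof (rule test_null_AE[OF \<Omega>(1,3)])
  show "sq_int (lebesgue_on \<Omega>) (\<lambda>x. F x $ i $ j - G x $ i $ j)"
   by (intro sq_int_diff sq_int_nth sq)
  fix \<psi> assume \<psi>: "\<psi> \<in> test_functions \<Omega>"
  have c: "continuous_on UNIV \<psi>" by (rule smooth_continuous_on[OF test_functionsD(1)[OF \<psi>]])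
  have "(LINT x|lebesgue_on \<Omega>. f x $ i * pd j \<psi> x)
    = - (LINT x|lebesgue_on \<Omega>. F x $ i $ j * \<psi> x)"
   "(LINT x|lebesgue_on \<Omega>. f x $ i * pd j \<psi> x)
    = - (LINT x|lebesgue_on \<Omega>. G x $ i $ j * \<psi> x)"
   using F G \<psi> unfolding has_weak_gradient_def by blast+
  then have "(LINT x|lebesgue_on \<Omega>. F x $ i $ j * \<psi> x) = (LINT x|lebesgue_on \<Omega>. G x $ i $ j * \<psi> x)"
   by linarith
  then show "(LINT x|lebesgue_on \<Omega>. (F x $ i $ j - G x $ i $ j) * \<psi> x) = 0"
   by (simp add: left_diff_distrib Bochner_Integration.integral_diff
     integrable_mult_continuous[OF sq_int_nth[OF sq_int_nth[OF sq(1)]] c \<Omega>(2,3)]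
     integrable_mult_continuous[OF sq_int_nth[OF sq_int_nth[OF sq(2)]] c \<Omega>(2,3)])
 qed
 then have "AE x in lebesgue_on \<Omega>. \<forall>i\<in>UNIV. \<forall>j\<in>UNIV. F x $ i $ j - G x $ i $ j = 0"
  by (intro AE_finite_allI) simp_all
 then show ?thesis by eventually_elim (simp add: vec_eq_iff)
qed

lemma has_weak_gradient_weak_gradient:
 "has_weak_gradient \<Omega> f G ==> has_weak_gradient \<Omega> f (weak_gradient \<Omega> f)"
 unfolding weak_gradient_def by (rule someI[where P = "has_weak_gradient \<Omega> f"])

text \<open>The H^1 norm of \<phi>_n - f contains the chosen weak gradient of the difference. By
  uniqueness it equals grad \<phi>_n minus the weak gradient of \<open>f\<close> almost everywhere,
  so the convergence can be expressed by classical gradients of the approximating fields.\<close>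

lemma H1_closure_approx:
 fixes f :: "real^'n => real^'m"
 assumes f: "f \<in> H1_closure \<Omega> S" and S: "\<And>\<phi>. \<phi> \<in> S ==> smooth_on \<phi> UNIV"
  and \<Omega>: "open \<Omega>" "bounded \<Omega>" "\<Omega> \<in> lmeasurable"
 shows "sq_int (lebesgue_on \<Omega>) f" "sq_int (lebesgue_on \<Omega>) (weak_gradient \<Omega> f)"
  "\<exists>\<phi>. (\<forall>n::nat. \<phi> n \<in> S) \<and> (\<lambda>n. dst (lebesgue_on \<Omega>) (\<phi> n) f) ----> 0 \<and>
   (\<lambda>n. dst (lebesgue_on \<Omega>) (grad (\<phi> n)) (weak_gradient \<Omega> f)) ----> 0"
proof -
 let ?M = "lebesgue_on \<Omega>" and ?G = "weak_gradient \<Omega> f"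
 have fL: "f \<in> L2 \<Omega>" using f by (simp add: H1_closure_def H1_def)
 have hw: "has_weak_gradient \<Omega> f ?G"
  using f has_weak_gradient_weak_gradient by (auto simp: H1_closure_def H1_def)
 show "sq_int ?M f" "sq_int ?M ?G" using fL hw by (simp_all add: L2_iff has_weak_gradient_def)
 have "\<exists>\<phi>\<in>S. H1_norm \<Omega> (\<lambda>x. \<phi> x - f x) < 1 / real (Suc n)" for n
 proof -
  have "1 / real (Suc n) > 0" by simp
  then show ?thesis using f unfolding H1_closure_def by blast
 qed
 then obtain \<phi> where \<phi>: "\<And>n. \<phi> n \<in> S" "\<And>n. H1_norm \<Omega> (\<lambda>x. \<phi> n x - f x) < 1 / real (Suc n)"
  by metis
 have e: "dst ?M (grad (\<phi> n)) ?G = nrm ?M (weak_gradient \<Omega> (\<lambda>x. \<phi> n x - f x))" for n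
 proof -
  have "has_weak_gradient \<Omega> (\<lambda>x. \<phi> n x - f x) (\<lambda>x. grad (\<phi> n) x - ?G x)"
   using sq_int_continuous[OF smooth_continuous_on[OF S[OF \<phi>(1)[of n]]] \<Omega>(2,3)]
   by (intro has_weak_gradient_diff smooth_has_weak_gradient S \<phi> hw fL \<Omega>) (simp add: L2_iff)
  note 1 = this and 2 = has_weak_gradient_weak_gradient[OF this]
  have "sq_int ?M (\<lambda>x. grad (\<phi> n) x - ?G x)"
   "sq_int ?M (weak_gradient \<Omega> (\<lambda>x. \<phi> n x - f x))"
   using 1 2 by (simp_all add: has_weak_gradient_def L2_iff)
  then show ?thesis
   by (intro nrm_cong_AE has_weak_gradient_unique[OF 1 2 \<Omega>] sq_int_measurable)
 qed
 have b: "dst ?M (\<phi> n) f \<le> 1 / real (Suc n)"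
  "dst ?M (grad (\<phi> n)) ?G \<le> 1 / real (Suc n)" for n
 proof -
  let ?h = "\<lambda>x. \<phi> n x - f x"
  have "L2_norm \<Omega> ?h \<le> H1_norm \<Omega> ?h" "L2_norm \<Omega> (weak_gradient \<Omega> ?h) \<le> H1_norm \<Omega> ?h"
   unfolding H1_norm_def by (auto intro!: real_le_rsqrt)
  then show "dst ?M (\<phi> n) f \<le> 1 / real (Suc n)"
   "dst ?M (grad (\<phi> n)) ?G \<le> 1 / real (Suc n)"
   using \<phi>(2)[of n] by (simp_all add: L2_norm_eq e)
 qed
 have "(\<lambda>n. 1 / real (Suc n)) ----> 0"
  using LIMSEQ_inverse_real_of_nat by (simp add: inverse_eq_divide)
 then have "(\<lambda>n. dst ?M (\<phi> n) f) ----> 0"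
  "(\<lambda>n. dst ?M (grad (\<phi> n)) ?G) ----> 0"
  using b by (auto intro: tendsto_zero_squeeze simp: nrm_nonneg)
 then show "\<exists>\<phi>. (\<forall>n::nat. \<phi> n \<in> S) \<and> (\<lambda>n. dst ?M (\<phi> n) f) ----> 0 \<and>
   (\<lambda>n. dst ?M (grad (\<phi> n)) ?G) ----> 0"
  by (intro exI[of _ \<phi>] conjI allI \<phi>(1))
qed

lemma L2_closure_approx:
 fixes f :: "real^'n => real^'m"
 assumes f: "f \<in> L2_closure \<Omega> S"
 shows "sq_int (lebesgue_on \<Omega>) f"
  "\<exists>\<phi>. (\<forall>n::nat. \<phi> n \<in> S) \<and> (\<lambda>n. dst (lebesgue_on \<Omega>) (\<phi> n) f) ----> 0"
proof -
 show "sq_int (lebesgue_on \<Omega>) f" using f by (simp add: L2_closure_def L2_iff)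
 have "\<exists>\<phi>\<in>S. dst (lebesgue_on \<Omega>) \<phi> f < 1 / real (Suc n)" for n
 proof -
  have "1 / real (Suc n) > 0" by simp
  then show ?thesis using f unfolding L2_closure_def L2_norm_eq by blast
 qed
 then obtain \<phi> where \<phi>: "\<And>n. \<phi> n \<in> S" "\<And>n. dst (lebesgue_on \<Omega>) (\<phi> n) f < 1 / real (Suc n)"
  by metis
 have "(\<lambda>n. 1 / real (Suc n)) ----> 0"
  using LIMSEQ_inverse_real_of_nat by (simp add: inverse_eq_divide)
 then have "(\<lambda>n. dst (lebesgue_on \<Omega>) (\<phi> n) f) ----> 0"
  by (rule tendsto_zero_squeeze) (use \<phi>(2) in \<open>auto simp: nrm_nonneg less_imp_le\<close>)
 then show "\<exists>\<phi>. (\<forall>n::nat. \<phi> n \<in> S) \<and> (\<lambda>n. dst (lebesgue_on \<Omega>) (\<phi> n) f) ----> 0"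
  by (intro exI[of _ \<phi>] conjI allI \<phi>(1))
qed

section \<open>Fubini on the cylinder\<close>

definition emb :: "real^2 => real => real^3" where
 "emb y z = (\<chi> i. if i = 1 then y $ 1 else if i = 2 then y $ 2 else z)"

definition pt :: "real => real => real^2" where
 "pt a b = (\<chi> i. if i = 1 then a else b)"

lemma emb_nth [simp]: "emb y z $ 1 = y $ 1" "emb y z $ 2 = y $ 2" "emb y z $ 3 = z"
 by (simp_all add: emb_def)

lemma pt_nth [simp]: "pt a b $ 1 = a" "pt a b $ 2 = b"
 by (simp_all add: pt_def)

lemma horiz_nth [simp]: "horiz x $ 1 = x $ 1" "horiz x $ 2 = x $ 2"
 by (simp_all add: horiz_def)

lemma horiz_emb [simp]: "horiz (emb y z) = y"
 by (simp add: vec_eq_iff forall_2)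

lemma emb_horiz [simp]: "emb (horiz x) (x $ 3) = x"
 by (simp add: vec_eq_iff forall_3)

lemma pt_eta [simp]: "pt (y $ 1) (y $ 2) = y"
 by (simp add: vec_eq_iff forall_2)

lemma emb_mem_cylinder [simp]: "emb y z \<in> cylinder D L \<longleftrightarrow> y \<in> D \<and> 0 < z \<and> z < L"
 by (simp add: cylinder_def)

lemma bounded_linear_horiz: "bounded_linear horiz"
proof -
 have "linear horiz"
  by (rule linearI) (simp_all add: vec_eq_iff forall_2)
 then show ?thesis by (simp add: linear_conv_bounded_linear)
qed

lemma bounded_linear_emb: "bounded_linear (\<lambda>p. emb (fst p) (snd p))"
proof -
 have "linear (\<lambda>p. emb (fst p) (snd p))"
  by (rule linearI) (simp_all add: vec_eq_iff forall_3)
 then show ?thesis by (simp add: linear_conv_bounded_linear)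
qed

lemma bounded_linear_pt: "bounded_linear (\<lambda>p. pt (fst p) (snd p))"
proof -
 have "linear (\<lambda>p. pt (fst p) (snd p))"
  by (rule linearI) (simp_all add: vec_eq_iff forall_2)
 then show ?thesis by (simp add: linear_conv_bounded_linear)
qed

lemma emb_add: "emb y z + emb y' z' = emb (y + y') (z + z')"
 by (simp add: vec_eq_iff forall_3)

lemma emb_scaleR: "c *\<^sub>R emb y z = emb (c *\<^sub>R y) (c * z)"
 by (simp add: vec_eq_iff forall_3)

lemma emb_axis: "emb (axis 1 1) 0 = axis 1 1" "emb (axis 2 1) 0 = axis 2 1" "emb 0 1 = axis 3 1"
 by (simp_all add: vec_eq_iff forall_3 axis_def)

lemma horiz_axis: "horiz (axis 1 1) = axis 1 1" "horiz (axis 2 1) = axis 2 1" "horiz (axis 3 1) = 0"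
 by (simp_all add: vec_eq_iff forall_2 axis_def)

lemma continuous_on_emb: "continuous_on UNIV (\<lambda>p. emb (fst p) (snd p))"
 by (rule linear_continuous_on[OF bounded_linear_emb])

lemma prod_Basis_vec: "(\<Prod>b\<in>Basis. (u - l) \<bullet> b) = (\<Prod>i\<in>UNIV. u $ i - l $ i)"
 for u l :: "real^'n"
proof -
 have B: "(Basis :: (real^'n) set) = range (\<lambda>i. axis i 1)"
  by (auto simp: Basis_vec_def)
 have "inj (\<lambda>i::'n. axis i (1::real))" by (auto simp: inj_def axis_eq_axis)
 then show ?thesis unfolding B by (simp add: prod.reindex inner_axis)
qed

lemma prod_UNIV_2: "(\<Prod>i\<in>UNIV. f (i :: 2)) = f 1 * (f 2 :: real)"
 unfolding UNIV_2 by simp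

lemma prod_UNIV_3: "(\<Prod>i\<in>UNIV. f (i :: 3)) = f 1 * f 2 * (f 3 :: real)"
 unfolding UNIV_3 by (simp add: mult.assoc)

text \<open>Lebesgue measure is determined by the volumes of boxes, and \<open>emb\<close> pulls a
  box back to the product of its horizontal and its vertical part.\<close>

lemma lborel_emb: "distr lborel borel (\<lambda>p. emb (fst p) (snd p)) = lborel"
proof (rule lborel_eqI[symmetric])
 fix l u :: "real^3" assume lu: "\<And>b. b \<in> Basis ==> l \<bullet> b \<le> u \<bullet> b"
 have le: "l $ i \<le> u $ i" for i
  using lu[of "axis i 1"] by (auto simp: Basis_vec_def inner_axis)
 have "(\<lambda>p. emb (fst p) (snd p)) -` box l u = box (horiz l) (horiz u) \<times> box (l $ 3) (u $ 3)"
  by (auto simp: mem_box_cart forall_3 forall_2 mem_box)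
 then have "emeasure (distr lborel borel (\<lambda>p. emb (fst p) (snd p))) (box l u) =
   emeasure (lborel \<Otimes>\<^sub>M lborel) (box (horiz l) (horiz u) \<times> box (l $ 3) (u $ 3))"
  using borel_measurable_continuous_onI[OF continuous_on_emb]
  by (subst emeasure_distr) (simp_all add: lborel_prod)
 also have "\<dots> = emeasure lborel (box (horiz l) (horiz u)) * emeasure lborel (box (l $ 3) (u $ 3))"
  by (rule lborel.emeasure_pair_measure_Times) simp_all
 also have "\<dots> = ennreal (\<Prod>b\<in>Basis. (horiz u - horiz l) \<bullet> b) * ennreal (u $ 3 - l $ 3)"
 proof -
  have "horiz l $ i \<le> horiz u $ i" for i using exhaust_2[of i] le by auto
  then have "horiz l \<bullet> b \<le> horiz u \<bullet> b" if "b \<in> Basis" for b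
   using that by (auto simp: Basis_vec_def inner_axis)
  from emeasure_lborel_box[OF this] show ?thesis
   using le[of 3] by (simp only: box_real emeasure_lborel_Ioo)
 qed
 also have "\<dots> = ennreal (\<Prod>b\<in>Basis. (u - l) \<bullet> b)"
  unfolding prod_Basis_vec prod_UNIV_2 prod_UNIV_3 horiz_nth
  using le[of 1] le[of 2] le[of 3] by (intro ennreal_mult[symmetric] mult_nonneg_nonneg) simp_all
 finally show "emeasure (distr lborel borel (\<lambda>p. emb (fst p) (snd p))) (box l u) = ennreal (\<Prod>b\<in>Basis. (u - l) \<bullet> b)" .
qed simp

lemma lborel_pt: "distr lborel borel (\<lambda>p. pt (fst p) (snd p)) = lborel"
proof (rule lborel_eqI[symmetric])
 fix l u :: "real^2" assume lu: "\<And>b. b \<in> Basis ==> l \<bullet> b \<le> u \<bullet> b"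
 have le: "l $ i \<le> u $ i" for i
  using lu[of "axis i 1"] by (auto simp: Basis_vec_def inner_axis)
 have "(\<lambda>p. pt (fst p) (snd p)) -` box l u = box (l $ 1) (u $ 1) \<times> box (l $ 2) (u $ 2)"
  by (auto simp: mem_box_cart forall_2 mem_box)
 then have "emeasure (distr lborel borel (\<lambda>p. pt (fst p) (snd p))) (box l u) =
   emeasure (lborel \<Otimes>\<^sub>M lborel) (box (l $ 1) (u $ 1) \<times> box (l $ 2) (u $ 2))"
  using borel_measurable_continuous_onI[OF linear_continuous_on[OF bounded_linear_pt]]
  by (subst emeasure_distr) (simp_all add: lborel_prod)
 also have "\<dots> = emeasure lborel (box (l $ 1) (u $ 1)) * emeasure lborel (box (l $ 2) (u $ 2))"
  by (rule lborel.emeasure_pair_measure_Times) simp_all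
 also have "\<dots> = ennreal (u $ 1 - l $ 1) * ennreal (u $ 2 - l $ 2)"
  using le[of 1] le[of 2] by (simp only: box_real emeasure_lborel_Ioo)
 also have "\<dots> = ennreal (\<Prod>b\<in>Basis. (u - l) \<bullet> b)"
  unfolding prod_Basis_vec prod_UNIV_2
  using le[of 1] le[of 2] by (intro ennreal_mult[symmetric]) simp_all
 finally show "emeasure (distr lborel borel (\<lambda>p. pt (fst p) (snd p))) (box l u) = ennreal (\<Prod>b\<in>Basis. (u - l) \<bullet> b)" .
qed simp

lemma measurable_emb: "(\<lambda>p. emb (fst p) (snd p)) \<in> borel_measurable (lborel \<Otimes>\<^sub>M lborel)"
 using borel_measurable_continuous_onI[OF continuous_on_emb] by (simp add: lborel_prod)

lemma measurable_pt: "(\<lambda>p. pt (fst p) (snd p)) \<in> borel_measurable (lborel \<Otimes>\<^sub>M lborel)"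
 using borel_measurable_continuous_onI[OF linear_continuous_on[OF bounded_linear_pt]]
 by (simp add: lborel_prod)

lemma lborel_emb_pair: "distr (lborel \<Otimes>\<^sub>M lborel) borel (\<lambda>p. emb (fst p) (snd p)) = lborel"
 using lborel_emb by (simp add: lborel_prod)

lemma nn_integral_emb:
 assumes "f \<in> borel_measurable borel"
 shows "(\<integral>\<^sup>+x. f x \<partial>lborel) = (\<integral>\<^sup>+y. \<integral>\<^sup>+z. f (emb y z) \<partial>lborel \<partial>lborel)"
proof -
 have "(\<integral>\<^sup>+x. f x \<partial>lborel) = (\<integral>\<^sup>+x. f x \<partial>distr (lborel \<Otimes>\<^sub>M lborel) borel (\<lambda>p. emb (fst p) (snd p)))"
  by (simp only: lborel_emb_pair)
 also have "\<dots> = (\<integral>\<^sup>+p. f (emb (fst p) (snd p)) \<partial>(lborel \<Otimes>\<^sub>M lborel))"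
  using assms measurable_emb by (intro nn_integral_distr) simp_all
 also have "\<dots> = (\<integral>\<^sup>+y. \<integral>\<^sup>+z. f (emb y z) \<partial>lborel \<partial>lborel)"
  using lborel.nn_integral_fst[OF measurable_compose[OF measurable_emb assms]] by simp
 finally show ?thesis .
qed

lemma nn_integral_pt:
 assumes "f \<in> borel_measurable borel"
 shows "(\<integral>\<^sup>+x. f x \<partial>lborel) = (\<integral>\<^sup>+a. \<integral>\<^sup>+b. f (pt a b) \<partial>lborel \<partial>lborel)"
proof -
 have "(\<integral>\<^sup>+x. f x \<partial>lborel) = (\<integral>\<^sup>+x. f x \<partial>distr (lborel \<Otimes>\<^sub>M lborel) borel (\<lambda>p. pt (fst p) (snd p)))"
  using lborel_pt by (simp add: lborel_prod)
 also have "\<dots> = (\<integral>\<^sup>+p. f (pt (fst p) (snd p)) \<partial>(lborel \<Otimes>\<^sub>M lborel))"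
  using assms measurable_pt by (intro nn_integral_distr) simp_all
 also have "\<dots> = (\<integral>\<^sup>+y. \<integral>\<^sup>+z. f (pt y z) \<partial>lborel \<partial>lborel)"
  using lborel.nn_integral_fst[OF measurable_compose[OF measurable_pt assms]] by simp
 finally show ?thesis .
qed

text \<open>The integral over the height, not the mean: on x_3-independent fields it is
  multiplication by \<open>L\<close>, and without a factor 1/L it is exactly the adjoint of the
  lift.\<close>

definition vert :: "real => (real^3 => 'b::euclidean_space) => real^2 => 'b" where
 "vert L f y = (LINT z|lebesgue_on {0<..<L}. f (emb y z))"

text \<open>Completeness at work: the Lebesgue sigma-algebra, unlike the Borel one, is stable under
  changes on null sets.\<close>

lemma borel_measurable_lebesgue_AE:
 fixes f g :: "'a::euclidean_space => real"
 assumes f: "f \<in> borel_measurable lebesgue" and eq: "AE x in lborel. f x = g x"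
 shows "g \<in> borel_measurable lebesgue"
proof (rule measurableI)
 fix A :: "real set" assume A: "A \<in> sets borel"
 have c: "complete_measure (lebesgue :: 'a measure)" by (rule completion.complete_measure_axioms)
 have "AE x in lebesgue. x \<in> f -` A \<longleftrightarrow> x \<in> g -` A"
  using AE_completion[OF eq] by eventually_elim simp
 moreover have "f -` A \<in> sets lebesgue" using measurable_sets[OF f A] by simp
 ultimately have "g -` A \<in> sets lebesgue"
  by (rule complete_measure.in_sets_AE[OF c]) simp
 then show "g -` A \<inter> space lebesgue \<in> sets lebesgue" by simp
qed simp

section \<open>Measure theory on the cylinder\<close>

locale cyl =
 fixes D :: "(real^2) set" and L :: real
 assumes D: "open D" "bounded D" and L: "L > 0"
begin

abbreviation "C \<equiv> cylinder D L"
abbreviation "MC \<equiv> lebesgue_on (cylinder D L)"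
abbreviation "MD \<equiv> lebesgue_on D"
abbreviation "MI \<equiv> lebesgue_on {0<..<L}"

lemma open_cylinder: "open C"
proof -
 have "C = horiz -` D \<inter> {x. 0 < x $ 3} \<inter> {x. x $ 3 < L}" by (auto simp: cylinder_def)
 moreover have "open (horiz -` D)"
  by (rule open_vimage[OF D(1) linear_continuous_on[OF bounded_linear_horiz]])
 moreover have "open {x :: real^3. 0 < x $ 3}" "open {x :: real^3. x $ 3 < L}"
  by (intro open_Collect_less continuous_intros)+
 ultimately show ?thesis by auto
qed

lemma bounded_cylinder: "bounded C"
proof -
 have "C \<subseteq> (\<lambda>p. emb (fst p) (snd p)) ` (D \<times> {0<..<L})"
 proof
  fix x assume "x \<in> C"
  then have "x = emb (fst (horiz x, x $ 3)) (snd (horiz x, x $ 3))" "(horiz x, x $ 3) \<in> D \<times> {0<..<L}"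
   by (simp_all add: cylinder_def)
  then show "x \<in> (\<lambda>p. emb (fst p) (snd p)) ` (D \<times> {0<..<L})" by (rule image_eqI)
 qed
 moreover have "bounded (D \<times> {0<..<L})" by (intro bounded_Times D) simp
 ultimately show ?thesis
  using bounded_linear_image[OF _ bounded_linear_emb] bounded_subset by blast
qed

lemma lmeasurable_cylinder: "C \<in> lmeasurable"
 by (rule lmeasurable_open[OF bounded_cylinder open_cylinder])

lemma lmeasurable_D: "D \<in> lmeasurable"
 by (rule lmeasurable_open[OF D(2,1)])

lemma sets_cylinder: "C \<in> sets lebesgue" and sets_D: "D \<in> sets lebesgue"
 using lmeasurable_cylinder lmeasurable_D by (simp_all add: fmeasurableD)

lemma AE_lebesgue_on: "S \<in> sets lebesgue ==>
 (AE x in lebesgue_on S. P x) \<longleftrightarrow> (AE x in lborel. x \<in> S \<longrightarrow> P x)" for S :: "'a::euclidean_space set"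
 by (simp add: AE_restrict_space_iff AE_completion_iff)

lemma AE_emb:
 assumes "AE x in lborel. P x"
 shows "AE y in lborel. AE z in lborel. P (emb y z)"
proof -
 have "AE p in lborel \<Otimes>\<^sub>M lborel. P (emb (fst p) (snd p))"
  using assms by (intro AE_distrD[OF measurable_emb, unfolded lborel_emb_pair])
 from lborel_pair.AE_pair[OF this] show ?thesis by simp
qed

text \<open>Fubini's theorem for products of Borel measures does not apply to \<open>f\<close>
  directly, which is merely Lebesgue measurable. A Borel function \<open>g\<close> equal to
  \<open>f\<close> almost everywhere is integrated instead; completeness of Lebesgue measure then
  returns measurability to almost every slice of \<open>f\<close> and to the vertical
  integral.\<close>

lemma vert_fubini:
 fixes f :: "real^3 => real"
 assumes f: "integrable MC f"
 shows "AE y in MD. integrable MI (\<lambda>z. f (emb y z))"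
  and "integrable MD (vert L f)" and "(LINT x|MC. f x) = (LINT y|MD. vert L f y)"
proof -
 let ?f = "\<lambda>x. indicator C x * f x"
 have fi: "integrable lebesgue ?f"
  using f integrable_restrict_space[of C lebesgue f] sets_cylinder by simp
 obtain g where g: "g \<in> borel_measurable lborel" and fg: "AE x in lborel. ?f x = g x"
  using completion_ex_borel_measurable_real[OF borel_measurable_integrable[OF fi]] by blast
 have gm: "g \<in> borel_measurable borel" using g by simp
 have gi: "integrable lborel g"
 proof -
  have "integrable lebesgue g"
   by (rule integrable_cong_AE_imp[OF fi measurable_completion[OF g]])
     (use AE_completion[OF fg] in \<open>eventually_elim, simp\<close>)
  then show ?thesis using g by (simp add: integrable_completion)
 qed
 have if_ig: "(LINT x|MC. f x) = (LINT x|lborel. g x)"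
 proof -
  have "(LINT x|MC. f x) = (LINT x|lebesgue. ?f x)"
   using integral_restrict_space[of C lebesgue f] sets_cylinder by simp
  also have "\<dots> = (LINT x|lebesgue. g x)"
   by (rule integral_cong_AE[OF borel_measurable_integrable[OF fi] measurable_completion[OF g] AE_completion[OF fg]])
  also have "\<dots> = (LINT x|lborel. g x)" by (rule integral_completion[OF g])
  finally show ?thesis .
 qed
 have gp: "integrable (lborel \<Otimes>\<^sub>M lborel) (\<lambda>p. g (emb (fst p) (snd p)))"
  using integrable_distr_eq[OF measurable_emb gm] gi by (simp add: lborel_emb_pair)
 have ig: "(LINT x|lborel. g x) = (LINT p|((lborel \<Otimes>\<^sub>M lborel)). g (emb (fst p) (snd p)))"
  using integral_distr[OF measurable_emb gm] by (simp add: lborel_emb_pair)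
 have 1: "AE y in lborel. integrable lborel (\<lambda>z. g (emb y z))"
  and 2: "integrable lborel (\<lambda>y. \<integral>z. g (emb y z) \<partial>lborel)"
  and 3: "(LINT y|lborel. \<integral>z. g (emb y z) \<partial>lborel) = (LINT p|((lborel \<Otimes>\<^sub>M lborel)). g (emb (fst p) (snd p)))"
  using lborel_pair.AE_integrable_fst'[OF gp] lborel_pair.integrable_fst'[OF gp] lborel_pair.integral_fst'[OF gp]
  by simp_all
 \<comment> \<open>For almost every \<open>y\<close> in \<open>D\<close> the slices of
   \<open>f\<close> and \<open>g\<close> agree almost everywhere; for almost every \<open>y\<close>
   outside \<open>D\<close> the slice of \<open>g\<close> vanishes almost everywhere.\<close>
 have key: "AE y in lborel. (y \<in> D \<longrightarrow> integrable MI (\<lambda>z. f (emb y z))) \<and>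
   indicator D y * vert L f y = (LINT z|lborel. g (emb y z))"
  using AE_emb[OF fg] 1
 proof eventually_elim
  case (elim y)
  let ?h = "\<lambda>z. indicator {0<..<L} z * f (emb y z)"
  have gy: "(\<lambda>z. g (emb y z)) \<in> borel_measurable lborel" using elim(2) by (rule borel_measurable_integrable)
  have gl: "integrable lebesgue (\<lambda>z. g (emb y z))" "(LINT z|lebesgue. g (emb y z)) = (LINT z|lborel. g (emb y z))"
   using elim(2) gy by (simp_all add: integrable_completion integral_completion)
  show ?case
  proof (cases "y \<in> D")
   case True
   have ae: "AE z in lborel. g (emb y z) = ?h z"
    using elim(1) by eventually_elim (use True in \<open>auto simp: indicator_def\<close>)
   have hm: "?h \<in> borel_measurable lebesgue"
    by (rule borel_measurable_lebesgue_AE[OF measurable_completion[OF gy] ae])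
   have hi: "integrable lebesgue ?h"
    by (rule integrable_cong_AE_imp[OF gl(1) hm]) (use AE_completion[OF ae] in \<open>eventually_elim, simp\<close>)
   then have "integrable MI (\<lambda>z. f (emb y z))"
    using integrable_restrict_space[of "{0<..<L}" lebesgue "\<lambda>z. f (emb y z)"] by simp
   moreover have "vert L f y = (LINT z|lebesgue. ?h z)"
    using integral_restrict_space[of "{0<..<L}" lebesgue "\<lambda>z. f (emb y z)"] by (simp add: vert_def)
   moreover have "(LINT z|lebesgue. ?h z) = (LINT z|lebesgue. g (emb y z))"
   proof (rule integral_cong_AE[OF hm measurable_completion[OF gy]])
    show "AE z in lebesgue. ?h z = g (emb y z)"
     using AE_completion[OF ae] by eventually_elim simp
   qed
   ultimately show ?thesis using True gl(2) by simp
  next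
   case False
   have "AE z in lborel. g (emb y z) = 0"
    using elim(1) by eventually_elim (use False in \<open>auto simp: indicator_def\<close>)
   then have "(LINT z|lborel. g (emb y z)) = 0" by (rule integral_eq_zero_AE)
   then show ?thesis using False by simp
  qed
 qed
 show "AE y in MD. integrable MI (\<lambda>z. f (emb y z))"
  unfolding AE_lebesgue_on[OF sets_D] using key by eventually_elim simp
 let ?v = "\<lambda>y. indicator D y * vert L f y"
 have ae: "AE y in lborel. (LINT z|lborel. g (emb y z)) = ?v y"
  using key by eventually_elim simp
 have gm2: "(\<lambda>y. \<integral>z. g (emb y z) \<partial>lborel) \<in> borel_measurable lborel" using 2 by (rule borel_measurable_integrable)
 have vm: "?v \<in> borel_measurable lebesgue"
  by (rule borel_measurable_lebesgue_AE[OF measurable_completion[OF gm2] ae])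
 have gl2: "integrable lebesgue (\<lambda>y. \<integral>z. g (emb y z) \<partial>lborel)" using 2 gm2 by (simp add: integrable_completion)
 have "integrable lebesgue ?v"
  by (rule integrable_cong_AE_imp[OF gl2 vm]) (use AE_completion[OF ae] in \<open>eventually_elim, simp\<close>)
 then show "integrable MD (vert L f)"
  using integrable_restrict_space[of D lebesgue "vert L f"] sets_D by simp
 have "(LINT y|MD. vert L f y) = (LINT y|lebesgue. ?v y)"
  using integral_restrict_space[of D lebesgue "vert L f"] sets_D by simp
 also have "\<dots> = (LINT y|lebesgue. \<integral>z. g (emb y z) \<partial>lborel)"
 proof (rule integral_cong_AE[OF vm measurable_completion[OF gm2]])
  show "AE y in lebesgue. ?v y = (LINT z|lborel. g (emb y z))"
   using AE_completion[OF ae] by eventually_elim simp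
 qed
 also have "\<dots> = (LINT y|lborel. \<integral>z. g (emb y z) \<partial>lborel)" by (rule integral_completion[OF gm2])
 finally show "(LINT x|MC. f x) = (LINT y|MD. vert L f y)"
  using if_ig ig 3 by simp
qed

text \<open>Beyond Borel measurability this requires preimages of null sets to be null. By Fubini
  the measure of the preimage of a null set \<open>N\<close> is the integral of the infinite height
  over \<open>N\<close>, and this is 0 because zero times infinity is 0.\<close>

lemma horiz_measurable: "horiz \<in> measurable lebesgue lebesgue"
proof (rule complete_measure.measurable_completion2)
 show "complete_measure (lebesgue :: (real^3) measure)" by (rule completion.complete_measure_axioms)
 have hb: "horiz \<in> borel_measurable borel"
  by (rule borel_measurable_continuous_onI[OF linear_continuous_on[OF bounded_linear_horiz]])
 have hl: "horiz \<in> measurable lebesgue lborel"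
  using hb by (intro measurable_completion) simp
 then show "horiz \<in> lebesgue \<rightarrow>\<^sub>M lborel" .
 show "null_sets lborel \<subseteq> null_sets (distr lebesgue lborel horiz)"
 proof
  fix N assume N: "N \<in> null_sets (lborel :: (real^2) measure)"
  then have Nb: "N \<in> sets borel" and N0: "emeasure lborel N = 0" by auto
  have hN: "horiz -` N \<in> sets borel" using measurable_sets[OF hb Nb] by simp
  have "emeasure lborel (horiz -` N) = (\<integral>\<^sup>+x. indicator (horiz -` N) x \<partial>lborel)"
   using hN by simp
  also have "\<dots> = (\<integral>\<^sup>+y. \<integral>\<^sup>+z. indicator (horiz -` N) (emb y z) \<partial>lborel \<partial>lborel)"
   using hN by (intro nn_integral_emb) simp
  also have "\<dots> = (\<integral>\<^sup>+y. indicator N y * (\<integral>\<^sup>+z. 1 \<partial>(lborel :: real measure)) \<partial>lborel)"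
   by (intro nn_integral_cong) (simp add: indicator_def)
  also have "\<dots> = (\<integral>\<^sup>+y. 0 \<partial>(lborel :: (real^2) measure))"
  proof (rule nn_integral_cong_AE)
   show "AE y in lborel. indicator N y * (\<integral>\<^sup>+z. 1 \<partial>(lborel :: real measure)) = 0"
    using AE_not_in[OF N] by eventually_elim simp
  qed
  finally have "emeasure lborel (horiz -` N) = 0" by simp
  then have "emeasure lebesgue (horiz -` N) = 0" using hN by simp
  then show "N \<in> null_sets (distr lebesgue lborel horiz)"
   using Nb hl by (intro null_setsI) (simp_all add: emeasure_distr)
 qed
qed

lemma horiz_measurable_on: "horiz \<in> measurable MC MD"
 by (rule measurable_restrict_space3[OF horiz_measurable]) (auto simp: cylinder_def)

lemma lift_measurable: "g \<in> borel_measurable MD ==> (lift g) \<in> borel_measurable MC"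
 by (rule measurable_compose[OF horiz_measurable_on])

lemma finite_MC: "finite_measure MC" and finite_MD: "finite_measure MD" and finite_MI: "finite_measure MI"
 by (intro finite_measure_lebesgue_on lmeasurable_cylinder lmeasurable_D lmeasurable_open, (simp_all)?)+

lemma measure_MI: "measure MI (space MI) = L"
 using L by (simp add: measure_restrict_space)

lemma vert_mult_lift: "vert L (\<lambda>x. g (horiz x) * f x) y = g y * vert L f y" for f :: "real^3 => real"
 by (simp add: vert_def)

lemma vert_lift: "vert L (lift g) y = L *\<^sub>R g y"
proof -
 interpret finite_measure MI by (rule finite_MI)
 show ?thesis using measure_MI by (simp add: vert_def)
qed

text \<open>\<open>vert_fubini\<close> presupposes integrability on the cylinder. It is clear for
  the bounded truncations of |g|, the cylinder having finite measure, and monotone convergence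
  passes it on to |g|.\<close>

lemma lift_integral:
 fixes g :: "real^2 => real"
 assumes g: "integrable MD g"
 shows "integrable MC (lift g)" "(LINT x|MC. g (horiz x)) = L * (LINT y|MD. g y)"
proof -
 have gm: "g \<in> borel_measurable MD" using g by (rule borel_measurable_integrable)
 interpret MC: finite_measure MC by (rule finite_MC)
 let ?h = "\<lambda>n::nat. \<lambda>y. min \<bar>g y\<bar> (real n)"
 have hi: "integrable MC (lift (?h n))" for n
  by (rule MC.integrable_const_bound[where B = "real n"])
    (use lift_measurable[OF gm] in auto)
 have hd: "integrable MD (?h n)" for n
  by (rule Bochner_Integration.integrable_bound[OF g]) (use gm in auto)
 have eq: "(LINT x|MC. ?h n (horiz x)) = L * (LINT y|MD. ?h n y)" for n
  using vert_fubini(3)[OF hi[of n]] vert_lift[of "?h n"] by simp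
 have lim: "(\<lambda>n. ?h n y) ----> \<bar>g y\<bar>" for y
 proof -
  obtain k :: nat where "\<bar>g y\<bar> \<le> real k" using real_arch_simple by blast
  then have "?h n y = \<bar>g y\<bar>" if "n \<ge> k" for n
   using that by (intro min_absorb1) linarith
  then have "eventually (\<lambda>n. ?h n y = \<bar>g y\<bar>) sequentially" unfolding eventually_sequentially by blast
  then show ?thesis by (rule tendsto_eventually)
 qed
 have "(\<lambda>n. \<integral>y. ?h n y \<partial>MD) ----> (LINT y|MD. \<bar>g y\<bar>)"
  by (rule integral_dominated_convergence[where w = "\<lambda>y. \<bar>g y\<bar>"]) (use gm g lim in auto)
 from tendsto_mult[OF tendsto_const[of L] this]
 have ilim: "(\<lambda>n. \<integral>x. ?h n (horiz x) \<partial>MC) ----> L * (LINT y|MD. \<bar>g y\<bar>)"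
  by (simp only: eq)
 have "integrable MC (\<lambda>x. \<bar>g (horiz x)\<bar>)"
 proof (rule integrable_monotone_convergence[OF hi _ _ ilim])
  show "AE x in MC. mono (\<lambda>n. ?h n (horiz x))"
   by (intro AE_I2 monoI) (simp add: min.coboundedI2)
  show "AE x in MC. (\<lambda>n. ?h n (horiz x)) ----> \<bar>g (horiz x)\<bar>"
   by (intro AE_I2 lim)
 qed (use lift_measurable[OF gm] in simp)
 then show gi: "integrable MC (lift g)"
  using lift_measurable[OF gm] by (simp add: integrable_abs_iff)
 show "(LINT x|MC. g (horiz x)) = L * (LINT y|MD. g y)"
  using vert_fubini(3)[OF gi] vert_lift[of g] by simp
qed

lemma lift_sq_int:
 fixes g :: "real^2 => 'b::euclidean_space"
 assumes "sq_int MD g"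
 shows "sq_int MC (lift g)" "(nrm MC (lift g))\<^sup>2 = L * (nrm MD g)\<^sup>2"
 using assms lift_measurable[of g] lift_integral[of "\<lambda>y. (norm (g y))\<^sup>2"]
 by (simp_all add: sq_int_def nrm_sq)

lemma integrable_mult_lift:
 fixes f :: "real^3 => real"
 assumes "integrable MC (\<lambda>x. g (horiz x) * f x)"
 shows "(LINT x|MC. g (horiz x) * f x) = (LINT y|MD. g y * vert L f y)"
 using vert_fubini(3)[OF assms] by (simp add: vert_mult_lift)

text \<open>Cauchy-Schwarz in the vertical variable against the constant 1: the square of the
  vertical integral is at most \<open>L\<close> times the vertical integral of the square.\<close>

lemma vert_sq_int:
 fixes f :: "real^3 => real"
 assumes f: "sq_int MC f"
 shows "sq_int MD (vert L f)"
proof -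
 have fi: "integrable MC f" by (rule sq_int_integrable_fm[OF lmeasurable_cylinder f])
 have f2: "integrable MC (\<lambda>x. (f x)\<^sup>2)" using sq_int_integrable[OF f] by simp
 have m: "vert L f \<in> borel_measurable MD" using vert_fubini(2)[OF fi] by (rule borel_measurable_integrable)
 have "integrable MD (\<lambda>y. (vert L f y)\<^sup>2)"
 proof (rule Bochner_Integration.integrable_bound)
  show "integrable MD (\<lambda>y. L * vert L (\<lambda>x. (f x)\<^sup>2) y)" using vert_fubini(2)[OF f2] by simp
  show "(\<lambda>y. (vert L f y)\<^sup>2) \<in> borel_measurable MD" using m by simp
  show "AE y in MD. norm ((vert L f y)\<^sup>2) \<le> norm (L * vert L (\<lambda>x. (f x)\<^sup>2) y)"
   using vert_fubini(1)[OF fi] vert_fubini(1)[OF f2]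
  proof eventually_elim
   case (elim y)
   have 1: "sq_int MI (\<lambda>z. f (emb y z))"
    using elim by (simp add: sq_int_def borel_measurable_integrable)
   have 2: "sq_int MI (\<lambda>z. 1 :: real)"
    by (rule sq_int_bounded[OF finite_MI, where C = 1]) auto
   interpret finite_measure MI by (rule finite_MI)
   have "\<bar>vert L f y\<bar> \<le> nrm MI (\<lambda>z. f (emb y z)) * nrm MI (\<lambda>z. 1 :: real)"
    using CS_inner[OF 1 2] by (simp add: vert_def)
   then have "\<bar>vert L f y\<bar>\<^sup>2 \<le> (nrm MI (\<lambda>z. f (emb y z)) * nrm MI (\<lambda>z. 1 :: real))\<^sup>2"
    by (intro power_mono) auto
   also have "\<dots> = L * vert L (\<lambda>x. (f x)\<^sup>2) y"
    using measure_MI by (simp add: power_mult_distrib nrm_sq vert_def mult.commute)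
   finally show ?case by simp
  qed
 qed
 then show ?thesis using m by (simp add: sq_int_def)
qed

text \<open>Vertical integration, taken componentwise, is the adjoint of the lift. It transfers weak
  continuity and weak measurability of \<open>u\<close> from \<open>D\<close> to its lift on the
  cylinder.\<close>

lemma lift_ip:
 fixes g :: "real^2 => real^'n" and w :: "real^3 => real^'n"
 assumes g: "sq_int MD g" and w: "sq_int MC w"
 shows "sq_int MD (\<lambda>y. \<chi> i. vert L (\<lambda>x. w x $ i) y)"
  "ip MC (lift g) w = ip MD g (\<lambda>y. \<chi> i. vert L (\<lambda>x. w x $ i) y)"
proof -
 let ?w = "\<lambda>y. \<chi> i. vert L (\<lambda>x. w x $ i) y"
 have v: "sq_int MD (vert L (\<lambda>x. w x $ i))" for i by (rule vert_sq_int[OF sq_int_nth[OF w]])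
 have e: "?w = (\<lambda>y. \<Sum>i\<in>UNIV. vert L (\<lambda>x. w x $ i) y *\<^sub>R axis i 1)"
  by (rule ext) (simp add: vec_eq_iff axis_def if_distrib cong: if_cong)
 show "sq_int MD ?w"
  unfolding e
 proof (rule sq_int_sum)
  fix i
  show "sq_int MD (\<lambda>y. vert L (\<lambda>x. w x $ i) y *\<^sub>R axis i (1::real))"
   by (rule sq_int_bound[OF v, of _ 1])
     (use sq_int_measurable[OF v] in \<open>auto intro!: borel_measurable_scaleR AE_I2\<close>)
 qed simp
 have i1: "integrable MC (\<lambda>x. g (horiz x) $ i * w x $ i)" for i
  using sq_int_inner[OF sq_int_nth[OF lift_sq_int(1)[OF g]] sq_int_nth[OF w]] by simp
 have i2: "integrable MD (\<lambda>y. g y $ i * vert L (\<lambda>x. w x $ i) y)" for i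
  using sq_int_inner[OF sq_int_nth[OF g] v] by simp
 show "ip MC (lift g) w = ip MD g ?w"
  unfolding inner_vec_def
  by (simp add: Bochner_Integration.integral_sum i1 i2 integrable_mult_lift[OF i1])
qed

end

section \<open>Vertical integrals of smooth functions\<close>

lemma continuous_on_slice: "continuous_on UNIV f ==> continuous_on S (\<lambda>z. f (emb y z))"
 by (rule continuous_on_compose2[of UNIV f])
   (auto intro!: continuous_on_compose2[OF continuous_on_emb, of S "\<lambda>z. (y, z)", simplified] continuous_intros)

lemma integrable_slice:
 fixes f :: "real^3 => 'b::euclidean_space"
 assumes "continuous_on UNIV f"
 shows "integrable (lebesgue_on {0<..<L}) (\<lambda>z. f (emb y z))"
proof -
 have m: "{0<..<L::real} \<in> lmeasurable" by (rule lmeasurable_open) auto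
 have "sq_int (lebesgue_on {0<..<L}) (\<lambda>z. f (emb y z))"
  by (rule sq_int_continuous[OF continuous_on_slice[OF assms] _ m]) simp
 then show ?thesis by (rule sq_int_integrable_fm[OF m])
qed

lemma vert_eq_integral:
 fixes f :: "real^3 => 'b::euclidean_space"
 assumes "continuous_on UNIV f"
 shows "vert L f y = integral (cbox 0 L) (\<lambda>z. f (emb y z))"
proof -
 have "vert L f y = integral {0<..<L} (\<lambda>z. f (emb y z))"
  unfolding vert_def by (rule lebesgue_integral_eq_integral[OF integrable_slice[OF assms]]) simp
 also have "\<dots> = integral (cbox 0 L) (\<lambda>z. f (emb y z))"
  using integral_open_interval[of 0 L "\<lambda>z. f (emb y z)"] by simp
 finally show ?thesis .
qed

text \<open>Differentiation under the integral sign over a compact interval, with the derivative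
  regarded as a continuous family of bounded linear maps. A horizontal direction \<open>h\<close>
  acts as \<open>emb h 0\<close>.\<close>

lemma vert_has_derivative:
 fixes \<psi> :: "real^3 => 'b::euclidean_space"
 assumes \<psi>: "smooth_on \<psi> UNIV"
 shows "(vert L \<psi> has_derivative (\<lambda>h. vert L (\<lambda>x. frechet_derivative \<psi> (at x) (emb h 0)) y)) (at y)"
proof -
 note d\<psi> = smooth_has_derivative[OF \<psi>]
 define fx where "fx y z = Blinfun (\<lambda>h. frechet_derivative \<psi> (at (emb y z)) (emb h 0))" for y z
 have bl: "bounded_linear (\<lambda>h. emb h 0)"
 proof -
  have "linear (\<lambda>h. emb h 0)" by (rule linearI) (simp_all add: vec_eq_iff forall_3)
  then show ?thesis by (simp add: linear_conv_bounded_linear)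
 qed
 have app: "blinfun_apply (fx y z) = (\<lambda>h. frechet_derivative \<psi> (at (emb y z)) (emb h 0))" for y z
  unfolding fx_def
  by (rule bounded_linear_Blinfun_apply[OF bounded_linear_compose[OF has_derivative_bounded_linear[OF d\<psi>] bl]])
 have cont: "continuous_on (UNIV \<times> cbox 0 L) (\<lambda>(y, z). fx y z)"
 proof (rule continuous_on_blinfun_componentwise)
  fix i :: "real^2" assume "i \<in> Basis"
  have "continuous_on (UNIV \<times> cbox 0 L) (\<lambda>p. frechet_derivative \<psi> (at (emb (fst p) (snd p))) (emb i 0))"
   by (rule continuous_on_compose2[OF smooth_continuous_on[OF smooth_frechet_derivative[OF \<psi>], of UNIV]
     continuous_on_subset[OF continuous_on_emb]]) auto
  then show "continuous_on (UNIV \<times> cbox 0 L) (\<lambda>x. blinfun_apply (case x of (y, z) => fx y z) i)"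
   by (simp add: case_prod_beta app)
 qed
 have der: "((\<lambda>y. \<psi> (emb y z)) has_derivative blinfun_apply (fx y z)) (at y within UNIV)" for y z
 proof -
  have "((\<lambda>y. emb y z) has_derivative (\<lambda>h. emb h 0)) (at y)"
  proof -
   have "((\<lambda>y. emb y 0 + emb 0 z) has_derivative (\<lambda>h. emb h 0)) (at y)"
    by (auto intro!: derivative_eq_intros bounded_linear_imp_has_derivative bl)
   then show ?thesis by (simp add: emb_add)
  qed
  from has_derivative_compose[OF this d\<psi>] show ?thesis by (simp add: app)
 qed
 have "((\<lambda>y. integral (cbox 0 L) (\<lambda>z. \<psi> (emb y z))) has_derivative
   blinfun_apply (integral (cbox 0 L) (fx y))) (at y within UNIV)"
  by (rule leibniz_rule[where f = "\<lambda>y z. \<psi> (emb y z)" and fx = fx,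
     OF der integrable_continuous[OF continuous_on_slice[OF smooth_continuous_on[OF \<psi>]]] cont])
    simp_all
 moreover have "blinfun_apply (integral (cbox 0 L) (fx y)) h =
   vert L (\<lambda>x. frechet_derivative \<psi> (at x) (emb h 0)) y" for h
 proof -
  have "continuous_on (cbox 0 L) (fx y)"
   using continuous_on_compose2[OF cont, of "cbox 0 L" "\<lambda>z. (y, z)"]
   by (simp add: continuous_intros image_subset_iff)
  then have "blinfun_apply (integral (cbox 0 L) (fx y)) h = integral (cbox 0 L) (\<lambda>z. blinfun_apply (fx y z) h)"
   by (intro blinfun_apply_integral integrable_continuous)
  then show ?thesis
   by (simp add: app vert_eq_integral[OF smooth_continuous_on[OF smooth_frechet_derivative[OF \<psi>]]])
 qed
 then have "blinfun_apply (integral (cbox 0 L) (fx y)) =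
   (\<lambda>h. vert L (\<lambda>x. frechet_derivative \<psi> (at x) (emb h 0)) y)"
  by (rule ext)
 ultimately show ?thesis
  by (simp add: vert_eq_integral[OF smooth_continuous_on[OF \<psi>], abs_def])
qed

lemma frechet_derivative_vert:
 fixes \<psi> :: "real^3 => 'b::euclidean_space"
 assumes "smooth_on \<psi> UNIV"
 shows "frechet_derivative (vert L \<psi>) (at y) h = vert L (\<lambda>x. frechet_derivative \<psi> (at x) (emb h 0)) y"
proof -
 have "(\<lambda>h. vert L (\<lambda>x. frechet_derivative \<psi> (at x) (emb h 0)) y) = frechet_derivative (vert L \<psi>) (at y)"
  by (rule frechet_derivative_at[OF vert_has_derivative[OF assms]])
 from fun_cong[OF this, of h] show ?thesis by simp
qed

lemma smooth_vert:
 fixes \<psi> :: "real^3 => 'b::euclidean_space"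
 assumes "smooth_on \<psi> UNIV"
 shows "smooth_on (vert L \<psi>) UNIV"
proof -
 have "Ck_on k (vert L \<psi>) UNIV" for k
  using assms
 proof (induction k arbitrary: \<psi>)
  case 0
  have "vert L \<psi> differentiable_on UNIV"
   using vert_has_derivative[OF 0] by (auto simp: differentiable_on_def differentiable_def)
  then show ?case by (simp add: differentiable_imp_continuous_on)
 next
  case (Suc k)
  show ?case
   by (rule Ck_on_SucI[OF vert_has_derivative[OF Suc.prems]])
     (rule Suc.IH[OF smooth_frechet_derivative[OF Suc.prems]])
 qed
 then show ?thesis by (simp add: smooth_on_def)
qed

lemma vert_d3:
 fixes \<psi> :: "real^3 => 'b::euclidean_space"
 assumes \<psi>: "smooth_on \<psi> UNIV" and L: "L > 0"
 shows "vert L (\<lambda>x. pd 3 \<psi> x) y = \<psi> (emb y L) - \<psi> (emb y 0)"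
proof -
 have "((\<lambda>z. \<psi> (emb y z)) has_vector_derivative pd 3 \<psi> (emb y z)) (at z within {0..L})" for z
 proof -
  have "((\<lambda>z. emb y 0 + z *\<^sub>R axis 3 1) has_derivative (\<lambda>h. h *\<^sub>R axis 3 1)) (at z within {0..L})"
   by (auto intro!: derivative_eq_intros)
  moreover have "emb y 0 + z *\<^sub>R axis 3 1 = emb y z" for z
   using emb_add[of y 0 0 z] emb_scaleR[of z 0 1] by (simp add: emb_axis)
  ultimately have e: "((\<lambda>z. emb y z) has_derivative (\<lambda>h. h *\<^sub>R axis 3 1)) (at z within {0..L})"
   by simp
  have "((\<lambda>z. \<psi> (emb y z)) has_derivative (\<lambda>h. frechet_derivative \<psi> (at (emb y z)) (h *\<^sub>R axis 3 1))) (at z within {0..L})"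
   by (rule has_derivative_compose[OF e smooth_has_derivative[OF \<psi>]])
  then show ?thesis
   by (simp add: has_vector_derivative_def linear_scale[OF has_derivative_linear[OF smooth_has_derivative[OF \<psi>]]])
 qed
 then have "((\<lambda>z. pd 3 \<psi> (emb y z)) has_integral (\<psi> (emb y L) - \<psi> (emb y 0))) {0..L}"
  using L by (intro fundamental_theorem_of_calculus) auto
 then show ?thesis
  by (simp add: vert_eq_integral[OF smooth_continuous_on[OF smooth_frechet_derivative[OF \<psi>]]] integral_unique)
qed

lemma real_le_nn_integral_deriv:
 fixes f f' :: "real => real"
 assumes d: "\<And>x. (f has_real_derivative f' x) (at x)" and c: "continuous_on UNIV f'"
  and R: "\<And>x. \<bar>x\<bar> > R ==> f x = 0"
 shows "ennreal (f x) \<le> (\<integral>\<^sup>+t. ennreal \<bar>f' t\<bar> \<partial>lborel)"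
proof -
 \<comment> \<open>A point to the left of \<open>x\<close> and beyond the support, where
   \<open>f\<close> vanishes.\<close>
 let ?a = "- (\<bar>x\<bar> + \<bar>R\<bar> + 1)"
 have "isCont f' t" for t using c by (simp add: continuous_on_eq_continuous_at)
 then have h: "has_bochner_integral lborel (\<lambda>t. f' t * indicator {?a..x} t) (f x - f ?a)"
  by (intro has_bochner_integral_FTC_Icc_real d) auto
 have "f ?a = 0" by (rule R) auto
 then have "f x = (LINT t|lborel. f' t * indicator {?a..x} t)"
  using h by (simp add: has_bochner_integral_integral_eq)
 then have "ennreal (f x) \<le> ennreal (norm (LINT t|lborel. f' t * indicator {?a..x} t))"
  by (simp add: ennreal_leI)
 also have "\<dots> \<le> (\<integral>\<^sup>+t. norm (f' t * indicator {?a..x} t) \<partial>lborel)"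
  using h by (intro integral_norm_bound_ennreal) (simp add: has_bochner_integral_iff)
 also have "\<dots> \<le> (\<integral>\<^sup>+t. ennreal \<bar>f' t\<bar> \<partial>lborel)"
  by (intro nn_integral_mono ennreal_leI) (simp add: abs_mult indicator_def)
 finally show ?thesis .
qed

lemma measurable_emb_comp [measurable (raw)]:
 "f \<in> borel_measurable M ==> g \<in> borel_measurable M ==> (\<lambda>x. emb (f x) (g x)) \<in> borel_measurable M"
 by (rule borel_measurable_continuous_Pair[OF _ _ continuous_on_emb])

lemma measurable_pt_comp [measurable (raw)]:
 "f \<in> borel_measurable M ==> g \<in> borel_measurable M ==> (\<lambda>x. pt (f x) (g x)) \<in> borel_measurable M"
 by (rule borel_measurable_continuous_Pair[OF _ _ linear_continuous_on[OF bounded_linear_pt]])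

section \<open>Ladyzhenskaya's inequality\<close>

text \<open>Ladyzhenskaya's argument: the vertical integral of \<open>F\<close> is bounded by a function of the first
 and by a function of the second horizontal coordinate, and the product of these integrates.\<close>

lemma vert_square_nn_integral:
 fixes F :: "real^3 => real"
 assumes F: "smooth_on F UNIV" and K: "bounded K" "\<And>x. horiz x \<notin> K ==> F x = 0" and pos: "\<And>x. F x \<ge> 0"
 shows "(\<integral>\<^sup>+y. ennreal ((vert L F y)\<^sup>2) \<partial>lborel) \<le>
  (\<integral>\<^sup>+x. indicator {x. 0 < x $ 3 \<and> x $ 3 < L} x * ennreal \<bar>pd 1 F x\<bar> \<partial>lborel) *
  (\<integral>\<^sup>+x. indicator {x. 0 < x $ 3 \<and> x $ 3 < L} x * ennreal \<bar>pd 2 F x\<bar> \<partial>lborel)"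
proof -
 define S :: "(real^3) set" where "S = {x. 0 < x $ 3 \<and> x $ 3 < L}"
 define H where "H j x = indicator S x * ennreal \<bar>pd j F x\<bar>" for j x
 have S[measurable]: "S \<in> sets borel"
 proof -
  have "S = {x. 0 < x $ 3} \<inter> {x. x $ 3 < L}" by (auto simp: S_def)
  then show ?thesis by (simp add: borel_open open_Int open_Collect_less continuous_intros)
 qed
 have [measurable]: "(\<lambda>x. pd j F x) \<in> borel_measurable borel" for j
  by (rule borel_measurable_continuous_onI[OF smooth_continuous_on[OF smooth_frechet_derivative[OF F]]])
 have Fm[measurable]: "F \<in> borel_measurable borel"
  by (rule borel_measurable_continuous_onI[OF smooth_continuous_on[OF F]])
 have H[measurable]: "H j \<in> borel_measurable borel" for j
  unfolding H_def[abs_def] by measurable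
 obtain R where R: "\<And>y. y \<in> K ==> norm y \<le> R" using K(1) by (auto simp: bounded_iff)
 define P where "P b = (\<integral>\<^sup>+a. \<integral>\<^sup>+z. H 1 (emb (pt a b) z) \<partial>lborel \<partial>lborel)" for b
 define Q where "Q a = (\<integral>\<^sup>+b. \<integral>\<^sup>+z. H 2 (emb (pt a b) z) \<partial>lborel \<partial>lborel)" for a
 have Pm[measurable]: "P \<in> borel_measurable borel" and Qm[measurable]: "Q \<in> borel_measurable borel"
  unfolding P_def[abs_def] Q_def[abs_def] by measurable
 have out: "F (emb (pt a b) z) = 0" if "\<bar>a\<bar> > R \<or> \<bar>b\<bar> > R" for a b z
 proof (rule K(2))
  have "\<bar>a\<bar> \<le> norm (pt a b)" "\<bar>b\<bar> \<le> norm (pt a b)"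
   using Finite_Cartesian_Product.norm_nth_le[of "pt a b" 1] Finite_Cartesian_Product.norm_nth_le[of "pt a b" 2] by simp_all
  then show "horiz (emb (pt a b) z) \<notin> K" using that R[of "pt a b"] by auto
 qed
 have dA: "((\<lambda>a. F (emb (pt a b) z)) has_real_derivative pd 1 F (emb (pt a b) z)) (at a)" for a b z
 proof -
  have "((\<lambda>a. emb (pt 0 b) z + a *\<^sub>R axis 1 1) has_derivative (\<lambda>h. h *\<^sub>R axis 1 1)) (at a)"
   by (auto intro!: derivative_eq_intros)
  moreover have "emb (pt 0 b) z + a *\<^sub>R axis 1 1 = emb (pt a b) z" for a
   by (simp add: vec_eq_iff forall_3 axis_def)
  ultimately have e: "((\<lambda>a. emb (pt a b) z) has_derivative (\<lambda>h. h *\<^sub>R axis 1 1)) (at a)" by simp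
  have "(\<lambda>h. frechet_derivative F (at (emb (pt a b) z)) (h *\<^sub>R axis 1 1)) =
    (*) (pd 1 F (emb (pt a b) z))"
   by (rule ext) (simp add: linear_scale[OF has_derivative_linear[OF smooth_has_derivative[OF F]]])
  then show ?thesis
   using has_derivative_compose[OF e smooth_has_derivative[OF F]]
   by (simp only: has_field_derivative_def)
 qed
 have dB: "((\<lambda>b. F (emb (pt a b) z)) has_real_derivative pd 2 F (emb (pt a b) z)) (at b)" for a b z
 proof -
  have "((\<lambda>b. emb (pt a 0) z + b *\<^sub>R axis 2 1) has_derivative (\<lambda>h. h *\<^sub>R axis 2 1)) (at b)"
   by (auto intro!: derivative_eq_intros)
  moreover have "emb (pt a 0) z + b *\<^sub>R axis 2 1 = emb (pt a b) z" for b
   by (simp add: vec_eq_iff forall_3 axis_def)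
  ultimately have e: "((\<lambda>b. emb (pt a b) z) has_derivative (\<lambda>h. h *\<^sub>R axis 2 1)) (at b)" by simp
  have "(\<lambda>h. frechet_derivative F (at (emb (pt a b) z)) (h *\<^sub>R axis 2 1)) =
    (*) (pd 2 F (emb (pt a b) z))"
   by (rule ext) (simp add: linear_scale[OF has_derivative_linear[OF smooth_has_derivative[OF F]]])
  then show ?thesis
   using has_derivative_compose[OF e smooth_has_derivative[OF F]]
   by (simp only: has_field_derivative_def)
 qed
 have cA: "continuous_on UNIV (\<lambda>a. pd j F (emb (pt a b) z))"
  and cB: "continuous_on UNIV (\<lambda>b. pd j F (emb (pt a b) z))" for a b z j
 proof -
  have "(\<lambda>a. emb (pt a b) z) = (\<lambda>a. emb (pt 0 b) z + a *\<^sub>R axis 1 1)"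
   by (simp add: vec_eq_iff forall_3 axis_def fun_eq_iff)
  then have "continuous_on UNIV (\<lambda>a. emb (pt a b) z)"
   by (simp only:) (intro continuous_intros)
  then show "continuous_on UNIV (\<lambda>a. pd j F (emb (pt a b) z))"
   by (rule continuous_on_compose2[OF smooth_continuous_on[OF smooth_frechet_derivative[OF F], of UNIV]]) simp
  have "(\<lambda>b. emb (pt a b) z) = (\<lambda>b. emb (pt a 0) z + b *\<^sub>R axis 2 1)"
   by (simp add: vec_eq_iff forall_3 axis_def fun_eq_iff)
  then have "continuous_on UNIV (\<lambda>b. emb (pt a b) z)"
   by (simp only:) (intro continuous_intros)
  then show "continuous_on UNIV (\<lambda>b. pd j F (emb (pt a b) z))"
   by (rule continuous_on_compose2[OF smooth_continuous_on[OF smooth_frechet_derivative[OF F], of UNIV]]) simp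
 qed
 have vle: "ennreal (vert L F (pt a b)) \<le> (\<integral>\<^sup>+z. indicator S (emb (pt a b) z) * ennreal (F (emb (pt a b) z)) \<partial>lborel)" for a b
 proof -
  have i: "integrable (lebesgue_on {0<..<L}) (\<lambda>z. F (emb (pt a b) z))"
   by (rule integrable_slice[OF smooth_continuous_on[OF F]])
  have "ennreal (vert L F (pt a b)) = (\<integral>\<^sup>+z. ennreal (F (emb (pt a b) z)) \<partial>lebesgue_on {0<..<L})"
   unfolding vert_def by (rule nn_integral_eq_integral[OF i, symmetric]) (simp add: pos)
  also have "\<dots> = (\<integral>\<^sup>+z. ennreal (F (emb (pt a b) z)) * indicator {0<..<L} z \<partial>lebesgue)"
   by (rule nn_integral_restrict_space) simp
  also have "\<dots> = (\<integral>\<^sup>+z. indicator S (emb (pt a b) z) * ennreal (F (emb (pt a b) z)) \<partial>lebesgue)"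
   by (intro nn_integral_cong) (simp add: S_def indicator_def)
  also have "\<dots> = (\<integral>\<^sup>+z. indicator S (emb (pt a b) z) * ennreal (F (emb (pt a b) z)) \<partial>lborel)"
   by (rule nn_integral_completion) measurable
  finally show ?thesis by simp
 qed
 have gP: "ennreal (vert L F (pt a b)) \<le> P b" for a b
 proof -
  have "ennreal (F (emb (pt a b) z)) \<le> (\<integral>\<^sup>+a. ennreal \<bar>pd 1 F (emb (pt a b) z)\<bar> \<partial>lborel)" for z
   by (rule real_le_nn_integral_deriv[OF dA cA, of R]) (simp add: out)
  then have "indicator S (emb (pt a b) z) * ennreal (F (emb (pt a b) z)) \<le> (\<integral>\<^sup>+a. H 1 (emb (pt a b) z) \<partial>lborel)" for z
   by (simp add: H_def S_def indicator_def)
  then have "ennreal (vert L F (pt a b)) \<le> (\<integral>\<^sup>+z. \<integral>\<^sup>+a. H 1 (emb (pt a b) z) \<partial>lborel \<partial>lborel)"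
   by (intro order_trans[OF vle] nn_integral_mono)
  also have "\<dots> = P b" unfolding P_def by (rule lborel_pair.Fubini') measurable
  finally show ?thesis .
 qed
 have gQ: "ennreal (vert L F (pt a b)) \<le> Q a" for a b
 proof -
  have "ennreal (F (emb (pt a b) z)) \<le> (\<integral>\<^sup>+b. ennreal \<bar>pd 2 F (emb (pt a b) z)\<bar> \<partial>lborel)" for z
   by (rule real_le_nn_integral_deriv[OF dB cB, of R]) (simp add: out)
  then have "indicator S (emb (pt a b) z) * ennreal (F (emb (pt a b) z)) \<le> (\<integral>\<^sup>+b. H 2 (emb (pt a b) z) \<partial>lborel)" for z
   by (simp add: H_def S_def indicator_def)
  then have "ennreal (vert L F (pt a b)) \<le> (\<integral>\<^sup>+z. \<integral>\<^sup>+b. H 2 (emb (pt a b) z) \<partial>lborel \<partial>lborel)"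
   by (intro order_trans[OF vle] nn_integral_mono)
  also have "\<dots> = Q a" unfolding Q_def by (rule lborel_pair.Fubini') measurable
  finally show ?thesis .
 qed
 have vm[measurable]: "vert L F \<in> borel_measurable borel"
  by (rule borel_measurable_continuous_onI[OF smooth_continuous_on[OF smooth_vert[OF F]]])
 have "vert L F y \<ge> 0" for y unfolding vert_def by (rule integral_nonneg_AE) (simp add: pos)
 then have sq: "ennreal ((vert L F y)\<^sup>2) = ennreal (vert L F y) * ennreal (vert L F y)" for y
  by (simp add: power2_eq_square ennreal_mult)
 have "(\<integral>\<^sup>+y. ennreal ((vert L F y)\<^sup>2) \<partial>lborel) = (\<integral>\<^sup>+a. \<integral>\<^sup>+b. ennreal ((vert L F (pt a b))\<^sup>2) \<partial>lborel \<partial>lborel)"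
  by (rule nn_integral_pt) measurable
 also have "\<dots> \<le> (\<integral>\<^sup>+a. \<integral>\<^sup>+b. P b * Q a \<partial>lborel \<partial>lborel)"
  unfolding sq by (intro nn_integral_mono mult_mono gP gQ) simp_all
 also have "\<dots> = (\<integral>\<^sup>+b. P b \<partial>lborel) * (\<integral>\<^sup>+a. Q a \<partial>lborel)"
  by (simp add: nn_integral_multc nn_integral_cmult)
 also have "(\<integral>\<^sup>+a. Q a \<partial>lborel) = (\<integral>\<^sup>+x. H 2 x \<partial>lborel)"
  unfolding Q_def
  by (subst nn_integral_emb, measurable) (subst nn_integral_pt, measurable)
 also have "(\<integral>\<^sup>+b. P b \<partial>lborel) = (\<integral>\<^sup>+a. \<integral>\<^sup>+b. \<integral>\<^sup>+z. H 1 (emb (pt a b) z) \<partial>lborel \<partial>lborel \<partial>lborel)"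
  unfolding P_def by (rule lborel_pair.Fubini') measurable
 also have "\<dots> = (\<integral>\<^sup>+x. H 1 x \<partial>lborel)"
  by (subst nn_integral_emb, measurable) (subst nn_integral_pt, measurable)
 finally show ?thesis by (simp add: H_def S_def)
qed

text \<open>Fatou's lemma along a subsequence that converges almost everywhere. It is meant for the
  vertical integrals of |\<phi>_n|^2, whose convergence is known in L^1 only, while bounds in L^2
  have to survive in the limit.\<close>

lemma L2_bound_of_L1_limit:
 fixes h :: "nat => 'a => real" and h' :: "'a => real"
 assumes h: "\<And>n. integrable M (h n)" "integrable M h'"
  and lim: "(\<lambda>n. \<integral>x. \<bar>h n x - h' x\<bar> \<partial>M) ----> 0"
  and sq: "\<And>n. sq_int M (h n)" "\<And>n. (nrm M (h n))\<^sup>2 \<le> c n" and c: "c ----> c'"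
 shows "sq_int M h'" "(nrm M h')\<^sup>2 \<le> c'"
proof -
 obtain r :: "nat => nat" where r: "strict_mono r" "AE x in M. (\<lambda>n. h (r n) x - h' x) ----> 0"
  using tendsto_L1_AE_subseq[of M "\<lambda>n x. h n x - h' x"] h lim by auto
 have hm: "h n \<in> borel_measurable M" "h' \<in> borel_measurable M" for n using h by auto
 have c0: "0 \<le> c n" for n using order_trans[OF zero_le_power2 sq(2)] .
 have "c' \<ge> 0" by (rule LIMSEQ_le_const[OF c]) (use c0 in auto)
 have e: "(\<integral>\<^sup>+x. ennreal ((h n x)\<^sup>2) \<partial>M) \<le> ennreal (c n)" for n
 proof -
  have "(\<integral>\<^sup>+x. ennreal ((h n x)\<^sup>2) \<partial>M) = ennreal (LINT x|M. (h n x)\<^sup>2)"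
   using sq_int_integrable[OF sq(1)[of n]] by (intro nn_integral_eq_integral) auto
  also have "\<dots> \<le> ennreal (c n)" using sq(2)[of n] by (intro ennreal_leI) (simp add: nrm_sq)
  finally show ?thesis .
 qed
 have "(\<integral>\<^sup>+x. ennreal ((h' x)\<^sup>2) \<partial>M) = (\<integral>\<^sup>+x. liminf (\<lambda>n. ennreal ((h (r n) x)\<^sup>2)) \<partial>M)"
 proof (rule nn_integral_cong_AE)
  show "AE x in M. ennreal ((h' x)\<^sup>2) = liminf (\<lambda>n. ennreal ((h (r n) x)\<^sup>2))"
   using r(2)
  proof eventually_elim
   case (elim x)
   from tendsto_add[OF elim tendsto_const[of "h' x"]] have "(\<lambda>n. h (r n) x) ----> h' x" by simp
   then have "(\<lambda>n. ennreal ((h (r n) x)\<^sup>2)) ----> ennreal ((h' x)\<^sup>2)"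
    by (intro tendsto_ennrealI tendsto_power)
   from lim_imp_Liminf[OF sequentially_bot this] show ?case by simp
  qed
 qed
 also have "\<dots> \<le> liminf (\<lambda>n. \<integral>\<^sup>+x. ennreal ((h (r n) x)\<^sup>2) \<partial>M)"
  using hm by (intro nn_integral_liminf) simp
 also have "\<dots> \<le> liminf (\<lambda>n. ennreal (c (r n)))"
  by (intro Liminf_mono always_eventually allI e)
 also have "\<dots> = ennreal c'"
 proof -
  have "(\<lambda>n. ennreal (c (r n))) ----> ennreal c'"
   by (intro tendsto_ennrealI) (rule LIMSEQ_subseq_LIMSEQ[OF c r(1), unfolded o_def])
  from lim_imp_Liminf[OF sequentially_bot this] show ?thesis .
 qed
 finally have le: "(\<integral>\<^sup>+x. ennreal ((h' x)\<^sup>2) \<partial>M) \<le> ennreal c'" .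
 have i: "integrable M (\<lambda>x. (h' x)\<^sup>2)"
 proof (rule integrableI_bounded)
  show "(\<lambda>x. (h' x)\<^sup>2) \<in> borel_measurable M" using hm by simp
  show "(\<integral>\<^sup>+x. ennreal (norm ((h' x)\<^sup>2)) \<partial>M) < \<infinity>"
   using le by (simp add: le_less_trans ennreal_less_top)
 qed
 then show "sq_int M h'" using hm by (simp add: sq_int_def)
 have "ennreal (LINT x|M. (h' x)\<^sup>2) \<le> ennreal c'"
  using nn_integral_eq_integral[OF i] le by simp
 then show "(nrm M h')\<^sup>2 \<le> c'" using \<open>c' \<ge> 0\<close> by (simp add: nrm_sq)
qed

text \<open>The closure of the graph of the gradient on \<open>S\<close>, with the gradient
  \<open>G\<close> carried as an explicit partner of \<open>f\<close>. Differences and lifts of such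
  pairs are formed directly, without appeal to the choice inside
  \<open>weak_gradient\<close>.\<close>

definition grad_closure ::
  "(real^'n) set => (real^'n => real^'m) set => (real^'n => real^'m) => (real^'n => real^'n^'m) => bool" where
 "grad_closure \<Omega> S f G \<longleftrightarrow> sq_int (lebesgue_on \<Omega>) f \<and> sq_int (lebesgue_on \<Omega>) G \<and>
   (\<exists>\<phi>. (\<forall>n::nat. \<phi> n \<in> S) \<and> (\<lambda>n. dst (lebesgue_on \<Omega>) (\<phi> n) f) ----> 0 \<and>
    (\<lambda>n. dst (lebesgue_on \<Omega>) (grad (\<phi> n)) G) ----> 0)"

lemma grad_closureD:
 assumes "grad_closure \<Omega> S f G"
 shows "sq_int (lebesgue_on \<Omega>) f" "sq_int (lebesgue_on \<Omega>) G"
 using assms by (simp_all add: grad_closure_def)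

lemma grad_closureE:
 assumes "grad_closure \<Omega> S f G"
 obtains \<phi> where "\<And>n::nat. \<phi> n \<in> S" "(\<lambda>n. dst (lebesgue_on \<Omega>) (\<phi> n) f) ----> 0"
  "(\<lambda>n. dst (lebesgue_on \<Omega>) (grad (\<phi> n)) G) ----> 0"
 using assms unfolding grad_closure_def by blast

lemma jacobian_diff:
 fixes f g :: "real^'n => real^'m"
 assumes "smooth_on f UNIV" "smooth_on g UNIV"
 shows "grad (\<lambda>x. f x - g x) x = grad f x - grad g x"
proof -
 have "frechet_derivative (\<lambda>x. f x - g x) (at x) = (\<lambda>h. frechet_derivative f (at x) h - frechet_derivative g (at x) h)"
  by (rule frechet_derivative_at[symmetric])
    (rule has_derivative_diff[OF smooth_has_derivative[OF assms(1)] smooth_has_derivative[OF assms(2)]])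
 then show ?thesis by (simp add: vec_eq_iff jacobian_nth)
qed

lemma jacobian_sq_int:
 fixes f :: "real^'n => real^'m"
 assumes "smooth_on f UNIV" "bounded \<Omega>" "\<Omega> \<in> lmeasurable"
 shows "sq_int (lebesgue_on \<Omega>) f" "sq_int (lebesgue_on \<Omega>) (grad f)"
 using sq_int_continuous[OF smooth_continuous_on[OF assms(1)] assms(2,3)]
  sq_int_continuous[OF continuous_jacobian[OF assms(1)] assms(2,3)] by auto

lemma grad_closure_smooth:
 assumes "\<phi> \<in> S" "smooth_on \<phi> UNIV" "bounded \<Omega>" "\<Omega> \<in> lmeasurable"
 shows "grad_closure \<Omega> S \<phi> (grad \<phi>)"
 unfolding grad_closure_def
 using jacobian_sq_int[OF assms(2-4)] assms(1) by (intro conjI exI[where x = "\<lambda>n. \<phi>"]) (simp_all add: nrm_def)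

lemma grad_closure_diff:
 assumes f: "grad_closure \<Omega> S f F" and g: "grad_closure \<Omega> S g G" and \<Omega>: "bounded \<Omega>" "\<Omega> \<in> lmeasurable"
  and S: "\<And>\<phi>. \<phi> \<in> S ==> smooth_on \<phi> UNIV" "\<And>\<phi> \<theta>. \<phi> \<in> S ==> \<theta> \<in> S ==> (\<lambda>x. \<phi> x - \<theta> x) \<in> S"
 shows "grad_closure \<Omega> S (\<lambda>x. f x - g x) (\<lambda>x. F x - G x)"
proof -
 let ?M = "lebesgue_on \<Omega>"
 obtain \<phi> where \<phi>: "\<And>n::nat. \<phi> n \<in> S" "(\<lambda>n. dst ?M (\<phi> n) f) ----> 0"
  "(\<lambda>n. dst ?M (grad (\<phi> n)) F) ----> 0" by (rule grad_closureE[OF f]) (rule that)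
 obtain \<theta> where \<theta>: "\<And>n::nat. \<theta> n \<in> S" "(\<lambda>n. dst ?M (\<theta> n) g) ----> 0"
  "(\<lambda>n. dst ?M (grad (\<theta> n)) G) ----> 0" by (rule grad_closureE[OF g]) (rule that)
 note sq = jacobian_sq_int[OF S(1)[OF \<phi>(1)] \<Omega>] jacobian_sq_int[OF S(1)[OF \<theta>(1)] \<Omega>]
  grad_closureD[OF f] grad_closureD[OF g]
 have b1: "nrm ?M (\<lambda>x. (\<phi> n x - \<theta> n x) - (f x - g x)) \<le> dst ?M (\<phi> n) f + dst ?M (\<theta> n) g" for n
  using nrm_triangle_diff[OF sq_int_diff[OF sq(1)[of n] sq(5)] sq_int_diff[OF sq(3)[of n] sq(7)]]
  by (simp add: algebra_simps)
 have b2: "nrm ?M (\<lambda>x. grad (\<lambda>x. \<phi> n x - \<theta> n x) x - (F x - G x)) \<le>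
   dst ?M (grad (\<phi> n)) F + dst ?M (grad (\<theta> n)) G" for n
  using nrm_triangle_diff[OF sq_int_diff[OF sq(2)[of n] sq(6)] sq_int_diff[OF sq(4)[of n] sq(8)]]
  by (simp add: algebra_simps jacobian_diff[OF S(1)[OF \<phi>(1)] S(1)[OF \<theta>(1)]])
 show ?thesis
  unfolding grad_closure_def
 proof (intro conjI exI[where x = "\<lambda>n x. \<phi> n x - \<theta> n x"] allI S(2) \<phi>(1) \<theta>(1) sq_int_diff sq)
  show "(\<lambda>n. nrm ?M (\<lambda>x. (\<phi> n x - \<theta> n x) - (f x - g x))) ----> 0"
   by (rule tendsto_zero_squeeze[OF _ nrm_nonneg b1]) (use tendsto_add[OF \<phi>(2) \<theta>(2)] in simp)
  show "(\<lambda>n. nrm ?M (\<lambda>x. grad (\<lambda>x. \<phi> n x - \<theta> n x) x - (F x - G x))) ----> 0"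
   by (rule tendsto_zero_squeeze[OF _ nrm_nonneg b2]) (use tendsto_add[OF \<phi>(3) \<theta>(3)] in simp)
 qed
qed

text \<open>The Jacobian of a lifted field: the third column, its x_3-derivative, is zero.\<close>

definition lift_mat :: "real^2^'m => real^3^'m" where
 "lift_mat A = (\<chi> i j. if j = 1 then A $ i $ 1 else if j = 2 then A $ i $ 2 else 0)"

lemma lift_mat_nth [simp]: "lift_mat A $ i $ 1 = A $ i $ 1" "lift_mat A $ i $ 2 = A $ i $ 2" "lift_mat A $ i $ 3 = 0"
 by (simp_all add: lift_mat_def)

lemma inner_lift_mat: "lift_mat A \<bullet> lift_mat B = A \<bullet> B"
 by (simp add: inner_vec_def sum_2 sum_3)

lemma norm_lift_mat [simp]: "norm (lift_mat A) = norm A"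
 by (simp add: norm_eq_sqrt_inner inner_lift_mat)

lemma lift_mat_diff: "lift_mat A - lift_mat B = lift_mat (A - B)"
 by (simp add: vec_eq_iff forall_3)

lemma bounded_linear_lift_mat: "bounded_linear (lift_mat :: real^2^'m => real^3^'m)"
proof -
 have "linear (lift_mat :: real^2^'m => real^3^'m)"
  by (rule linearI) (simp_all add: vec_eq_iff forall_3)
 then show ?thesis by (simp add: linear_conv_bounded_linear)
qed

lemma jacobian_lift:
 fixes \<theta> :: "real^2 => real^'m"
 assumes "smooth_on \<theta> UNIV"
 shows "grad (lift \<theta>) x = lift_mat (grad \<theta> (horiz x))"
proof -
 have "((lift \<theta>) has_derivative (\<lambda>h. frechet_derivative \<theta> (at (horiz x)) (horiz h))) (at x)"
  by (rule has_derivative_compose[OF bounded_linear_imp_has_derivative[OF bounded_linear_horiz] smooth_has_derivative[OF assms]])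
 from frechet_derivative_at[OF this]
 have "frechet_derivative (lift \<theta>) (at x) h = frechet_derivative \<theta> (at (horiz x)) (horiz h)" for h
  by (metis (no_types))
 then show ?thesis
  by (simp add: vec_eq_iff forall_3 jacobian_nth horiz_axis
    linear_0[OF has_derivative_linear[OF smooth_has_derivative[OF assms]]])
qed

lemma smooth_lift: "smooth_on \<theta> UNIV ==> smooth_on (lift \<theta>) UNIV"
 by (rule smooth_comp_linear[OF bounded_linear_horiz])

section \<open>Divergence-free test fields and Ladyzhenskaya's inequality on the cylinder\<close>

context cyl
begin

definition "SC = {\<phi> \<in> smooth_C D L. div_free3 \<phi>}"
definition "SD = {\<phi> \<in> smooth_D D. div_free2 \<phi>}"

lemma SC_D:
 assumes "\<phi> \<in> SC"
 obtains K where "compact K" "K \<subseteq> D" "smooth_on \<phi> UNIV" "\<And>x. \<phi> (x + L *\<^sub>R axis 3 1) = \<phi> x"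
  "\<And>x. horiz x \<notin> K ==> \<phi> x = 0" "\<And>x. trace (grad \<phi> x) = 0"
 using assms by (auto simp: SC_def smooth_C_def cyl_fields_def div_free3_def)

lemma SD_D:
 assumes "\<phi> \<in> SD"
 obtains K where "compact K" "K \<subseteq> D" "smooth_on \<phi> UNIV"
  "\<And>x. x \<notin> K ==> \<phi> x = 0" "\<And>x. grad \<phi> x $ 1 $ 1 + grad \<phi> x $ 2 $ 2 = 0"
 using assms by (auto simp: SD_def smooth_D_def plane_fields_def div_free2_def)

lemma SC_smooth: "\<phi> \<in> SC ==> smooth_on \<phi> UNIV"
 using SC_D by metis

lemma SD_smooth: "\<phi> \<in> SD ==> smooth_on \<phi> UNIV"
 using SD_D by metis

lemma SC_I:
 assumes "compact K" "K \<subseteq> D" "smooth_on \<phi> UNIV" "\<And>x. \<phi> (x + L *\<^sub>R axis 3 1) = \<phi> x"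
  "\<And>x. horiz x \<notin> K ==> \<phi> x = 0" "\<And>x. trace (grad \<phi> x) = 0"
 shows "\<phi> \<in> SC"
 using assms by (auto simp: SC_def smooth_C_def cyl_fields_def div_free3_def)

lemma SD_I:
 assumes "compact K" "K \<subseteq> D" "smooth_on \<phi> UNIV"
  "\<And>x. x \<notin> K ==> \<phi> x = 0" "\<And>x. grad \<phi> x $ 1 $ 1 + grad \<phi> x $ 2 $ 2 = 0"
 shows "\<phi> \<in> SD"
 using assms by (auto simp: SD_def smooth_D_def plane_fields_def div_free2_def)

lemma SC_diff:
 assumes "\<phi> \<in> SC" "\<theta> \<in> SC" shows "(\<lambda>x. \<phi> x - \<theta> x) \<in> SC"
proof -
 obtain K where K: "compact K" "K \<subseteq> D" "smooth_on \<phi> UNIV" "\<And>x. \<phi> (x + L *\<^sub>R axis 3 1) = \<phi> x"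
  "\<And>x. horiz x \<notin> K ==> \<phi> x = 0" "\<And>x. trace (grad \<phi> x) = 0" using SC_D[OF assms(1)] by metis
 obtain J where J: "compact J" "J \<subseteq> D" "smooth_on \<theta> UNIV" "\<And>x. \<theta> (x + L *\<^sub>R axis 3 1) = \<theta> x"
  "\<And>x. horiz x \<notin> J ==> \<theta> x = 0" "\<And>x. trace (grad \<theta> x) = 0" using SC_D[OF assms(2)] by metis
 show ?thesis
  by (rule SC_I[of "K \<union> J"])
    (use K J in \<open>simp_all add: compact_Un smooth_diff jacobian_diff trace_sub\<close>)
qed

lemma SD_diff:
 assumes "\<phi> \<in> SD" "\<theta> \<in> SD" shows "(\<lambda>x. \<phi> x - \<theta> x) \<in> SD"
proof -
 obtain K where K: "compact K" "K \<subseteq> D" "smooth_on \<phi> UNIV"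
  "\<And>x. x \<notin> K ==> \<phi> x = 0" "\<And>x. grad \<phi> x $ 1 $ 1 + grad \<phi> x $ 2 $ 2 = 0" using SD_D[OF assms(1)] by metis
 obtain J where J: "compact J" "J \<subseteq> D" "smooth_on \<theta> UNIV"
  "\<And>x. x \<notin> J ==> \<theta> x = 0" "\<And>x. grad \<theta> x $ 1 $ 1 + grad \<theta> x $ 2 $ 2 = 0" using SD_D[OF assms(2)] by metis
 have dz: "grad (\<lambda>x. \<phi> x - \<theta> x) x $ 1 $ 1 + grad (\<lambda>x. \<phi> x - \<theta> x) x $ 2 $ 2 = 0" for x
  unfolding jacobian_diff[OF K(3) J(3)] vector_minus_component using K(5)[of x] J(5)[of x] by linarith
 show ?thesis
  by (rule SD_I[OF _ _ _ _ dz, of "K \<union> J"])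
    (use K J in \<open>simp_all add: compact_Un smooth_diff\<close>)
qed

lemma SD_lift:
 assumes "\<theta> \<in> SD" shows "(lift \<theta>) \<in> SC"
proof -
 obtain K where K: "compact K" "K \<subseteq> D" "smooth_on \<theta> UNIV"
  "\<And>x. x \<notin> K ==> \<theta> x = 0" "\<And>x. grad \<theta> x $ 1 $ 1 + grad \<theta> x $ 2 $ 2 = 0" using SD_D[OF assms(1)] by metis
 have "horiz (x + L *\<^sub>R axis 3 1) = horiz x" for x
  by (simp add: vec_eq_iff forall_2 axis_def)
 then show ?thesis
  by (intro SC_I[of K]) (use K in \<open>simp_all add: smooth_lift jacobian_lift trace_def sum_3\<close>)
qed

text \<open>By periodicity the vertical integral of every x_3-derivative vanishes. Integrating div
  \<psi> = 0 over the height therefore leaves the horizontal divergence of the vertical integral,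
  which makes the latter an admissible test field for the plane equation. This is how
  three-dimensional fields come to be paired with the equation of \<open>u\<close>.\<close>

lemma SC_vert:
 assumes "\<psi> \<in> SC" shows "vert L \<psi> \<in> SD"
  and "\<And>y i. grad (vert L \<psi>) y $ i $ 1 = vert L (\<lambda>x. grad \<psi> x $ i $ 1) y"
  and "\<And>y i. grad (vert L \<psi>) y $ i $ 2 = vert L (\<lambda>x. grad \<psi> x $ i $ 2) y"
  and "\<And>y i. vert L (\<lambda>x. grad \<psi> x $ i $ 3) y = 0"
  and "\<And>y i. vert L \<psi> y $ i = vert L (\<lambda>x. \<psi> x $ i) y"
proof -
 obtain K where K: "compact K" "K \<subseteq> D" "smooth_on \<psi> UNIV" "\<And>x. \<psi> (x + L *\<^sub>R axis 3 1) = \<psi> x"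
  "\<And>x. horiz x \<notin> K ==> \<psi> x = 0" "\<And>x. trace (grad \<psi> x) = 0" using SC_D[OF assms(1)] by metis
 have nth: "vert L f y $ i = vert L (\<lambda>x. f x $ i) y" if "continuous_on UNIV f" for f :: "real^3 => real^3" and y i
  unfolding vert_def
  using integral_bounded_linear[OF bounded_linear_vec_nth integrable_slice[OF that, of L y], of i] by simp
 show e0: "vert L \<psi> y $ i = vert L (\<lambda>x. \<psi> x $ i) y" for y i
  by (rule nth[OF smooth_continuous_on[OF K(3)]])
 have d: "frechet_derivative (vert L \<psi>) (at y) h $ i = vert L (\<lambda>x. frechet_derivative \<psi> (at x) (emb h 0) $ i) y" for y h i
  unfolding frechet_derivative_vert[OF K(3)]
  by (rule nth[OF smooth_continuous_on[OF smooth_frechet_derivative[OF K(3)]]])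
 show e1: "grad (vert L \<psi>) y $ i $ 1 = vert L (\<lambda>x. grad \<psi> x $ i $ 1) y" for y i
  unfolding jacobian_nth d emb_axis ..
 show e2: "grad (vert L \<psi>) y $ i $ 2 = vert L (\<lambda>x. grad \<psi> x $ i $ 2) y" for y i
  unfolding jacobian_nth d emb_axis ..
 show e3: "vert L (\<lambda>x. grad \<psi> x $ i $ 3) y = 0" for y i
 proof -
  have "emb y L = emb y 0 + L *\<^sub>R axis 3 1" by (simp add: vec_eq_iff forall_3 axis_def)
  then have "vert L (\<lambda>x. pd 3 \<psi> x) y = 0"
   using vert_d3[OF K(3) L] K(4) by simp
  then show ?thesis
   unfolding jacobian_nth
   using nth[OF smooth_continuous_on[OF smooth_frechet_derivative[OF K(3)]], of "axis 3 1" y i] by simp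
 qed
 show "vert L \<psi> \<in> SD"
 proof (rule SD_I[OF K(1,2)])
  show "smooth_on (vert L \<psi>) UNIV" by (rule smooth_vert[OF K(3)])
  show "vert L \<psi> y = 0" if "y \<notin> K" for y
   unfolding vert_def using K(5) that by simp
  fix y
  have i: "integrable MI (\<lambda>z. grad \<psi> (emb y z) $ i $ i)" for i
   by (rule integrable_slice[OF smooth_continuous_on[OF smooth_jacobian_nth[OF K(3)]]])
  have "vert L (\<lambda>x. grad \<psi> x $ 1 $ 1) y + vert L (\<lambda>x. grad \<psi> x $ 2 $ 2) y
    + vert L (\<lambda>x. grad \<psi> x $ 3 $ 3) y = vert L (\<lambda>x. trace (grad \<psi> x)) y"
   unfolding vert_def by (simp add: trace_def sum_3 i)
  then show "grad (vert L \<psi>) y $ 1 $ 1 + grad (vert L \<psi>) y $ 2 $ 2 = 0"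
   using e1[of y 1] e2[of y 2] e3[of 3 y] K(6) by (simp add: vert_def)
 qed
qed

text \<open>Horizontal derivatives integrate to 0 because the vertical integral of \<open>F\<close>
  has compact support in \<open>D\<close>; for the vertical derivative the boundary terms at bottom
  and top cancel by periodicity.\<close>

lemma cyl_integral_derivative_zero:
 fixes F :: "real^3 => real"
 assumes F: "smooth_on F UNIV" and K: "compact K" "K \<subseteq> D" "\<And>x. horiz x \<notin> K ==> F x = 0"
  and per: "\<And>x. F (x + L *\<^sub>R axis 3 1) = F x"
 shows "(LINT x|MC. pd j F x) = 0"
proof -
 have i: "integrable MC (\<lambda>x. pd j F x)" for j
  by (intro sq_int_integrable_fm[OF lmeasurable_cylinder] sq_int_continuous smooth_continuous_on
    smooth_frechet_derivative F bounded_cylinder lmeasurable_cylinder)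
 have "vert L F y = 0" if "y \<notin> K" for y
  unfolding vert_def using K(3) that by simp
 then have z: "(LINT y|MD. frechet_derivative (vert L F) (at y) h) = 0" for h
  by (rule integral_frechet_derivative_zero[OF smooth_vert[OF F] K(1,2) _ sets_D])
 have "j = 1 \<or> j = 2 \<or> j = 3" by (rule exhaust_3)
 then show ?thesis
 proof (elim disjE)
  assume j: "j = 1"
  show ?thesis using z[of "axis 1 1"] unfolding vert_fubini(3)[OF i] frechet_derivative_vert[OF F] emb_axis j .
 next
  assume j: "j = 2"
  show ?thesis using z[of "axis 2 1"] unfolding vert_fubini(3)[OF i] frechet_derivative_vert[OF F] emb_axis j .
 next
  assume j: "j = 3"
  have "emb y L = emb y 0 + L *\<^sub>R axis 3 1" for y by (simp add: vec_eq_iff forall_3 axis_def)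
  then have "vert L (\<lambda>x. pd 3 F x) = (\<lambda>y. 0)"
   using per by (intro ext) (simp add: vert_d3[OF F L])
  then show ?thesis unfolding vert_fubini(3)[OF i] unfolding j by simp
 qed
qed

abbreviation "vsq f \<equiv> vert L (\<lambda>x. (norm (f x))\<^sup>2)"

text \<open>Apply \<open>vert_square_nn_integral\<close> to F = |\<phi>|^2, where |d_j F| \<le> 2
  |\<phi>| |d_j \<phi>|. In L^2 norms the two factors give 4 |\<phi>|^2 |d_1 \<phi>| |d_2 \<phi>|,
  and 2 |d_1 \<phi>| |d_2 \<phi>| \<le> |d_1 \<phi>|^2 + |d_2 \<phi>|^2 leaves the constant
  2.\<close>

lemma ladyzhenskaya_smooth:
 assumes "\<phi> \<in> SC"
 shows "sq_int MD (vsq \<phi>)"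
  "(nrm MD (vsq \<phi>))\<^sup>2 \<le> 2 * (nrm MC \<phi>)\<^sup>2 * (nrm MC (grad \<phi>))\<^sup>2"
proof -
 obtain K where K: "compact K" "K \<subseteq> D" "smooth_on \<phi> UNIV" 
  "\<And>x. horiz x \<notin> K ==> \<phi> x = 0" using SC_D[OF assms(1)] by metis
 define F where "F x = \<phi> x \<bullet> \<phi> x" for x
 have Fs: "smooth_on F UNIV" unfolding F_def[abs_def] by (intro smooth_bilinear[OF bounded_bilinear_inner] K)
 have vF: "vsq \<phi> = vert L F" by (simp add: F_def[abs_def] power2_norm_eq_inner)
 note MDc = D(2) lmeasurable_D and MCc = bounded_cylinder lmeasurable_cylinder
 show sv: "sq_int MD (vsq \<phi>)"
  unfolding vF by (intro sq_int_continuous smooth_continuous_on smooth_vert Fs MDc)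
 let ?d = "\<lambda>j x. pd j \<phi> x"
 have sd: "sq_int MC (?d j)" for j
  by (intro sq_int_continuous smooth_continuous_on smooth_frechet_derivative K MCc)
 have s\<phi>: "sq_int MC \<phi>" by (intro sq_int_continuous smooth_continuous_on K MCc)
 have dF: "frechet_derivative F (at x) h = 2 * (\<phi> x \<bullet> frechet_derivative \<phi> (at x) h)" for x h
 proof -
  have "(F has_derivative (\<lambda>h. \<phi> x \<bullet> frechet_derivative \<phi> (at x) h + frechet_derivative \<phi> (at x) h \<bullet> \<phi> x)) (at x)"
   unfolding F_def[abs_def] by (rule has_derivative_inner[OF smooth_has_derivative[OF K(3)] smooth_has_derivative[OF K(3)]])
  from fun_cong[OF frechet_derivative_at[OF this], of h] show ?thesis by (simp add: inner_commute)
 qed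
 have iF: "integrable MC (\<lambda>x. \<bar>pd j F x\<bar>)" for j
  by (intro integrable_abs sq_int_integrable_fm[OF lmeasurable_cylinder] sq_int_continuous
    smooth_continuous_on smooth_frechet_derivative Fs MCc)
 define N where "N j = (LINT x|MC. \<bar>pd j F x\<bar>)" for j
 have N0: "N j \<ge> 0" for j unfolding N_def by simp
 have N: "N j \<le> 2 * (nrm MC \<phi> * nrm MC (?d j))" for j
 proof -
  have "N j \<le> (LINT x|MC. 2 * (norm (\<phi> x) * norm (?d j x)))"
   unfolding N_def dF
   by (intro integral_mono iF[unfolded dF] integrable_mult_right sq_int_mult_norm[OF s\<phi> sd])
     (simp add: abs_mult Cauchy_Schwarz_ineq2)
  also have "\<dots> \<le> 2 * (nrm MC \<phi> * nrm MC (?d j))"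
   using CS_norm[OF s\<phi> sd, of j] by simp
  finally show ?thesis .
 qed
 have eN: "(\<integral>\<^sup>+x. indicator {x. 0 < x $ 3 \<and> x $ 3 < L} x * ennreal \<bar>pd j F x\<bar> \<partial>lborel) = ennreal (N j)" for j
 proof -
  have "closed (horiz -` K)"
   by (rule closed_vimage[OF compact_imp_closed[OF K(1)] linear_continuous_on[OF bounded_linear_horiz]])
  moreover have "F x = 0" if "x \<notin> horiz -` K" for x using K(4) that by (simp add: F_def)
  ultimately have out: "frechet_derivative F (at x) e = 0" if "x \<notin> horiz -` K" for x e
   by (rule frechet_derivative_outside) (use that in auto)
  \<comment> \<open>The derivative vanishes outside the horizontal support, so the integral over the
    whole slab reduces to one over the cylinder.\<close>
  have ind: "indicator {x. 0 < x $ 3 \<and> x $ 3 < L} x * ennreal \<bar>pd j F x\<bar> =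
   ennreal \<bar>pd j F x\<bar> * indicator C x" for x
  proof (cases "horiz x \<in> K")
   case True
   then have "horiz x \<in> D" using K(2) by blast
   then show ?thesis by (simp add: indicator_def cylinder_def)
  next
   case False
   then show ?thesis by (simp add: out)
  qed
  have "(\<integral>\<^sup>+x. indicator {x. 0 < x $ 3 \<and> x $ 3 < L} x * ennreal \<bar>pd j F x\<bar> \<partial>lborel)
    = (\<integral>\<^sup>+x. ennreal \<bar>pd j F x\<bar> * indicator C x \<partial>lborel)"
   unfolding ind ..
  also have "\<dots> = (\<integral>\<^sup>+x. ennreal \<bar>pd j F x\<bar> * indicator C x \<partial>lebesgue)"
   by (rule nn_integral_completion[symmetric])
  also have "\<dots> = (\<integral>\<^sup>+x. ennreal \<bar>pd j F x\<bar> \<partial>MC)"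
   using sets_cylinder by (intro nn_integral_restrict_space[symmetric]) simp
  also have "\<dots> = ennreal (N j)"
   unfolding N_def by (rule nn_integral_eq_integral[OF iF]) simp
  finally show ?thesis .
 qed
 have "ennreal ((nrm MD (vsq \<phi>))\<^sup>2) = (\<integral>\<^sup>+y. ennreal ((vert L F y)\<^sup>2) \<partial>MD)"
  using sq_int_integrable[OF sv] by (simp add: nrm_sq vF nn_integral_eq_integral)
 also have "\<dots> = (\<integral>\<^sup>+y. ennreal ((vert L F y)\<^sup>2) * indicator D y \<partial>lebesgue)"
  using sets_D by (intro nn_integral_restrict_space) simp
 also have "\<dots> \<le> (\<integral>\<^sup>+y. ennreal ((vert L F y)\<^sup>2) \<partial>lebesgue)"
  by (intro nn_integral_mono) (simp add: indicator_def)
 also have "\<dots> = (\<integral>\<^sup>+y. ennreal ((vert L F y)\<^sup>2) \<partial>lborel)"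
  by (rule nn_integral_completion)
 also have "\<dots> \<le> ennreal (N 1) * ennreal (N 2)"
  unfolding eN[symmetric]
  by (rule vert_square_nn_integral[OF Fs compact_imp_bounded[OF K(1)]]) (simp_all add: F_def K(4))
 also have "\<dots> = ennreal (N 1 * N 2)" by (simp add: ennreal_mult N0)
 finally have "(nrm MD (vsq \<phi>))\<^sup>2 \<le> N 1 * N 2"
  by (subst (asm) ennreal_le_iff) (simp_all add: N0)
 also have "\<dots> \<le> (2 * (nrm MC \<phi> * nrm MC (?d 1))) * (2 * (nrm MC \<phi> * nrm MC (?d 2)))"
  by (intro mult_mono N N0) (simp add: nrm_nonneg)
 also have "\<dots> = 2 * (nrm MC \<phi>)\<^sup>2 * (2 * (nrm MC (?d 1) * nrm MC (?d 2)))"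
  by (simp add: power2_eq_square)
 also have "\<dots> \<le> 2 * (nrm MC \<phi>)\<^sup>2 * ((nrm MC (?d 1))\<^sup>2 + (nrm MC (?d 2))\<^sup>2)"
  by (intro mult_left_mono two_mult_le_squares) simp
 also have "\<dots> \<le> 2 * (nrm MC \<phi>)\<^sup>2 * (nrm MC (grad \<phi>))\<^sup>2"
 proof (intro mult_left_mono)
  have p: "(norm (?d 1 x))\<^sup>2 + (norm (?d 2 x))\<^sup>2 \<le> (norm (grad \<phi> x))\<^sup>2" for x
  proof -
   have "(norm (grad \<phi> x))\<^sup>2 = (norm (?d 1 x))\<^sup>2 + (norm (?d 2 x))\<^sup>2 + (norm (?d 3 x))\<^sup>2"
    unfolding power2_norm_eq_inner by (simp add: inner_vec_def sum_3 jacobian_nth)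
   then show ?thesis by simp
  qed
  have "(nrm MC (?d 1))\<^sup>2 + (nrm MC (?d 2))\<^sup>2 = (LINT x|MC. (norm (?d 1 x))\<^sup>2 + (norm (?d 2 x))\<^sup>2)"
   using sq_int_integrable[OF sd] by (simp add: nrm_sq)
  also have "\<dots> \<le> (LINT x|MC. (norm (grad \<phi> x))\<^sup>2)"
   by (intro integral_mono p Bochner_Integration.integrable_add sq_int_integrable sd jacobian_sq_int(2) K MCc)
  finally show "(nrm MC (?d 1))\<^sup>2 + (nrm MC (?d 2))\<^sup>2 \<le> (nrm MC (grad \<phi>))\<^sup>2"
   by (simp add: nrm_sq)
 qed simp
 finally show "(nrm MD (vsq \<phi>))\<^sup>2 \<le> 2 * (nrm MC \<phi>)\<^sup>2 * (nrm MC (grad \<phi>))\<^sup>2" .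
qed

text \<open>Since | |a|^2 - |b|^2 | \<le> |a - b| (|a| + |b|), convergence of \<phi>_n in L^2 yields
  convergence of \<open>vsq (\<phi> n)\<close> in L^1; the bound in L^2 is then rescued by
  \<open>L2_bound_of_L1_limit\<close>.\<close>

lemma ladyzhenskaya:
 assumes f: "grad_closure C SC f G"
 shows "sq_int MD (vsq f)" "(nrm MD (vsq f))\<^sup>2 \<le> 2 * (nrm MC f)\<^sup>2 * (nrm MC G)\<^sup>2"
proof -
 obtain \<phi> where \<phi>: "\<And>n::nat. \<phi> n \<in> SC" "(\<lambda>n. dst MC (\<phi> n) f) ----> 0"
  "(\<lambda>n. dst MC (grad (\<phi> n)) G) ----> 0" by (rule grad_closureE[OF f]) (rule that)
 note sf = grad_closureD[OF f]
 note s\<phi> = jacobian_sq_int[OF SC_smooth[OF \<phi>(1)] bounded_cylinder lmeasurable_cylinder]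
 note i = sq_int_integrable[OF s\<phi>(1)] sq_int_integrable[OF sf(1)]
 have b: "(LINT y|MD. \<bar>vsq (\<phi> n) y - vsq f y\<bar>) \<le> dst MC (\<phi> n) f * (nrm MC (\<phi> n) + nrm MC f)" for n
 proof -
  let ?h = "\<lambda>x. (norm (\<phi> n x))\<^sup>2 - (norm (f x))\<^sup>2"
  have ih: "integrable MC ?h" using i by simp
  have "(LINT y|MD. \<bar>vsq (\<phi> n) y - vsq f y\<bar>) \<le> (LINT y|MD. vert L (\<lambda>x. \<bar>?h x\<bar>) y)"
  proof (rule integral_mono_AE)
   show "integrable MD (\<lambda>y. \<bar>vsq (\<phi> n) y - vsq f y\<bar>)"
    using vert_fubini(2)[OF i(1)] vert_fubini(2)[OF i(2)] by simp
   show "integrable MD (vert L (\<lambda>x. \<bar>?h x\<bar>))" using ih by (intro vert_fubini(2)) simp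
   show "AE y in MD. \<bar>vsq (\<phi> n) y - vsq f y\<bar> \<le> vert L (\<lambda>x. \<bar>?h x\<bar>) y"
    using vert_fubini(1)[OF i(1)[of n]] vert_fubini(1)[OF i(2)]
   proof eventually_elim
    case (elim y)
    then have "vsq (\<phi> n) y - vsq f y = (LINT z|MI. ?h (emb y z))" by (simp add: vert_def)
    then show ?case unfolding vert_def by simp
   qed
  qed
  also have "\<dots> = (LINT x|MC. \<bar>?h x\<bar>)" using ih by (intro vert_fubini(3)[symmetric]) simp
  also have "\<dots> \<le> (LINT x|MC. norm (\<phi> n x - f x) * norm (\<phi> n x) + norm (\<phi> n x - f x) * norm (f x))"
  proof (rule integral_mono)
   show "integrable MC (\<lambda>x. \<bar>?h x\<bar>)" using ih by simp
   show "integrable MC (\<lambda>x. norm (\<phi> n x - f x) * norm (\<phi> n x) + norm (\<phi> n x - f x) * norm (f x))"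
    by (intro Bochner_Integration.integrable_add sq_int_mult_norm sq_int_diff sf s\<phi>)
   fix x
   have "\<bar>?h x\<bar> = \<bar>norm (\<phi> n x) - norm (f x)\<bar> * (norm (\<phi> n x) + norm (f x))"
   proof -
    have "?h x = (norm (\<phi> n x) - norm (f x)) * (norm (\<phi> n x) + norm (f x))"
     by (simp add: power2_eq_square algebra_simps)
    moreover have "\<bar>norm (\<phi> n x) + norm (f x)\<bar> = norm (\<phi> n x) + norm (f x)" by simp
    ultimately show ?thesis by (simp only: abs_mult)
   qed
   also have "\<dots> \<le> norm (\<phi> n x - f x) * (norm (\<phi> n x) + norm (f x))"
    by (intro mult_right_mono norm_triangle_ineq3) simp
   finally show "\<bar>?h x\<bar> \<le> norm (\<phi> n x - f x) * norm (\<phi> n x) + norm (\<phi> n x - f x) * norm (f x)"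
    by (simp add: algebra_simps)
  qed
  also have "\<dots> = (LINT x|MC. norm (\<phi> n x - f x) * norm (\<phi> n x)) + (LINT x|MC. norm (\<phi> n x - f x) * norm (f x))"
   by (intro Bochner_Integration.integral_add sq_int_mult_norm sq_int_diff sf s\<phi>)
  also have "\<dots> \<le> dst MC (\<phi> n) f * nrm MC (\<phi> n) + dst MC (\<phi> n) f * nrm MC f"
   by (intro add_mono CS_norm sq_int_diff sf s\<phi>)
  finally show ?thesis by (simp add: algebra_simps)
 qed
 note t\<phi> = nrm_tendsto[OF s\<phi>(1) sf(1) \<phi>(2)] nrm_tendsto[OF s\<phi>(2) sf(2) \<phi>(3)]
 have "(\<lambda>n. dst MC (\<phi> n) f * (nrm MC (\<phi> n) + nrm MC f)) ----> 0 * (nrm MC f + nrm MC f)"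
  by (intro tendsto_mult tendsto_add \<phi>(2) t\<phi>(1) tendsto_const)
 then have lim: "(\<lambda>n. \<integral>y. \<bar>vsq (\<phi> n) y - vsq f y\<bar> \<partial>MD) ----> 0"
  by (intro tendsto_zero_squeeze[OF _ _ b]) simp_all
 have c: "(\<lambda>n. 2 * (nrm MC (\<phi> n))\<^sup>2 * (nrm MC (grad (\<phi> n)))\<^sup>2) ----> 2 * (nrm MC f)\<^sup>2 * (nrm MC G)\<^sup>2"
  by (intro tendsto_mult tendsto_power tendsto_const t\<phi>)
 show "sq_int MD (vsq f)" "(nrm MD (vsq f))\<^sup>2 \<le> 2 * (nrm MC f)\<^sup>2 * (nrm MC G)\<^sup>2"
  by (rule L2_bound_of_L1_limit[OF vert_fubini(2)[OF i(1)] vert_fubini(2)[OF i(2)] lim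
     ladyzhenskaya_smooth(1)[OF \<phi>(1)] ladyzhenskaya_smooth(2)[OF \<phi>(1)] c])+
qed

end

section \<open>The nonlinear term\<close>

text \<open>The tensor product. The order of the arguments fits the convention for Jacobians:
  \<open>M \<bullet> outer b a\<close> is ((a . grad) f) . b if \<open>M\<close> is the gradient of
  \<open>f\<close>, so the advecting field comes second.\<close>

definition outer :: "real^3 => real^3 => real^3^3" where
 "outer b a = (\<chi> i j. b $ i * a $ j)"

lemma inner_outer: "M \<bullet> outer b a = (M *v a) \<bullet> b"
 by (simp add: outer_def inner_vec_def matrix_vector_mult_def sum_3 algebra_simps)

lemma norm_outer: "norm (outer b a) = norm b * norm a"
proof -
 have "(norm (outer b a))\<^sup>2 = (norm b * norm a)\<^sup>2"
  unfolding power_mult_distrib power2_norm_eq_inner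
  by (simp add: outer_def inner_vec_def sum_3 algebra_simps)
 then show ?thesis by (simp add: power2_eq_iff_nonneg)
qed

lemma outer_diff_right: "outer b (a - a') = outer b a - outer b a'"
 and outer_diff_left: "outer (b - b') a = outer b a - outer b' a"
 by (simp_all add: outer_def vec_eq_iff algebra_simps)

lemma abs_inner_outer_le: "\<bar>M \<bullet> outer b a\<bar> \<le> norm M * (norm b * norm a)"
 using Cauchy_Schwarz_ineq2[of M "outer b a"] by (simp add: norm_outer)

lemma norm_matrix_vector_le: "norm (M *v a) \<le> norm M * norm a" for M :: "real^3^3"
proof (cases "M *v a = 0")
 case False
 have "norm (M *v a) * norm (M *v a) = M \<bullet> outer (M *v a) a"
  by (simp add: inner_outer norm_eq_sqrt_inner)
 also have "\<dots> \<le> norm M * (norm (M *v a) * norm a)"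
  using abs_inner_outer_le[of M "M *v a" a] by linarith
 finally have "norm (M *v a) * norm (M *v a) \<le> norm (M *v a) * (norm M * norm a)" by (simp add: algebra_simps)
 then show ?thesis using False by (simp add: mult_le_cancel_left_pos)
qed simp

lemma borel_measurable_outer:
 assumes "f \<in> borel_measurable M" "g \<in> borel_measurable M"
 shows "(\<lambda>x. outer (f x) (g x)) \<in> borel_measurable M"
proof (rule borel_measurable_continuous_Pair[OF assms])
 show "continuous_on UNIV (\<lambda>x. outer (fst x) (snd x))"
  unfolding outer_def by (intro continuous_on_vec_lambda continuous_intros)
qed

lemma borel_measurable_matrix_vector:
 fixes A :: "'a => real^3^3"
 assumes "A \<in> borel_measurable M" "g \<in> borel_measurable M"
 shows "(\<lambda>x. A x *v g x) \<in> borel_measurable M"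
proof (rule borel_measurable_continuous_Pair[OF assms])
 show "continuous_on UNIV (\<lambda>x :: (real^3^3) \<times> (real^3). fst x *v snd x)"
  unfolding matrix_vector_mult_def by (intro continuous_on_vec_lambda continuous_intros)
qed

lemma nrm_le_bound:
 assumes "sq_int M g" "f \<in> borel_measurable M" "\<And>x. x \<in> space M ==> norm (f x) \<le> K * norm (g x)" "K \<ge> 0"
 shows "sq_int M f" "nrm M f \<le> K * nrm M g"
proof -
 show s: "sq_int M f" by (rule sq_int_bound[OF assms(1,2), of K]) (rule AE_I2[OF assms(3)])
 have "(nrm M f)\<^sup>2 \<le> (LINT x|M. K\<^sup>2 * (norm (g x))\<^sup>2)"
  unfolding nrm_sq
 proof (rule integral_mono)
  show "integrable M (\<lambda>x. (norm (f x))\<^sup>2)" by (rule sq_int_integrable[OF s])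
  show "integrable M (\<lambda>x. K\<^sup>2 * (norm (g x))\<^sup>2)" using sq_int_integrable[OF assms(1)] by simp
  show "(norm (f x))\<^sup>2 \<le> K\<^sup>2 * (norm (g x))\<^sup>2" if "x \<in> space M" for x
   using power_mono[OF assms(3)[OF that] norm_ge_zero, of 2] by (simp add: power_mult_distrib)
 qed
 also have "\<dots> = (K * nrm M g)\<^sup>2" by (simp add: power_mult_distrib nrm_sq)
 finally show "nrm M f \<le> K * nrm M g"
  by (rule power2_le_imp_le) (simp add: assms(4) nrm_nonneg)
qed

context cyl
begin

lemma vert_nonneg: "(\<And>x. 0 \<le> h x) ==> 0 \<le> vert L h y" for h :: "real^3 => real"
 unfolding vert_def by (rule integral_nonneg_AE) simp

text \<open>A Tonelli statement for an unbounded factor \<open>g\<close>: truncations of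
  \<open>g\<close> have integrable products, their integrals are computed on \<open>D\<close>, and
  monotone convergence removes the truncation.\<close>

lemma mult_lift_integrable:
 fixes h :: "real^3 => real" and g :: "real^2 => real"
 assumes h: "integrable MC h" "\<And>x. 0 \<le> h x" and g: "g \<in> borel_measurable MD" "\<And>y. 0 \<le> g y"
  and gh: "integrable MD (\<lambda>y. g y * vert L h y)"
 shows "integrable MC (\<lambda>x. g (horiz x) * h x)"
proof -
 let ?g = "\<lambda>n::nat. \<lambda>y. min (g y) (real n)"
 note hm = borel_measurable_integrable[OF h(1)]
 have gm: "(lift (?g n)) \<in> borel_measurable MC" for n
  using lift_measurable[OF g(1)] by simp
 have i: "integrable MC (\<lambda>x. ?g n (horiz x) * h x)" for n
 proof (rule Bochner_Integration.integrable_bound)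
  show "integrable MC (\<lambda>x. real n * h x)" using h(1) by simp
  show "(\<lambda>x. ?g n (horiz x) * h x) \<in> borel_measurable MC" by (intro borel_measurable_times gm hm)
  show "AE x in MC. norm (?g n (horiz x) * h x) \<le> norm (real n * h x)"
   by (rule AE_I2) (use g(2) in \<open>simp add: abs_mult mult_right_mono\<close>)
 qed
 have lim: "(\<lambda>n. ?g n y) ----> g y" for y
 proof -
  obtain k :: nat where "g y \<le> real k" using real_arch_simple by blast
  then have "?g n y = g y" if "n \<ge> k" for n using that by (intro min_absorb1) linarith
  then have "eventually (\<lambda>n. ?g n y = g y) sequentially" unfolding eventually_sequentially by blast
  then show ?thesis by (rule tendsto_eventually)
 qed
 have "(\<lambda>n. \<integral>y. ?g n y * vert L h y \<partial>MD) ----> (LINT y|MD. g y * vert L h y)"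
 proof (rule integral_dominated_convergence[where w = "\<lambda>y. g y * vert L h y"])
  show "(\<lambda>y. g y * vert L h y) \<in> borel_measurable MD" using gh by simp
  show "(\<lambda>y. ?g n y * vert L h y) \<in> borel_measurable MD" for n
   using g(1) borel_measurable_integrable[OF vert_fubini(2)[OF h(1)]] by simp
  show "AE y in MD. (\<lambda>n. ?g n y * vert L h y) ----> g y * vert L h y"
   by (intro AE_I2 tendsto_mult lim tendsto_const)
  show "AE y in MD. norm (?g n y * vert L h y) \<le> g y * vert L h y" for n
   by (rule AE_I2) (simp add: abs_mult vert_nonneg h(2) g(2) mult_right_mono)
 qed (rule gh)
 then have ilim: "(\<lambda>n. \<integral>x. ?g n (horiz x) * h x \<partial>MC) ----> (LINT y|MD. g y * vert L h y)"
  by (simp only: integrable_mult_lift[OF i])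
 show ?thesis
 proof (rule integrable_monotone_convergence[OF i _ _ ilim])
  show "AE x in MC. mono (\<lambda>n. ?g n (horiz x) * h x)"
   by (intro AE_I2 monoI mult_right_mono h(2)) (simp add: min.coboundedI2)
  show "AE x in MC. (\<lambda>n. ?g n (horiz x) * h x) ----> g (horiz x) * h x"
   by (intro AE_I2 tendsto_mult lim tendsto_const)
  show "(\<lambda>x. g (horiz x) * h x) \<in> borel_measurable MC"
   by (intro borel_measurable_times lift_measurable[OF g(1)] hm)
 qed
qed

text \<open>A factor independent of x_3 sees |f|^2 only through its vertical integral. Square
  integrability of \<open>vsq f\<close> thus takes the place of a bound on the fourth power of
  \<open>f\<close> on the cylinder.\<close>

lemma vsq_mult:
 fixes f :: "real^3 => 'b::euclidean_space" and g :: "real^2 => real"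
 assumes f: "sq_int MC f" "sq_int MD (vsq f)" and g: "sq_int MD g" "\<And>y. 0 \<le> g y"
 shows "integrable MC (\<lambda>x. g (horiz x) * (norm (f x))\<^sup>2)"
  "(LINT x|MC. g (horiz x) * (norm (f x))\<^sup>2) \<le> nrm MD g * nrm MD (vsq f)"
proof -
 have gh: "integrable MD (\<lambda>y. g y * vsq f y)" using sq_int_inner[OF g(1) f(2)] by simp
 show i: "integrable MC (\<lambda>x. g (horiz x) * (norm (f x))\<^sup>2)"
  by (rule mult_lift_integrable[OF sq_int_integrable[OF f(1)] _ sq_int_measurable[OF g(1)] g(2) gh]) simp
 have "(LINT x|MC. g (horiz x) * (norm (f x))\<^sup>2) = ip MD g (vsq f)"
  using integrable_mult_lift[OF i] by simp
 then show "(LINT x|MC. g (horiz x) * (norm (f x))\<^sup>2) \<le> nrm MD g * nrm MD (vsq f)"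
  using CS_inner[OF g(1) f(2)] by simp
qed

lemma vsq_mult2:
 fixes f f' :: "real^3 => real^3" and B :: "real^2 => real^2^3"
 assumes f: "sq_int MC f" "sq_int MD (vsq f)" and f': "sq_int MC f'" "sq_int MD (vsq f')"
  and B: "sq_int MD B"
 shows "integrable MC (\<lambda>x. lift_mat (B (horiz x)) \<bullet> outer (f x) (f' x))"
  "\<bar>\<integral>x. lift_mat (B (horiz x)) \<bullet> outer (f x) (f' x) \<partial>MC\<bar> \<le> nrm MD B * (nrm MD (vsq f) + nrm MD (vsq f'))"
proof -
 have nB: "sq_int MD (\<lambda>y. norm (B y))" "nrm MD (\<lambda>y. norm (B y)) = nrm MD B"
  by (rule sq_int_bound[OF B measurable_compose[OF sq_int_measurable[OF B] borel_measurable_norm], of 1])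
    (simp_all add: nrm_def)
 note a = vsq_mult[OF f nB(1)] and b = vsq_mult[OF f' nB(1)]
 have i: "integrable MC (\<lambda>x. norm (B (horiz x)) * (norm (f x))\<^sup>2 + norm (B (horiz x)) * (norm (f' x))\<^sup>2)"
  using a(1) b(1) by simp
 have le: "\<bar>lift_mat (B (horiz x)) \<bullet> outer (f x) (f' x)\<bar> \<le>
   norm (B (horiz x)) * (norm (f x))\<^sup>2 + norm (B (horiz x)) * (norm (f' x))\<^sup>2" for x
 proof -
  have "\<bar>lift_mat (B (horiz x)) \<bullet> outer (f x) (f' x)\<bar> \<le> norm (B (horiz x)) * (norm (f x) * norm (f' x))"
   using abs_inner_outer_le[of "lift_mat (B (horiz x))"] by simp
  also have "\<dots> \<le> norm (B (horiz x)) * ((norm (f x))\<^sup>2 + (norm (f' x))\<^sup>2)"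
   using two_mult_le_squares[of "norm (f x)" "norm (f' x)"]
    mult_nonneg_nonneg[OF norm_ge_zero[of "f x"] norm_ge_zero[of "f' x"]]
   by (intro mult_left_mono norm_ge_zero) linarith
  finally show ?thesis by (simp add: algebra_simps)
 qed
 have m: "(\<lambda>x. lift_mat (B (horiz x)) \<bullet> outer (f x) (f' x)) \<in> borel_measurable MC"
  by (rule borel_measurable_inner[OF
     borel_measurable_continuous_on[OF linear_continuous_on[OF bounded_linear_lift_mat]
      lift_measurable[OF sq_int_measurable[OF B]]]
     borel_measurable_outer[OF sq_int_measurable[OF f(1)] sq_int_measurable[OF f'(1)]]])
 show I: "integrable MC (\<lambda>x. lift_mat (B (horiz x)) \<bullet> outer (f x) (f' x))"
  by (rule Bochner_Integration.integrable_bound[OF i m], rule AE_I2)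
    (use le in \<open>simp add: order_trans[OF le abs_ge_self]\<close>)
 have "\<bar>\<integral>x. lift_mat (B (horiz x)) \<bullet> outer (f x) (f' x) \<partial>MC\<bar> \<le>
   (LINT x|MC. \<bar>lift_mat (B (horiz x)) \<bullet> outer (f x) (f' x)\<bar>)" by (rule integral_abs_bound)
 also have "\<dots> \<le> (LINT x|MC. norm (B (horiz x)) * (norm (f x))\<^sup>2 + norm (B (horiz x)) * (norm (f' x))\<^sup>2)"
  by (intro integral_mono integrable_abs I i le)
 also have "\<dots> \<le> nrm MD B * (nrm MD (vsq f) + nrm MD (vsq f'))"
  using a b by (simp add: nB algebra_simps)
 finally show "\<bar>\<integral>x. lift_mat (B (horiz x)) \<bullet> outer (f x) (f' x) \<partial>MC\<bar> \<le>
   nrm MD B * (nrm MD (vsq f) + nrm MD (vsq f'))" .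
qed

lemma outer_sq_int:
 fixes w :: "real^3 => real^3" and \<beta> :: "real^2 => real^3"
 assumes w: "sq_int MC w" "sq_int MD (vsq w)" and \<beta>: "\<beta> \<in> borel_measurable MD" "sq_int MD (\<lambda>y. (norm (\<beta> y))\<^sup>2)"
 shows "sq_int MC (\<lambda>x. outer (\<beta> (horiz x)) (w x))"
  "(nrm MC (\<lambda>x. outer (\<beta> (horiz x)) (w x)))\<^sup>2 \<le> nrm MD (\<lambda>y. (norm (\<beta> y))\<^sup>2) * nrm MD (vsq w)"
proof -
 note a = vsq_mult[OF w \<beta>(2)]
 have m: "(\<lambda>x. outer (\<beta> (horiz x)) (w x)) \<in> borel_measurable MC"
  by (intro borel_measurable_outer lift_measurable \<beta> sq_int_measurable w)
 show "sq_int MC (\<lambda>x. outer (\<beta> (horiz x)) (w x))"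
  using a(1) m by (simp add: sq_int_def norm_outer power_mult_distrib)
 show "(nrm MC (\<lambda>x. outer (\<beta> (horiz x)) (w x)))\<^sup>2 \<le> nrm MD (\<lambda>y. (norm (\<beta> y))\<^sup>2) * nrm MD (vsq w)"
  using a(2) by (simp add: nrm_sq norm_outer power_mult_distrib)
qed

lemma SD_SC_sq_int:
 assumes "\<phi> \<in> SC" shows "sq_int MC \<phi>" "sq_int MC (grad \<phi>)"
 using jacobian_sq_int[OF SC_smooth[OF assms] bounded_cylinder lmeasurable_cylinder] by auto

lemma SD_sq_int:
 assumes "\<phi> \<in> SD" shows "sq_int MD \<phi>" "sq_int MD (grad \<phi>)"
 using jacobian_sq_int[OF SD_smooth[OF assms] D(2) lmeasurable_D] by auto

lemma lift_mat_lift: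
 fixes B :: "real^2 => real^2^3"
 assumes "sq_int MD B"
 shows "sq_int MC (\<lambda>x. lift_mat (B (horiz x)))" "(nrm MC (\<lambda>x. lift_mat (B (horiz x))))\<^sup>2 = L * (nrm MD B)\<^sup>2"
proof -
 have "(\<lambda>x. lift_mat (B (horiz x))) \<in> borel_measurable MC"
  by (intro borel_measurable_continuous_on[OF linear_continuous_on[OF bounded_linear_lift_mat]]
    lift_measurable sq_int_measurable assms)
 then show "sq_int MC (\<lambda>x. lift_mat (B (horiz x)))" "(nrm MC (\<lambda>x. lift_mat (B (horiz x))))\<^sup>2 = L * (nrm MD B)\<^sup>2"
  using lift_sq_int[OF assms] by (simp_all add: sq_int_def nrm_sq)
qed

text \<open>Lifting multiplies all L^2 norms by sqrt L, so approximating sequences can be lifted. In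
  this way \<open>u\<close> becomes a field of the same kind as \<open>v\<close>.\<close>

lemma grad_closure_lift:
 assumes f: "grad_closure D SD f G"
 shows "grad_closure C SC (lift f) (\<lambda>x. lift_mat (G (horiz x)))"
proof -
 obtain \<phi> where \<phi>: "\<And>n::nat. \<phi> n \<in> SD" "(\<lambda>n. dst MD (\<phi> n) f) ----> 0"
  "(\<lambda>n. dst MD (grad (\<phi> n)) G) ----> 0" by (rule grad_closureE[OF f]) (rule that)
 note sf = grad_closureD[OF f] and s\<phi> = SD_sq_int[OF \<phi>(1)]
 have sqrtL: "nrm MC h = sqrt L * nrm MD h'" if "(nrm MC h)\<^sup>2 = L * (nrm MD h')\<^sup>2"
  for h :: "real^3 => 'x::euclidean_space" and h' :: "real^2 => 'y::euclidean_space"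
  using arg_cong[OF that, of sqrt] by (simp add: real_sqrt_mult nrm_nonneg)
 have 1: "nrm MC (\<lambda>x. \<phi> n (horiz x) - f (horiz x)) = sqrt L * dst MD (\<phi> n) f" for n
  by (rule sqrtL) (rule lift_sq_int(2)[OF sq_int_diff[OF s\<phi>(1) sf(1)]])
 have 2: "nrm MC (\<lambda>x. grad (lift (\<phi> n)) x - lift_mat (G (horiz x))) =
   sqrt L * dst MD (grad (\<phi> n)) G" for n
  unfolding jacobian_lift[OF SD_smooth[OF \<phi>(1)]] lift_mat_diff
  by (rule sqrtL) (rule lift_mat_lift(2)[OF sq_int_diff[OF s\<phi>(2) sf(2)]])
 show ?thesis
  unfolding grad_closure_def
 proof (intro conjI exI[where x = "\<lambda>n x. \<phi> n (horiz x)"] allI SD_lift \<phi>(1))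
  show "sq_int MC (lift f)" by (rule lift_sq_int(1)[OF sf(1)])
  show "sq_int MC (\<lambda>x. lift_mat (G (horiz x)))" by (rule lift_mat_lift(1)[OF sf(2)])
  show "(\<lambda>n. nrm MC (\<lambda>x. \<phi> n (horiz x) - f (horiz x))) ----> 0"
   unfolding 1 using tendsto_mult[OF tendsto_const[of "sqrt L"] \<phi>(2)] by simp
  show "(\<lambda>n. nrm MC (\<lambda>x. grad (lift (\<phi> n)) x - lift_mat (G (horiz x)))) ----> 0"
   unfolding 2 using tendsto_mult[OF tendsto_const[of "sqrt L"] \<phi>(3)] by simp
 qed
qed

text \<open>Apply the inequality on the cylinder to the lift; both sides then carry the factor L^2,
  which cancels.\<close>

lemma ladyzhenskaya_D:
 assumes f: "grad_closure D SD f G"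
 shows "sq_int MD (\<lambda>y. (norm (f y))\<^sup>2)" "(nrm MD (\<lambda>y. (norm (f y))\<^sup>2))\<^sup>2 \<le> 2 * (nrm MD f)\<^sup>2 * (nrm MD G)\<^sup>2"
proof -
 note l = ladyzhenskaya[OF grad_closure_lift[OF f]]
 have e: "vsq (lift f) = (\<lambda>y. L *\<^sub>R (norm (f y))\<^sup>2)"
  by (rule ext) (rule vert_lift)
 show "sq_int MD (\<lambda>y. (norm (f y))\<^sup>2)"
  using sq_int_scaleR[OF l(1), of "1 / L"] L by (simp add: e)
 have "L\<^sup>2 * (nrm MD (\<lambda>y. (norm (f y))\<^sup>2))\<^sup>2 = (nrm MD (vsq (lift f)))\<^sup>2"
  unfolding e nrm_scaleR using L by (simp add: power_mult_distrib)
 also have "\<dots> \<le> 2 * (L * (nrm MD f)\<^sup>2) * (L * (nrm MD G)\<^sup>2)"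
  using l(2) unfolding lift_sq_int(2)[OF grad_closureD(1)[OF f]] lift_mat_lift(2)[OF grad_closureD(2)[OF f]] .
 also have "\<dots> = L\<^sup>2 * (2 * (nrm MD f)\<^sup>2 * (nrm MD G)\<^sup>2)" by (simp add: power2_eq_square)
 finally show "(nrm MD (\<lambda>y. (norm (f y))\<^sup>2))\<^sup>2 \<le> 2 * (nrm MD f)\<^sup>2 * (nrm MD G)\<^sup>2"
  using L by (simp add: mult_le_cancel_left_pos)
qed

text \<open>The sum of the integrands is the divergence of (b . c) a, because \<open>a\<close> is
  divergence-free; it integrates to 0 by compact support and periodicity.\<close>

lemma trilinear_smooth:
 assumes a: "a \<in> SC" and b: "b \<in> SC" and c: "c \<in> SC"
 shows "(LINT x|MC. grad b x \<bullet> outer (c x) (a x)) + (LINT x|MC. grad c x \<bullet> outer (b x) (a x)) = 0"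
proof -
 obtain K where K: "compact K" "K \<subseteq> D" "smooth_on a UNIV" "\<And>x. a (x + L *\<^sub>R axis 3 1) = a x"
  "\<And>x. horiz x \<notin> K ==> a x = 0" "\<And>x. trace (grad a x) = 0" using SC_D[OF a] by metis
 have bs: "smooth_on b UNIV" and bp: "b (x + L *\<^sub>R axis 3 1) = b x" for x using SC_D[OF b] by metis+
 have cs: "smooth_on c UNIV" and cp: "c (x + L *\<^sub>R axis 3 1) = c x" for x using SC_D[OF c] by metis+
 define F where "F j x = a x $ j * (b x \<bullet> c x)" for j x
 have bc: "smooth_on (\<lambda>x. b x \<bullet> c x) UNIV" by (rule smooth_bilinear[OF bounded_bilinear_inner bs cs])
 have Fs: "smooth_on (F j) UNIV" for j unfolding F_def[abs_def] by (intro smooth_mult smooth_nth K(3) bc)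
 have dbc: "frechet_derivative (\<lambda>x. b x \<bullet> c x) (at x) h =
   b x \<bullet> frechet_derivative c (at x) h + frechet_derivative b (at x) h \<bullet> c x" for x h
  using fun_cong[OF frechet_derivative_at[OF has_derivative_inner[OF smooth_has_derivative[OF bs] smooth_has_derivative[OF cs]]], of x h]
  by simp
 have dF: "frechet_derivative (F j) (at x) h = a x $ j * (b x \<bullet> frechet_derivative c (at x) h + frechet_derivative b (at x) h \<bullet> c x)
   + frechet_derivative a (at x) h $ j * (b x \<bullet> c x)" for j x h
  unfolding F_def[abs_def] frechet_derivative_mult_real[OF smooth_nth[OF K(3)] bc] dbc frechet_derivative_nth[OF K(3)] ..
 have z: "(LINT x|MC. pd j (F j) x) = 0" for j
  by (rule cyl_integral_derivative_zero[OF Fs K(1,2)]) (simp_all add: F_def K(4,5) bp cp)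
 have i: "integrable MC (\<lambda>x. pd j (F j) x)" for j
  by (intro sq_int_integrable_fm[OF lmeasurable_cylinder] sq_int_continuous smooth_continuous_on
    smooth_frechet_derivative Fs bounded_cylinder lmeasurable_cylinder)
 have i1: "integrable MC (\<lambda>x. grad b x \<bullet> outer (c x) (a x))" if "smooth_on b UNIV" "smooth_on c UNIV" for b c
 proof -
  have "continuous_on UNIV (\<lambda>x. grad b x \<bullet> outer (c x) (a x))"
   unfolding outer_def
   by (intro continuous_on_inner continuous_jacobian that continuous_on_vec_lambda continuous_on_mult
     smooth_continuous_on smooth_nth K)
  then show ?thesis
   by (intro sq_int_integrable_fm[OF lmeasurable_cylinder] sq_int_continuous bounded_cylinder lmeasurable_cylinder)
 qed
 have "grad b x \<bullet> outer (c x) (a x) + grad c x \<bullet> outer (b x) (a x) =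
   pd 1 (F 1) x + pd 2 (F 2) x
   + pd 3 (F 3) x" for x
 proof -
  have "pd 1 a x $ 1 + pd 2 a x $ 2
    + pd 3 a x $ 3 = 0"
   using K(6)[of x] by (simp add: trace_def sum_3 jacobian_nth)
  then have "pd 1 a x $ 1 * (b x \<bullet> c x) + pd 2 a x $ 2 * (b x \<bullet> c x)
    + pd 3 a x $ 3 * (b x \<bullet> c x) = 0"
   by (simp add: distrib_right[symmetric])
  then show ?thesis
   unfolding dF
   by (simp add: inner_vec_def[of "grad b x"] inner_vec_def[of "grad c x"])
     (simp add: outer_def inner_vec_def sum_3 jacobian_nth algebra_simps)
 qed
 then have "(LINT x|MC. grad b x \<bullet> outer (c x) (a x) + grad c x \<bullet> outer (b x) (a x)) =
   (LINT x|MC. pd 1 (F 1) x + pd 2 (F 2) x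
   + pd 3 (F 3) x)" by simp
 also have "\<dots> = 0" using i[of 1] i[of 2] i[of 3] z[of 1] z[of 2] z[of 3] by simp
 finally show ?thesis using Bochner_Integration.integral_add[OF i1[OF bs cs] i1[OF cs bs]] by simp
qed

text \<open>As long as \<open>b\<close> is smooth, it and its gradient are bounded on the cylinder,
  and both terms are continuous in \<open>a\<close> and \<open>c\<close> with respect to the
  convergence that defines the closure.\<close>

lemma trilinear_closure_smooth:
 assumes a: "grad_closure C SC a A" and c: "grad_closure C SC c Cc" and b: "b \<in> SC"
 shows "(LINT x|MC. grad b x \<bullet> outer (c x) (a x)) + (LINT x|MC. Cc x \<bullet> outer (b x) (a x)) = 0"
proof -
 obtain \<phi> where \<phi>: "\<And>n::nat. \<phi> n \<in> SC" "(\<lambda>n. dst MC (\<phi> n) a) ----> 0" by (rule grad_closureE[OF a]) (rule that)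
 obtain \<theta> where \<theta>: "\<And>n::nat. \<theta> n \<in> SC" "(\<lambda>n. dst MC (\<theta> n) c) ----> 0"
  "(\<lambda>n. dst MC (grad (\<theta> n)) Cc) ----> 0" by (rule grad_closureE[OF c]) (rule that)
 note sa = grad_closureD[OF a] and sc = grad_closureD[OF c]
 note s\<phi> = SD_SC_sq_int[OF \<phi>(1)] and s\<theta> = SD_SC_sq_int[OF \<theta>(1)] and sb = SD_SC_sq_int[OF b]
 obtain B1 where B1: "B1 > 0" "\<And>x. x \<in> C ==> norm (b x) \<le> B1"
  using continuous_on_bounded_set[OF smooth_continuous_on[OF SC_smooth[OF b]] bounded_cylinder] by metis
 obtain B2 where B2: "B2 > 0" "\<And>x. x \<in> C ==> norm (grad b x) \<le> B2"
  using continuous_on_bounded_set[OF continuous_jacobian[OF SC_smooth[OF b]] bounded_cylinder] by metis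
 have M1: "sq_int MC (\<lambda>x. grad b x *v f x)" "nrm MC (\<lambda>x. grad b x *v f x) \<le> B2 * nrm MC f"
  if f: "sq_int MC f" for f
 proof -
  have le: "norm (grad b x *v f x) \<le> B2 * norm (f x)" if "x \<in> space MC" for x
   using that mult_right_mono[OF B2(2) norm_ge_zero[of "f x"], of x]
   by (intro order_trans[OF norm_matrix_vector_le]) simp
  note * = nrm_le_bound[OF f borel_measurable_matrix_vector[OF sq_int_measurable[OF sb(2)] sq_int_measurable[OF f]] le
    less_imp_le[OF B2(1)]]
  show "sq_int MC (\<lambda>x. grad b x *v f x)" by (rule *(1))
  show "nrm MC (\<lambda>x. grad b x *v f x) \<le> B2 * nrm MC f" by (rule *(2))
 qed
 have M2: "sq_int MC (\<lambda>x. outer (b x) (f x))" "nrm MC (\<lambda>x. outer (b x) (f x)) \<le> B1 * nrm MC f"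
  if f: "sq_int MC f" for f
 proof -
  have le: "norm (outer (b x) (f x)) \<le> B1 * norm (f x)" if "x \<in> space MC" for x
   using that mult_right_mono[OF B1(2) norm_ge_zero[of "f x"], of x] by (simp add: norm_outer)
  note * = nrm_le_bound[OF f borel_measurable_outer[OF sq_int_measurable[OF sb(1)] sq_int_measurable[OF f]] le
    less_imp_le[OF B1(1)]]
  show "sq_int MC (\<lambda>x. outer (b x) (f x))" by (rule *(1))
  show "nrm MC (\<lambda>x. outer (b x) (f x)) \<le> B1 * nrm MC f" by (rule *(2))
 qed
 have l1: "(\<lambda>n. nrm MC (\<lambda>x. grad b x *v \<phi> n x - grad b x *v a x)) ----> 0"
 proof (rule tendsto_zero_squeeze[OF _ nrm_nonneg])
  show "(\<lambda>n. B2 * dst MC (\<phi> n) a) ----> 0"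
   using tendsto_mult[OF tendsto_const[of B2] \<phi>(2)] by simp
  show "nrm MC (\<lambda>x. grad b x *v \<phi> n x - grad b x *v a x) \<le> B2 * dst MC (\<phi> n) a" for n
   using M1(2)[OF sq_int_diff[OF s\<phi>(1) sa(1)], of n] by (simp add: matrix_vector_mult_diff_distrib)
 qed
 have l2: "(\<lambda>n. nrm MC (\<lambda>x. outer (b x) (\<phi> n x) - outer (b x) (a x))) ----> 0"
 proof (rule tendsto_zero_squeeze[OF _ nrm_nonneg])
  show "(\<lambda>n. B1 * dst MC (\<phi> n) a) ----> 0"
   using tendsto_mult[OF tendsto_const[of B1] \<phi>(2)] by simp
  show "nrm MC (\<lambda>x. outer (b x) (\<phi> n x) - outer (b x) (a x)) \<le> B1 * dst MC (\<phi> n) a" for n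
   using M2(2)[OF sq_int_diff[OF s\<phi>(1) sa(1)], of n] by (simp add: outer_diff_right)
 qed
 have t1: "(\<lambda>n. ip MC (\<lambda>x. grad b x *v \<phi> n x) (\<theta> n)) ----> ip MC (\<lambda>x. grad b x *v a x) c"
  by (rule ip_tendsto[OF M1(1)[OF s\<phi>(1)] M1(1)[OF sa(1)] l1 s\<theta>(1) sc(1) \<theta>(2)])
 have t2: "(\<lambda>n. ip MC (grad (\<theta> n)) (\<lambda>x. outer (b x) (\<phi> n x))) ----> ip MC Cc (\<lambda>x. outer (b x) (a x))"
  by (rule ip_tendsto[OF s\<theta>(2) sc(2) \<theta>(3) M2(1)[OF s\<phi>(1)] M2(1)[OF sa(1)] l2])
 have "ip MC (\<lambda>x. grad b x *v \<phi> n x) (\<theta> n) + ip MC (grad (\<theta> n)) (\<lambda>x. outer (b x) (\<phi> n x)) = 0" for n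
  using trilinear_smooth[OF \<phi>(1) b \<theta>(1), of n n] unfolding inner_outer .
 then have "(\<lambda>n::nat. 0) ----> ip MC (\<lambda>x. grad b x *v a x) c + ip MC Cc (\<lambda>x. outer (b x) (a x))"
  using tendsto_add[OF t1 t2] by simp
 then have "ip MC (\<lambda>x. grad b x *v a x) c + ip MC Cc (\<lambda>x. outer (b x) (a x)) = 0"
  by (simp add: LIMSEQ_const_iff)
 then show ?thesis by (simp add: inner_outer)
qed

text \<open>Now the middle field is rough as well, but independent of x_3. The first term is bounded
  by the norm of its gradient times the sum of the L^2 norms of \<open>vsq c\<close> and
  \<open>vsq a\<close>; for the second, Ladyzhenskaya's inequality in the plane is applied to
  \<phi>_n - \<beta>. Both bounds allow the limit.\<close>

lemma trilinear_closure:
 assumes a: "grad_closure C SC a A" and c: "grad_closure C SC c Cc" and b: "grad_closure D SD \<beta> B"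
 shows "(LINT x|MC. lift_mat (B (horiz x)) \<bullet> outer (c x) (a x)) + (LINT x|MC. Cc x \<bullet> outer (\<beta> (horiz x)) (a x)) = 0"
proof -
 obtain \<phi> where \<phi>: "\<And>n::nat. \<phi> n \<in> SD" "(\<lambda>n. dst MD (\<phi> n) \<beta>) ----> 0"
  "(\<lambda>n. dst MD (grad (\<phi> n)) B) ----> 0" by (rule grad_closureE[OF b]) (rule that)
 note sa = grad_closureD[OF a] and sc = grad_closureD[OF c] and sb = grad_closureD[OF b]
 note s\<phi> = SD_sq_int[OF \<phi>(1)]
 note la = ladyzhenskaya[OF a] and lc = ladyzhenskaya[OF c]
 define X where "X n = (LINT x|MC. lift_mat (grad (\<phi> n) (horiz x)) \<bullet> outer (c x) (a x))" for n
 define Y where "Y n = (LINT x|MC. Cc x \<bullet> outer (\<phi> n (horiz x)) (a x))" for n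
 have XY: "X n + Y n = 0" for n
  using trilinear_closure_smooth[OF a c SD_lift[OF \<phi>(1)], of n]
  unfolding jacobian_lift[OF SD_smooth[OF \<phi>(1)]] X_def Y_def .
 have dcl: "grad_closure D SD (\<lambda>x. \<phi> n x - \<beta> x) (\<lambda>x. grad (\<phi> n) x - B x)" for n
  by (rule grad_closure_diff[OF grad_closure_smooth[OF \<phi>(1) SD_smooth[OF \<phi>(1)] D(2) lmeasurable_D] b D(2) lmeasurable_D SD_smooth SD_diff])
 have tX: "(\<lambda>n. X n - (LINT x|MC. lift_mat (B (horiz x)) \<bullet> outer (c x) (a x))) ----> 0"
 proof (rule tendsto_rabs_zero_cancel, rule tendsto_zero_squeeze[OF _ abs_ge_zero])
  let ?b = "nrm MD (vsq c) + nrm MD (vsq a)"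
  show "(\<lambda>n. dst MD (grad (\<phi> n)) B * ?b) ----> 0"
   using tendsto_mult[OF \<phi>(3) tendsto_const[of ?b]] by simp
  fix n
  have "X n - (LINT x|MC. lift_mat (B (horiz x)) \<bullet> outer (c x) (a x)) =
    (LINT x|MC. lift_mat (grad (\<phi> n) (horiz x) - B (horiz x)) \<bullet> outer (c x) (a x))"
   unfolding X_def lift_mat_diff[symmetric] inner_diff_left
   by (rule Bochner_Integration.integral_diff[symmetric])
     (rule vsq_mult2(1)[OF sc(1) lc(1) sa(1) la(1) s\<phi>(2)] vsq_mult2(1)[OF sc(1) lc(1) sa(1) la(1) sb(2)])+
  then show "\<bar>X n - (LINT x|MC. lift_mat (B (horiz x)) \<bullet> outer (c x) (a x))\<bar> \<le>
    dst MD (grad (\<phi> n)) B * ?b"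
   using vsq_mult2(2)[OF sc(1) lc(1) sa(1) la(1) sq_int_diff[OF s\<phi>(2) sb(2)], of n] by simp
 qed
 have tY: "(\<lambda>n. Y n - (LINT x|MC. Cc x \<bullet> outer (\<beta> (horiz x)) (a x))) ----> 0"
 proof (rule tendsto_rabs_zero_cancel, rule tendsto_zero_squeeze[OF _ abs_ge_zero])
  let ?e = "\<lambda>n. sqrt (2 * (dst MD (\<phi> n) \<beta>)\<^sup>2 * (dst MD (grad (\<phi> n)) B)\<^sup>2)"
  have "?e ----> sqrt (2 * 0\<^sup>2 * 0\<^sup>2)"
   by (intro tendsto_real_sqrt tendsto_mult tendsto_power tendsto_const \<phi>)
  then have "(\<lambda>n. nrm MC Cc * sqrt (?e n * nrm MD (vsq a))) ----> nrm MC Cc * sqrt (0 * nrm MD (vsq a))"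
   by (intro tendsto_real_sqrt tendsto_mult tendsto_const) simp
  then show "(\<lambda>n. nrm MC Cc * sqrt (?e n * nrm MD (vsq a))) ----> 0" by simp
  fix n
  note o1 = outer_sq_int(1)[OF sa(1) la(1) sq_int_measurable[OF s\<phi>(1)]
    ladyzhenskaya_D(1)[OF grad_closure_smooth[OF \<phi>(1) SD_smooth[OF \<phi>(1)] D(2) lmeasurable_D]], of n]
  note o2 = outer_sq_int(1)[OF sa(1) la(1) sq_int_measurable[OF sb(1)] ladyzhenskaya_D(1)[OF b]]
  note o3 = outer_sq_int[OF sa(1) la(1) sq_int_measurable[OF sq_int_diff[OF s\<phi>(1) sb(1)]] ladyzhenskaya_D(1)[OF dcl], of n]
  have "Y n - (LINT x|MC. Cc x \<bullet> outer (\<beta> (horiz x)) (a x)) =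
    ip MC Cc (\<lambda>x. outer (\<phi> n (horiz x) - \<beta> (horiz x)) (a x))"
   unfolding Y_def outer_diff_left inner_diff_right
   by (rule Bochner_Integration.integral_diff[symmetric]) (rule sq_int_inner[OF sc(2) o1] sq_int_inner[OF sc(2) o2])+
  then have "\<bar>Y n - (LINT x|MC. Cc x \<bullet> outer (\<beta> (horiz x)) (a x))\<bar> \<le>
    nrm MC Cc * nrm MC (\<lambda>x. outer (\<phi> n (horiz x) - \<beta> (horiz x)) (a x))"
   using CS_inner[OF sc(2) o3(1)] by simp
  also have "\<dots> \<le> nrm MC Cc * sqrt (?e n * nrm MD (vsq a))"
  proof (intro mult_left_mono real_le_rsqrt nrm_nonneg)
   have "nrm MD (\<lambda>y. (norm (\<phi> n y - \<beta> y))\<^sup>2) \<le> ?e n"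
    by (rule real_le_rsqrt) (rule ladyzhenskaya_D(2)[OF dcl])
   then show "(nrm MC (\<lambda>x. outer (\<phi> n (horiz x) - \<beta> (horiz x)) (a x)))\<^sup>2 \<le> ?e n * nrm MD (vsq a)"
    by (intro order_trans[OF o3(2)] mult_right_mono nrm_nonneg)
  qed
  finally show "\<bar>Y n - (LINT x|MC. Cc x \<bullet> outer (\<beta> (horiz x)) (a x))\<bar> \<le> nrm MC Cc * sqrt (?e n * nrm MD (vsq a))" .
 qed
 have "(\<lambda>n. (X n - (LINT x|MC. lift_mat (B (horiz x)) \<bullet> outer (c x) (a x))) +
   (Y n - (LINT x|MC. Cc x \<bullet> outer (\<beta> (horiz x)) (a x)))) ----> 0 + 0"
  by (rule tendsto_add[OF tX tY])
 moreover have "(X n - p) + (Y n - q) = - (p + q)" for n p q using XY[of n] by linarith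
 ultimately show ?thesis by (simp add: LIMSEQ_const_iff)
qed

text \<open>The vertical average of \<open>f \<otimes> f\<close>. Paired with gradients of fields independent of \<open>x\<^sub>3\<close> it
 agrees with \<open>f \<otimes> f\<close>, but unlike \<open>f \<otimes> f\<close> it is square integrable, by Ladyzhenskaya's inequality.\<close>

definition flux :: "(real^3 => real^3) => real^3 => real^3^3" where
 "flux f x = (\<chi> i j. vert L (\<lambda>x. f x $ i * f x $ j) (horiz x) / L)"

lemma flux_lift: "flux (lift u) x = outer (u (horiz x)) (u (horiz x))"
proof -
 have "vert L (\<lambda>x. u (horiz x) $ i * u (horiz x) $ j) y = L * (u y $ i * u y $ j)" for i j y
  using vert_lift[of "\<lambda>y. u y $ i * u y $ j" y] by simp
 then show ?thesis using L by (simp add: flux_def outer_def vec_eq_iff)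
qed

lemma nth_mult_integrable:
 fixes f :: "real^3 => real^3"
 assumes "sq_int MC f"
 shows "integrable MC (\<lambda>x. f x $ i * f x $ j)"
 using sq_int_inner[OF sq_int_nth[OF assms, of i] sq_int_nth[OF assms, of j]] by simp

text \<open>The factor 9 counts the matrix entries, each bounded by \<open>vsq f y / L\<close>;
  lifting multiplies the norm by sqrt L. A crude constant is enough, as the bound serves
  integrability in time only.\<close>

lemma flux_sq_int:
 assumes f: "sq_int MC f" "sq_int MD (vsq f)"
 shows "sq_int MC (flux f)" "nrm MC (flux f) \<le> 9 / sqrt L * nrm MD (vsq f)"
proof -
 define R where "R y = (\<chi> i j. vert L (\<lambda>x. f x $ i * f x $ j) y / L)" for y
 note i = nth_mult_integrable[OF f(1)]
 have Rm: "R \<in> borel_measurable MD"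
 proof -
  have "R = (\<lambda>y. \<Sum>i\<in>UNIV. \<Sum>j\<in>UNIV. (vert L (\<lambda>x. f x $ i * f x $ j) y / L) *\<^sub>R axis i (axis j 1))"
   by (rule ext) (simp add: R_def vec_eq_iff axis_def sum_3 forall_3)
  then show ?thesis
   using borel_measurable_integrable[OF vert_fubini(2)[OF i]]
   by (simp only:) (intro borel_measurable_sum borel_measurable_scaleR borel_measurable_divide borel_measurable_const)
 qed
 have ent: "AE y in MD. norm (R y) \<le> 9 / L * norm (vsq f y)"
  using vert_fubini(1)[OF sq_int_integrable[OF f(1)]]
 proof eventually_elim
  case (elim y)
  have e: "\<bar>vert L (\<lambda>x. f x $ i * f x $ j) y\<bar> \<le> vsq f y" for i j
  proof -
   have "\<bar>vert L (\<lambda>x. f x $ i * f x $ j) y\<bar> \<le> (LINT z|MI. \<bar>f (emb y z) $ i * f (emb y z) $ j\<bar>)"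
    unfolding vert_def by (rule integral_abs_bound)
   also have "\<dots> \<le> vsq f y"
    unfolding vert_def
   proof (rule integral_mono'[OF elim])
    fix z
    have "\<bar>f (emb y z) $ i\<bar> \<le> norm (f (emb y z))" "\<bar>f (emb y z) $ j\<bar> \<le> norm (f (emb y z))"
     using component_le_norm_cart by auto
    then show "\<bar>f (emb y z) $ i * f (emb y z) $ j\<bar> \<le> (norm (f (emb y z)))\<^sup>2"
     unfolding abs_mult power2_eq_square by (intro mult_mono) auto
   qed simp
   finally show ?thesis .
  qed
  have "norm (R y) \<le> (\<Sum>i\<in>UNIV. \<Sum>j\<in>UNIV. \<bar>R y $ i $ j\<bar>)"
  proof -
   have "norm (R y) \<le> (\<Sum>i\<in>UNIV. norm (R y $ i))"
    unfolding norm_vec_def by (rule L2_set_le_sum) simp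
   also have "\<dots> \<le> (\<Sum>i\<in>UNIV. \<Sum>j\<in>UNIV. \<bar>R y $ i $ j\<bar>)"
    by (intro sum_mono norm_le_l1_cart)
   finally show ?thesis .
  qed
  also have "\<dots> \<le> (\<Sum>i\<in>(UNIV::3 set). \<Sum>j\<in>(UNIV::3 set). vsq f y / L)"
   by (intro sum_mono) (use e L in \<open>simp add: R_def divide_right_mono\<close>)
  also have "\<dots> = 9 / L * vsq f y" by simp
  also have "\<dots> = 9 / L * norm (vsq f y)" using vert_nonneg[of "\<lambda>x. (norm (f x))\<^sup>2" y] by simp
  finally show ?case .
 qed
 have Rs: "sq_int MD R" by (rule sq_int_bound[OF f(2) Rm ent])
 have fl: "flux f = (lift R)" by (rule ext) (simp add: flux_def R_def)
 show "sq_int MC (flux f)" unfolding fl by (rule lift_sq_int(1)[OF Rs])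
 have "(nrm MD R)\<^sup>2 \<le> (LINT y|MD. (9 / L)\<^sup>2 * (vsq f y)\<^sup>2)"
  unfolding nrm_sq
 proof (rule integral_mono_AE)
  show "AE y in MD. (norm (R y))\<^sup>2 \<le> (9 / L)\<^sup>2 * (vsq f y)\<^sup>2"
   using ent
  proof eventually_elim
   case (elim y)
   from power_mono[OF this norm_ge_zero, of 2] show ?case
    by (simp only: power_mult_distrib real_norm_def power2_abs)
  qed
  show "integrable MD (\<lambda>y. (norm (R y))\<^sup>2)" by (rule sq_int_integrable[OF Rs])
  show "integrable MD (\<lambda>y. (9 / L)\<^sup>2 * (vsq f y)\<^sup>2)" using sq_int_integrable[OF f(2)] by simp
 qed
 also have "\<dots> = (9 / L)\<^sup>2 * (nrm MD (vsq f))\<^sup>2" by (simp add: nrm_sq)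
 finally have "(nrm MC (flux f))\<^sup>2 \<le> L * ((9 / L)\<^sup>2 * (nrm MD (vsq f))\<^sup>2)"
  unfolding fl lift_sq_int(2)[OF Rs] using L by (simp add: mult_left_mono)
 also have "\<dots> = (9 / sqrt L * nrm MD (vsq f))\<^sup>2"
  using L by (simp add: power_mult_distrib power_divide power2_eq_square[of L])
 finally show "nrm MC (flux f) \<le> 9 / sqrt L * nrm MD (vsq f)"
  by (rule power2_le_imp_le) (use L in \<open>simp add: nrm_nonneg\<close>)
qed

text \<open>By Fubini a matrix independent of x_3 can be taken out of the vertical integral. The
  nonlinear term of the equation, tested with lifted fields, is therefore unchanged when f \<otimes>
  f is replaced by its vertical mean.\<close>

lemma flux_ip_lift:
 assumes f: "sq_int MC f" "sq_int MD (vsq f)" and B: "sq_int MD B"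
 shows "ip MC (flux f) (\<lambda>x. lift_mat (B (horiz x))) = (LINT x|MC. lift_mat (B (horiz x)) \<bullet> outer (f x) (f x))"
proof -
 define R :: "real^2 => real^3^3" where "R y = (\<chi> i j. vert L (\<lambda>x. f x $ i * f x $ j) y / L)" for y
 note i = nth_mult_integrable[OF f(1)]
 have fl: "flux f x \<bullet> lift_mat (B (horiz x)) = (\<lambda>y. R y \<bullet> lift_mat (B y)) (horiz x)" for x
  by (simp add: flux_def R_def)
 have I: "integrable MC (\<lambda>x. flux f x \<bullet> lift_mat (B (horiz x)))"
  by (rule sq_int_inner[OF flux_sq_int(1)[OF f] lift_mat_lift(1)[OF B]])
 have "ip MC (flux f) (\<lambda>x. lift_mat (B (horiz x))) = (LINT y|MD. vert L (\<lambda>x. flux f x \<bullet> lift_mat (B (horiz x))) y)"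
  by (rule vert_fubini(3)[OF I])
 also have "\<dots> = (LINT y|MD. L * (R y \<bullet> lift_mat (B y)))"
 proof -
  have "vert L (\<lambda>x. flux f x \<bullet> lift_mat (B (horiz x))) y = L * (R y \<bullet> lift_mat (B y))" for y
   unfolding fl using vert_lift[of "\<lambda>y. R y \<bullet> lift_mat (B y)" y] by simp
  then show ?thesis by simp
 qed
 also have "\<dots> = (LINT y|MD. vert L (\<lambda>x. lift_mat (B (horiz x)) \<bullet> outer (f x) (f x)) y)"
 proof (rule integral_cong_AE)
  have "(\<lambda>y. vert L (\<lambda>x. flux f x \<bullet> lift_mat (B (horiz x))) y) \<in> borel_measurable MD"
   using vert_fubini(2)[OF I] by (rule borel_measurable_integrable)
  then show "(\<lambda>y. L * (R y \<bullet> lift_mat (B y))) \<in> borel_measurable MD"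
   unfolding fl using vert_lift[of "\<lambda>y. R y \<bullet> lift_mat (B y)"] by simp
  show "vert L (\<lambda>x. lift_mat (B (horiz x)) \<bullet> outer (f x) (f x)) \<in> borel_measurable MD"
   using vert_fubini(2)[OF vsq_mult2(1)[OF f f B]] by (rule borel_measurable_integrable)
  have "AE y in MD. \<forall>i\<in>UNIV. \<forall>j\<in>UNIV. integrable MI (\<lambda>z. f (emb y z) $ i * f (emb y z) $ j)"
   using vert_fubini(1)[OF i] by (intro AE_finite_allI) simp_all
  then show "AE y in MD. L * (R y \<bullet> lift_mat (B y)) = vert L (\<lambda>x. lift_mat (B (horiz x)) \<bullet> outer (f x) (f x)) y"
  proof eventually_elim
   case (elim y)
   then have ij: "integrable MI (\<lambda>z. f (emb y z) $ i * f (emb y z) $ j)" for i j by simp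
   have "vert L (\<lambda>x. lift_mat (B (horiz x)) \<bullet> outer (f x) (f x)) y =
     (LINT z|MI. (\<Sum>i\<in>UNIV. \<Sum>j\<in>UNIV. lift_mat (B y) $ i $ j * (f (emb y z) $ i * f (emb y z) $ j)))"
    unfolding vert_def by (simp add: inner_vec_def outer_def)
   also have "\<dots> = (\<Sum>i\<in>UNIV. \<Sum>j\<in>UNIV. lift_mat (B y) $ i $ j * (LINT z|MI. f (emb y z) $ i * f (emb y z) $ j))"
    by (simp add: Bochner_Integration.integral_sum ij)
   also have "\<dots> = L * (R y \<bullet> lift_mat (B y))"
    using L by (simp add: R_def inner_vec_def vert_def sum_distrib_left mult.commute)
   finally show ?case by simp
  qed
 qed
 also have "\<dots> = (LINT x|MC. lift_mat (B (horiz x)) \<bullet> outer (f x) (f x))"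
  by (rule vert_fubini(3)[symmetric, OF vsq_mult2(1)[OF f f B]])
 finally show ?thesis .
qed

text \<open>Write b(a, f, c) for the integral of ((a . grad) f) . c. Antisymmetry gives b(v, u, v) =
  - b(v, v, u) and b(v, u, u) = b(u, u, u) = 0. What remains of the two flux terms is - b(w, w, u)
  with w = v - u, so the derivative falls on \<open>w\<close>. The bound is Cauchy-Schwarz followed
  by Ladyzhenskaya for \<open>w\<close> on the cylinder and for \<open>u\<close> in the plane, each
  with a factor sqrt 2.\<close>

lemma nonlinear_cancellation:
 assumes v: "grad_closure C SC v Gv" and u: "grad_closure D SD u Gu"
 defines "U \<equiv> \<lambda>x. u (horiz x)" and "GU \<equiv> \<lambda>x. lift_mat (Gu (horiz x))"
 shows "ip MC (flux v) GU + ip MC (flux U) Gv = - (LINT x|MC. (Gv x - GU x) \<bullet> outer (U x) (v x - U x))" (is ?eq)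
  and "\<bar>ip MC (flux v) GU + ip MC (flux U) Gv\<bar> \<le> dst MC Gv GU *
   sqrt (2 * (dst MC v U * dst MC Gv GU) * (nrm MD u * nrm MD Gu))" (is ?le)
proof -
 have U: "grad_closure C SC U GU" unfolding U_def GU_def by (rule grad_closure_lift[OF u])
 have w: "grad_closure C SC (\<lambda>x. v x - U x) (\<lambda>x. Gv x - GU x)"
  by (rule grad_closure_diff[OF v U bounded_cylinder lmeasurable_cylinder SC_smooth SC_diff])
 note sv = grad_closureD[OF v] and sU = grad_closureD[OF U] and su = grad_closureD[OF u] and sw = grad_closureD[OF w]
 note lv = ladyzhenskaya[OF v] and lU = ladyzhenskaya[OF U] and lw = ladyzhenskaya[OF w] and lu = ladyzhenskaya_D[OF u]
 have o: "sq_int MC (\<lambda>x. outer (U x) (f x))" if "sq_int MC f" "sq_int MD (vsq f)" for f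
  unfolding U_def by (rule outer_sq_int(1)[OF that sq_int_measurable[OF su(1)] lu(1)])
 note ov = o[OF sv(1) lv(1)] and oU = o[OF sU(1) lU(1)] and ow = o[OF sw(1) lw(1)]
 have f1: "ip MC (flux v) GU = (LINT x|MC. GU x \<bullet> outer (v x) (v x))"
  unfolding GU_def by (rule flux_ip_lift[OF sv(1) lv(1) su(2)])
 have f2: "ip MC (flux U) Gv = ip MC Gv (\<lambda>x. outer (U x) (U x))"
  unfolding U_def flux_lift by (simp add: inner_commute)
 have t1: "(LINT x|MC. GU x \<bullet> outer (v x) (v x)) + ip MC Gv (\<lambda>x. outer (U x) (v x)) = 0"
  unfolding GU_def U_def by (rule trilinear_closure[OF v v u])
 have t2: "ip MC GU (\<lambda>x. outer (U x) (v x)) = 0"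
  using trilinear_closure[OF v U u] unfolding GU_def U_def by linarith
 have t3: "ip MC GU (\<lambda>x. outer (U x) (U x)) = 0"
  using trilinear_closure[OF U U u] unfolding GU_def U_def by linarith
 have "(LINT x|MC. (Gv x - GU x) \<bullet> outer (U x) (v x - U x)) =
   ip MC (\<lambda>x. Gv x - GU x) (\<lambda>x. outer (U x) (v x) - outer (U x) (U x))"
  by (simp add: outer_diff_right)
 also have "\<dots> = ip MC Gv (\<lambda>x. outer (U x) (v x)) - ip MC GU (\<lambda>x. outer (U x) (v x)) -
   (ip MC Gv (\<lambda>x. outer (U x) (U x)) - ip MC GU (\<lambda>x. outer (U x) (U x)))"
  by (simp only: ip_diff_right[OF ov oU sw(2)] ip_diff_left[OF sv(2) sU(2) ov] ip_diff_left[OF sv(2) sU(2) oU])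
 finally show eq: ?eq using f1 f2 t1 t2 t3 by linarith
 have "\<bar>ip MC (flux v) GU + ip MC (flux U) Gv\<bar> \<le> dst MC Gv GU * nrm MC (\<lambda>x. outer (U x) (v x - U x))"
  unfolding eq using CS_inner[OF sw(2) ow] by simp
 also have "\<dots> \<le> dst MC Gv GU *
   sqrt (2 * (dst MC v U * dst MC Gv GU) * (nrm MD u * nrm MD Gu))"
 proof (intro mult_left_mono real_le_rsqrt nrm_nonneg)
  have "nrm MD (vsq (\<lambda>x. v x - U x)) \<le> sqrt 2 * (dst MC v U * dst MC Gv GU)"
   by (rule power2_le_imp_le) (use lw(2) in \<open>simp_all add: power_mult_distrib nrm_nonneg\<close>)
  moreover have "nrm MD (\<lambda>y. (norm (u y))\<^sup>2) \<le> sqrt 2 * (nrm MD u * nrm MD Gu)"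
   by (rule power2_le_imp_le) (use lu(2) in \<open>simp_all add: power_mult_distrib nrm_nonneg\<close>)
  ultimately have "nrm MD (\<lambda>y. (norm (u y))\<^sup>2) * nrm MD (vsq (\<lambda>x. v x - U x)) \<le>
    (sqrt 2 * (nrm MD u * nrm MD Gu)) * (sqrt 2 * (dst MC v U * dst MC Gv GU))"
   by (intro mult_mono) (simp_all add: nrm_nonneg)
  also have "\<dots> = (sqrt 2 * sqrt 2) * (dst MC v U * dst MC Gv GU) * (nrm MD u * nrm MD Gu)"
   by (simp only: mult_ac)
  also have "\<dots> = 2 * (dst MC v U * dst MC Gv GU) * (nrm MD u * nrm MD Gu)"
   by simp
  finally show "(nrm MC (\<lambda>x. outer (U x) (v x - U x)))\<^sup>2 \<le>
    2 * (dst MC v U * dst MC Gv GU) * (nrm MD u * nrm MD Gu)"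
   using outer_sq_int(2)[OF sw(1) lw(1) sq_int_measurable[OF su(1)] lu(1)] unfolding U_def by linarith
 qed
 finally show ?le .
qed

end

section \<open>Weakly measurable curves\<close>

text \<open>The condition of \<open>bochner_meas\<close> for arbitrary measures and values, so that
  it also applies to gradients and fluxes.\<close>

definition wmeas :: "'t measure => 'a measure => ('t => 'a => 'b::euclidean_space) => bool" where
 "wmeas N M K \<longleftrightarrow> (\<forall>w. sq_int M w \<longrightarrow> (\<lambda>t. ip M (K t) w) \<in> borel_measurable N)"

lemma sq_int_abs:
 fixes f :: "'a => real"
 assumes "sq_int M f"
 shows "sq_int M (\<lambda>s. \<bar>f s\<bar>)" "nrm M (\<lambda>s. \<bar>f s\<bar>) = nrm M f"
 using sq_int_bound[OF assms measurable_compose[OF sq_int_measurable[OF assms] borel_measurable_norm], of 1]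
 by (simp_all add: nrm_def)

lemma wmeasD: "wmeas N M K ==> sq_int M w ==> (\<lambda>t. ip M (K t) w) \<in> borel_measurable N"
 by (simp add: wmeas_def)

lemma atom_int_measurable:
 fixes K :: "'t => 'a::euclidean_space => 'b::euclidean_space"
 assumes \<Omega>: "\<Omega> \<in> lmeasurable" and K: "wmeas N (lebesgue_on \<Omega>) K" "\<And>t. sq_int (lebesgue_on \<Omega>) (K t)"
 shows "(\<lambda>t. atom_int \<Omega> k S (K t)) \<in> borel_measurable N"
proof -
 have "(\<lambda>t. atom_int \<Omega> k S (K t) \<bullet> b) \<in> borel_measurable N" for b
 proof -
  let ?w = "\<lambda>x. indicator (atom k S) x *\<^sub>R b"
  have "sq_int (lebesgue_on \<Omega>) ?w"
  proof (rule sq_int_bounded[OF finite_measure_lebesgue_on[OF \<Omega>]])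
   show "?w \<in> borel_measurable (lebesgue_on \<Omega>)"
    by (intro borel_measurable_scaleR atom_measurable[OF \<Omega>] borel_measurable_const)
   show "norm (?w x) \<le> norm b" for x by (cases "x \<in> atom k S") simp_all
  qed
  from wmeasD[OF K(1) this] have "(\<lambda>t. \<integral>x. K t x \<bullet> ?w x \<partial>lebesgue_on \<Omega>) \<in> borel_measurable N" .
  moreover have "(LINT x|lebesgue_on \<Omega>. K t x \<bullet> ?w x) = atom_int \<Omega> k S (K t) \<bullet> b" for t
  proof -
   have "(LINT x|lebesgue_on \<Omega>. (indicator (atom k S) x *\<^sub>R K t x) \<bullet> b) = atom_int \<Omega> k S (K t) \<bullet> b"
    unfolding atom_int_def by (rule integral_inner_left) (rule atom_integrable[OF \<Omega> K(2)])
   then show ?thesis by simp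
  qed
  ultimately show ?thesis by simp
 qed
 then show ?thesis by (subst borel_measurable_euclidean_space) blast
qed

text \<open>The projection of \<open>K s\<close> pairs with \<open>Z t\<close> as a finite sum of
  products of measurable scalars in \<open>s\<close> and \<open>t\<close>, and the limit of the
  projections preserves measurability on the product. Weak measurability thus suffices even for
  expressions that are not linear in the curves, such as norms.\<close>

lemma ip_pair_measurable:
 fixes K :: "'t => 'a::euclidean_space => 'b::euclidean_space" and Z :: "'s => 'a => 'b"
 assumes \<Omega>: "\<Omega> \<in> lmeasurable" and K: "wmeas N (lebesgue_on \<Omega>) K" "\<And>t. sq_int (lebesgue_on \<Omega>) (K t)"
  and Z: "wmeas N' (lebesgue_on \<Omega>) Z" "\<And>t. sq_int (lebesgue_on \<Omega>) (Z t)"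
 shows "(\<lambda>p. ip (lebesgue_on \<Omega>) (K (fst p)) (Z (snd p))) \<in> borel_measurable (N \<Otimes>\<^sub>M N')"
proof (rule borel_measurable_LIMSEQ_real)
 note mK = measurable_compose[OF measurable_fst atom_int_measurable[OF \<Omega> K]]
 note mZ = measurable_compose[OF measurable_snd atom_int_measurable[OF \<Omega> Z]]
 show "(\<lambda>p. ip (lebesgue_on \<Omega>) (proj \<Omega> k (K (fst p))) (Z (snd p))) \<in> borel_measurable (N \<Otimes>\<^sub>M N')" for k
  unfolding ip_proj[OF \<Omega> Z(2)]
  by (intro borel_measurable_sum borel_measurable_divide borel_measurable_inner mK mZ borel_measurable_const)
 show "(\<lambda>k. ip (lebesgue_on \<Omega>) (proj \<Omega> k (K (fst p))) (Z (snd p))) ----> ip (lebesgue_on \<Omega>) (K (fst p)) (Z (snd p))" for p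
  by (rule ip_tendsto[OF sq_int_proj[OF \<Omega>] K(2) proj_tendsto[OF \<Omega> K(2)] Z(2) Z(2)]) (simp add: nrm_def)
qed

lemma ip_diag_measurable:
 fixes K Z :: "'t => 'a::euclidean_space => 'b::euclidean_space"
 assumes "\<Omega> \<in> lmeasurable" "wmeas N (lebesgue_on \<Omega>) K" "\<And>t. sq_int (lebesgue_on \<Omega>) (K t)"
  "wmeas N (lebesgue_on \<Omega>) Z" "\<And>t. sq_int (lebesgue_on \<Omega>) (Z t)"
 shows "(\<lambda>t. ip (lebesgue_on \<Omega>) (K t) (Z t)) \<in> borel_measurable N"
 using measurable_compose[OF measurable_Pair[OF measurable_ident_sets[OF refl] measurable_ident_sets[OF refl]]
   ip_pair_measurable[OF assms]] by simp

lemma nrm_measurable: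
 fixes K :: "'t => 'a::euclidean_space => 'b::euclidean_space"
 assumes "\<Omega> \<in> lmeasurable" "wmeas N (lebesgue_on \<Omega>) K" "\<And>t. sq_int (lebesgue_on \<Omega>) (K t)"
 shows "(\<lambda>t. nrm (lebesgue_on \<Omega>) (K t)) \<in> borel_measurable N"
proof -
 have "(\<lambda>t. sqrt (ip (lebesgue_on \<Omega>) (K t) (K t))) \<in> borel_measurable N"
  by (rule measurable_compose[OF ip_diag_measurable[OF assms(1,2,3,2,3)] borel_measurable_sqrt])
 then show ?thesis by (simp add: nrm_def power2_norm_eq_inner)
qed

lemma wmeas_diff:
 fixes K Z :: "'t => 'a => 'b::euclidean_space"
 assumes "wmeas N M K" "wmeas N M Z" "\<And>t. sq_int M (K t)" "\<And>t. sq_int M (Z t)"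
 shows "wmeas N M (\<lambda>t x. K t x - Z t x)"
 unfolding wmeas_def
proof (intro allI impI)
 fix w :: "'a => 'b" assume w: "sq_int M w"
 show "(\<lambda>t. ip M (\<lambda>x. K t x - Z t x) w) \<in> borel_measurable N"
  unfolding ip_diff_left[OF assms(3,4) w] by (intro borel_measurable_diff wmeasD[OF _ w] assms)
qed

lemma wmeas_scaleR:
 fixes K :: "'t => 'a => 'b::euclidean_space"
 assumes "wmeas N M K"
 shows "wmeas N M (\<lambda>t x. c *\<^sub>R K t x)"
 unfolding wmeas_def
proof (intro allI impI)
 fix w :: "'a => 'b" assume w: "sq_int M w"
 have "(\<lambda>t. c * ip M (K t) w) \<in> borel_measurable N"
  by (intro borel_measurable_times borel_measurable_const wmeasD[OF assms w])
 then show "(\<lambda>t. ip M (\<lambda>x. c *\<^sub>R K t x) w) \<in> borel_measurable N" by simp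
qed

lemma wmeas_proj:
 fixes K :: "'t => 'a::euclidean_space => 'b::euclidean_space"
 assumes "\<Omega> \<in> lmeasurable" "wmeas N (lebesgue_on \<Omega>) K" "\<And>t. sq_int (lebesgue_on \<Omega>) (K t)"
 shows "wmeas N (lebesgue_on \<Omega>) (\<lambda>t. proj \<Omega> k (K t))"
 unfolding wmeas_def
proof (intro allI impI)
 fix w :: "'a => 'b" assume "sq_int (lebesgue_on \<Omega>) w"
 then show "(\<lambda>t. ip (lebesgue_on \<Omega>) (proj \<Omega> k (K t)) w) \<in> borel_measurable N"
  unfolding ip_proj[OF assms(1) \<open>sq_int (lebesgue_on \<Omega>) w\<close>]
  by (intro borel_measurable_sum borel_measurable_divide borel_measurable_inner
    atom_int_measurable assms borel_measurable_const)
qed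

text \<open>Truncated multiples of the distance to the complement. The whole space is treated apart,
  because the distance to its empty complement is 0 by convention.\<close>

lemma open_indicator_continuous_approx:
 fixes V :: "'a::euclidean_space set"
 assumes "open V"
 obtains g :: "nat => 'a => real" where "\<And>n. continuous_on UNIV (g n)" "\<And>n x. \<bar>g n x\<bar> \<le> 1"
  "\<And>x. (\<lambda>n. g n x) ----> indicator V x"
proof (cases "V = UNIV")
 case True
 then show ?thesis using that[of "\<lambda>n x. 1"] by simp
next
 case False
 define g where "g n x = min 1 (real n * infdist x (- V))" for n x
 have "continuous_on UNIV (g n)" for n
  unfolding g_def[abs_def] by (intro continuous_intros)
 moreover have "\<bar>g n x\<bar> \<le> 1" for n x
  unfolding g_def using infdist_nonneg[of x "- V"] by (simp add: min_def)
 moreover have "(\<lambda>n. g n x) ----> indicator V x" for x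
 proof (cases "x \<in> V")
  case True
  have "- V \<noteq> {}" using False by auto
  then have "infdist x (- V) \<noteq> 0"
   using True assms by (metis ComplD closed_Compl in_closed_iff_infdist_zero)
  then have d: "infdist x (- V) > 0" using infdist_nonneg[of x "- V"] by linarith
  obtain k :: nat where k: "1 / infdist x (- V) \<le> real k" using real_arch_simple by blast
  have "g n x = 1" if "n \<ge> k" for n
  proof -
   have "1 / infdist x (- V) \<le> real n" using k that by linarith
   then show ?thesis using d by (simp add: g_def field_simps)
  qed
  then have "eventually (\<lambda>n. g n x = 1) sequentially" unfolding eventually_sequentially by blast
  then show ?thesis using True by (simp add: tendsto_eventually)
 next
  case False
  then have "infdist x (- V) = 0" by simp
  then show ?thesis using False by (simp add: g_def)
 qed
 ultimately show ?thesis by (rule that)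
qed

text \<open>The projections of \<beta> are finite combinations of indicators of atoms, hence of
  differences of indicators of open sets, and these are bounded limits of continuous
  functions.\<close>

lemma continuous_dense_L2:
 fixes \<beta> :: "'a::euclidean_space => real"
 assumes \<Omega>: "\<Omega> \<in> lmeasurable" "bounded \<Omega>" and \<beta>: "sq_int (lebesgue_on \<Omega>) \<beta>" and e: "e > 0"
 shows "\<exists>g. continuous_on UNIV g \<and> dst (lebesgue_on \<Omega>) g \<beta> < e"
proof -
 let ?M = "lebesgue_on \<Omega>"
 define P where "P f \<longleftrightarrow> sq_int ?M f \<and> (\<forall>e>0. \<exists>g. continuous_on UNIV g \<and> dst ?M g f < e)"
  for f :: "'a => real"
 have P_add: "P (\<lambda>x. f x + f' x)" if Pf: "P f" "P f'" for f f'
  unfolding P_def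
 proof (intro conjI allI impI)
  have s: "sq_int ?M f" "sq_int ?M f'" using Pf by (simp_all add: P_def)
  then show "sq_int ?M (\<lambda>x. f x + f' x)" by (rule sq_int_add)
  fix e :: real assume "e > 0"
  then have "e / 2 > 0" by simp
  then have ex: "\<exists>g. continuous_on UNIV g \<and> dst ?M g f < e / 2"
   "\<exists>g. continuous_on UNIV g \<and> dst ?M g f' < e / 2"
   using Pf unfolding P_def by blast+
  from ex obtain g g' where g: "continuous_on UNIV g" "dst ?M g f < e / 2"
   "continuous_on UNIV g'" "dst ?M g' f' < e / 2" by blast
  have "nrm ?M (\<lambda>x. (g x + g' x) - (f x + f' x)) \<le> dst ?M g f + dst ?M g' f'"
   using nrm_triangle[OF sq_int_diff[OF sq_int_continuous[OF g(1) \<Omega>(2,1)] s(1)] sq_int_diff[OF sq_int_continuous[OF g(3) \<Omega>(2,1)] s(2)]]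
   by (simp add: algebra_simps)
  then show "\<exists>h. continuous_on UNIV h \<and> nrm ?M (\<lambda>x. h x - (f x + f' x)) < e"
   using g by (intro exI[where x = "\<lambda>x. g x + g' x"]) (auto intro: continuous_on_add)
 qed
 have P_ind: "P (\<lambda>x. indicator V x * c)" if V: "open V" for V c
  unfolding P_def
 proof (intro conjI allI impI)
  have vm: "(\<lambda>x. indicator V x * c) \<in> borel_measurable ?M"
   by (intro borel_measurable_times borel_measurable_const measurable_restrict_space1 borel_measurable_indicator
     open_sets_lebesgue V)
  have vb: "norm (indicator V x * c) \<le> \<bar>c\<bar>" for x by (cases "x \<in> V") simp_all
  show "sq_int ?M (\<lambda>x. indicator V x * c)"
   by (rule sq_int_bounded[OF finite_measure_lebesgue_on[OF \<Omega>(1)] vm vb])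
  obtain g :: "nat => 'a => real" where g: "\<And>n. continuous_on UNIV (g n)" "\<And>n x. \<bar>g n x\<bar> \<le> 1"
   "\<And>x. (\<lambda>n. g n x) ----> indicator V x" by (rule open_indicator_continuous_approx[OF V]) (rule that)
  have gc: "continuous_on UNIV (\<lambda>x. g n x * c)" for n by (intro continuous_intros g)
  fix e :: real assume "e > 0"
  have "(\<lambda>n. nrm ?M (\<lambda>x. g n x * c - indicator V x * c)) ----> 0"
  proof (rule nrm_tendsto_bounded[OF finite_measure_lebesgue_on[OF \<Omega>(1)] borel_measurable_continuous_lebesgue_on[OF gc] vm _ _ vb])
   show "(\<lambda>n. g n x * c) ----> indicator V x * c" for x by (intro tendsto_intros g)
   show "norm (g n x * c) \<le> \<bar>c\<bar>" for n x
    using mult_right_mono[OF g(2)[of n x] abs_ge_zero[of c]] by (simp add: abs_mult)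
  qed
  from tendsto_zero_less[OF this \<open>e > 0\<close>] obtain n where "nrm ?M (\<lambda>x. g n x * c - indicator V x * c) < e" by blast
  then show "\<exists>h. continuous_on UNIV h \<and> nrm ?M (\<lambda>x. h x - indicator V x * c) < e"
   using gc by (intro exI[where x = "\<lambda>x. g n x * c"]) simp
 qed
 have P_atom: "P (\<lambda>x. indicator (atom k S) x * c)" for k S c
 proof -
  define V :: "'a set" where "V = (\<Inter>i\<in>{..<k} \<inter> S. bseq i)"
  define W where "W = (\<Union>i\<in>{..<k} - S. bseq i) \<inter> V"
  have oV: "open V" unfolding V_def by (intro open_INT ballI open_bseq) simp
  have oW: "open W" unfolding W_def by (intro open_Int open_UN ballI open_bseq oV)
  have "indicator (atom k S) x * c = indicator V x * c + indicator W x * (- c)" for x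
  proof -
   have "x \<in> atom k S \<longleftrightarrow> x \<in> V \<and> x \<notin> W" "x \<in> W \<longrightarrow> x \<in> V"
    unfolding atom_eq V_def W_def by blast+
   then show ?thesis unfolding indicator_def by (cases "x \<in> V"; cases "x \<in> W") simp_all
  qed
  then show ?thesis using P_add[OF P_ind[OF oV, of c] P_ind[OF oW, of "- c"]] by simp
 qed
 have P_sum: "P (\<lambda>x. \<Sum>S\<in>I. indicator (atom k S) x * c S)" if "finite I" for I k c
  using that
 proof (induction I rule: finite_induct)
  case empty
  show ?case using P_ind[OF open_empty, of 0] by simp
 next
  case (insert S I)
  show ?case
   unfolding sum.insert[OF insert.hyps] by (rule P_add[OF P_atom insert.IH])
 qed
 have Pp: "P (proj \<Omega> k \<beta>)" for k
  using P_sum[of "Pow {..<k}" k "\<lambda>S. (1 / atom_measure \<Omega> k S) *\<^sub>R atom_int \<Omega> k S \<beta>"]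
  unfolding proj_def[abs_def] by simp
 have "e / 2 > 0" using e by simp
 from tendsto_zero_less[OF proj_tendsto[OF \<Omega>(1) \<beta>] this]
 obtain k where k: "dst ?M (proj \<Omega> k \<beta>) \<beta> < e / 2" by blast
 obtain g where g: "continuous_on UNIV g" "dst ?M g (proj \<Omega> k \<beta>) < e / 2"
  using Pp[of k] \<open>e / 2 > 0\<close> unfolding P_def by blast
 have "dst ?M g \<beta> \<le> dst ?M g (proj \<Omega> k \<beta>) + dst ?M (proj \<Omega> k \<beta>) \<beta>"
  by (rule nrm_triangle3[OF sq_int_continuous[OF g(1) \<Omega>(2,1)] sq_int_proj[OF \<Omega>(1)] \<beta>])
 then show ?thesis using g k by (intro exI[of _ g]) linarith
qed

section \<open>Steklov averages and the Lions--Magenes formula\<close>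

text \<open>Averaging over the strip \<open>s < \<tau> < s + h\<close> lets each equation be tested with the other solution at
 a fixed different time, so that no product of two curves is ever differentiated.\<close>

locale time_strip =
 fixes T R :: real
 assumes T: "0 < T" "T < R"
begin

abbreviation "N \<equiv> lebesgue_on {0<..<R}"
abbreviation "N2 \<equiv> N \<Otimes>\<^sub>M N"

text \<open>Only the first time is cut off at \<open>T\<close>; the second may exceed it by up to
  \<open>h\<close>. This is why the ambient interval extends to \<open>R > T\<close> and why
  \<open>h < R - T\<close> is required below.\<close>

definition strip :: "real => (real \<times> real) set" where
 "strip h = {p. fst p < T \<and> fst p < snd p \<and> snd p < fst p + h}"

abbreviation "S h p \<equiv> (1 / h) * (LINT x|N2. indicator (strip h) x * p x)"

lemma lm: "{0<..<R} \<in> lmeasurable" by (rule lmeasurable_open) auto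

lemma finite_N: "finite_measure N" by (rule finite_measure_lebesgue_on[OF lm])

lemma pair_N: "pair_sigma_finite N N"
proof -
 interpret finite_measure N by (rule finite_N)
 show ?thesis by (rule pair_sigma_finite.intro; unfold_locales)
qed

lemma borel_N: "f \<in> borel_measurable borel ==> f \<in> borel_measurable N" for f :: "real => real"
 by (rule measurable_restrict_space1[OF measurable_completion]) simp

lemma strip_meas: "(\<lambda>p. indicator (strip h) p :: real) \<in> borel_measurable N2"
proof -
 have f: "(\<lambda>p. fst p) \<in> borel_measurable N2" and s: "(\<lambda>p. snd p) \<in> borel_measurable N2"
  using measurable_compose[OF measurable_fst borel_N, of "\<lambda>x. x"]
   measurable_compose[OF measurable_snd borel_N, of "\<lambda>x. x"] by auto
 have "{p \<in> space N2. fst p < T \<and> fst p < snd p \<and> snd p < fst p + h} \<in> sets N2"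
  by (intro sets.sets_Collect borel_measurable_less borel_measurable_add f s borel_measurable_const)
 moreover have "{p \<in> space N2. fst p < T \<and> fst p < snd p \<and> snd p < fst p + h} = strip h \<inter> space N2"
  by (auto simp: strip_def)
 ultimately have "strip h \<inter> space N2 \<in> sets N2" by simp
 then show ?thesis by (simp add: borel_measurable_indicator_iff)
qed

lemma emeasure_N_interval: "emeasure N {z \<in> space N. c < z \<and> z < c + h} \<le> ennreal h" if "h \<ge> 0"
proof -
 have sp: "space N = {0<..<R}" by simp
 have e: "{z \<in> space N. c < z \<and> z < c + h} = {0<..<R} \<inter> {c<..<c+h}"
  unfolding sp by (rule set_eqI) (simp only: mem_Collect_eq Int_iff greaterThanLessThan_iff)
 have "emeasure N {z \<in> space N. c < z \<and> z < c + h} = emeasure lebesgue ({0<..<R} \<inter> {c<..<c+h})"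
  unfolding e by (rule emeasure_restrict_space) (simp, rule Int_lower1)
 also have "\<dots> \<le> emeasure lebesgue {c<..<c+h}" by (rule emeasure_mono[OF Int_lower2]) simp
 also have "\<dots> = ennreal h" using that by simp
 finally show ?thesis .
qed

text \<open>Sections of the strip in either direction have length at most \<open>h\<close>, so
  Tonelli's theorem yields the factor \<open>h\<close>.\<close>

lemma strip_nrm:
 fixes a :: "real => real"
 assumes a: "sq_int N a" and h: "h > 0"
 shows "sq_int N2 (\<lambda>p. indicator (strip h) p * a (fst p))"
  "(nrm N2 (\<lambda>p. indicator (strip h) p * a (fst p)))\<^sup>2 \<le> h * (nrm N a)\<^sup>2"
  "sq_int N2 (\<lambda>p. indicator (strip h) p * a (snd p))"
  "(nrm N2 (\<lambda>p. indicator (strip h) p * a (snd p)))\<^sup>2 \<le> h * (nrm N a)\<^sup>2"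
proof -
 interpret pair_sigma_finite N N by (rule pair_N)
 note am = sq_int_measurable[OF a]
 have ai: "(\<integral>\<^sup>+s. ennreal ((a s)\<^sup>2) \<partial>N) = ennreal ((nrm N a)\<^sup>2)"
  using sq_int_integrable[OF a] by (simp add: nrm_sq nn_integral_eq_integral)
 have fm: "(\<lambda>p. indicator (strip h) p * a (fst p)) \<in> borel_measurable N2"
  and sm: "(\<lambda>p. indicator (strip h) p * a (snd p)) \<in> borel_measurable N2"
  by (rule borel_measurable_times[OF strip_meas measurable_compose[OF measurable_fst am]],
    rule borel_measurable_times[OF strip_meas measurable_compose[OF measurable_snd am]])
 have fst: "(\<integral>\<^sup>+p. ennreal ((indicator (strip h) p * a (fst p))\<^sup>2) \<partial>N2) \<le> ennreal (h * (nrm N a)\<^sup>2)"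
 proof -
  have "(\<integral>\<^sup>+p. ennreal ((indicator (strip h) p * a (fst p))\<^sup>2) \<partial>N2) =
    (\<integral>\<^sup>+s. \<integral>\<^sup>+\<tau>. ennreal ((indicator (strip h) (s, \<tau>) * a s)\<^sup>2) \<partial>N \<partial>N)"
   using M1.nn_integral_fst[of "\<lambda>p. ennreal ((indicator (strip h) p * a (fst p))\<^sup>2)" N] fm by simp
  also have "\<dots> \<le> (\<integral>\<^sup>+s. ennreal h * ennreal ((a s)\<^sup>2) \<partial>N)"
  proof (rule nn_integral_mono)
   fix s
   have "(\<integral>\<^sup>+\<tau>. ennreal ((indicator (strip h) (s, \<tau>) * a s)\<^sup>2) \<partial>N) \<le>
     (\<integral>\<^sup>+\<tau>. ennreal ((a s)\<^sup>2) * indicator {\<tau>' \<in> space N. s < \<tau>' \<and> \<tau>' < s + h} \<tau> \<partial>N)"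
    by (rule nn_integral_mono) (auto simp: strip_def indicator_def)
   also have "\<dots> = ennreal ((a s)\<^sup>2) * emeasure N {\<tau>' \<in> space N. s < \<tau>' \<and> \<tau>' < s + h}"
    by (intro nn_integral_cmult_indicator sets.sets_Collect borel_measurable_less borel_measurable_const borel_N)
      simp_all
   also have "\<dots> \<le> ennreal ((a s)\<^sup>2) * ennreal h"
    by (intro mult_left_mono emeasure_N_interval) (use h in auto)
   finally show "(\<integral>\<^sup>+\<tau>. ennreal ((indicator (strip h) (s, \<tau>) * a s)\<^sup>2) \<partial>N) \<le> ennreal h * ennreal ((a s)\<^sup>2)"
    by (simp add: mult.commute)
  qed
  also have "\<dots> = ennreal h * ennreal ((nrm N a)\<^sup>2)"
   using am by (simp add: nn_integral_cmult ai)
  also have "\<dots> = ennreal (h * (nrm N a)\<^sup>2)" using h by (simp add: ennreal_mult)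
  finally show ?thesis .
 qed
 have snd: "(\<integral>\<^sup>+p. ennreal ((indicator (strip h) p * a (snd p))\<^sup>2) \<partial>N2) \<le> ennreal (h * (nrm N a)\<^sup>2)"
 proof -
  have "(\<integral>\<^sup>+p. ennreal ((indicator (strip h) p * a (snd p))\<^sup>2) \<partial>N2) =
    (\<integral>\<^sup>+\<tau>. \<integral>\<^sup>+s. ennreal ((indicator (strip h) (s, \<tau>) * a \<tau>)\<^sup>2) \<partial>N \<partial>N)"
   using nn_integral_snd[of "\<lambda>p. ennreal ((indicator (strip h) p * a (snd p))\<^sup>2)"] sm by simp
  also have "\<dots> \<le> (\<integral>\<^sup>+s. ennreal h * ennreal ((a s)\<^sup>2) \<partial>N)"
  proof (rule nn_integral_mono)
   fix t
   have "(\<integral>\<^sup>+s. ennreal ((indicator (strip h) (s, t) * a t)\<^sup>2) \<partial>N) \<le>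
     (\<integral>\<^sup>+s. ennreal ((a t)\<^sup>2) * indicator {s' \<in> space N. t - h < s' \<and> s' < (t - h) + h} s \<partial>N)"
    by (rule nn_integral_mono) (auto simp: strip_def indicator_def)
   also have "\<dots> = ennreal ((a t)\<^sup>2) * emeasure N {s' \<in> space N. t - h < s' \<and> s' < (t - h) + h}"
    by (intro nn_integral_cmult_indicator sets.sets_Collect borel_measurable_less borel_measurable_const borel_N)
      simp_all
   also have "\<dots> \<le> ennreal ((a t)\<^sup>2) * ennreal h"
    by (intro mult_left_mono emeasure_N_interval) (use h in auto)
   finally show "(\<integral>\<^sup>+s. ennreal ((indicator (strip h) (s, t) * a t)\<^sup>2) \<partial>N) \<le> ennreal h * ennreal ((a t)\<^sup>2)"
    by (simp add: mult.commute)
  qed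
  also have "\<dots> = ennreal h * ennreal ((nrm N a)\<^sup>2)"
   using am by (simp add: nn_integral_cmult ai)
  also have "\<dots> = ennreal (h * (nrm N a)\<^sup>2)" using h by (simp add: ennreal_mult)
  finally show ?thesis .
 qed
 have fin: "sq_int N2 f \<and> (nrm N2 f)\<^sup>2 \<le> h * (nrm N a)\<^sup>2"
  if f: "f \<in> borel_measurable N2" and le: "(\<integral>\<^sup>+p. ennreal ((f p)\<^sup>2) \<partial>N2) \<le> ennreal (h * (nrm N a)\<^sup>2)" for f :: "real \<times> real => real"
 proof -
  have i: "integrable N2 (\<lambda>p. (f p)\<^sup>2)"
  proof (rule integrableI_bounded)
   show "(\<integral>\<^sup>+p. ennreal (norm ((f p)\<^sup>2)) \<partial>N2) < \<infinity>"
    using le by (simp add: le_less_trans ennreal_less_top)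
  qed (use f in simp)
  have "ennreal (LINT p|N2. (f p)\<^sup>2) \<le> ennreal (h * (nrm N a)\<^sup>2)"
   using nn_integral_eq_integral[OF i] le by simp
  then have "(LINT p|N2. (f p)\<^sup>2) \<le> h * (nrm N a)\<^sup>2"
   using h by (subst (asm) ennreal_le_iff) simp_all
  then show ?thesis using i f by (simp add: sq_int_def nrm_sq)
 qed
 show "sq_int N2 (\<lambda>p. indicator (strip h) p * a (fst p))"
  "(nrm N2 (\<lambda>p. indicator (strip h) p * a (fst p)))\<^sup>2 \<le> h * (nrm N a)\<^sup>2"
  using fin[OF fm fst] by blast+
 show "sq_int N2 (\<lambda>p. indicator (strip h) p * a (snd p))"
  "(nrm N2 (\<lambda>p. indicator (strip h) p * a (snd p)))\<^sup>2 \<le> h * (nrm N a)\<^sup>2"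
  using fin[OF sm snd] by blast+
qed

text \<open>Each of the two curves contributes a factor sqrt h by \<open>strip_nrm\<close>, which
  together cancel the 1/h of the average. The bound is uniform in \<open>h\<close>, so approximation
  of either curve in L^2 commutes with the limit h -> 0.\<close>

lemma strip_bound:
 fixes a b :: "real => real"
 assumes a: "sq_int N a" and b: "sq_int N b" and h: "h > 0" and q: "q \<in> borel_measurable N2"
  and le: "\<And>p. \<bar>q p\<bar> \<le> a (fst p) * b (snd p)"
 shows "integrable N2 (\<lambda>p. indicator (strip h) p * q p)" "\<bar>S h q\<bar> \<le> nrm N a * nrm N b"
proof -
 let ?f = "\<lambda>p. indicator (strip h) p * a (fst p)" and ?g = "\<lambda>p. indicator (strip h) p * b (snd p)"
 note fs = strip_nrm(1,2)[OF a h] and gs = strip_nrm(3,4)[OF b h]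
 have le2: "\<bar>indicator (strip h) p * q p\<bar> \<le> norm (?f p) * norm (?g p)" for p
  using order_trans[OF le[of p] abs_ge_self[of "a (fst p) * b (snd p)"]] by (simp add: indicator_def abs_mult)
 show i: "integrable N2 (\<lambda>p. indicator (strip h) p * q p)"
  by (rule Bochner_Integration.integrable_bound[OF sq_int_mult_norm[OF fs(1) gs(1)]])
    (use le2 q strip_meas in \<open>auto intro!: AE_I2 simp: abs_mult\<close>)
 have "\<bar>\<integral>p. indicator (strip h) p * q p \<partial>N2\<bar> \<le> (LINT p|N2. \<bar>indicator (strip h) p * q p\<bar>)" by (rule integral_abs_bound)
 also have "\<dots> \<le> (LINT p|N2. norm (?f p) * norm (?g p))"
  by (intro integral_mono integrable_abs i sq_int_mult_norm fs gs le2)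
 also have "\<dots> \<le> nrm N2 ?f * nrm N2 ?g" by (rule CS_norm[OF fs(1) gs(1)])
 also have "\<dots> \<le> (sqrt h * nrm N a) * (sqrt h * nrm N b)"
 proof (intro mult_mono)
  show "nrm N2 ?f \<le> sqrt h * nrm N a"
   by (rule power2_le_imp_le) (use fs(2) h in \<open>simp_all add: power_mult_distrib nrm_nonneg\<close>)
  show "nrm N2 ?g \<le> sqrt h * nrm N b"
   by (rule power2_le_imp_le) (use gs(2) h in \<open>simp_all add: power_mult_distrib nrm_nonneg\<close>)
 qed (use h in \<open>simp_all add: nrm_nonneg\<close>)
 also have "\<dots> = h * (nrm N a * nrm N b)"
 proof -
  have "(sqrt h * nrm N a) * (sqrt h * nrm N b) = (sqrt h * sqrt h) * (nrm N a * nrm N b)"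
   by (simp only: mult_ac)
  then show ?thesis using h by simp
 qed
 finally have "(1 / h) * \<bar>\<integral>p. indicator (strip h) p * q p \<partial>N2\<bar> \<le> (1 / h) * (h * (nrm N a * nrm N b))"
  using h by (intro mult_left_mono) simp_all
 moreover have "(1 / h) * (h * (nrm N a * nrm N b)) = nrm N a * nrm N b" using h by simp
 ultimately show "\<bar>S h q\<bar> \<le> nrm N a * nrm N b"
  using h by (simp only: abs_mult) simp
qed

text \<open>The candidate for the limit of the averages \<open>S h\<close>, as the strip collapses
  onto the diagonal.\<close>

definition diag_int :: "(real \<times> real => real) => real" where
 "diag_int q = (LINT s|N. indicator {..<T} s * q (s, s))"

lemma indicator_T_meas: "(\<lambda>s. indicator {..<T} s :: real) \<in> borel_measurable N"
 by (rule borel_N) simp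

lemma diag_bound:
 fixes a b :: "real => real"
 assumes a: "sq_int N a" and b: "sq_int N b" and q: "(\<lambda>s. q (s, s)) \<in> borel_measurable N"
  and le: "\<And>p. \<bar>q p\<bar> \<le> a (fst p) * b (snd p)"
 shows "integrable N (\<lambda>s. indicator {..<T} s * q (s, s))" "\<bar>diag_int q\<bar> \<le> nrm N a * nrm N b"
proof -
 have le2: "\<bar>indicator {..<T} s * q (s, s)\<bar> \<le> norm (a s) * norm (b s)" for s
 proof -
  have "\<bar>indicator {..<T} s * q (s, s)\<bar> \<le> \<bar>q (s, s)\<bar>" by (simp add: indicator_def abs_mult)
  also have "\<dots> \<le> \<bar>a s * b s\<bar>" using le[of "(s, s)"] by simp
  finally show ?thesis by (simp add: abs_mult)
 qed
 show i: "integrable N (\<lambda>s. indicator {..<T} s * q (s, s))"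
  by (rule Bochner_Integration.integrable_bound[OF sq_int_mult_norm[OF a b]
     borel_measurable_times[OF indicator_T_meas q]], rule AE_I2)
    (use le2 in \<open>simp add: abs_mult\<close>)
 have "\<bar>diag_int q\<bar> \<le> (LINT s|N. \<bar>indicator {..<T} s * q (s, s)\<bar>)"
  unfolding diag_int_def by (rule integral_abs_bound)
 also have "\<dots> \<le> (LINT s|N. norm (a s) * norm (b s))"
  by (intro integral_mono integrable_abs i sq_int_mult_norm a b le2)
 also have "\<dots> \<le> nrm N a * nrm N b" by (rule CS_norm[OF a b])
 finally show "\<bar>diag_int q\<bar> \<le> nrm N a * nrm N b" .
qed

lemma prod_meas:
 assumes "\<alpha> \<in> borel_measurable N" "\<beta> \<in> borel_measurable N"
 shows "(\<lambda>p. \<alpha> (fst p) * \<beta> (snd p) :: real) \<in> borel_measurable N2"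
 by (intro borel_measurable_times measurable_compose[OF measurable_fst assms(1)] measurable_compose[OF measurable_snd assms(2)])

text \<open>For s < T the inner average runs over all of (s, s + h), which lies in (0, R) because h
  < R - T; uniform continuity of \<open>g\<close> replaces it by g(s) up to a uniform error.\<close>

lemma steklov_continuous:
 fixes \<alpha> g :: "real => real"
 assumes \<alpha>: "sq_int N \<alpha>" and g: "continuous_on UNIV g" and h: "\<And>n. 0 < h n" "\<And>n. h n < R - T" "h ----> 0"
 shows "(\<lambda>n. S (h n) (\<lambda>p. \<alpha> (fst p) * g (snd p)) - diag_int (\<lambda>p. \<alpha> (fst p) * g (snd p))) ----> 0"
proof (rule tendsto_rabs_zero_cancel)
 interpret P: pair_sigma_finite N N by (rule pair_N)
 interpret N: finite_measure N by (rule finite_N)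
 note \<alpha>m = sq_int_measurable[OF \<alpha>]
 have gb: "g \<in> borel_measurable borel" by (rule borel_measurable_continuous_onI[OF g])
 note gm = borel_N[OF gb]
 have gs: "sq_int N g" by (rule sq_int_continuous[OF g _ lm]) simp
 note abs\<alpha> = sq_int_abs(1)[OF \<alpha>] sq_int_abs(1)[OF gs]
 have \<alpha>i: "integrable N \<alpha>" by (rule sq_int_integrable_fm[OF lm \<alpha>])
 have uc: "uniformly_continuous_on {0..R} g"
  by (intro compact_uniformly_continuous continuous_on_subset[OF g]) auto
 have est: "\<bar>S k (\<lambda>p. \<alpha> (fst p) * g (snd p)) - diag_int (\<lambda>p. \<alpha> (fst p) * g (snd p))\<bar> \<le> e * (LINT s|N. \<bar>\<alpha> s\<bar>)"
  if k: "0 < k" "k < R - T" and e: "e \<ge> 0" "\<And>s t. s \<in> {0..R} ==> t \<in> {0..R} ==> \<bar>t - s\<bar> < k ==> \<bar>g t - g s\<bar> \<le> e" for k e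
 proof -
  have i: "integrable N2 (\<lambda>p. indicator (strip k) p * (\<alpha> (fst p) * g (snd p)))"
   by (rule strip_bound(1)[OF abs\<alpha> k(1) prod_meas[OF \<alpha>m gm]]) (simp add: abs_mult)
  let ?I = "\<lambda>s. {s<..<s+k}"
  have sub: "?I s \<subseteq> {0<..<R}" if "s \<in> {0<..<R}" "s < T" for s using that k by auto
  have inner: "(LINT \<tau>|N. indicator (strip k) (s, \<tau>) * (\<alpha> s * g \<tau>)) =
    indicator {..<T} s * \<alpha> s * (LINT \<tau>|N. indicator (?I s) \<tau> * g \<tau>)" for s
   by (subst Bochner_Integration.integral_mult_right_zero[symmetric])
     (rule Bochner_Integration.integral_cong, simp_all add: strip_def indicator_def)
  have "(LINT x|N2. indicator (strip k) x * (\<alpha> (fst x) * g (snd x))) =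
    (LINT s|N. indicator {..<T} s * \<alpha> s * (LINT \<tau>|N. indicator (?I s) \<tau> * g \<tau>))"
   using P.integral_fst'[OF i] by (simp add: inner)
  moreover have ii: "integrable N (\<lambda>s. indicator {..<T} s * \<alpha> s * (LINT \<tau>|N. indicator (?I s) \<tau> * g \<tau>))"
   using P.integrable_fst'[OF i] by (simp add: inner)
  moreover have di: "integrable N (\<lambda>s. indicator {..<T} s * (\<alpha> s * g s))"
   using diag_bound(1)[OF abs\<alpha>, of "\<lambda>p. \<alpha> (fst p) * g (snd p)"] \<alpha>m gm by (simp add: abs_mult)
  ultimately have eq: "S k (\<lambda>p. \<alpha> (fst p) * g (snd p)) - diag_int (\<lambda>p. \<alpha> (fst p) * g (snd p)) =
    (LINT s|N. (1 / k) * (indicator {..<T} s * \<alpha> s * (LINT \<tau>|N. indicator (?I s) \<tau> * g \<tau>)) - indicator {..<T} s * (\<alpha> s * g s))"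
   unfolding diag_int_def by simp
  have pw: "\<bar>(1 / k) * (indicator {..<T} s * \<alpha> s * (LINT \<tau>|N. indicator (?I s) \<tau> * g \<tau>)) - indicator {..<T} s * (\<alpha> s * g s)\<bar> \<le> e * \<bar>\<alpha> s\<bar>"
   if s: "s \<in> space N" for s
  proof (cases "s < T")
   case True
   have s0: "s \<in> {0<..<R}" using s by simp
   have Im: "?I s \<in> sets N" using sub[OF s0 True] by (simp add: sets_restrict_space_iff)
   have mI: "measure N (?I s) = k"
    using sub[OF s0 True] k by (simp add: measure_restrict_space)
   have ind1: "integrable N (\<lambda>\<tau>. indicator (?I s) \<tau> * g s)"
    using Im by (intro integrable_mult_left integrable_real_indicator) (simp_all add: N.emeasure_eq_measure)
   have one: "(LINT \<tau>|N. indicator (?I s) \<tau> * g s) = k * g s"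
   proof -
    have "?I s \<inter> {0<..<R} = ?I s" using sub[OF s0 True] by blast
    then show ?thesis using mI by simp
   qed
   have ind2: "integrable N (\<lambda>\<tau>. indicator (?I s) \<tau> * g \<tau>)"
    by (rule Bochner_Integration.integrable_bound[OF sq_int_integrable_fm[OF lm gs]
       borel_measurable_times[OF borel_N gm]])
      (auto simp: indicator_def)
   have "\<bar>(LINT \<tau>|N. indicator (?I s) \<tau> * g \<tau>) - k * g s\<bar> = \<bar>\<integral>\<tau>. indicator (?I s) \<tau> * g \<tau> - indicator (?I s) \<tau> * g s \<partial>N\<bar>"
    by (simp only: Bochner_Integration.integral_diff[OF ind2 ind1] one)
   also have "\<dots> \<le> (LINT \<tau>|N. \<bar>indicator (?I s) \<tau> * g \<tau> - indicator (?I s) \<tau> * g s\<bar>)" by (rule integral_abs_bound)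
   also have "\<dots> \<le> (LINT \<tau>|N. indicator (?I s) \<tau> * e)"
   proof (rule integral_mono)
    show "integrable N (\<lambda>\<tau>. \<bar>indicator (?I s) \<tau> * g \<tau> - indicator (?I s) \<tau> * g s\<bar>)" using ind1 ind2 by simp
    show "integrable N (\<lambda>\<tau>. indicator (?I s) \<tau> * e)"
     using Im by (intro integrable_mult_left integrable_real_indicator) (simp_all add: N.emeasure_eq_measure)
    show "\<bar>indicator (?I s) \<tau> * g \<tau> - indicator (?I s) \<tau> * g s\<bar> \<le> indicator (?I s) \<tau> * e" if "\<tau> \<in> space N" for \<tau>
     using e(2)[of s \<tau>] s0 that by (auto simp: indicator_def)
   qed
   also have "\<dots> = k * e"
   proof -
    have "?I s \<inter> {0<..<R} = ?I s" using sub[OF s0 True] by blast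
    then show ?thesis using mI by simp
   qed
   finally have b: "\<bar>(LINT \<tau>|N. indicator (?I s) \<tau> * g \<tau>) - k * g s\<bar> \<le> k * e" .
   have "(1 / k) * (\<alpha> s * G) - \<alpha> s * g s = \<alpha> s * ((1 / k) * (G - k * g s))" for G
    using k by (simp add: field_simps)
   then have "\<bar>(1 / k) * (\<alpha> s * (LINT \<tau>|N. indicator (?I s) \<tau> * g \<tau>)) - \<alpha> s * g s\<bar> =
     \<bar>\<alpha> s\<bar> * ((1 / k) * \<bar>(LINT \<tau>|N. indicator (?I s) \<tau> * g \<tau>) - k * g s\<bar>)"
    using k by (simp add: abs_mult)
   also have "\<dots> \<le> \<bar>\<alpha> s\<bar> * ((1 / k) * (k * e))"
    using k by (intro mult_left_mono b) auto
   also have "\<dots> = e * \<bar>\<alpha> s\<bar>" using k by simp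
   finally show ?thesis using True by simp
  next
   case False
   then show ?thesis using e(1) by simp
  qed
  have "\<bar>\<integral>s. (1 / k) * (indicator {..<T} s * \<alpha> s * (LINT \<tau>|N. indicator (?I s) \<tau> * g \<tau>)) - indicator {..<T} s * (\<alpha> s * g s) \<partial>N\<bar>
   \<le> (LINT s|N. \<bar>(1 / k) * (indicator {..<T} s * \<alpha> s * (LINT \<tau>|N. indicator (?I s) \<tau> * g \<tau>)) - indicator {..<T} s * (\<alpha> s * g s)\<bar>)"
   by (rule integral_abs_bound)
  also have "\<dots> \<le> (LINT s|N. e * \<bar>\<alpha> s\<bar>)"
   by (rule integral_mono) (use ii di \<alpha>i pw in auto)
  also have "\<dots> = e * (LINT s|N. \<bar>\<alpha> s\<bar>)" by simp
  finally show ?thesis unfolding eq .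
 qed
 let ?A = "\<integral>s. \<bar>\<alpha> s\<bar> \<partial>N"
 show "(\<lambda>n. \<bar>S (h n) (\<lambda>p. \<alpha> (fst p) * g (snd p)) - diag_int (\<lambda>p. \<alpha> (fst p) * g (snd p))\<bar>) ----> 0"
 proof (rule LIMSEQ_I)
  fix r :: real assume "r > 0"
  \<comment> \<open>The summand 1 keeps the denominator positive even if \<alpha> vanishes almost
    everywhere.\<close>
  define e where "e = r / 2 / (?A + 1)"
  have A1: "?A + 1 > 0" by (intro add_nonneg_pos) simp_all
  have e: "e > 0" unfolding e_def using \<open>r > 0\<close> A1 by (intro divide_pos_pos) simp_all
  obtain d where d: "d > 0" "\<And>s t. s \<in> {0..R} ==> t \<in> {0..R} ==> dist t s < d ==> dist (g t) (g s) < e"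
   using uc e unfolding uniformly_continuous_on_def by metis
  obtain n0 where n0: "\<forall>n\<ge>n0. h n < d" using tendsto_zero_less[OF h(3) d(1)] by blast
  have "e * ?A < r"
  proof -
   have "e * ?A \<le> e * (?A + 1)" using e by simp
   also have "\<dots> = r / 2" unfolding e_def 
    by (rule nonzero_eq_divide_eq[THEN iffD1, OF _ refl]) (use A1 in linarith)
   finally show ?thesis using \<open>r > 0\<close> by linarith
  qed
  show "\<exists>n0. \<forall>n\<ge>n0. norm (\<bar>S (h n) (\<lambda>p. \<alpha> (fst p) * g (snd p)) - diag_int (\<lambda>p. \<alpha> (fst p) * g (snd p))\<bar> - 0) < r"
  proof (intro exI[of _ n0] allI impI)
   fix n assume n: "n0 \<le> n"
   have close: "\<bar>g t - g s\<bar> \<le> e" if "s \<in> {0..R}" "t \<in> {0..R}" "\<bar>t - s\<bar> < h n" for s t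
   proof -
    have "dist t s < d" using n0 n that(3) by (simp add: dist_real_def) (meson less_trans)
    from d(2)[OF that(1,2) this] show ?thesis by (simp add: dist_real_def)
   qed
   show "norm (\<bar>S (h n) (\<lambda>p. \<alpha> (fst p) * g (snd p)) - diag_int (\<lambda>p. \<alpha> (fst p) * g (snd p))\<bar> - 0) < r"
    unfolding real_norm_def diff_zero abs_idempotent
    by (rule le_less_trans[OF est[OF h(1) h(2) less_imp_le[OF e] close] \<open>e * ?A < r\<close>])
  qed
 qed
qed

text \<open>Two approximation errors of at most r/4, one for the averages and one for the diagonal,
  and a third r/4 from the convergence for \<open>q'\<close>. What matters is that the first error
  is uniform in \<open>n\<close>.\<close>

lemma steklov_approx:
 assumes q: "\<And>n. integrable N2 (\<lambda>p. indicator (strip (h n)) p * q p)" "integrable N (\<lambda>s. indicator {..<T} s * q (s, s))"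
  and approx: "\<And>e. e > 0 ==> \<exists>q'. (\<lambda>n. S (h n) q' - diag_int q') ----> 0 \<and>
   (\<forall>n. integrable N2 (\<lambda>p. indicator (strip (h n)) p * q' p)) \<and> integrable N (\<lambda>s. indicator {..<T} s * q' (s, s)) \<and>
   (\<forall>n. \<bar>S (h n) (\<lambda>p. q p - q' p)\<bar> \<le> e) \<and> \<bar>diag_int (\<lambda>p. q p - q' p)\<bar> \<le> e"
 shows "(\<lambda>n. S (h n) q - diag_int q) ----> 0"
proof (rule LIMSEQ_I)
 fix r :: real assume "r > 0"
 then have r4: "r / 4 > 0" by simp
 from approx[OF r4] obtain q' where q': "(\<lambda>n. S (h n) q' - diag_int q') ----> 0"
  "\<And>n. integrable N2 (\<lambda>p. indicator (strip (h n)) p * q' p)" "integrable N (\<lambda>s. indicator {..<T} s * q' (s, s))"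
  "\<And>n. \<bar>S (h n) (\<lambda>p. q p - q' p)\<bar> \<le> r / 4" "\<bar>diag_int (\<lambda>p. q p - q' p)\<bar> \<le> r / 4" by blast
 have s: "S (h n) (\<lambda>p. q p - q' p) = S (h n) q - S (h n) q'" for n
  by (simp add: right_diff_distrib Bochner_Integration.integral_diff[OF q(1) q'(2)])
 have d: "diag_int (\<lambda>p. q p - q' p) = diag_int q - diag_int q'"
  unfolding diag_int_def by (simp add: right_diff_distrib Bochner_Integration.integral_diff[OF q(2) q'(3)])
 obtain n0 where n0: "\<forall>n\<ge>n0. norm (S (h n) q' - diag_int q' - 0) < r / 4" using LIMSEQ_D[OF q'(1) r4] by blast
 have "norm (S (h n) q - diag_int q - 0) < r" if "n \<ge> n0" for n
 proof -
  have "norm (S (h n) q' - diag_int q' - 0) < r / 4" using n0 that by blast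
  moreover have "\<bar>S (h n) q - S (h n) q'\<bar> \<le> r / 4" using q'(4)[of n] by (simp only: s)
  moreover have "\<bar>diag_int q - diag_int q'\<bar> \<le> r / 4" using q'(5) by (simp only: d)
  ultimately show ?thesis using \<open>r > 0\<close> unfolding real_norm_def diff_0_right by linarith
 qed
 then show "\<exists>n0. \<forall>n\<ge>n0. norm (S (h n) q - diag_int q - 0) < r" by blast
qed

text \<open>Approximate \<beta> by a continuous \<open>g\<close> in L^2. By the uniform bounds the
  error is at most |\<alpha>| |\<beta> - g|, for all averages and for the diagonal alike.\<close>

lemma steklov_scalar:
 fixes \<alpha> \<beta> :: "real => real"
 assumes \<alpha>: "sq_int N \<alpha>" and \<beta>: "sq_int N \<beta>" and h: "\<And>n. 0 < h n" "\<And>n. h n < R - T" "h ----> 0"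
 shows "(\<lambda>n. S (h n) (\<lambda>p. \<alpha> (fst p) * \<beta> (snd p)) - diag_int (\<lambda>p. \<alpha> (fst p) * \<beta> (snd p))) ----> 0"
proof -
 note abs = sq_int_abs
 have m: "(\<lambda>s. f s * g s) \<in> borel_measurable N" if "sq_int N f" "sq_int N g" for f g :: "real => real"
  by (intro borel_measurable_times sq_int_measurable that)
 have I: "integrable N2 (\<lambda>p. indicator (strip (h n)) p * (f (fst p) * g (snd p)))"
  "\<bar>S (h n) (\<lambda>p. f (fst p) * g (snd p))\<bar> \<le> nrm N f * nrm N g"
  "integrable N (\<lambda>s. indicator {..<T} s * (f s * g s))"
  "\<bar>diag_int (\<lambda>p. f (fst p) * g (snd p))\<bar> \<le> nrm N f * nrm N g"
  if f: "sq_int N f" and g: "sq_int N g" for f g :: "real => real" and n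
  using strip_bound[OF abs(1)[OF f] abs(1)[OF g] h(1) prod_meas[OF sq_int_measurable[OF f] sq_int_measurable[OF g]], of n]
   diag_bound[OF abs(1)[OF f] abs(1)[OF g], of "\<lambda>p. f (fst p) * g (snd p)"] m[OF f g] abs(2)[OF f] abs(2)[OF g]
  by (simp_all add: abs_mult)
 show ?thesis
 proof (rule steklov_approx)
  show "integrable N2 (\<lambda>p. indicator (strip (h n)) p * (\<alpha> (fst p) * \<beta> (snd p)))" for n by (rule I(1)[OF \<alpha> \<beta>])
  show "integrable N (\<lambda>s. indicator {..<T} s * (\<alpha> (fst (s, s)) * \<beta> (snd (s, s))))" using I(3)[OF \<alpha> \<beta>] by simp
  fix e :: real assume "e > 0"
  then have "e / (nrm N \<alpha> + 1) > 0" using nrm_nonneg[of N \<alpha>] by (intro divide_pos_pos) linarith+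
  from continuous_dense_L2[OF lm _ \<beta> this] obtain g where g: "continuous_on UNIV g"
   "dst N g \<beta> < e / (nrm N \<alpha> + 1)" by auto
  have gs: "sq_int N g" by (rule sq_int_continuous[OF g(1) _ lm]) simp
  have bd: "nrm N \<alpha> * dst N \<beta> g \<le> e"
  proof -
   have "nrm N \<alpha> * dst N \<beta> g \<le> (nrm N \<alpha> + 1) * (e / (nrm N \<alpha> + 1))"
    using g(2) by (intro mult_mono) (simp_all add: nrm_nonneg nrm_minus_commute[of N \<beta>] less_imp_le)
   also have "\<dots> = e" using nrm_nonneg[of N \<alpha>] by simp
   finally show ?thesis .
  qed
  note J = I[OF \<alpha> sq_int_diff[OF \<beta> gs]]
  show "\<exists>q'. (\<lambda>n. S (h n) q' - diag_int q') ----> 0 \<and>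
   (\<forall>n. integrable N2 (\<lambda>p. indicator (strip (h n)) p * q' p)) \<and> integrable N (\<lambda>s. indicator {..<T} s * q' (s, s)) \<and>
   (\<forall>n. \<bar>S (h n) (\<lambda>p. \<alpha> (fst p) * \<beta> (snd p) - q' p)\<bar> \<le> e) \<and> \<bar>diag_int (\<lambda>p. \<alpha> (fst p) * \<beta> (snd p) - q' p)\<bar> \<le> e"
  proof (intro exI[where x = "\<lambda>p. \<alpha> (fst p) * g (snd p)"] conjI allI)
   show "(\<lambda>n. S (h n) (\<lambda>p. \<alpha> (fst p) * g (snd p)) - diag_int (\<lambda>p. \<alpha> (fst p) * g (snd p))) ----> 0"
    by (rule steklov_continuous[OF \<alpha> g(1) h])
   show "integrable N2 (\<lambda>p. indicator (strip (h n)) p * (\<alpha> (fst p) * g (snd p)))" for n by (rule I(1)[OF \<alpha> gs])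
   show "integrable N (\<lambda>s. indicator {..<T} s * (\<alpha> (fst (s, s)) * g (snd (s, s))))" using I(3)[OF \<alpha> gs] by simp
   show "\<bar>S (h n) (\<lambda>p. \<alpha> (fst p) * \<beta> (snd p) - \<alpha> (fst p) * g (snd p))\<bar> \<le> e" for n
    using order_trans[OF J(2) bd, of n] by (simp only: right_diff_distrib)
   show "\<bar>diag_int (\<lambda>p. \<alpha> (fst p) * \<beta> (snd p) - \<alpha> (fst p) * g (snd p))\<bar> \<le> e"
    using order_trans[OF J(4) bd] by (simp only: right_diff_distrib)
  qed
 qed
qed

end

section \<open>Averages over short time intervals\<close>

lemma integral_lebesgue_on_subset:
 fixes \<phi> :: "'a::euclidean_space => real"
 assumes "A \<subseteq> B" "A \<in> sets lebesgue" "B \<in> sets lebesgue"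
 shows "(LINT s|lebesgue_on B. indicator A s * \<phi> s) = (LINT s|lebesgue_on A. \<phi> s)"
proof -
 have "(LINT s|lebesgue_on B. indicator A s * \<phi> s) = (LINT s|lebesgue. indicator B s *\<^sub>R (indicator A s * \<phi> s))"
  using assms by (intro integral_restrict_space) simp
 also have "\<dots> = (LINT s|lebesgue. indicator A s *\<^sub>R \<phi> s)"
  by (rule Bochner_Integration.integral_cong) (use assms(1) in \<open>auto simp: indicator_def\<close>)
 also have "\<dots> = (LINT s|lebesgue_on A. \<phi> s)"
  using assms by (intro integral_restrict_space[symmetric]) simp
 finally show ?thesis .
qed

lemma average_tendsto:
 fixes \<phi> :: "real => real"
 assumes \<phi>: "continuous_on UNIV \<phi>" and h: "\<And>n. 0 < h n" "h ----> 0"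
 shows "(\<lambda>n. (1 / h n) * (LINT t|lborel. indicator {c<..<c + h n} t * \<phi> t)) ----> \<phi> c"
proof (rule LIMSEQ_I)
 fix r :: real assume r: "r > 0"
 have r2: "r / 2 > 0" using r by simp
 have "isCont \<phi> c" using \<phi> by (simp add: continuous_on_eq_continuous_at)
 then obtain d where d: "d > 0" "\<And>t. \<bar>t - c\<bar> < d ==> \<bar>\<phi> t - \<phi> c\<bar> < r / 2"
  using r2 unfolding continuous_at_eps_delta dist_real_def by blast
 obtain n0 where n0: "\<forall>n\<ge>n0. h n < d" using tendsto_zero_less[OF h(2) d(1)] by blast
 have \<phi>m: "\<phi> \<in> borel_measurable borel" by (rule borel_measurable_continuous_onI[OF \<phi>])
 have "norm ((1 / h n) * (LINT t|lborel. indicator {c<..<c + h n} t * \<phi> t) - \<phi> c) < r" if n: "n \<ge> n0" for n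
 proof -
  let ?i = "\<lambda>t. indicator {c<..<c + h n} t :: real"
  have hn: "0 < h n" "h n < d" using h(1) n0 n by auto
  have i1: "integrable lborel (\<lambda>t. ?i t * x)" for x
   by (intro integrable_mult_left integrable_real_indicator) (use hn in simp_all)
  have one: "(LINT t|lborel. ?i t * x) = h n * x" for x using hn by simp
  have close: "\<bar>?i t * (\<phi> t - \<phi> c)\<bar> \<le> ?i t * (r / 2)" for t
   using d(2)[of t] hn by (auto simp: indicator_def less_imp_le)
  have i2: "integrable lborel (\<lambda>t. ?i t * (\<phi> t - \<phi> c))"
  proof (rule Bochner_Integration.integrable_bound[OF i1[of "r / 2"]])
   show "(\<lambda>t. ?i t * (\<phi> t - \<phi> c)) \<in> borel_measurable lborel" using \<phi>m by simp
   show "AE t in lborel. norm (?i t * (\<phi> t - \<phi> c)) \<le> norm (?i t * (r / 2))"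
    unfolding real_norm_def by (rule AE_I2, rule order_trans[OF close abs_ge_self])
  qed
  have "(LINT t|lborel. ?i t * \<phi> t) = (LINT t|lborel. ?i t * (\<phi> t - \<phi> c) + ?i t * \<phi> c)"
   by (simp add: algebra_simps)
  also have "\<dots> = (LINT t|lborel. ?i t * (\<phi> t - \<phi> c)) + h n * \<phi> c"
   by (simp only: Bochner_Integration.integral_add[OF i2 i1] one)
  finally have e: "(1 / h n) * (LINT t|lborel. ?i t * \<phi> t) - \<phi> c = (1 / h n) * (LINT t|lborel. ?i t * (\<phi> t - \<phi> c))"
   using hn by (simp add: field_simps)
  have "\<bar>\<integral>t. ?i t * (\<phi> t - \<phi> c) \<partial>lborel\<bar> \<le> (LINT t|lborel. \<bar>?i t * (\<phi> t - \<phi> c)\<bar>)" by (rule integral_abs_bound)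
  also have "\<dots> \<le> (LINT t|lborel. ?i t * (r / 2))"
   by (intro integral_mono integrable_abs i2 i1 close)
  finally have "\<bar>\<integral>t. ?i t * (\<phi> t - \<phi> c) \<partial>lborel\<bar> \<le> h n * (r / 2)" by (simp only: one)
  then have "(1 / h n) * \<bar>\<integral>t. ?i t * (\<phi> t - \<phi> c) \<partial>lborel\<bar> \<le> (1 / h n) * (h n * (r / 2))"
   using hn by (intro mult_left_mono) simp_all
  also have "\<dots> = r / 2" using hn by simp
  finally have "(1 / h n) * \<bar>\<integral>t. ?i t * (\<phi> t - \<phi> c) \<partial>lborel\<bar> < r" using r by linarith
  moreover have "\<bar>1 / h n\<bar> = 1 / h n" using hn by simp
  ultimately show ?thesis unfolding e real_norm_def abs_mult by (simp only:)
 qed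
 then show "\<exists>n0. \<forall>n\<ge>n0. norm ((1 / h n) * (LINT t|lborel. indicator {c<..<c + h n} t * \<phi> t) - \<phi> c) < r" by blast
qed

context time_strip
begin

lemma steklov_sum:
 assumes "finite I"
  and "\<And>i. i \<in> I ==> (\<lambda>n. S (h n) (q i) - diag_int (q i)) ----> 0"
  and "\<And>i n. i \<in> I ==> integrable N2 (\<lambda>p. indicator (strip (h n)) p * q i p)"
  and "\<And>i. i \<in> I ==> integrable N (\<lambda>s. indicator {..<T} s * q i (s, s))"
 shows "(\<lambda>n. S (h n) (\<lambda>p. \<Sum>i\<in>I. q i p) - diag_int (\<lambda>p. \<Sum>i\<in>I. q i p)) ----> 0"
proof -
 have "S (h n) (\<lambda>p. \<Sum>i\<in>I. q i p) - diag_int (\<lambda>p. \<Sum>i\<in>I. q i p) = (\<Sum>i\<in>I. S (h n) (q i) - diag_int (q i))" for n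
 proof -
  have "(LINT p|N2. indicator (strip (h n)) p * (\<Sum>i\<in>I. q i p)) = (\<Sum>i\<in>I. \<integral>p. indicator (strip (h n)) p * q i p \<partial>N2)"
   unfolding sum_distrib_left by (rule Bochner_Integration.integral_sum) (rule assms(3))
  moreover have "diag_int (\<lambda>p. \<Sum>i\<in>I. q i p) = (\<Sum>i\<in>I. diag_int (q i))"
   unfolding diag_int_def sum_distrib_left by (rule Bochner_Integration.integral_sum) (rule assms(4))
  ultimately show ?thesis by (simp only: sum_distrib_left sum_subtractf)
 qed
 then show ?thesis using tendsto_sum[of I "\<lambda>i n. S (h n) (q i) - diag_int (q i)" "\<lambda>i. 0"] assms(2) by simp
qed

text \<open>Replacing \<open>K\<close> by its finite-rank projections turns the pairing into a
  finite sum of products of scalar functions, which \<open>steklov_scalar\<close> handles. The error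
  is uniform in \<open>h\<close>, and it tends to 0 by dominated convergence in time, since |K - P_k
  K| \<le> 2 |K| at each time.\<close>

lemma steklov_pairing:
 fixes K Z :: "real => 'a::euclidean_space => 'b::euclidean_space"
 assumes \<Omega>: "\<Omega> \<in> lmeasurable"
  and K: "wmeas N (lebesgue_on \<Omega>) K" "\<And>t. sq_int (lebesgue_on \<Omega>) (K t)" "integrable N (\<lambda>t. (nrm (lebesgue_on \<Omega>) (K t))\<^sup>2)"
  and Z: "wmeas N (lebesgue_on \<Omega>) Z" "\<And>t. sq_int (lebesgue_on \<Omega>) (Z t)" "integrable N (\<lambda>t. (nrm (lebesgue_on \<Omega>) (Z t))\<^sup>2)"
  and h: "\<And>n. 0 < h n" "\<And>n. h n < R - T" "h ----> 0"
 defines "q \<equiv> \<lambda>p. ip (lebesgue_on \<Omega>) (K (fst p)) (Z (snd p))"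
 shows "\<And>k. 0 < k ==> integrable N2 (\<lambda>p. indicator (strip k) p * q p)"
  "integrable N (\<lambda>s. indicator {..<T} s * q (s, s))"
  "(\<lambda>n. S (h n) q) ----> diag_int q"
proof -
 let ?M = "lebesgue_on \<Omega>"
 have a: "sq_int N (\<lambda>t. nrm ?M (K t))" and b: "sq_int N (\<lambda>t. nrm ?M (Z t))"
  using K Z by (simp_all add: sq_int_def nrm_measurable[OF \<Omega>])
 have I: "\<And>k. 0 < k ==> integrable N2 (\<lambda>p. indicator (strip k) p * ip ?M (X (fst p)) (Z (snd p)))"
  "\<And>k. 0 < k ==> \<bar>S k (\<lambda>p. ip ?M (X (fst p)) (Z (snd p)))\<bar> \<le> nrm N (\<lambda>t. nrm ?M (X t)) * nrm N (\<lambda>t. nrm ?M (Z t))"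
  "integrable N (\<lambda>s. indicator {..<T} s * ip ?M (X s) (Z s))"
  "\<bar>diag_int (\<lambda>p. ip ?M (X (fst p)) (Z (snd p)))\<bar> \<le> nrm N (\<lambda>t. nrm ?M (X t)) * nrm N (\<lambda>t. nrm ?M (Z t))"
  if X: "wmeas N ?M X" "\<And>t. sq_int ?M (X t)" "sq_int N (\<lambda>t. nrm ?M (X t))" for X
 proof -
  have le: "\<bar>ip ?M (X (fst p)) (Z (snd p))\<bar> \<le> nrm ?M (X (fst p)) * nrm ?M (Z (snd p))" for p
   by (rule CS_inner[OF X(2) Z(2)])
  note s = strip_bound[OF X(3) b _ ip_pair_measurable[OF \<Omega> X(1,2) Z(1,2)] le]
  have dm: "(\<lambda>s. ip ?M (X (fst (s, s))) (Z (snd (s, s)))) \<in> borel_measurable N"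
   using ip_diag_measurable[OF \<Omega> X(1,2) Z(1,2)] by simp
  note d = diag_bound[OF X(3) b, of "\<lambda>p. ip ?M (X (fst p)) (Z (snd p))", OF dm le]
  show "integrable N2 (\<lambda>p. indicator (strip k) p * ip ?M (X (fst p)) (Z (snd p)))" if "0 < k" for k
   by (rule s(1)[OF that])
  show "\<bar>S k (\<lambda>p. ip ?M (X (fst p)) (Z (snd p)))\<bar> \<le> nrm N (\<lambda>t. nrm ?M (X t)) * nrm N (\<lambda>t. nrm ?M (Z t))" if "0 < k" for k
   by (rule s(2)[OF that])
  show "integrable N (\<lambda>s. indicator {..<T} s * ip ?M (X s) (Z s))" using d(1) by simp
  show "\<bar>diag_int (\<lambda>p. ip ?M (X (fst p)) (Z (snd p)))\<bar> \<le> nrm N (\<lambda>t. nrm ?M (X t)) * nrm N (\<lambda>t. nrm ?M (Z t))"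
   by (rule d(2))
 qed
 show i2: "integrable N2 (\<lambda>p. indicator (strip k) p * q p)" if "0 < k" for k
  unfolding q_def by (rule I(1)[OF K(1,2) a that])
 show i1: "integrable N (\<lambda>s. indicator {..<T} s * q (s, s))"
  unfolding q_def using I(3)[OF K(1,2) a] by simp
 define a' where "a' k t = dst ?M (K t) (proj \<Omega> k (K t))" for k t
 define E where "E k t x = K t x - proj \<Omega> k (K t) x" for k t x
 have E: "wmeas N ?M (E k)" "\<And>t. sq_int ?M (E k t)" for k
  unfolding E_def[abs_def]
  by (intro wmeas_diff K wmeas_proj \<Omega> sq_int_proj[OF \<Omega>] sq_int_diff)+
 have E2: "nrm ?M (E k t) \<le> 2 * nrm ?M (K t)" for k t
  unfolding E_def
  using nrm_triangle_diff[OF K(2) sq_int_proj[OF \<Omega>], of t k "K t"] nrm_proj_le[OF \<Omega> K(2), of k t] by linarith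
 have Em: "(\<lambda>t. nrm ?M (E k t)) \<in> borel_measurable N" for k by (rule nrm_measurable[OF \<Omega> E])
 have Es: "sq_int N (\<lambda>t. nrm ?M (E k t))" for k
  by (rule sq_int_bound[OF a Em, where C = 2], rule AE_I2) (use E2 in \<open>simp add: nrm_nonneg\<close>)
 have Elim: "(\<lambda>k. nrm N (\<lambda>t. nrm ?M (E k t))) ----> 0"
 proof -
  have "(\<lambda>k. \<integral>t. (norm (nrm ?M (E k t)))\<^sup>2 \<partial>N) ----> (LINT t|N. 0)"
  proof (rule integral_dominated_convergence[where w = "\<lambda>t. 4 * (nrm ?M (K t))\<^sup>2"])
   show "AE t in N. (\<lambda>k. (norm (nrm ?M (E k t)))\<^sup>2) ----> 0"
   proof (rule AE_I2)
    fix t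
    have "(\<lambda>k. nrm ?M (E k t)) ----> 0"
     unfolding E_def nrm_minus_commute[of ?M "K t"] by (rule proj_tendsto[OF \<Omega> K(2)])
    from tendsto_power[OF tendsto_norm[OF this], of 2] show "(\<lambda>k. (norm (nrm ?M (E k t)))\<^sup>2) ----> 0" by simp
   qed
   show "AE t in N. norm ((norm (nrm ?M (E k t)))\<^sup>2) \<le> 4 * (nrm ?M (K t))\<^sup>2" for k
   proof (rule AE_I2)
    fix t
    from power_mono[OF E2 nrm_nonneg, of k t 2] show "norm ((norm (nrm ?M (E k t)))\<^sup>2) \<le> 4 * (nrm ?M (K t))\<^sup>2"
     by (simp add: power_mult_distrib)
   qed
   show "integrable N (\<lambda>t. 4 * (nrm ?M (K t))\<^sup>2)" using K(3) by simp
   show "(\<lambda>t. (norm (nrm ?M (E k t)))\<^sup>2) \<in> borel_measurable N" for k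
    by (intro borel_measurable_power measurable_compose[OF Em borel_measurable_norm])
  qed simp
  from tendsto_real_sqrt[OF this] show ?thesis by (simp add: nrm_def)
 qed
 have "(\<lambda>n. S (h n) q - diag_int q) ----> 0"
 proof (rule steklov_approx[OF i2[OF h(1)] i1])
  fix e :: real assume "e > 0"
  let ?b = "nrm N (\<lambda>t. nrm ?M (Z t))"
  have e1: "e / (?b + 1) > 0" using \<open>e > 0\<close> nrm_nonneg[of N "\<lambda>t. nrm ?M (Z t)"] by (intro divide_pos_pos) linarith+
  obtain k where k: "nrm N (\<lambda>t. nrm ?M (E k t)) < e / (?b + 1)" using tendsto_zero_less[OF Elim e1] by blast
  have ke: "nrm N (\<lambda>t. nrm ?M (E k t)) * ?b \<le> e"
  proof -
   have "nrm N (\<lambda>t. nrm ?M (E k t)) * ?b \<le> (e / (?b + 1)) * (?b + 1)"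
    using k e1 by (intro mult_mono) (simp_all add: nrm_nonneg)
   also have "\<dots> = e" using nrm_nonneg[of N "\<lambda>t. nrm ?M (Z t)"] by simp
   finally show ?thesis .
  qed
  define P where "P t = proj \<Omega> k (K t)" for t
  have P: "wmeas N ?M P" "\<And>t. sq_int ?M (P t)" unfolding P_def[abs_def]
   by (intro wmeas_proj \<Omega> K sq_int_proj[OF \<Omega>])+
  have Ps: "sq_int N (\<lambda>t. nrm ?M (P t))"
   by (rule sq_int_bound[OF a nrm_measurable[OF \<Omega> P], of 1], rule AE_I2)
     (use nrm_proj_le[OF \<Omega> K(2)] in \<open>simp add: P_def nrm_nonneg\<close>)
  define q' where "q' p = ip ?M (P (fst p)) (Z (snd p))" for p
  have diff: "q p - q' p = ip ?M (E k (fst p)) (Z (snd p))" for p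
   unfolding q_def q'_def E_def P_def by (rule ip_diff_left[OF K(2) sq_int_proj[OF \<Omega>] Z(2), symmetric])
  \<comment> \<open>One scalar term for each atom and each coordinate of the values: the inner
    product of two atom integrals is expanded in the basis.\<close>
  let ?J = "Pow {..<k} \<times> (Basis :: 'b set)"
  let ?al = "\<lambda>j t. (1 / atom_measure \<Omega> k (fst j)) * (atom_int \<Omega> k (fst j) (K t) \<bullet> snd j)"
  let ?be = "\<lambda>j t. atom_int \<Omega> k (fst j) (Z t) \<bullet> snd j"
  have scal: "sq_int N (\<lambda>t. atom_int \<Omega> k S' (X t) \<bullet> w)"
   if X: "wmeas N ?M X" "\<And>t. sq_int ?M (X t)" "sq_int N (\<lambda>t. nrm ?M (X t))" for X S' and w :: 'b
  proof -
   let ?w = "\<lambda>x. indicator (atom k S') x *\<^sub>R w"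
   have ws: "sq_int ?M ?w"
   proof (rule sq_int_bounded[OF finite_measure_lebesgue_on[OF \<Omega>]])
    show "?w \<in> borel_measurable ?M" by (intro borel_measurable_scaleR atom_measurable[OF \<Omega>] borel_measurable_const)
    show "norm (?w x) \<le> norm w" for x by (cases "x \<in> atom k S'") simp_all
   qed
   have eq: "atom_int \<Omega> k S' (X t) \<bullet> w = ip ?M (X t) ?w" for t
   proof -
    have "(LINT x|?M. (indicator (atom k S') x *\<^sub>R X t x) \<bullet> w) = atom_int \<Omega> k S' (X t) \<bullet> w"
     unfolding atom_int_def by (rule integral_inner_left) (rule atom_integrable[OF \<Omega> X(2)])
    then show ?thesis by simp
   qed
   show ?thesis
    unfolding eq
    by (rule sq_int_bound[OF X(3) wmeasD[OF X(1) ws], of "nrm ?M ?w"], rule AE_I2)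
      (use CS_inner[OF X(2) ws] in \<open>simp add: nrm_nonneg mult.commute\<close>)
  qed
  have al: "sq_int N (?al j)" for j
   using sq_int_scaleR[OF scal[OF K(1,2) a], where c = "1 / atom_measure \<Omega> k (fst j)"] by (simp only: real_scaleR_def)
  have be: "sq_int N (?be j)" for j by (rule scal[OF Z(1,2) b])
  have qsum: "q' = (\<lambda>p. \<Sum>j\<in>?J. ?al j (fst p) * ?be j (snd p))"
  proof (rule ext)
   fix p :: "real \<times> real"
   have "q' p = (\<Sum>S'\<in>Pow {..<k}. \<Sum>w\<in>Basis. ?al (S', w) (fst p) * ?be (S', w) (snd p))"
    unfolding q'_def P_def ip_proj[OF \<Omega> Z(2)]
   proof (rule sum.cong[OF refl])
    fix S'
    show "atom_int \<Omega> k S' (K (fst p)) \<bullet> atom_int \<Omega> k S' (Z (snd p)) / atom_measure \<Omega> k S' =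
      (\<Sum>w\<in>Basis. ?al (S', w) (fst p) * ?be (S', w) (snd p))"
     by (subst euclidean_inner) (simp add: sum_divide_distrib)
   qed
   also have "\<dots> = (\<Sum>j\<in>?J. ?al j (fst p) * ?be j (snd p))"
    by (simp add: sum.cartesian_product case_prod_beta)
   finally show "q' p = (\<Sum>j\<in>?J. ?al j (fst p) * ?be j (snd p))" .
  qed
  show "\<exists>q'. (\<lambda>n. S (h n) q' - diag_int q') ----> 0 \<and>
   (\<forall>n. integrable N2 (\<lambda>p. indicator (strip (h n)) p * q' p)) \<and> integrable N (\<lambda>s. indicator {..<T} s * q' (s, s)) \<and>
   (\<forall>n. \<bar>S (h n) (\<lambda>p. q p - q' p)\<bar> \<le> e) \<and> \<bar>diag_int (\<lambda>p. q p - q' p)\<bar> \<le> e"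
  proof (intro exI[where x = q'] conjI allI)
   show "(\<lambda>n. S (h n) q' - diag_int q') ----> 0"
    unfolding qsum
   proof (rule steklov_sum)
    show "finite ?J" by simp
    fix j assume "j \<in> ?J"
    show "(\<lambda>n. S (h n) (\<lambda>p. ?al j (fst p) * ?be j (snd p)) - diag_int (\<lambda>p. ?al j (fst p) * ?be j (snd p))) ----> 0"
     by (rule steklov_scalar[OF al be h])
    have le: "\<bar>?al j (fst p) * ?be j (snd p)\<bar> \<le> \<bar>?al j (fst p)\<bar> * \<bar>?be j (snd p)\<bar>" for p by (simp add: abs_mult)
    show "integrable N2 (\<lambda>p. indicator (strip (h n)) p * (?al j (fst p) * ?be j (snd p)))" for n
     by (rule strip_bound(1)[OF sq_int_abs(1)[OF al] sq_int_abs(1)[OF be] h(1)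
        prod_meas[OF sq_int_measurable[OF al] sq_int_measurable[OF be]] le])
    have m: "(\<lambda>s. ?al j (fst (s, s)) * ?be j (snd (s, s))) \<in> borel_measurable N"
     unfolding fst_conv snd_conv by (intro borel_measurable_times sq_int_measurable[OF al] sq_int_measurable[OF be])
    show "integrable N (\<lambda>s. indicator {..<T} s * (?al j (fst (s, s)) * ?be j (snd (s, s))))"
     by (rule diag_bound(1)[OF sq_int_abs(1)[OF al] sq_int_abs(1)[OF be], of "\<lambda>p. ?al j (fst p) * ?be j (snd p)", OF m le])
   qed
   show "integrable N2 (\<lambda>p. indicator (strip (h n)) p * q' p)" for n
    unfolding q'_def by (rule I(1)[OF P Ps h(1)])
   show "integrable N (\<lambda>s. indicator {..<T} s * q' (s, s))"
    unfolding q'_def using I(3)[OF P Ps] by simp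
   show "\<bar>S (h n) (\<lambda>p. q p - q' p)\<bar> \<le> e" for n
    unfolding diff by (rule order_trans[OF I(2)[OF E Es h(1)] ke])
   show "\<bar>diag_int (\<lambda>p. q p - q' p)\<bar> \<le> e"
    unfolding diff by (rule order_trans[OF I(4)[OF E Es] ke])
  qed
 qed
 then show "(\<lambda>n. S (h n) q) ----> diag_int q" by (rule LIM_zero_cancel)
qed

lemma integral_N_lborel:
 fixes f :: "real => real"
 assumes "f \<in> borel_measurable borel"
 shows "(LINT s|N. f s) = (LINT s|lborel. indicator {0<..<R} s * f s)"
proof -
 have "(LINT s|N. f s) = (LINT s|N. indicator {0<..<R} s * f s)"
  by (rule Bochner_Integration.integral_cong) (simp_all add: indicator_def)
 also have "\<dots> = (LINT s|lborel. indicator {0<..<R} s * f s)"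
  by (rule integral_lebesgue_on_lborel) (use assms in \<open>simp_all add: indicator_def\<close>)
 finally show ?thesis .
qed

text \<open>Here \<open>q1\<close> and \<open>q2\<close> are, in integrated form, the derivatives of
  \<open>F\<close> in its first and second argument. Integrating \<open>q1\<close> in
  \<open>s\<close> and \<open>q2\<close> in \<open>t\<close> across the strip leaves boundary
  values: those on the diagonal, F(t, t), and those on the other edge, F(s, s + h), occur twice with
  opposite signs. Only averages of F(T, .) and F(0, .) over intervals of length \<open>h\<close>
  remain.\<close>

lemma strip_telescope:
 fixes F :: "real => real => real"
 assumes Fm: "(\<lambda>p. F (fst p) (snd p)) \<in> borel_measurable (borel \<Otimes>\<^sub>M borel)" and FB: "\<And>s t. \<bar>F s t\<bar> \<le> B"
  and h: "0 < h" "h < R - T"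
  and q1: "integrable N2 (\<lambda>p. indicator (strip h) p * q1 p)"
   "AE t in N. \<forall>a b. 0 \<le> a \<longrightarrow> a \<le> b \<longrightarrow> b < R \<longrightarrow> (LINT s|N. indicator {a<..<b} s * q1 (s, t)) = F b t - F a t"
  and q2: "integrable N2 (\<lambda>p. indicator (strip h) p * q2 p)"
   "AE s in N. \<forall>a b. 0 \<le> a \<longrightarrow> a \<le> b \<longrightarrow> b < R \<longrightarrow> (LINT t|N. indicator {a<..<b} t * q2 (s, t)) = F s b - F s a"
 shows "S h q1 + S h q2 = (1 / h) * (LINT t|lborel. indicator {T<..<T + h} t * F T t) - (1 / h) * (LINT t|lborel. indicator {0<..<0 + h} t * F 0 t)"
proof -
 interpret P: pair_sigma_finite N N by (rule pair_N)
 have Fc: "(\<lambda>t. F (f t) (g t)) \<in> borel_measurable borel"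
  if "f \<in> borel_measurable borel" "g \<in> borel_measurable borel" for f g :: "real => real"
  using measurable_compose[OF measurable_Pair[OF that] Fm] by simp
 have ib: "integrable lborel (\<lambda>t. indicator {a<..<b} t * F (f t) (g t))"
  if "f \<in> borel_measurable borel" "g \<in> borel_measurable borel" for f g :: "real => real" and a b
 proof (rule Bochner_Integration.integrable_bound)
  show "integrable lborel (\<lambda>t. indicator {a<..<b} t * B)"
   by (intro integrable_mult_left integrable_real_indicator) (cases "a \<le> b"; simp)+
  show "AE t in lborel. norm (indicator {a<..<b} t * F (f t) (g t)) \<le> norm (indicator {a<..<b} t * B)"
   by (rule AE_I2) (use FB order_trans[OF FB abs_ge_self] in \<open>simp add: indicator_def\<close>)
  show "(\<lambda>t. indicator {a<..<b} t * F (f t) (g t)) \<in> borel_measurable lborel"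
   using Fc[OF that] by simp
 qed
 \<comment> \<open>For fixed \<open>t\<close> the section of the strip is max 0 (t - h) < s < min t
   T, which is empty for t \<ge> T + h; for fixed s < T it is s < t < s + h.\<close>
 let ?G1 = "\<lambda>t. indicator {..<T + h} t * (F (min t T) t - F (max 0 (t - h)) t)"
 let ?G2 = "\<lambda>s. indicator {..<T} s * (F s (s + h) - F s s)"
 have m1: "?G1 \<in> borel_measurable borel"
  by (intro borel_measurable_times borel_measurable_diff Fc) simp_all
 have m2: "?G2 \<in> borel_measurable borel"
  by (intro borel_measurable_times borel_measurable_diff Fc) simp_all
 have "(LINT p|N2. indicator (strip h) p * q1 p) = (LINT t|N. \<integral>s. indicator (strip h) (s, t) * q1 (s, t) \<partial>N)"
  using P.integral_snd[of "\<lambda>s t. indicator (strip h) (s, t) * q1 (s, t)"] q1(1) by (simp add: case_prod_unfold)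
 also have "\<dots> = (LINT t|N. ?G1 t)"
 proof (rule integral_cong_AE)
  show "(\<lambda>t. \<integral>s. indicator (strip h) (s, t) * q1 (s, t) \<partial>N) \<in> borel_measurable N"
   using P.integrable_snd[of "\<lambda>s t. indicator (strip h) (s, t) * q1 (s, t)"] q1(1)
   by (simp add: case_prod_unfold borel_measurable_integrable)
  show "?G1 \<in> borel_measurable N" by (rule borel_N[OF m1])
  have "AE t in N. t \<in> {0<..<R}" by (rule AE_I2) simp
  with q1(2) show "AE t in N. (LINT s|N. indicator (strip h) (s, t) * q1 (s, t)) = ?G1 t"
  proof eventually_elim
   case (elim t)
   have e: "(LINT s|N. indicator (strip h) (s, t) * q1 (s, t)) =
     (LINT s|N. indicator {max 0 (t - h)<..<min t T} s * q1 (s, t))"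
    by (rule Bochner_Integration.integral_cong) (auto simp: strip_def indicator_def)
   show ?case
   proof (cases "t < T + h")
    case True
    have "0 \<le> max 0 (t - h)" "max 0 (t - h) \<le> min t T" "min t T < R"
     using elim(2) True h T by auto
    then have "(LINT s|N. indicator {max 0 (t - h)<..<min t T} s * q1 (s, t)) = F (min t T) t - F (max 0 (t - h)) t"
     using elim(1) by blast
    then show ?thesis using e True by simp
   next
    case False
    then have "{max 0 (t - h)<..<min t T} = {}" by auto
    then show ?thesis unfolding e using False by simp
   qed
  qed
 qed
 also have "\<dots> = (LINT t|lborel. indicator {0<..<R} t * ?G1 t)" by (rule integral_N_lborel[OF m1])
 also have "\<dots> = (LINT t|lborel. indicator {0<..<T + h} t * F (min t T) t - indicator {0<..<T + h} t * F (max 0 (t - h)) t)"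
  by (rule Bochner_Integration.integral_cong) (use h in \<open>auto simp: indicator_def\<close>)
 also have "\<dots> = (LINT t|lborel. indicator {0<..<T + h} t * F (min t T) t) - (LINT t|lborel. indicator {0<..<T + h} t * F (max 0 (t - h)) t)"
  by (rule Bochner_Integration.integral_diff; rule ib; simp)
 also have "(LINT t|lborel. indicator {0<..<T + h} t * F (min t T) t) =
   (LINT t|lborel. indicator {0<..<T} t * F t t + indicator {T<..<T + h} t * F T t)"
 proof (rule integral_cong_AE)
  show "(\<lambda>t. indicator {0<..<T + h} t * F (min t T) t) \<in> borel_measurable lborel"
   by (rule borel_measurable_integrable[OF ib]) simp_all
  show "(\<lambda>t. indicator {0<..<T} t * F t t + indicator {T<..<T + h} t * F T t) \<in> borel_measurable lborel"
   by (intro borel_measurable_add borel_measurable_integrable[OF ib]) simp_all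
  have "AE t in lborel. t \<noteq> T" by (rule AE_lborel_singleton)
  then show "AE t in lborel. indicator {0<..<T + h} t * F (min t T) t = indicator {0<..<T} t * F t t + indicator {T<..<T + h} t * F T t"
   by eventually_elim (use T h in \<open>auto simp: indicator_def min_def\<close>)
 qed
 also have "\<dots> = (LINT t|lborel. indicator {0<..<T} t * F t t) + (LINT t|lborel. indicator {T<..<T + h} t * F T t)"
  by (rule Bochner_Integration.integral_add; rule ib; simp)
 also have "(LINT t|lborel. indicator {0<..<T + h} t * F (max 0 (t - h)) t) =
   (LINT t|lborel. indicator {0<..<0 + h} t * F 0 t + indicator {h<..<T + h} t * F (t - h) t)"
 proof (rule integral_cong_AE)
  show "(\<lambda>t. indicator {0<..<T + h} t * F (max 0 (t - h)) t) \<in> borel_measurable lborel"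
   by (rule borel_measurable_integrable[OF ib]) simp_all
  show "(\<lambda>t. indicator {0<..<0 + h} t * F 0 t + indicator {h<..<T + h} t * F (t - h) t) \<in> borel_measurable lborel"
   by (intro borel_measurable_add borel_measurable_integrable[OF ib]) simp_all
  have "AE t in lborel. t \<noteq> h" by (rule AE_lborel_singleton)
  then show "AE t in lborel. indicator {0<..<T + h} t * F (max 0 (t - h)) t =
    indicator {0<..<0 + h} t * F 0 t + indicator {h<..<T + h} t * F (t - h) t"
   by eventually_elim (use T h in \<open>auto simp: indicator_def max_def\<close>)
 qed
 also have "\<dots> = (LINT t|lborel. indicator {0<..<0 + h} t * F 0 t) + (LINT t|lborel. indicator {h<..<T + h} t * F (t - h) t)"
  by (rule Bochner_Integration.integral_add; rule ib; simp)
 \<comment> \<open>The shift t = s + h brings this term into the form in which it cancels against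
   the contribution of \<open>q2\<close>.\<close>
 also have "(LINT t|lborel. indicator {h<..<T + h} t * F (t - h) t) = (LINT s|lborel. indicator {0<..<T} s * F s (s + h))"
 proof -
  have "(LINT t|lborel. indicator {h<..<T + h} t * F (t - h) t) =
    (LINT s|lborel. indicator {h<..<T + h} (h + 1 * s) * F (h + 1 * s - h) (h + 1 * s))"
   using lborel_integral_real_affine[of 1 "\<lambda>t. indicator {h<..<T + h} t * F (t - h) t" h] by simp
  also have "\<dots> = (LINT s|lborel. indicator {0<..<T} s * F s (s + h))"
   by (rule Bochner_Integration.integral_cong) (auto simp: indicator_def add.commute)
  finally show ?thesis .
 qed
 finally have e1: "(LINT p|N2. indicator (strip h) p * q1 p) =
   (LINT t|lborel. indicator {0<..<T} t * F t t) + (LINT t|lborel. indicator {T<..<T + h} t * F T t) -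
   ((LINT t|lborel. indicator {0<..<0 + h} t * F 0 t) + (LINT s|lborel. indicator {0<..<T} s * F s (s + h)))" .
 have "(LINT p|N2. indicator (strip h) p * q2 p) = (LINT s|N. \<integral>t. indicator (strip h) (s, t) * q2 (s, t) \<partial>N)"
  using P.integral_fst'[OF q2(1)] by simp
 also have "\<dots> = (LINT s|N. ?G2 s)"
 proof (rule integral_cong_AE)
  show "(\<lambda>s. \<integral>t. indicator (strip h) (s, t) * q2 (s, t) \<partial>N) \<in> borel_measurable N"
   using P.integrable_fst'[OF q2(1)] by (rule borel_measurable_integrable)
  show "?G2 \<in> borel_measurable N" by (rule borel_N[OF m2])
  have "AE s in N. s \<in> {0<..<R}" by (rule AE_I2) simp
  with q2(2) show "AE s in N. (LINT t|N. indicator (strip h) (s, t) * q2 (s, t)) = ?G2 s"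
  proof eventually_elim
   case (elim s)
   show ?case
   proof (cases "s < T")
    case True
    have e: "(LINT t|N. indicator (strip h) (s, t) * q2 (s, t)) = (LINT t|N. indicator {s<..<s + h} t * q2 (s, t))"
     by (rule Bochner_Integration.integral_cong) (use True in \<open>auto simp: strip_def indicator_def\<close>)
    have "0 \<le> s" "s \<le> s + h" "s + h < R" using elim(2) True h by auto
    then have "(LINT t|N. indicator {s<..<s + h} t * q2 (s, t)) = F s (s + h) - F s s"
     using elim(1) by blast
    then show ?thesis using e True by simp
   next
    case False
    have "(LINT t|N. indicator (strip h) (s, t) * q2 (s, t)) = (LINT t|N. 0)"
     by (rule Bochner_Integration.integral_cong) (use False in \<open>auto simp: strip_def indicator_def\<close>)
    then show ?thesis using False by simp
   qed
  qed
 qed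
 also have "\<dots> = (LINT s|lborel. indicator {0<..<R} s * ?G2 s)" by (rule integral_N_lborel[OF m2])
 also have "\<dots> = (LINT s|lborel. indicator {0<..<T} s * F s (s + h) - indicator {0<..<T} s * F s s)"
  by (rule Bochner_Integration.integral_cong) (use T in \<open>auto simp: indicator_def\<close>)
 also have "\<dots> = (LINT s|lborel. indicator {0<..<T} s * F s (s + h)) - (LINT s|lborel. indicator {0<..<T} s * F s s)"
  by (rule Bochner_Integration.integral_diff; rule ib; simp)
 finally have e2: "(LINT p|N2. indicator (strip h) p * q2 p) =
   (LINT s|lborel. indicator {0<..<T} s * F s (s + h)) - (LINT s|lborel. indicator {0<..<T} s * F s s)" .
 show ?thesis unfolding e1 e2 by (simp add: algebra_simps)
qed

text \<open>The product rule for <f, g> in integrated form, although neither curve has a time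
  derivative in L^2: \<open>K\<close> and \<open>J\<close> represent the derivatives and act on the
  gradients \<open>Dg\<close> and \<open>Df\<close>. The function F(s, t) = <f s, g t> separates the
  two times, so each equation is used with the other curve frozen. Weak continuity suffices to
  evaluate the averages at both ends.\<close>

lemma lions_magenes:
 fixes f g :: "real => 'a::euclidean_space => 'b::euclidean_space" and K Dg J Df :: "real => 'a => 'c::euclidean_space"
 assumes \<Omega>: "\<Omega> \<in> lmeasurable"
  and f: "\<And>t. sq_int (lebesgue_on \<Omega>) (f t)" "\<And>w. sq_int (lebesgue_on \<Omega>) w ==> continuous_on UNIV (\<lambda>t. ip (lebesgue_on \<Omega>) (f t) w)"
   "\<And>t. nrm (lebesgue_on \<Omega>) (f t) \<le> Bf"
  and g: "\<And>t. sq_int (lebesgue_on \<Omega>) (g t)" "\<And>w. sq_int (lebesgue_on \<Omega>) w ==> continuous_on UNIV (\<lambda>t. ip (lebesgue_on \<Omega>) (g t) w)"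
   "\<And>t. nrm (lebesgue_on \<Omega>) (g t) \<le> Bg"
  and K: "wmeas N (lebesgue_on \<Omega>) K" "\<And>t. sq_int (lebesgue_on \<Omega>) (K t)" "integrable N (\<lambda>t. (nrm (lebesgue_on \<Omega>) (K t))\<^sup>2)"
  and Dg: "wmeas N (lebesgue_on \<Omega>) Dg" "\<And>t. sq_int (lebesgue_on \<Omega>) (Dg t)" "integrable N (\<lambda>t. (nrm (lebesgue_on \<Omega>) (Dg t))\<^sup>2)"
  and J: "wmeas N (lebesgue_on \<Omega>) J" "\<And>t. sq_int (lebesgue_on \<Omega>) (J t)" "integrable N (\<lambda>t. (nrm (lebesgue_on \<Omega>) (J t))\<^sup>2)"
  and Df: "wmeas N (lebesgue_on \<Omega>) Df" "\<And>t. sq_int (lebesgue_on \<Omega>) (Df t)" "integrable N (\<lambda>t. (nrm (lebesgue_on \<Omega>) (Df t))\<^sup>2)"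
  and eq1: "AE t in N. \<forall>a b. 0 \<le> a \<longrightarrow> a \<le> b \<longrightarrow> b < R \<longrightarrow>
   (LINT s|N. indicator {a<..<b} s * ip (lebesgue_on \<Omega>) (K s) (Dg t)) = ip (lebesgue_on \<Omega>) (f b) (g t) - ip (lebesgue_on \<Omega>) (f a) (g t)"
  and eq2: "AE s in N. \<forall>a b. 0 \<le> a \<longrightarrow> a \<le> b \<longrightarrow> b < R \<longrightarrow>
   (LINT t|N. indicator {a<..<b} t * ip (lebesgue_on \<Omega>) (Df s) (J t)) = ip (lebesgue_on \<Omega>) (f s) (g b) - ip (lebesgue_on \<Omega>) (f s) (g a)"
 shows "ip (lebesgue_on \<Omega>) (f T) (g T) - ip (lebesgue_on \<Omega>) (f 0) (g 0) =
  diag_int (\<lambda>p. ip (lebesgue_on \<Omega>) (K (fst p)) (Dg (snd p))) + diag_int (\<lambda>p. ip (lebesgue_on \<Omega>) (Df (fst p)) (J (snd p)))"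
proof -
 let ?M = "lebesgue_on \<Omega>"
 define F where "F s t = ip ?M (f s) (g t)" for s t
 \<comment> \<open>A null sequence strictly below R - T; the summand 2 ensures this already for n =
   0.\<close>
 define h where "h n = (R - T) / (real n + 2)" for n
 have h: "0 < h n" "h n < R - T" for n
 proof -
  show "0 < h n" using T by (simp add: h_def)
  have "(R - T) * 1 < (R - T) * (real n + 2)" using T by (intro mult_strict_left_mono) simp_all
  then show "h n < R - T" by (simp add: h_def divide_less_eq)
 qed
 have h0: "h ----> 0"
 proof -
  have "(\<lambda>n. (R - T) / real (n + 2)) ----> 0" by (rule LIMSEQ_ignore_initial_segment[OF lim_const_over_n])
  then show ?thesis by (simp add: h_def[abs_def] add.commute)
 qed
 have wf: "wmeas borel ?M f" and wg: "wmeas borel ?M g"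
  unfolding wmeas_def using borel_measurable_continuous_onI[OF f(2)] borel_measurable_continuous_onI[OF g(2)] by blast+
 have Fm: "(\<lambda>p. F (fst p) (snd p)) \<in> borel_measurable (borel \<Otimes>\<^sub>M borel)"
  unfolding F_def by (rule ip_pair_measurable[OF \<Omega> wf f(1) wg g(1)])
 have FB: "\<bar>F s t\<bar> \<le> Bf * Bg" for s t
  unfolding F_def
  by (rule order_trans[OF CS_inner[OF f(1) g(1)]], rule mult_mono[OF f(3) g(3)])
    (auto intro: order_trans[OF nrm_nonneg f(3)] nrm_nonneg)
 note p1 = steklov_pairing[OF \<Omega> K Dg h h0] and p2 = steklov_pairing[OF \<Omega> Df J h h0]
 let ?q1 = "\<lambda>p. ip ?M (K (fst p)) (Dg (snd p))" and ?q2 = "\<lambda>p. ip ?M (Df (fst p)) (J (snd p))"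
 have tel: "S (h n) ?q1 + S (h n) ?q2 = (1 / h n) * (LINT t|lborel. indicator {T<..<T + h n} t * F T t)
   - (1 / h n) * (LINT t|lborel. indicator {0<..<0 + h n} t * F 0 t)" for n
  by (rule strip_telescope[OF Fm FB h p1(1)[OF h(1)] _ p2(1)[OF h(1)]])
    (use eq1 eq2 in \<open>simp_all add: F_def\<close>)
 have cF: "continuous_on UNIV (F s)" for s
  using g(2)[OF f(1), of s] unfolding F_def[abs_def] by (simp only: ip_commute[of ?M "f s"])
 have "(\<lambda>n. S (h n) ?q1 + S (h n) ?q2) ----> F T T - F 0 0"
  unfolding tel by (intro tendsto_diff average_tendsto cF h h0)
 from LIMSEQ_unique[OF this tendsto_add[OF p1(3) p2(3)]] show ?thesis by (simp only: F_def)
qed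

end

lemma integrable_lebesgue_on_subset:
 fixes f :: "'a::euclidean_space => real"
 assumes f: "integrable (lebesgue_on B) f" and A: "A \<subseteq> B" "A \<in> sets lebesgue" "B \<in> sets lebesgue"
 shows "integrable (lebesgue_on A) f"
proof -
 have "set_integrable lebesgue A f"
  by (rule set_integrable_subset[of _ B]) (use f A in \<open>simp_all add: set_integrable_def integrable_restrict_space\<close>)
 then show ?thesis using A by (simp add: set_integrable_def integrable_restrict_space)
qed

section \<open>The weak formulation in time and Gronwall's inequality\<close>

lemma smooth_step_deriv:
 obtains d B where "continuous_on UNIV d" "\<And>x. (smooth_step has_real_derivative d x) (at x)"
  "\<And>x. x < 0 \<or> 1 < x ==> d x = 0" "\<And>x. \<bar>d x\<bar> \<le> B"
proof -
 let ?d = "\<lambda>x. frechet_derivative smooth_step (at x) (1::real)"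
 have c: "continuous_on UNIV ?d"
  by (rule smooth_continuous_on[OF smooth_frechet_derivative[OF smooth_smooth_step]])
 have h: "(smooth_step has_real_derivative ?d x) (at x)" for x
 proof (rule has_derivative_imp_has_field_derivative[OF smooth_has_derivative[OF smooth_smooth_step]])
  fix y
  have "linear (frechet_derivative smooth_step (at x))"
   by (rule has_derivative_linear[OF smooth_has_derivative[OF smooth_smooth_step]])
  from linear_scale[OF this, of y 1] show "y * ?d x = frechet_derivative smooth_step (at x) y" by simp
 qed
 have z: "?d x = 0" if x: "x < 0 \<or> 1 < x" for x
 proof -
  obtain S c where S: "open S" "x \<in> S" "\<And>y. y \<in> S ==> c = smooth_step y"
  proof (cases "x < 0")
   case True
   show ?thesis by (rule that[of "{..<0}" 0]) (use True in \<open>simp_all add: smooth_step_eq_0\<close>)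
  next
   case False
   show ?thesis by (rule that[of "{1<..}" 1]) (use False x in \<open>simp_all add: smooth_step_eq_1\<close>)
  qed
  have "(smooth_step has_real_derivative 0) (at x)"
   by (rule has_field_derivative_transform_within_open[OF DERIV_const S])
  from DERIV_unique[OF h this] show ?thesis .
 qed
 have "compact (?d ` {0..1})"
  by (rule compact_continuous_image[OF continuous_on_subset[OF c]]) simp_all
 then have "bounded (?d ` {0..1})" by (rule compact_imp_bounded)
 then obtain B where B: "\<And>x. x \<in> {0..1} ==> \<bar>?d x\<bar> \<le> B"
  unfolding bounded_iff by force
 have "\<bar>?d x\<bar> \<le> \<bar>B\<bar>" for x
  using B[of x] z[of x] by (cases "x \<in> {0..1}") auto
 with c h z show ?thesis by (rule that)
qed

text \<open>The cutoffs \<eta>_k equal 1 up to \<open>T\<close> and descend to 0 within a time e_k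
  after \<open>T\<close>, so their negative derivatives form an approximate identity to the right of
  \<open>T\<close>. Placing the descent after \<open>T\<close> requires continuity from the right
  only; thus T = 0 is included and yields g 0 = g0.\<close>

lemma weak_time_derivative:
 fixes g n :: "real => real"
 assumes g: "continuous_on {0..} g" and n: "\<And>R. integrable (lebesgue_on {0<..<R}) n"
  and w: "\<And>\<eta> \<eta>' R. smooth_on \<eta> UNIV ==> (\<And>t. (\<eta> has_real_derivative \<eta>' t) (at t)) ==> (\<And>t. R \<le> t ==> \<eta> t = 0) ==>
   (LINT t|lebesgue_on {0<..}. - (\<eta>' t * g t) - \<eta> t * n t) = \<eta> 0 * g0"
  and T: "0 \<le> T"
 shows "g T = g0 + (LINT t|lebesgue_on {0<..<T}. n t)"
proof -
 obtain d B where d: "continuous_on UNIV d" "\<And>x. (smooth_step has_real_derivative d x) (at x)"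
  "\<And>x. x < 0 \<or> 1 < x ==> d x = 0" "\<And>x. \<bar>d x\<bar> \<le> B"
  by (rule smooth_step_deriv) (rule that)
 have B: "0 \<le> B" using d(4)[of 0] by simp
 define e where "e k = 1 / real (Suc k)" for k
 have e: "0 < e k" "e k \<le> 1" for k by (simp_all add: e_def)
 have e0: "e ----> 0" unfolding e_def[abs_def] by (rule LIMSEQ_Suc[OF lim_const_over_n])
 define \<eta> where "\<eta> k t = smooth_step ((T + e k - t) / e k)" for k t
 define \<eta>' where "\<eta>' k t = - (d ((T + e k - t) / e k) / e k)" for k t
 \<comment> \<open>Since e_k \<le> 1, all cutoffs vanish from T + 2 on; the locale supplies the
   facts about this bounded interval.\<close>
 interpret ts: time_strip "T + 1" "T + 2" by unfold_locales (use T in simp_all)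
 let ?N = "lebesgue_on {0<..<T + 2}"
 have \<eta>s: "smooth_on (\<eta> k) UNIV" for k
 proof -
  have "(T + e k - t) / e k = - 1 / e k * t + (T + e k) / e k" for t using e[of k] by (simp add: field_simps)
  then show ?thesis
   unfolding \<eta>_def using smooth_comp_affine[OF bounded_linear_mult_right[of "- 1 / e k"] smooth_smooth_step] by presburger
 qed
 have \<eta>d: "(\<eta> k has_real_derivative \<eta>' k t) (at t)" for k t
 proof -
  have "((\<lambda>t. (T + e k - t) / e k) has_real_derivative (- 1 / e k)) (at t)"
   using e(1)[of k] by (auto intro!: derivative_eq_intros simp: power2_eq_square)
  from DERIV_chain2[OF d(2) this] show ?thesis unfolding \<eta>_def \<eta>'_def by simp
 qed
 have \<eta>c: "continuous_on UNIV (\<eta> k)" for k by (rule smooth_continuous_on[OF \<eta>s])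
 have \<eta>'c: "continuous_on UNIV (\<eta>' k)" for k
  unfolding \<eta>'_def by (intro continuous_intros continuous_on_compose2[OF d(1)]) (simp_all add: e_def)
 have \<eta>1: "\<eta> k t = 1" if "t \<le> T" for k t
  unfolding \<eta>_def by (rule smooth_step_eq_1) (use that e(1)[of k] in \<open>simp add: le_divide_eq\<close>)
 have \<eta>0: "\<eta> k t = 0" if "T + e k \<le> t" for k t
  unfolding \<eta>_def by (rule smooth_step_eq_0) (use that e[of k] in \<open>simp add: divide_le_eq\<close>)
 have \<eta>b: "\<bar>\<eta> k t\<bar> \<le> 1" for k t
  unfolding \<eta>_def using smooth_step_nonneg smooth_step_le_1 by (simp add: abs_le_iff)
 have \<eta>'0: "\<eta>' k t = 0" if "t < T \<or> T + e k < t" for k t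
 proof -
  have "(T + e k - t) / e k < 0 \<or> 1 < (T + e k - t) / e k"
   using that e(1)[of k] by (simp add: less_divide_eq divide_less_0_iff) linarith
  then show ?thesis unfolding \<eta>'_def by (simp add: d(3))
 qed
 have \<eta>'b: "\<bar>\<eta>' k t\<bar> \<le> B / e k" for k t
  unfolding \<eta>'_def using d(4) e(1)[of k] by (simp add: abs_divide divide_right_mono)
 have gm: "g \<in> borel_measurable ?N"
  by (rule continuous_imp_measurable_on_sets_lebesgue[OF continuous_on_subset[OF g]]) auto
 have gb: "\<exists>G. \<forall>t\<in>{0..T + 2}. \<bar>g t\<bar> \<le> G"
 proof -
  have "compact (g ` {0..T + 2})"
   by (rule compact_continuous_image[OF continuous_on_subset[OF g]]) auto
  from compact_imp_bounded[OF this] show ?thesis unfolding bounded_iff by force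
 qed
 obtain G where G: "\<And>t. t \<in> {0..T + 2} ==> \<bar>g t\<bar> \<le> G" using gb by blast
 have mc: "f \<in> borel_measurable ?N" if "continuous_on UNIV f" for f :: "real => real"
  by (rule ts.borel_N[OF borel_measurable_continuous_onI[OF that]])
 have i1: "integrable ?N (\<lambda>t. \<eta>' k t * g t)" for k
 proof (rule finite_measure.integrable_const_bound[OF ts.finite_N, where B = "B / e k * G"])
  show "AE t in ?N. norm (\<eta>' k t * g t) \<le> B / e k * G"
  proof (rule AE_I2)
   fix t assume "t \<in> space ?N"
   then have "\<bar>g t\<bar> \<le> G" by (intro G) simp
   then show "norm (\<eta>' k t * g t) \<le> B / e k * G"
    unfolding real_norm_def abs_mult using B e(1)[of k] by (intro mult_mono \<eta>'b) simp_all
  qed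
  show "(\<lambda>t. \<eta>' k t * g t) \<in> borel_measurable ?N" by (intro borel_measurable_times mc gm \<eta>'c)
 qed
 have i2: "integrable ?N (\<lambda>t. \<eta>' k t * c)" for k c
 proof (rule finite_measure.integrable_const_bound[OF ts.finite_N, where B = "B / e k * \<bar>c\<bar>"])
  show "AE t in ?N. norm (\<eta>' k t * c) \<le> B / e k * \<bar>c\<bar>"
   unfolding real_norm_def abs_mult by (rule AE_I2, rule mult_right_mono[OF \<eta>'b]) simp
  show "(\<lambda>t. \<eta>' k t * c) \<in> borel_measurable ?N" by (intro borel_measurable_times mc \<eta>'c continuous_on_const)
 qed
 have i3: "integrable ?N (\<lambda>t. \<eta> k t * n t)" for k
 proof (rule Bochner_Integration.integrable_bound[OF n[of "T + 2"]])
  show "(\<lambda>t. \<eta> k t * n t) \<in> borel_measurable ?N"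
   by (intro borel_measurable_times mc \<eta>c borel_measurable_integrable[OF n])
  show "AE t in ?N. norm (\<eta> k t * n t) \<le> norm (n t)"
   by (rule AE_I2) (use mult_right_mono[OF \<eta>b abs_ge_zero] in \<open>simp add: abs_mult\<close>)
 qed
 have eq: "g0 = (LINT t|?N. - (\<eta>' k t * g t)) - (LINT t|?N. \<eta> k t * n t)" for k
 proof -
  let ?\<phi> = "\<lambda>t. - (\<eta>' k t * g t) - \<eta> k t * n t"
  have v: "\<eta> k t = 0" if "T + 2 \<le> t" for t by (rule \<eta>0) (use that e[of k] in linarith)
  have z: "?\<phi> t = 0" if "T + 2 \<le> t" for t
   using v[OF that] \<eta>'0[of t k] that e(2)[of k] by simp
  have "g0 = (LINT t|lebesgue_on {0<..}. ?\<phi> t)"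
   using w[OF \<eta>s \<eta>d v] \<eta>1[of 0] T by simp
  also have "\<dots> = (LINT t|lebesgue_on {0<..}. indicator {0<..<T + 2} t * ?\<phi> t)"
  proof (rule Bochner_Integration.integral_cong[OF refl])
   fix t :: real assume "t \<in> space (lebesgue_on {0<..})"
   then have "0 < t" by simp
   then show "?\<phi> t = indicator {0<..<T + 2} t * ?\<phi> t"
    using z[of t] by (cases "t < T + 2") simp_all
  qed
  also have "\<dots> = (LINT t|?N. ?\<phi> t)" by (rule integral_lebesgue_on_subset) auto
  also have "\<dots> = (LINT t|?N. - (\<eta>' k t * g t)) - (LINT t|?N. \<eta> k t * n t)"
   by (rule Bochner_Integration.integral_diff) (use i1 i3 in simp_all)
  finally show ?thesis .
 qed
 have one: "(LINT t|?N. - \<eta>' k t) = 1" for k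
 proof -
  have "(LINT t|?N. - \<eta>' k t) = (LINT t|lborel. indicator {0<..<T + 2} t * - \<eta>' k t)"
   by (rule ts.integral_N_lborel, rule borel_measurable_continuous_onI) (intro continuous_intros \<eta>'c)
  also have "\<dots> = (LINT t|lborel. indicator {0..T + 2} t *\<^sub>R - \<eta>' k t)"
  proof (rule integral_cong_AE)
   have [measurable]: "\<eta>' k \<in> borel_measurable borel" by (rule borel_measurable_continuous_onI[OF \<eta>'c])
   show "(\<lambda>t. indicator {0<..<T + 2} t * - \<eta>' k t) \<in> borel_measurable lborel" by measurable
   show "(\<lambda>t. indicator {0..T + 2} t *\<^sub>R - \<eta>' k t) \<in> borel_measurable lborel" by measurable
   have "AE t in lborel. t \<noteq> 0" "AE t in lborel. t \<noteq> T + 2" by (rule AE_lborel_singleton)+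
   then show "AE t in lborel. indicator {0<..<T + 2} t * - \<eta>' k t = indicator {0..T + 2} t *\<^sub>R - \<eta>' k t"
    by eventually_elim (auto simp: indicator_def)
  qed
  also have "\<dots> = - \<eta> k (T + 2) - - \<eta> k 0"
  proof (rule integral_FTC_atLeastAtMost)
   show "((\<lambda>t. - \<eta> k t) has_vector_derivative - \<eta>' k t) (at t within {0..T + 2})" for t
    using \<eta>d has_real_derivative_iff_has_vector_derivative[of "\<eta> k" "\<eta>' k t" "at t"]
    by (intro has_vector_derivative_minus) (blast intro: has_vector_derivative_at_within)
   show "continuous_on {0..T + 2} (\<lambda>t. - \<eta>' k t)" by (intro continuous_intros continuous_on_subset[OF \<eta>'c]) simp
  qed (use T in simp)
  also have "\<dots> = 1" using \<eta>0[of k "T + 2"] \<eta>1[of 0 k] e(2)[of k] T by simp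
  finally show ?thesis .
 qed
 have "(\<lambda>k. (LINT t|?N. - (\<eta>' k t * g t))) ----> g T"
 proof (rule LIMSEQ_I)
  fix r :: real assume r: "r > 0"
  \<comment> \<open>As |\<eta>'| \<le> B / e_k on an interval of length e_k, an oscillation of
    \<open>g\<close> by at most \<open>q\<close> contributes no more than B q, which is below
    \<open>r\<close>.\<close>
  define q where "q = r / (2 * (B + 1))"
  have q: "q > 0" "B * q < r" using r B by (simp_all add: q_def divide_less_eq)
  obtain \<delta> where \<delta>: "\<delta> > 0" "\<And>t. 0 \<le> t ==> \<bar>t - T\<bar> < \<delta> ==> \<bar>g t - g T\<bar> < q"
   using g q(1) T unfolding continuous_on_iff dist_real_def by (metis atLeast_iff)
  obtain k0 where k0: "\<forall>k\<ge>k0. e k < \<delta>" using tendsto_zero_less[OF e0 \<delta>(1)] by blast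
  have "norm ((LINT t|?N. - (\<eta>' k t * g t)) - g T) < r" if k: "k \<ge> k0" for k
  proof -
   let ?i = "\<lambda>t. indicator {T..T + e k} t * (B / e k * q) :: real"
   have "(LINT t|?N. - (\<eta>' k t * g t)) = - (LINT t|?N. \<eta>' k t * g t)" by simp
   moreover have "(LINT t|?N. \<eta>' k t * g T) = - g T" using one[of k] by simp
   ultimately have "(LINT t|?N. - (\<eta>' k t * g t)) - g T = - ((LINT t|?N. \<eta>' k t * g t) - (LINT t|?N. \<eta>' k t * g T))" by simp
   also have "\<dots> = - (LINT t|?N. \<eta>' k t * g t - \<eta>' k t * g T)"
    by (simp only: Bochner_Integration.integral_diff[OF i1 i2])
   finally have e1: "norm ((LINT t|?N. - (\<eta>' k t * g t)) - g T) = \<bar>\<integral>t. \<eta>' k t * g t - \<eta>' k t * g T \<partial>?N\<bar>" by simp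
   have mI: "measure ?N ({T..T + e k} \<inter> {0<..<T + 2}) \<le> e k"
   proof -
    have "measure ?N ({T..T + e k} \<inter> {0<..<T + 2}) = measure lebesgue ({T..T + e k} \<inter> {0<..<T + 2})"
     by (rule measure_restrict_space) simp_all
    also have "\<dots> \<le> measure lebesgue {T..T + e k}"
     by (rule measure_mono_fmeasurable) simp_all
    also have "\<dots> = e k" using e[of k] by simp
    finally show ?thesis .
   qed
   have ii: "integrable ?N ?i"
    by (intro integrable_mult_left finite_measure.integrable_const_bound[OF ts.finite_N, where B = 1])
      (auto simp: indicator_def intro!: AE_I2 ts.borel_N)
   have "\<bar>\<integral>t. \<eta>' k t * g t - \<eta>' k t * g T \<partial>?N\<bar> \<le> (LINT t|?N. \<bar>\<eta>' k t * g t - \<eta>' k t * g T\<bar>)"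
    by (rule integral_abs_bound)
   also have "\<dots> \<le> (LINT t|?N. ?i t)"
   proof (rule integral_mono[OF integrable_abs[OF Bochner_Integration.integrable_diff[OF i1 i2]] ii])
    fix t assume "t \<in> space ?N"
    then have t0: "0 \<le> t" by simp
    show "\<bar>\<eta>' k t * g t - \<eta>' k t * g T\<bar> \<le> ?i t"
    proof (cases "t \<in> {T..T + e k}")
     case True
     then have "\<bar>g t - g T\<bar> \<le> q" using \<delta>(2)[OF t0] k0 k by force
     then have "\<bar>\<eta>' k t\<bar> * \<bar>g t - g T\<bar> \<le> B / e k * q"
      using \<eta>'b B e(1)[of k] by (intro mult_mono) simp_all
     then show ?thesis using True by (simp add: abs_mult[symmetric] right_diff_distrib)
    next
     case False
     then have "\<eta>' k t = 0" by (intro \<eta>'0) auto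
     then show ?thesis using False by simp
    qed
   qed
   also have "\<dots> = measure ?N ({T..T + e k} \<inter> {0<..<T + 2}) * (B / e k * q)" by simp
   also have "\<dots> \<le> e k * (B / e k * q)"
    using mI B q e(1)[of k] by (intro mult_right_mono) simp_all
   also have "\<dots> = B * q" using e(1)[of k] by simp
   finally show ?thesis using e1 q(2) by linarith
  qed
  then show "\<exists>k0. \<forall>k\<ge>k0. norm ((LINT t|?N. - (\<eta>' k t * g t)) - g T) < r" by blast
 qed
 moreover have "(\<lambda>k. (LINT t|?N. \<eta> k t * n t)) ----> (LINT t|?N. indicator {..T} t * n t)"
 proof (rule integral_dominated_convergence[where w = "\<lambda>t. \<bar>n t\<bar>"])
  show "AE t in ?N. (\<lambda>k. \<eta> k t * n t) ----> indicator {..T} t * n t"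
  proof (rule AE_I2)
   fix t
   show "(\<lambda>k. \<eta> k t * n t) ----> indicator {..T} t * n t"
   proof (cases "t \<le> T")
    case True
    then show ?thesis by (simp add: \<eta>1)
   next
    case False
    then have "t - T > 0" by simp
    then obtain k0 where k0: "\<forall>k\<ge>k0. e k < t - T" using tendsto_zero_less[OF e0] by blast
    show ?thesis
    proof (rule tendsto_eventually, rule eventually_sequentiallyI)
     fix k assume "k0 \<le> k"
     then have "\<eta> k t = 0" by (intro \<eta>0) (use k0 in force)
     then show "\<eta> k t * n t = indicator {..T} t * n t" using False by simp
    qed
   qed
  qed
  show "(\<lambda>t. indicator {..T} t * n t) \<in> borel_measurable ?N"
   by (intro borel_measurable_times borel_measurable_integrable[OF n] ts.borel_N) simp
  show "AE t in ?N. norm (\<eta> k t * n t) \<le> \<bar>n t\<bar>" for k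
   by (rule AE_I2) (use mult_right_mono[OF \<eta>b abs_ge_zero] in \<open>simp add: abs_mult\<close>)
 qed (use i3 n in \<open>simp_all add: borel_measurable_integrable\<close>)
 ultimately have "(\<lambda>k. g0) ----> g T - (LINT t|?N. indicator {..T} t * n t)"
  unfolding eq[symmetric] by (rule tendsto_diff[where f = "\<lambda>k. \<integral>t. - (\<eta>' k t * g t) \<partial>?N" and g = "\<lambda>k. \<integral>t. \<eta> k t * n t \<partial>?N", folded eq])
 then have "g0 = g T - (LINT t|?N. indicator {..T} t * n t)" using LIMSEQ_unique tendsto_const by blast
 also have "(LINT t|?N. indicator {..T} t * n t) = (LINT t|?N. indicator {0<..<T} t * n t)"
 proof (rule integral_cong_AE)
  have "AE t in lebesgue. t \<noteq> T" by (rule AE_completion[OF AE_lborel_singleton])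
  then have "AE t in ?N. t \<noteq> T" by (auto simp: AE_restrict_space_iff)
  then show "AE t in ?N. indicator {..T} t * n t = indicator {0<..<T} t * n t"
   by (rule AE_mp, intro AE_I2) (auto simp: indicator_def)
 qed (intro borel_measurable_times borel_measurable_integrable[OF n] ts.borel_N; simp)+
 also have "\<dots> = (LINT t|lebesgue_on {0<..<T}. n t)" by (rule integral_lebesgue_on_subset) auto
 finally show ?thesis by simp
qed

text \<open>Gronwall's inequality without derivatives, as \<open>A\<close> is merely continuous.
  Time is divided by the levels of \<open>A\<close>: going back from \<open>t\<close>, the
  intermediate value theorem finds a time where \<open>A\<close> is lower by \<open>a\<close>, and
  each such step costs a factor 1 - a.\<close>

lemma gronwall_levels:
 fixes c A :: "real => real"
 assumes cont: "continuous_on {0..T} A" and A0: "A 0 = 0"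
  and mono: "\<And>s t. 0 \<le> s ==> s \<le> t ==> t \<le> T ==> A s \<le> A t"
  and c: "\<And>t. 0 \<le> t ==> t \<le> T ==> 0 \<le> c t"
  and step: "\<And>s t. 0 \<le> s ==> s \<le> t ==> t \<le> T ==> c t * (1 - (A t - A s)) \<le> c s"
  and a: "0 \<le> a" "a < 1" and t: "0 \<le> t" "t \<le> T" "A t \<le> real k * a"
 shows "c t * (1 - a) ^ k \<le> c 0"
 using t
proof (induction k arbitrary: t)
 case 0
 then have "A t = 0" using mono[of 0 t] A0 by simp
 then show ?case using step[of 0 t] 0 A0 by simp
next
 case (Suc k)
 \<comment> \<open>The maximum with 0 covers the last step, in which less than \<open>a\<close> is
   left.\<close>
 have "\<exists>s. 0 \<le> s \<and> s \<le> t \<and> A s = max 0 (A t - a)"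
 proof (rule IVT')
  show "continuous_on {0..t} A" using continuous_on_subset[OF cont] Suc.prems by auto
  show "A 0 \<le> max 0 (A t - a)" using A0 by simp
  show "max 0 (A t - a) \<le> A t" using mono[of 0 t] A0 a Suc.prems by simp
 qed (use Suc.prems in simp)
 then obtain s where s: "0 \<le> s" "s \<le> t" "A s = max 0 (A t - a)" by blast
 have ct: "0 \<le> c t" using c Suc.prems by simp
 have "A s \<le> real k * a" using s(3) Suc.prems(3) a by (simp add: algebra_simps)
 then have IH: "c s * (1 - a) ^ k \<le> c 0" using Suc.IH[of s] s Suc.prems by simp
 have "c t * (1 - a) \<le> c t * (1 - (A t - A s))" using s(3) ct by (intro mult_left_mono) simp_all
 also have "\<dots> \<le> c s" by (rule step[OF s(1,2) Suc.prems(2)])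
 finally have "c t * (1 - a) * (1 - a) ^ k \<le> c s * (1 - a) ^ k" using a by (intro mult_right_mono) simp_all
 then show ?case using IH by (simp add: mult.assoc)
qed

text \<open>Take a = A T / k in \<open>gronwall_levels\<close>, which is less than 1 for k > A T,
  and let k tend to infinity: (1 - A T / k)^k tends to exp (- A T).\<close>

lemma gronwall_step:
 fixes c A :: "real => real"
 assumes cont: "continuous_on {0..T} A" and A0: "A 0 = 0"
  and mono: "\<And>s t. 0 \<le> s ==> s \<le> t ==> t \<le> T ==> A s \<le> A t"
  and c: "\<And>t. 0 \<le> t ==> t \<le> T ==> 0 \<le> c t"
  and step: "\<And>s t. 0 \<le> s ==> s \<le> t ==> t \<le> T ==> c t * (1 - (A t - A s)) \<le> c s"
  and T: "0 \<le> T"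
 shows "c T \<le> c 0 * exp (A T)"
proof -
 have AT: "0 \<le> A T" using mono[of 0 T] T A0 by simp
 have "(\<lambda>k. c T * (1 + (- A T) / real k) ^ k) ----> c T * exp (- A T)"
  by (intro tendsto_mult tendsto_const tendsto_exp_limit_sequentially)
 moreover obtain k0 :: nat where k0: "A T < real k0" using reals_Archimedean2 by blast
 have "c T * (1 + (- A T) / real k) ^ k \<le> c 0" if "k \<ge> k0" for k
 proof -
  have k: "A T < real k" using k0 that by simp
  then have "A T / real k < 1" "0 \<le> A T / real k" "A T \<le> real k * (A T / real k)" using AT by simp_all
  then have "c T * (1 - A T / real k) ^ k \<le> c 0"
   by (intro gronwall_levels[OF cont A0 mono c step]) (use T in simp_all)
  then show ?thesis by simp
 qed
 ultimately have "c T * exp (- A T) \<le> c 0" by (intro LIMSEQ_le_const2) blast+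
 then have "c T * exp (- A T) * exp (A T) \<le> c 0 * exp (A T)" by (intro mult_right_mono) simp_all
 then show ?thesis by (simp add: mult.assoc exp_minus_inverse flip: exp_add)
qed

lemma lebesgue_on_interval:
 fixes f :: "real => real"
 assumes f: "integrable (lebesgue_on {0<..<T}) f"
 shows "f integrable_on {0..T}" "0 \<le> t ==> t \<le> T ==> (LINT s|lebesgue_on {0<..<t}. f s) = integral {0..t} f"
proof -
 have o: "f integrable_on {0<..<t} \<longleftrightarrow> f integrable_on {0..t}" "integral {0<..<t} f = integral {0..t} f" for t
  using integrable_on_open_interval[of f 0 t] integral_open_interval[of 0 t f] by simp_all
 have "f integrable_on {0<..<T}" by (rule integrable_on_lebesgue_on[OF f]) simp
 then show "f integrable_on {0..T}" by (simp only: o)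
 assume t: "0 \<le> t" "t \<le> T"
 have "integrable (lebesgue_on {0<..<t}) f" by (rule integrable_lebesgue_on_subset[OF f]) (use t in auto)
 then show "(LINT s|lebesgue_on {0<..<t}. f s) = integral {0..t} f"
  using lebesgue_integral_eq_integral[of "{0<..<t}" f] by (simp add: o)
qed

text \<open>The right side c(t), that is y0 plus the integral of m y, is nondecreasing and dominates
  \<open>y\<close>. Hence c t - c s \<le> (A t - A s) c t with \<open>A\<close> the integral of
  \<open>m\<close>, which is the hypothesis of \<open>gronwall_step\<close>; \<open>y\<close> itself
  may be discontinuous.\<close>

lemma gronwall_integral:
 fixes y m :: "real => real"
 assumes T: "0 \<le> T" and m: "integrable (lebesgue_on {0<..<T}) m" "\<And>t. 0 \<le> m t"
  and my: "integrable (lebesgue_on {0<..<T}) (\<lambda>t. m t * y t)" and y: "\<And>t. 0 \<le> y t" "0 \<le> y0"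
  and ineq: "\<And>t. 0 \<le> t ==> t \<le> T ==> y t \<le> y0 + (LINT s|lebesgue_on {0<..<t}. m s * y s)"
 shows "y T \<le> y0 * exp (LINT s|lebesgue_on {0<..<T}. m s)"
proof -
 note Hm = lebesgue_on_interval[OF m(1)] and Hy = lebesgue_on_interval[OF my]
 define A where "A t = integral {0..t} m" for t
 define c where "c t = y0 + integral {0..t} (\<lambda>s. m s * y s)" for t
 have sub: "m integrable_on {s..t}" "(\<lambda>s. m s * y s) integrable_on {s..t}" if "0 \<le> s" "t \<le> T" for s t
  using that by (auto intro: integrable_subinterval_real[OF Hm(1)] integrable_subinterval_real[OF Hy(1)])
 have Ad: "A t - A s = integral {s..t} m" and cd: "c t - c s = integral {s..t} (\<lambda>s. m s * y s)"
  if "0 \<le> s" "s \<le> t" "t \<le> T" for s t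
  using Henstock_Kurzweil_Integration.integral_combine[of 0 s t m] Henstock_Kurzweil_Integration.integral_combine[of 0 s t "\<lambda>s. m s * y s"] sub[of 0 t] that
  by (simp_all add: A_def c_def)
 have cmono: "c s \<le> c t" if "0 \<le> s" "s \<le> t" "t \<le> T" for s t
 proof -
  have "0 \<le> integral {s..t} (\<lambda>s. m s * y s)"
   by (rule Henstock_Kurzweil_Integration.integral_nonneg[OF sub(2)]) (use that m(2) y in simp_all)
  then show ?thesis using cd[OF that] by linarith
 qed
 have c0: "c 0 = y0" "A 0 = 0" by (simp_all add: c_def A_def)
 have "y T \<le> c T" using ineq[of T] Hy(2)[of T] T by (simp add: c_def)
 also have "c T \<le> c 0 * exp (A T)"
 proof (rule gronwall_step)
  show "continuous_on {0..T} A" unfolding A_def by (rule indefinite_integral_continuous_1[OF Hm(1)])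
  show "A s \<le> A t" if "0 \<le> s" "s \<le> t" "t \<le> T" for s t
  proof -
   have "0 \<le> integral {s..t} m"
    by (rule Henstock_Kurzweil_Integration.integral_nonneg[OF sub(1)]) (use that m(2) in simp_all)
   then show ?thesis using Ad[OF that] by linarith
  qed
  show "0 \<le> c t" if "0 \<le> t" "t \<le> T" for t using cmono[of 0 t] that c0 y by simp
  show "c t * (1 - (A t - A s)) \<le> c s" if st: "0 \<le> s" "s \<le> t" "t \<le> T" for s t
  proof -
   have "c t - c s = integral {s..t} (\<lambda>s. m s * y s)" by (rule cd[OF st])
   also have "\<dots> \<le> integral {s..t} (\<lambda>r. m r * c t)"
   proof (rule integral_le[OF sub(2)])
    show "(\<lambda>r. m r * c t) integrable_on {s..t}" using sub(1)[of s t] st by (intro integrable_on_mult_left) simp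
    fix r assume r: "r \<in> {s..t}"
    have "y r \<le> c r" using ineq[of r] Hy(2)[of r] r st by (simp add: c_def)
    also have "\<dots> \<le> c t" using cmono[of r t] r st by simp
    finally show "m r * y r \<le> m r * c t" using m(2) by (rule mult_left_mono)
   qed (use st in simp_all)
   also have "\<dots> = (A t - A s) * c t" using Ad[OF st] by simp
   finally show ?thesis by (simp add: algebra_simps)
  qed
 qed (use T c0 in simp_all)
 finally show ?thesis using Hm(2)[of T] T by (simp add: c0 A_def)
qed

text \<open>Atom integrals are limits of pairings with test functions that do not depend on
  \<open>t\<close>, and the pairing with any \<open>w\<close> is a limit of finite expressions in
  atom integrals.\<close>

lemma wmeas_of_test:
 fixes K :: "'t => real^'n => 'b::euclidean_space"
 assumes \<Omega>: "open \<Omega>" "\<Omega> \<in> lmeasurable" and K: "\<And>t. sq_int (lebesgue_on \<Omega>) (K t)"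
  and m: "\<And>\<psi> b. \<psi> \<in> test_functions \<Omega> ==> b \<in> Basis ==> (\<lambda>t. \<integral>x. (K t x \<bullet> b) * \<psi> x \<partial>lebesgue_on \<Omega>) \<in> borel_measurable N"
 shows "wmeas N (lebesgue_on \<Omega>) K"
 unfolding wmeas_def
proof (intro allI impI)
 let ?M = "lebesgue_on \<Omega>"
 fix w :: "real^'n => 'b" assume w: "sq_int ?M w"
 have "(\<lambda>t. atom_int \<Omega> k S (K t) \<bullet> b) \<in> borel_measurable N" if b: "b \<in> Basis" for k S b
 proof -
  obtain \<psi> \<psi>' where \<psi>: "\<And>n::nat. \<psi> n \<in> test_functions \<Omega>" "\<And>n. \<psi>' n \<in> test_functions \<Omega>"
   "\<And>G :: real^'n => real. sq_int ?M G ==> (\<lambda>n. (LINT x|?M. G x * \<psi> n x) - (LINT x|?M. G x * \<psi>' n x)) ----> atom_int \<Omega> k S G"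
   using atom_int_approx[OF \<Omega>, of k S] by blast
  have "(\<lambda>t. atom_int \<Omega> k S (\<lambda>x. K t x \<bullet> b)) \<in> borel_measurable N"
  proof (rule borel_measurable_LIMSEQ_real)
   show "(\<lambda>n. (LINT x|?M. (K t x \<bullet> b) * \<psi> n x) - (LINT x|?M. (K t x \<bullet> b) * \<psi>' n x)) ----> atom_int \<Omega> k S (\<lambda>x. K t x \<bullet> b)" for t
    by (rule \<psi>(3), rule sq_int_bound[OF K[of t], where C = "norm b"])
      (use sq_int_measurable[OF K] in \<open>auto intro!: AE_I2 simp: mult.commute[of "norm b"] Cauchy_Schwarz_ineq2\<close>)
   show "(\<lambda>t. (LINT x|?M. (K t x \<bullet> b) * \<psi> n x) - (LINT x|?M. (K t x \<bullet> b) * \<psi>' n x)) \<in> borel_measurable N" for n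
    by (intro borel_measurable_diff m \<psi> b)
  qed
  moreover have "atom_int \<Omega> k S (\<lambda>x. K t x \<bullet> b) = atom_int \<Omega> k S (K t) \<bullet> b" for t
  proof -
   have "(LINT x|?M. (indicator (atom k S) x *\<^sub>R K t x) \<bullet> b) = atom_int \<Omega> k S (K t) \<bullet> b"
    unfolding atom_int_def by (rule integral_inner_left) (rule atom_integrable[OF \<Omega>(2) K])
   then show ?thesis by (simp add: atom_int_def)
  qed
  ultimately show ?thesis by simp
 qed
 then have ai: "(\<lambda>t. atom_int \<Omega> k S (K t)) \<in> borel_measurable N" for k S
  using borel_measurable_euclidean_space by blast
 show "(\<lambda>t. ip ?M (K t) w) \<in> borel_measurable N"
 proof (rule borel_measurable_LIMSEQ_real)
  show "(\<lambda>k. ip ?M (proj \<Omega> k (K t)) w) ----> ip ?M (K t) w" for t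
   by (rule ip_tendsto[OF sq_int_proj[OF \<Omega>(2)] K proj_tendsto[OF \<Omega>(2) K] w w])
     (simp add: nrm_def)
  show "(\<lambda>t. ip ?M (proj \<Omega> k (K t)) w) \<in> borel_measurable N" for k
   unfolding ip_proj[OF \<Omega>(2) w] by (intro borel_measurable_sum borel_measurable_divide borel_measurable_inner ai borel_measurable_const)
 qed
qed

section \<open>Changes on null sets and restriction of the time interval\<close>

lemma measurable_lebesgue_on_AE:
 fixes f g :: "'a::euclidean_space => real"
 assumes f: "f \<in> borel_measurable (lebesgue_on S)" and S: "S \<in> sets lebesgue" and eq: "AE x in lebesgue_on S. f x = g x"
 shows "g \<in> borel_measurable (lebesgue_on S)"
proof -
 have "(\<lambda>x. if x \<in> S then f x else 0) \<in> borel_measurable lebesgue"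
  using f S by (simp add: borel_measurable_if)
 moreover have "AE x in lborel. (if x \<in> S then f x else 0) = (if x \<in> S then g x else 0)"
 proof -
  have "AE x in lebesgue. x \<in> S \<longrightarrow> f x = g x"
   using eq S by (simp add: AE_restrict_space_iff)
  then have "AE x in lborel. x \<in> S \<longrightarrow> f x = g x" by (simp only: AE_completion_iff)
  then show ?thesis by eventually_elim simp
 qed
 ultimately have "(\<lambda>x. if x \<in> S then g x else 0) \<in> borel_measurable lebesgue"
  by (rule borel_measurable_lebesgue_AE)
 then show ?thesis using S by (simp add: borel_measurable_if)
qed

text \<open>By completeness of Lebesgue measure either both functions are measurable or neither is,
  and in the second case both integrals are 0 by convention. The time integrands of the weak
  formulations, whose measurability is not known beforehand, are rewritten with this rule.\<close>

lemma integral_lebesgue_on_cong_AE: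
 fixes f g :: "'a::euclidean_space => real"
 assumes S: "S \<in> sets lebesgue" and eq: "AE x in lebesgue_on S. f x = g x"
 shows "(LINT x|lebesgue_on S. f x) = (LINT x|lebesgue_on S. g x)"
proof -
 have eq': "AE x in lebesgue_on S. g x = f x" using eq by eventually_elim simp
 show ?thesis
 proof (cases "f \<in> borel_measurable (lebesgue_on S)")
  case True
  then show ?thesis using measurable_lebesgue_on_AE[OF True S eq] eq by (intro integral_cong_AE)
 next
  case False
  then have "g \<notin> borel_measurable (lebesgue_on S)" using measurable_lebesgue_on_AE[OF _ S eq'] by blast
  with False have "\<not> integrable (lebesgue_on S) f" "\<not> integrable (lebesgue_on S) g"
   using borel_measurable_integrable by blast+
  then show ?thesis by (simp add: not_integrable_integral_eq)
 qed
qed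

lemma measurable_lebesgue_on_subset:
 "f \<in> borel_measurable (lebesgue_on B) ==> A \<subseteq> B ==> f \<in> borel_measurable (lebesgue_on A)"
 by (rule measurable_restrict_mono)

lemma wmeas_subset: "wmeas (lebesgue_on B) M K ==> A \<subseteq> B ==> wmeas (lebesgue_on A) M K"
 unfolding wmeas_def by (blast intro: measurable_lebesgue_on_subset)

lemma AE_lebesgue_on_mono:
 assumes "AE x in lebesgue_on B. P x" "A \<subseteq> B" "A \<in> sets lebesgue" "B \<in> sets lebesgue"
 shows "AE x in lebesgue_on A. P x"
proof -
 have "AE x in lebesgue. x \<in> B \<longrightarrow> P x" using assms by (simp add: AE_restrict_space_iff)
 then have "AE x in lebesgue. x \<in> A \<longrightarrow> P x" by eventually_elim (use assms(2) in blast)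
 then show ?thesis using assms by (simp add: AE_restrict_space_iff)
qed

lemma interval_integral_diff:
 fixes \<phi> :: "real => real"
 assumes \<phi>: "integrable (lebesgue_on {0<..<R}) \<phi>" and ab: "0 \<le> a" "a \<le> b" "b \<le> R"
 shows "(LINT s|lebesgue_on {0<..<R}. indicator {a<..<b} s * \<phi> s) =
  (LINT s|lebesgue_on {0<..<b}. \<phi> s) - (LINT s|lebesgue_on {0<..<a}. \<phi> s)"
proof -
 note H = lebesgue_on_interval[OF \<phi>]
 have "(LINT s|lebesgue_on {0<..<R}. indicator {a<..<b} s * \<phi> s) = (LINT s|lebesgue_on {a<..<b}. \<phi> s)"
  by (rule integral_lebesgue_on_subset) (use ab in auto)
 also have "\<dots> = integral {a<..<b} \<phi>"
  by (rule lebesgue_integral_eq_integral, rule integrable_lebesgue_on_subset[OF \<phi>]) (use ab in auto)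
 also have "\<dots> = integral {a..b} \<phi>" using integral_open_interval[of a b \<phi>] by simp
 also have "\<dots> = integral {0..b} \<phi> - integral {0..a} \<phi>"
  using Henstock_Kurzweil_Integration.integral_combine[OF ab(1,2) integrable_subinterval_real[OF H(1)]] ab by simp
 also have "\<dots> = (LINT s|lebesgue_on {0<..<b}. \<phi> s) - (LINT s|lebesgue_on {0<..<a}. \<phi> s)"
  using H(2)[of a] H(2)[of b] ab by simp
 finally show ?thesis .
qed

section \<open>Product test fields in time and space, and limits of tested identities\<close>

lemma jacobian_scaleR:
 fixes \<phi> :: "real^'n => real^'m"
 assumes "smooth_on \<phi> UNIV"
 shows "grad (\<lambda>x. c *\<^sub>R \<phi> x) x = c *\<^sub>R grad \<phi> x"
proof -
 have "frechet_derivative (\<lambda>x. c *\<^sub>R \<phi> x) (at x) = (\<lambda>h. c *\<^sub>R frechet_derivative \<phi> (at x) h)"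
  by (rule frechet_derivative_at[symmetric]) (intro has_derivative_scaleR_right smooth_has_derivative assms)
 then show ?thesis by (simp add: vec_eq_iff jacobian_nth)
qed

text \<open>Positive steps along basis directions never leave the half space of nonnegative times,
  so \<open>Ck_on_subset\<close> reduces smoothness within it to smoothness on the whole
  space.\<close>

lemma smooth_time_product:
 fixes \<eta> :: "real => real" and \<phi> :: "real^'n => real^3"
 assumes "smooth_on \<eta> UNIV" "smooth_on \<phi> UNIV"
 shows "smooth_on (\<lambda>(t, x). \<eta> t *\<^sub>R \<phi> x) ({0..} \<times> UNIV)"
proof -
 have "smooth_on (\<lambda>p. \<eta> (fst p) *\<^sub>R \<phi> (snd p)) UNIV"
  by (intro smooth_scaleR smooth_comp_linear[OF bounded_linear_fst] smooth_comp_linear[OF bounded_linear_snd] assms)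
 then have "Ck_on k (\<lambda>p. \<eta> (fst p) *\<^sub>R \<phi> (snd p)) UNIV" for k by (simp add: smooth_on_def)
 then have "Ck_on k (\<lambda>p. \<eta> (fst p) *\<^sub>R \<phi> (snd p)) ({0..} \<times> UNIV)" for k
 proof (rule Ck_on_subset[rotated])
  fix p i :: "real \<times> (real^'n)" and e :: real
  assume p: "p \<in> {0..} \<times> UNIV" and i: "i \<in> Basis" and e: "0 < e"
  have "0 \<le> fst i" using i by (auto simp: Basis_prod_def)
  then have "0 \<le> fst (p + (e / 2) *\<^sub>R i)" using p e by auto
  then show "\<exists>d. 0 < \<bar>d\<bar> \<and> \<bar>d\<bar> < e \<and> p + d *\<^sub>R i \<in> {0..} \<times> UNIV"
   using e by (intro exI[of _ "e / 2"]) (simp add: mem_Times_iff)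
 qed
 then show ?thesis by (simp add: smooth_on_def case_prod_unfold)
qed

lemma vector_derivative_time_product:
 fixes \<eta> :: "real => real" and a :: "'a::real_normed_vector"
 assumes "(\<eta> has_real_derivative \<eta>') (at t)" "0 < t"
 shows "vector_derivative (\<lambda>s. \<eta> s *\<^sub>R a) (at t within {0..}) = \<eta>' *\<^sub>R a"
proof -
 have "at t within {0..} = at t" by (rule at_within_open_subset[of t "{0<..}"]) (use assms(2) in auto)
 moreover have "((\<lambda>s. \<eta> s *\<^sub>R a) has_vector_derivative \<eta>' *\<^sub>R a) (at t)"
  using has_vector_derivative_scaleR[OF assms(1) has_vector_derivative_const[of a]] by simp
 ultimately show ?thesis by (simp add: vector_derivative_at)
qed

lemma sq_int_scaled_axis:
 fixes h :: "'a => real" and c :: "'b::euclidean_space"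
 assumes "sq_int M h"
 shows "sq_int M (\<lambda>x. h x *\<^sub>R c)"
proof (rule sq_int_bound[OF assms, where C = "norm c"])
 show "(\<lambda>x. h x *\<^sub>R c) \<in> borel_measurable M"
  by (intro borel_measurable_scaleR sq_int_measurable[OF assms] borel_measurable_const)
qed (simp add: mult.commute)

lemma grad_closure_by_parts:
 fixes f :: "real^'n => real^'m"
 assumes f: "grad_closure \<Omega> S f G" and S: "\<And>\<phi>. \<phi> \<in> S ==> smooth_on \<phi> UNIV"
  and \<psi>: "\<psi> \<in> test_functions \<Omega>" and \<Omega>: "bounded \<Omega>" "\<Omega> \<in> lmeasurable"
 shows "ip (lebesgue_on \<Omega>) f (\<lambda>x. pd j \<psi> x *\<^sub>R axis i 1) =
  - ip (lebesgue_on \<Omega>) G (\<lambda>x. \<psi> x *\<^sub>R axis i (axis j 1))"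
proof -
 let ?M = "lebesgue_on \<Omega>"
 obtain \<phi> where \<phi>: "\<And>n::nat. \<phi> n \<in> S" "(\<lambda>n. dst ?M (\<phi> n) f) ----> 0"
  "(\<lambda>n. dst ?M (grad (\<phi> n)) G) ----> 0"
  by (rule grad_closureE[OF f]) (rule that)
 note fG = grad_closureD[OF f]
 have ps: "smooth_on \<psi> UNIV" by (rule test_functionsD[OF \<psi>])
 let ?p = "\<lambda>x. pd j \<psi> x *\<^sub>R (axis i 1 :: real^'m)"
 let ?q = "\<lambda>x. \<psi> x *\<^sub>R (axis i (axis j 1) :: real^'n^'m)"
 have p: "sq_int ?M ?p"
  by (intro sq_int_scaled_axis sq_int_continuous smooth_continuous_on smooth_frechet_derivative ps \<Omega>)
 have q: "sq_int ?M ?q" by (intro sq_int_scaled_axis sq_int_continuous smooth_continuous_on ps \<Omega>)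
 have "ip ?M (\<phi> n) ?p = - ip ?M (grad (\<phi> n)) ?q" for n
  using smooth_integration_by_parts[OF S[OF \<phi>(1)] \<psi> \<Omega>, of n i j]
  by (simp add: inner_axis mult.commute)
 moreover have "(\<lambda>n. ip ?M (\<phi> n) ?p) ----> ip ?M f ?p"
  by (rule ip_tendsto[OF jacobian_sq_int(1)[OF S[OF \<phi>(1)] \<Omega>] fG(1) \<phi>(2) p p]) (simp add: nrm_def)
 moreover have "(\<lambda>n. - ip ?M (grad (\<phi> n)) ?q) ----> - ip ?M G ?q"
  by (rule tendsto_minus, rule ip_tendsto[OF jacobian_sq_int(2)[OF S[OF \<phi>(1)] \<Omega>] fG(2) \<phi>(3) q q]) (simp add: nrm_def)
 ultimately show ?thesis using LIMSEQ_unique by simp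
qed

text \<open>Integration by parts moves the derivative onto the test function, so pairings of
  \<open>G\<close> with test functions are pairings of \<open>f\<close>; by
  \<open>wmeas_of_test\<close> these suffice.\<close>

lemma wmeas_gradient:
 fixes f :: "'t => real^'n => real^'m"
 assumes f: "\<And>t. grad_closure \<Omega> S (f t) (G t)" "wmeas N (lebesgue_on \<Omega>) f" and S: "\<And>\<phi>. \<phi> \<in> S ==> smooth_on \<phi> UNIV"
  and \<Omega>: "open \<Omega>" "bounded \<Omega>" "\<Omega> \<in> lmeasurable"
 shows "wmeas N (lebesgue_on \<Omega>) G"
proof (rule wmeas_of_test[OF \<Omega>(1,3) grad_closureD(2)[OF f(1)]])
 fix \<psi> :: "real^'n => real" and b :: "real^'n^'m"
 assume \<psi>: "\<psi> \<in> test_functions \<Omega>" and b: "b \<in> Basis"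
 obtain i j where ij: "b = axis i (axis j 1)" using b by (auto simp: Basis_vec_def)
 have "(LINT x|lebesgue_on \<Omega>. (G t x \<bullet> b) * \<psi> x) = - ip (lebesgue_on \<Omega>) (f t) (\<lambda>x. pd j \<psi> x *\<^sub>R axis i 1)" for t
  using grad_closure_by_parts[OF f(1) S \<psi> \<Omega>(2,3), of t j i] by (simp add: ij mult.commute)
 moreover have "(\<lambda>t. - ip (lebesgue_on \<Omega>) (f t) (\<lambda>x. pd j \<psi> x *\<^sub>R axis i 1)) \<in> borel_measurable N"
  by (intro borel_measurable_uminus wmeasD[OF f(2)] sq_int_scaled_axis sq_int_continuous smooth_continuous_on
    smooth_frechet_derivative test_functionsD(1)[OF \<psi>] \<Omega>)
 ultimately show "(\<lambda>t. \<integral>x. (G t x \<bullet> b) * \<psi> x \<partial>lebesgue_on \<Omega>) \<in> borel_measurable N" by simp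
qed

text \<open>The error on the right is at most the time integral of |K| times |\<Phi>_n - F|. An
  identity integrated in time therefore extends from test fields to limits of test fields with
  convergent gradients.\<close>

lemma pairing_closure:
 fixes K :: "'t => 'a => 'c::euclidean_space" and a :: "'a => 'b::euclidean_space"
 assumes K: "wmeas N M K" "\<And>t. sq_int M (K t)" "integrable N (\<lambda>t. nrm M (K t))"
  and a: "sq_int M a"
  and \<phi>: "\<And>n::nat. sq_int M (\<phi> n)" "\<And>n. sq_int M (\<Phi> n)" "\<And>n. ip M a (\<phi> n) = (LINT t|N. ip M (K t) (\<Phi> n))"
  and f: "sq_int M f" "(\<lambda>n. dst M (\<phi> n) f) ----> 0"
  and F: "sq_int M F" "(\<lambda>n. dst M (\<Phi> n) F) ----> 0"
 shows "ip M a f = (LINT t|N. ip M (K t) F)"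
proof -
 have I: "integrable N (\<lambda>t. ip M (K t) W)" if W: "sq_int M W" for W
 proof (rule Bochner_Integration.integrable_bound)
  show "integrable N (\<lambda>t. nrm M (K t) * nrm M W)" using K(3) by simp
  show "(\<lambda>t. ip M (K t) W) \<in> borel_measurable N" by (rule wmeasD[OF K(1) W])
  show "AE t in N. norm (ip M (K t) W) \<le> norm (nrm M (K t) * nrm M W)"
   by (rule AE_I2) (use CS_inner[OF K(2) W] in \<open>simp add: nrm_nonneg\<close>)
 qed
 have "(\<lambda>n. (LINT t|N. ip M (K t) (\<Phi> n)) - (LINT t|N. ip M (K t) F)) ----> 0"
 proof (rule tendsto_rabs_zero_cancel, rule tendsto_zero_squeeze)
  show "0 \<le> \<bar>(LINT t|N. ip M (K t) (\<Phi> n)) - (LINT t|N. ip M (K t) F)\<bar>" for n by simp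
  show "\<bar>(LINT t|N. ip M (K t) (\<Phi> n)) - (LINT t|N. ip M (K t) F)\<bar> \<le> (LINT t|N. nrm M (K t)) * dst M (\<Phi> n) F" for n
  proof -
   have d: "sq_int M (\<lambda>x. \<Phi> n x - F x)" by (rule sq_int_diff[OF \<phi>(2) F(1)])
   have "(LINT t|N. ip M (K t) (\<Phi> n)) - (LINT t|N. ip M (K t) F) = (LINT t|N. ip M (K t) (\<Phi> n) - ip M (K t) F)"
    by (rule Bochner_Integration.integral_diff[symmetric]) (intro I \<phi> F)+
   also have "\<dots> = (LINT t|N. ip M (K t) (\<lambda>x. \<Phi> n x - F x))"
    by (rule Bochner_Integration.integral_cong[OF refl]) (rule ip_diff_right[OF \<phi>(2) F(1) K(2), symmetric])
   finally have "\<bar>(LINT t|N. ip M (K t) (\<Phi> n)) - (LINT t|N. ip M (K t) F)\<bar> \<le> (LINT t|N. \<bar>ip M (K t) (\<lambda>x. \<Phi> n x - F x)\<bar>)"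
    by (simp only: integral_abs_bound)
   also have "\<dots> \<le> (LINT t|N. nrm M (K t) * dst M (\<Phi> n) F)"
    by (rule integral_mono) (use I[OF d] K(3) CS_inner[OF K(2) d] in simp_all)
   finally show ?thesis by simp
  qed
  show "(\<lambda>n. (LINT t|N. nrm M (K t)) * dst M (\<Phi> n) F) ----> 0"
   using tendsto_mult_left[OF F(2)] by simp
 qed
 from LIM_zero_cancel[OF this] have l: "(\<lambda>n. ip M a (\<phi> n)) ----> (LINT t|N. ip M (K t) F)" by (simp only: \<phi>(3))
 have "(\<lambda>n. ip M a (\<phi> n)) ----> ip M a f"
  by (rule ip_tendsto[OF a a _ \<phi>(1) f]) (simp add: nrm_def)
 from LIMSEQ_unique[OF this l] show ?thesis .
qed

context cyl
begin

lemma vert_continuous_bounded: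
 fixes \<psi> :: "real^3 => real"
 assumes "smooth_on \<psi> UNIV"
 shows "sq_int MC (lift (vert L \<psi>))" "(lift (vert L \<psi>)) \<in> borel_measurable MC"
  "\<exists>B. \<forall>x\<in>C. \<bar>vert L \<psi> (horiz x)\<bar> \<le> B"
proof -
 have c: "continuous_on UNIV (lift (vert L \<psi>))"
  by (rule smooth_continuous_on[OF smooth_comp_linear[OF bounded_linear_horiz smooth_vert[OF assms]]])
 show "sq_int MC (lift (vert L \<psi>))" by (rule sq_int_continuous[OF c bounded_cylinder lmeasurable_cylinder])
 then show "(lift (vert L \<psi>)) \<in> borel_measurable MC" by (rule sq_int_measurable)
 obtain B where "\<And>x. x \<in> C ==> norm (vert L \<psi> (horiz x)) \<le> B"
  using continuous_on_bounded_set[OF c bounded_cylinder] by metis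
 then show "\<exists>B. \<forall>x\<in>C. \<bar>vert L \<psi> (horiz x)\<bar> \<le> B" by auto
qed

text \<open>By Fubini the vertical integral moves from the quadratic term onto the test function.
  What remains is bilinear in the components of \<open>f\<close>, the form exploited in
  \<open>wmeas_flux\<close>.\<close>

lemma flux_test:
 assumes f: "sq_int MC f" "sq_int MD (vsq f)" and \<psi>: "smooth_on \<psi> UNIV"
 shows "(LINT x|MC. flux f x $ i $ j * \<psi> x) = (LINT x|MC. vert L \<psi> (horiz x) * (f x $ i * f x $ j)) / L"
proof -
 let ?h = "\<lambda>x. f x $ i * f x $ j"
 obtain B where B: "\<And>x. x \<in> C ==> \<bar>vert L \<psi> (horiz x)\<bar> \<le> B" using vert_continuous_bounded(3)[OF \<psi>] by blast
 have hm: "integrable MC ?h" by (rule nth_mult_integrable[OF f(1)])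
 have i2: "integrable MC (\<lambda>x. vert L \<psi> (horiz x) * ?h x)"
 proof (rule Bochner_Integration.integrable_bound)
  show "integrable MC (\<lambda>x. B * ?h x)" using hm by simp
  show "(\<lambda>x. vert L \<psi> (horiz x) * ?h x) \<in> borel_measurable MC"
   by (intro borel_measurable_times vert_continuous_bounded(2)[OF \<psi>] borel_measurable_integrable[OF hm])
  show "AE x in MC. norm (vert L \<psi> (horiz x) * ?h x) \<le> norm (B * ?h x)"
  proof (rule AE_I2)
   fix x assume "x \<in> space MC"
   then have "\<bar>vert L \<psi> (horiz x)\<bar> \<le> \<bar>B\<bar>" using B[of x] by (simp add: space_restrict_space)
   then show "norm (vert L \<psi> (horiz x) * ?h x) \<le> norm (B * ?h x)"
    unfolding real_norm_def abs_mult by (rule mult_right_mono) simp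
  qed
 qed
 have "integrable MC (\<lambda>x. flux f x $ i $ j * \<psi> x)"
  by (rule integrable_mult_continuous[OF sq_int_nth[OF sq_int_nth[OF flux_sq_int(1)[OF f]]] smooth_continuous_on[OF \<psi>] bounded_cylinder lmeasurable_cylinder])
 then have "integrable MC (\<lambda>x. L * (flux f x $ i $ j * \<psi> x))" by simp
 then have i1: "integrable MC (\<lambda>x. vert L ?h (horiz x) * \<psi> x)" using L by (simp add: flux_def)
 have "(LINT x|MC. flux f x $ i $ j * \<psi> x) = (LINT x|MC. vert L ?h (horiz x) * \<psi> x) / L" by (simp add: flux_def)
 also have "(LINT x|MC. vert L ?h (horiz x) * \<psi> x) = (LINT y|MD. vert L ?h y * vert L \<psi> y)"
  by (rule integrable_mult_lift[OF i1])
 also have "\<dots> = (LINT y|MD. vert L \<psi> y * vert L ?h y)" by (simp only: mult.commute)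
 also have "\<dots> = (LINT x|MC. vert L \<psi> (horiz x) * ?h x)" by (rule integrable_mult_lift[OF i2, symmetric])
 finally show ?thesis .
qed

text \<open>The flux is quadratic, so its pairings are not pairings of \<open>f\<close> with a fixed
  function. After \<open>flux_test\<close> they are inner products of \<open>f\<close> with a second
  weakly measurable curve \<open>Z\<close>, and \<open>ip_diag_measurable\<close> covers such
  products.\<close>

lemma wmeas_flux:
 assumes f: "\<And>t. sq_int MC (f t)" "\<And>t. sq_int MD (vsq (f t))" "wmeas N MC f"
 shows "wmeas N MC (\<lambda>t. flux (f t))"
proof (rule wmeas_of_test[OF open_cylinder lmeasurable_cylinder flux_sq_int(1)[OF f(1,2)]])
 fix \<psi> :: "real^3 => real" and b :: "real^3^3"
 assume \<psi>: "\<psi> \<in> test_functions C" and b: "b \<in> Basis"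
 have ps: "smooth_on \<psi> UNIV" by (rule test_functionsD(1)[OF \<psi>])
 obtain i j where ij: "b = axis i (axis j 1)" using b by (auto simp: Basis_vec_def)
 obtain B where B: "\<And>x. x \<in> C ==> \<bar>vert L \<psi> (horiz x)\<bar> \<le> B" using vert_continuous_bounded(3)[OF ps] by blast
 define Z where "Z t x = (vert L \<psi> (horiz x) * f t x $ j) *\<^sub>R (axis i 1 :: real^3)" for t x
 have scal: "sq_int MC (\<lambda>x. vert L \<psi> (horiz x) * g x)" if g: "sq_int MC g" for g :: "real^3 => real"
 proof (rule sq_int_bound[OF g, where C = "\<bar>B\<bar>"])
  show "(\<lambda>x. vert L \<psi> (horiz x) * g x) \<in> borel_measurable MC"
   by (intro borel_measurable_times vert_continuous_bounded(2)[OF ps] sq_int_measurable[OF g])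
  show "AE x in MC. norm (vert L \<psi> (horiz x) * g x) \<le> \<bar>B\<bar> * norm (g x)"
  proof (rule AE_I2)
   fix x assume "x \<in> space MC"
   then have "\<bar>vert L \<psi> (horiz x)\<bar> \<le> \<bar>B\<bar>" using B[of x] by (simp add: space_restrict_space)
   then show "norm (vert L \<psi> (horiz x) * g x) \<le> \<bar>B\<bar> * norm (g x)"
    unfolding real_norm_def abs_mult by (rule mult_right_mono) simp
  qed
 qed
 have Z: "sq_int MC (Z t)" for t
  unfolding Z_def by (intro sq_int_scaled_axis scal sq_int_nth f)
 have "wmeas N MC Z"
  unfolding wmeas_def
 proof (intro allI impI)
  fix w :: "real^3 => real^3" assume w: "sq_int MC w"
  have "ip MC (Z t) w = ip MC (f t) (\<lambda>x. (vert L \<psi> (horiz x) * w x $ i) *\<^sub>R axis j 1)" for t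
   by (rule Bochner_Integration.integral_cong) (simp_all add: Z_def inner_axis inner_axis' mult_ac)
  moreover have "(\<lambda>t. ip MC (f t) (\<lambda>x. (vert L \<psi> (horiz x) * w x $ i) *\<^sub>R axis j 1)) \<in> borel_measurable N"
   by (intro wmeasD[OF f(3)] sq_int_scaled_axis scal sq_int_nth w)
  ultimately show "(\<lambda>t. ip MC (Z t) w) \<in> borel_measurable N" by simp
 qed
 from ip_diag_measurable[OF lmeasurable_cylinder f(3,1) this Z]
 have "(\<lambda>t. ip MC (f t) (Z t) / L) \<in> borel_measurable N" by simp
 moreover have "(LINT x|MC. (flux (f t) x \<bullet> b) * \<psi> x) = ip MC (f t) (Z t) / L" for t
 proof -
  have "(LINT x|MC. (flux (f t) x \<bullet> b) * \<psi> x) = (LINT x|MC. flux (f t) x $ i $ j * \<psi> x)" by (simp add: ij inner_axis)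
  also have "\<dots> = (LINT x|MC. vert L \<psi> (horiz x) * (f t x $ i * f t x $ j)) / L" by (rule flux_test[OF f(1,2) ps])
  also have "(LINT x|MC. vert L \<psi> (horiz x) * (f t x $ i * f t x $ j)) = ip MC (f t) (Z t)"
   by (rule Bochner_Integration.integral_cong) (simp_all add: Z_def inner_axis mult_ac)
  finally show ?thesis .
 qed
 ultimately show "(\<lambda>t. \<integral>x. (flux (f t) x \<bullet> b) * \<psi> x \<partial>MC) \<in> borel_measurable N" by simp
qed

text \<open>The adjoint relation between lift and vertical integration, row by row. The third column
  of grad \<psi> integrates to 0 over the height, in accordance with the zero column of
  \<open>lift_mat\<close>.\<close>

lemma lift_jacobian_ip:
 fixes B :: "real^2 => real^3^3"
 assumes B: "sq_int MD B" and \<psi>: "\<psi> \<in> SC"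
 shows "ip MC (lift B) (grad \<psi>) = ip MD B (\<lambda>y. lift_mat (grad (vert L \<psi>) y))"
proof -
 let ?J = "\<lambda>x. grad \<psi> x" and ?X = "\<lambda>y. lift_mat (grad (vert L \<psi>) y)"
 note v = SC_vert[OF \<psi>]
 have J: "sq_int MC ?J" by (rule SD_SC_sq_int(2)[OF \<psi>])
 have row: "(\<chi> j. vert L (\<lambda>x. ?J x $ i $ j) y) = ?X y $ i" for i y
  by (simp add: vec_eq_iff forall_3 v)
 have X: "sq_int MD (\<lambda>y. ?X y $ i)" for i
  using lift_ip(1)[OF sq_int_nth[OF B, of i] sq_int_nth[OF J, of i]] by (simp only: row)
 have e: "ip MC (\<lambda>x. B (horiz x) $ i) (\<lambda>x. ?J x $ i) = ip MD (\<lambda>y. B y $ i) (\<lambda>y. ?X y $ i)" for i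
  using lift_ip(2)[OF sq_int_nth[OF B, of i] sq_int_nth[OF J, of i]] by (simp only: row)
 have "ip MC (lift B) ?J = (\<Sum>i\<in>UNIV. ip MC (\<lambda>x. B (horiz x) $ i) (\<lambda>x. ?J x $ i))"
  unfolding inner_vec_def[of "B _"]
  by (rule Bochner_Integration.integral_sum) (rule sq_int_inner[OF sq_int_nth[OF lift_sq_int(1)[OF B]] sq_int_nth[OF J]])
 also have "\<dots> = (\<Sum>i\<in>UNIV. ip MD (\<lambda>y. B y $ i) (\<lambda>y. ?X y $ i))" by (simp only: e)
 also have "\<dots> = ip MD B ?X"
  unfolding inner_vec_def[of "B _"]
  by (rule Bochner_Integration.integral_sum[symmetric]) (rule sq_int_inner[OF sq_int_nth[OF B] X])
 finally show ?thesis .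
qed

end

section \<open>The equations tested with divergence-free fields\<close>

text \<open>A curve in \<open>L\<^sup>2(V)\<close> may leave \<open>V\<close> on a null set of times; there, and for \<open>t \<le> 0\<close>, it is replaced by \<open>0\<close>.\<close>

definition reg_field :: "(real^'n) set => (real^'n => real^3) set => (real => real^'n => real^3) => real => real^'n => real^3" where
 "reg_field \<Omega> S w t = (if 0 < t \<and> w t \<in> H1_closure \<Omega> S then w t else (\<lambda>x. 0))"

definition reg_grad :: "(real^'n) set => (real^'n => real^3) set => (real => real^'n => real^3) => real => real^'n => real^'n^3" where
 "reg_grad \<Omega> S w t = (if 0 < t \<and> w t \<in> H1_closure \<Omega> S then weak_gradient \<Omega> (w t) else (\<lambda>x. 0))"

lemma jacobian_zero: "grad (\<lambda>x. 0 :: real^'m) (x :: real^'n) = 0"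
 using jacobian_scaleR[OF smooth_const, of 0 "0 :: real^'m" x] by simp

text \<open>After the modification the pair lies in \<open>grad_closure\<close> at every time, so
  lemmas about such pairs apply pointwise. Weak measurability of the field survives a change on a
  null set of times; that of the gradient follows by \<open>wmeas_gradient\<close>.\<close>

lemma L2_time_regular:
 fixes w :: "real => real^'n => real^3"
 assumes w: "w \<in> L2_time \<Omega> {0<..} (H1_closure \<Omega> S)"
  and sm: "\<forall>\<phi>\<in>S. smooth_on \<phi> UNIV" and z: "(\<lambda>x. 0) \<in> S"
  and \<Omega>: "open \<Omega>" "bounded \<Omega>" "\<Omega> \<in> lmeasurable"
 shows "AE t in lebesgue_on {0<..}. reg_field \<Omega> S w t = w t \<and> reg_grad \<Omega> S w t = weak_gradient \<Omega> (w t)"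
  "\<And>t. grad_closure \<Omega> S (reg_field \<Omega> S w t) (reg_grad \<Omega> S w t)"
  "wmeas (lebesgue_on {0<..}) (lebesgue_on \<Omega>) (reg_field \<Omega> S w)"
  "wmeas (lebesgue_on {0<..}) (lebesgue_on \<Omega>) (reg_grad \<Omega> S w)"
  "integrable (lebesgue_on {0<..}) (\<lambda>t. (nrm (lebesgue_on \<Omega>) (reg_grad \<Omega> S w t))\<^sup>2)"
proof -
 have S: "\<And>\<phi>. \<phi> \<in> S ==> smooth_on \<phi> UNIV" "(\<lambda>x. 0) \<in> S" using sm z by auto
 let ?M = "lebesgue_on \<Omega>" and ?N = "lebesgue_on {0::real<..}"
 have w': "bochner_meas \<Omega> {0<..} w" "AE t in ?N. w t \<in> H1_closure \<Omega> S" "integrable ?N (\<lambda>t. (H1_norm \<Omega> (w t))\<^sup>2)"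
  using w by (simp_all add: L2_time_def)
 have "AE t in ?N. 0 < t" by (rule AE_I2) simp
 with w'(2) show ae: "AE t in ?N. reg_field \<Omega> S w t = w t \<and> reg_grad \<Omega> S w t = weak_gradient \<Omega> (w t)"
  by eventually_elim (simp add: reg_field_def reg_grad_def)
 show g: "grad_closure \<Omega> S (reg_field \<Omega> S w t) (reg_grad \<Omega> S w t)" for t
 proof (cases "0 < t \<and> w t \<in> H1_closure \<Omega> S")
  case True
  then show ?thesis
   using H1_closure_approx[of "w t" \<Omega> S, OF _ S(1) \<Omega>] by (simp add: reg_field_def reg_grad_def grad_closure_def)
 next
  case False
  have "grad_closure \<Omega> S (\<lambda>x. 0) (\<lambda>x. 0)"
   using grad_closure_smooth[OF S(2) S(1)[OF S(2)] \<Omega>(2,3)] by (simp add: jacobian_zero)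
  then show ?thesis unfolding reg_field_def reg_grad_def if_not_P[OF False] .
 qed
 show m: "wmeas ?N ?M (reg_field \<Omega> S w)"
  unfolding wmeas_def
 proof (intro allI impI)
  fix z :: "real^'n => real^3" assume "sq_int ?M z"
  then have "(\<lambda>t. ip ?M (w t) z) \<in> borel_measurable ?N" using w'(1) by (simp add: bochner_meas_def L2_iff)
  then show "(\<lambda>t. ip ?M (reg_field \<Omega> S w t) z) \<in> borel_measurable ?N"
  proof (rule measurable_lebesgue_on_AE)
   show "AE t in ?N. ip ?M (w t) z = ip ?M (reg_field \<Omega> S w t) z" using ae by eventually_elim simp
  qed simp
 qed
 show mg: "wmeas ?N ?M (reg_grad \<Omega> S w)" by (rule wmeas_gradient[OF g m S(1) \<Omega>])
 show "integrable ?N (\<lambda>t. (nrm ?M (reg_grad \<Omega> S w t))\<^sup>2)"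
 proof (rule Bochner_Integration.integrable_bound[OF w'(3)])
  show "(\<lambda>t. (nrm ?M (reg_grad \<Omega> S w t))\<^sup>2) \<in> borel_measurable ?N"
   by (intro borel_measurable_power nrm_measurable[OF \<Omega>(3) mg grad_closureD(2)[OF g]])
  show "AE t in ?N. norm ((nrm ?M (reg_grad \<Omega> S w t))\<^sup>2) \<le> norm ((H1_norm \<Omega> (w t))\<^sup>2)"
   using ae by eventually_elim (simp add: H1_norm_def L2_norm_eq)
 qed
qed

lemma energy_regular:
 fixes w :: "real => real^'n => real^3"
 assumes w: "w \<in> L2_time \<Omega> {0<..} (H1_closure \<Omega> S)" and e: "energy_inequality \<Omega> \<nu> w0 w" and T: "0 < T"
 shows "(nrm (lebesgue_on \<Omega>) (w T))\<^sup>2 + 2 * \<nu> * (LINT t|lebesgue_on {0<..<T}. (nrm (lebesgue_on \<Omega>) (reg_grad \<Omega> S w t))\<^sup>2)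
  \<le> (nrm (lebesgue_on \<Omega>) w0)\<^sup>2"
proof -
 let ?M = "lebesgue_on \<Omega>" and ?\<phi> = "\<lambda>t. (nrm (lebesgue_on \<Omega>) (weak_gradient \<Omega> (w t)))\<^sup>2"
 have "AE t in lebesgue_on {0::real<..}. w t \<in> H1_closure \<Omega> S" using w by (simp add: L2_time_def)
 moreover have "AE t in lebesgue_on {0::real<..}. 0 < t" by (rule AE_I2) simp
 ultimately have "AE t in lebesgue_on {0::real<..}. (nrm ?M (reg_grad \<Omega> S w t))\<^sup>2 = ?\<phi> t"
  by eventually_elim (simp add: reg_grad_def)
 then have "AE t in lebesgue_on {0<..<T}. (nrm ?M (reg_grad \<Omega> S w t))\<^sup>2 = ?\<phi> t" by (rule AE_lebesgue_on_mono) auto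
 then have "(LINT t|lebesgue_on {0<..<T}. (nrm ?M (reg_grad \<Omega> S w t))\<^sup>2) = (LINT t|lebesgue_on {0<..<T}. ?\<phi> t)"
  by (intro integral_lebesgue_on_cong_AE) simp
 also have "\<dots> = (LINT t|lebesgue_on {0..T}. indicator {0<..<T} t * ?\<phi> t)"
  by (rule integral_lebesgue_on_subset[symmetric]) auto
 also have "\<dots> = (LINT t|lebesgue_on {0..T}. ?\<phi> t)"
 proof (rule integral_lebesgue_on_cong_AE)
  have "AE t in lebesgue. t \<noteq> 0" "AE t in lebesgue. t \<noteq> T" by (rule AE_completion[OF AE_lborel_singleton])+
  then have "AE t in lebesgue. t \<in> {0..T} \<longrightarrow> indicator {0<..<T} t * ?\<phi> t = ?\<phi> t"
   by eventually_elim auto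
  then show "AE t in lebesgue_on {0..T}. indicator {0<..<T} t * ?\<phi> t = ?\<phi> t" by (simp add: AE_restrict_space_iff)
 qed simp
 finally show ?thesis using e T by (simp add: energy_inequality_def L2_norm_eq)
qed

lemma lift_mat_horiz: "lift_mat A *v a = A *v horiz a" for A :: "real^2^3"
 by (simp add: vec_eq_iff matrix_vector_mult_def sum_3 sum_2)

context cyl
begin

lemma SC_zero: "(\<lambda>x. 0) \<in> SC" and SD_zero: "(\<lambda>x. 0) \<in> SD"
proof -
 show "(\<lambda>x. 0) \<in> SC" "(\<lambda>x. 0) \<in> SD"
  by (auto intro!: SC_I[of "{}"] SD_I[of "{}"] smooth_const simp: trace_def jacobian_zero)
qed

lemma nrm_lift: "sq_int MD g ==> nrm MC (lift g) = sqrt L * nrm MD g"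
 by (rule power2_eq_imp_eq) (use lift_sq_int(2)[of g] L in \<open>simp_all add: nrm_nonneg power_mult_distrib\<close>)

text \<open>Flux minus viscous stress: the matrix whose pairing with grad \<phi> is the time
  derivative of <f, \<phi>> according to the weak equation.\<close>

definition momentum :: "real => (real^3 => real^3) => (real^3 => real^3^3) => real^3 => real^3^3" where
 "momentum \<nu> f G x = flux f x - \<nu> *\<^sub>R G x"

text \<open>By Ladyzhenskaya's inequality the flux is bounded by a multiple of |f| |G|, and |f| is
  bounded in time. Square integrability in space and time is thus inherited from \<open>G\<close>;
  the vertical averaging in \<open>flux\<close> is what makes this possible.\<close>

lemma momentum_regular:
 assumes p: "\<And>t. grad_closure C SC (f t) (G t)" and m: "wmeas N MC f" and B: "\<And>t. nrm MC (f t) \<le> B"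
  and i: "integrable N (\<lambda>t. (nrm MC (G t))\<^sup>2)" and \<nu>: "0 \<le> \<nu>"
 shows "wmeas N MC (\<lambda>t. momentum \<nu> (f t) (G t))" "\<And>t. sq_int MC (momentum \<nu> (f t) (G t))"
  "integrable N (\<lambda>t. (nrm MC (momentum \<nu> (f t) (G t)))\<^sup>2)"
proof -
 note pD = grad_closureD[OF p] and la = ladyzhenskaya[OF p]
 have F: "sq_int MC (flux (f t))" for t by (rule flux_sq_int(1)[OF pD(1) la(1)])
 have G: "sq_int MC (\<lambda>x. \<nu> *\<^sub>R G t x)" for t by (rule sq_int_scaleR[OF pD(2)])
 show s: "sq_int MC (momentum \<nu> (f t) (G t))" for t
  unfolding momentum_def[abs_def] by (rule sq_int_diff[OF F G])
 show w: "wmeas N MC (\<lambda>t. momentum \<nu> (f t) (G t))"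
  unfolding momentum_def[abs_def]
  by (rule wmeas_diff[OF wmeas_flux[OF pD(1) la(1) m] wmeas_scaleR[OF wmeas_gradient[OF p m SC_smooth open_cylinder bounded_cylinder lmeasurable_cylinder]] F G])
 \<comment> \<open>The factor 9 / sqrt L stems from \<open>flux_sq_int\<close> and sqrt 2 from
   \<open>ladyzhenskaya\<close>.\<close>
 define c where "c = 9 / sqrt L * (sqrt 2 * B) + \<nu>"
 have bound: "nrm MC (momentum \<nu> (f t) (G t)) \<le> c * nrm MC (G t)" for t
 proof -
  have "nrm MD (vsq (f t)) \<le> sqrt (2 * (nrm MC (f t))\<^sup>2 * (nrm MC (G t))\<^sup>2)" by (rule real_le_rsqrt[OF la(2)])
  also have "\<dots> = sqrt 2 * nrm MC (f t) * nrm MC (G t)" by (simp add: real_sqrt_mult nrm_nonneg)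
  also have "\<dots> \<le> sqrt 2 * B * nrm MC (G t)" using B by (intro mult_right_mono mult_left_mono) (simp_all add: nrm_nonneg)
  finally have "9 / sqrt L * nrm MD (vsq (f t)) \<le> 9 / sqrt L * (sqrt 2 * B * nrm MC (G t))"
   using L by (intro mult_left_mono) simp_all
  then have "nrm MC (flux (f t)) \<le> 9 / sqrt L * (sqrt 2 * B * nrm MC (G t))"
   using flux_sq_int(2)[OF pD(1) la(1), of t] by linarith
  moreover have "nrm MC (momentum \<nu> (f t) (G t)) \<le> nrm MC (flux (f t)) + \<nu> * nrm MC (G t)"
   using nrm_triangle_diff[OF F G, of t t] \<nu> by (simp add: momentum_def[abs_def] nrm_scaleR)
  ultimately show ?thesis by (simp add: c_def algebra_simps)
 qed
 show "integrable N (\<lambda>t. (nrm MC (momentum \<nu> (f t) (G t)))\<^sup>2)"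
 proof (rule Bochner_Integration.integrable_bound)
  show "integrable N (\<lambda>t. c\<^sup>2 * (nrm MC (G t))\<^sup>2)" using i by simp
  show "(\<lambda>t. (nrm MC (momentum \<nu> (f t) (G t)))\<^sup>2) \<in> borel_measurable N"
   by (intro borel_measurable_power nrm_measurable[OF lmeasurable_cylinder w s])
  show "AE t in N. norm ((nrm MC (momentum \<nu> (f t) (G t)))\<^sup>2) \<le> norm (c\<^sup>2 * (nrm MC (G t))\<^sup>2)"
   by (rule AE_I2) (use power_mono[OF bound nrm_nonneg, of _ 2] in \<open>simp add: power_mult_distrib\<close>)
 qed
qed

lemma momentum_integrable:
 fixes R :: real
 assumes K: "wmeas (lebesgue_on {0<..}) MC K" "\<And>t. sq_int MC (K t)" "integrable (lebesgue_on {0<..}) (\<lambda>t. (nrm MC (K t))\<^sup>2)"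
 shows "integrable (lebesgue_on {0<..<R}) (\<lambda>t. nrm MC (K t))"
  "sq_int MC W ==> integrable (lebesgue_on {0<..<R}) (\<lambda>t. ip MC (K t) W)"
proof -
 have sub: "{0<..<R} \<subseteq> {0<..}" by auto
 have lm: "{0<..<R} \<in> lmeasurable" by (rule lmeasurable_open) auto
 have m: "(\<lambda>t. nrm MC (K t)) \<in> borel_measurable (lebesgue_on {0<..<R})"
  by (rule measurable_lebesgue_on_subset[OF nrm_measurable[OF lmeasurable_cylinder K(1,2)] sub])
 have "sq_int (lebesgue_on {0<..<R}) (\<lambda>t. nrm MC (K t))"
  using integrable_lebesgue_on_subset[OF K(3) sub] m by (simp add: sq_int_def)
 then show i: "integrable (lebesgue_on {0<..<R}) (\<lambda>t. nrm MC (K t))" by (rule sq_int_integrable_fm[OF lm])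
 assume W: "sq_int MC W"
 show "integrable (lebesgue_on {0<..<R}) (\<lambda>t. ip MC (K t) W)"
 proof (rule Bochner_Integration.integrable_bound)
  show "integrable (lebesgue_on {0<..<R}) (\<lambda>t. nrm MC (K t) * nrm MC W)" using i by simp
  show "(\<lambda>t. ip MC (K t) W) \<in> borel_measurable (lebesgue_on {0<..<R})"
   by (rule wmeasD[OF wmeas_subset[OF K(1) sub] W])
  show "AE t in lebesgue_on {0<..<R}. norm (ip MC (K t) W) \<le> norm (nrm MC (K t) * nrm MC W)"
   by (rule AE_I2) (use CS_inner[OF K(2) W] in \<open>simp add: nrm_nonneg\<close>)
 qed
qed

lemma SD_sq_int_lift:
 assumes "\<theta> \<in> SD"
 shows "sq_int MC (lift \<theta>)" "sq_int MC (\<lambda>x. lift_mat (grad \<theta> (horiz x)))"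
 using lift_sq_int(1)[OF SD_sq_int(1)[OF assms]] lift_mat_lift(1)[OF SD_sq_int(2)[OF assms]] by auto

text \<open>For product test fields \<eta>(t) \<theta>(x) the space integral splits into a term with
  \<eta>' and one with \<eta>. As \<theta> is lifted from the plane, \<open>flux_ip_lift\<close>
  puts the vertical mean in place of f \<otimes> f.\<close>

lemma weak_form_C_integral:
 fixes f :: "real^3 => real^3"
 assumes p: "grad_closure C SC f G" and \<theta>: "\<theta> \<in> SD"
 shows "(LINT x|MC. - ((\<eta>' *\<^sub>R \<theta> (horiz x)) \<bullet> f x) - ((\<eta> *\<^sub>R lift_mat (grad \<theta> (horiz x))) *v f x) \<bullet> f x
   + \<nu> * (G x \<bullet> (\<eta> *\<^sub>R lift_mat (grad \<theta> (horiz x))))) =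
  - (\<eta>' * ip MC f (lift \<theta>)) - \<eta> * ip MC (momentum \<nu> f G) (\<lambda>x. lift_mat (grad \<theta> (horiz x)))"
proof -
 let ?\<theta> = "\<lambda>x. \<theta> (horiz x)" and ?J = "\<lambda>x. lift_mat (grad \<theta> (horiz x))"
 note pD = grad_closureD[OF p] and la = ladyzhenskaya[OF p] and t = SD_sq_int_lift[OF \<theta>]
 note o = vsq_mult2(1)[OF pD(1) la(1) pD(1) la(1) SD_sq_int(2)[OF \<theta>]]
 have F: "sq_int MC (flux f)" by (rule flux_sq_int(1)[OF pD(1) la(1)])
 have "ip MC (momentum \<nu> f G) ?J = ip MC (flux f) ?J - ip MC (\<lambda>x. \<nu> *\<^sub>R G x) ?J"
  unfolding momentum_def[abs_def] by (rule ip_diff_left[OF F sq_int_scaleR[OF pD(2)] t(2)])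
 also have "\<dots> = (LINT x|MC. ?J x \<bullet> outer (f x) (f x)) - \<nu> * ip MC G ?J"
  using flux_ip_lift[OF pD(1) la(1) SD_sq_int(2)[OF \<theta>]] by simp
 finally have e: "ip MC (momentum \<nu> f G) ?J = (LINT x|MC. ?J x \<bullet> outer (f x) (f x)) - \<nu> * ip MC G ?J" .
 have "(LINT x|MC. - ((\<eta>' *\<^sub>R ?\<theta> x) \<bullet> f x) - ((\<eta> *\<^sub>R ?J x) *v f x) \<bullet> f x + \<nu> * (G x \<bullet> (\<eta> *\<^sub>R ?J x)))
   = (LINT x|MC. - \<eta>' * (f x \<bullet> ?\<theta> x) - \<eta> * (?J x \<bullet> outer (f x) (f x)) + \<nu> * \<eta> * (G x \<bullet> ?J x))"
  by (rule Bochner_Integration.integral_cong[OF refl])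
    (simp add: inner_outer scaleR_matrix_vector_assoc[symmetric] inner_commute[of "?\<theta> _"] mult.assoc)
 also have "\<dots> = - \<eta>' * ip MC f ?\<theta> - \<eta> * (LINT x|MC. ?J x \<bullet> outer (f x) (f x)) + \<nu> * \<eta> * ip MC G ?J"
  using o sq_int_inner[OF pD(1) t(1)] sq_int_inner[OF pD(2) t(2)] by simp
 finally show ?thesis unfolding e by (simp add: algebra_simps)
qed

text \<open>The plane equation is tested with the vertical integral of \<psi>. By the adjoint
  relations all pairings on \<open>D\<close> become pairings of the lifted field with \<psi> and its
  full gradient on the cylinder, so that both equations take the same form.\<close>

lemma weak_form_D_integral:
 fixes f :: "real^2 => real^3"
 assumes p: "grad_closure D SD f G" and \<psi>: "\<psi> \<in> SC"
 shows "(LINT y|MD. - ((\<eta>' *\<^sub>R vert L \<psi> y) \<bullet> f y) - ((\<eta> *\<^sub>R grad (vert L \<psi>) y) *v horiz (f y)) \<bullet> f y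
   + \<nu> * (G y \<bullet> (\<eta> *\<^sub>R grad (vert L \<psi>) y))) =
  - (\<eta>' * ip MC (lift f) \<psi>)
  - \<eta> * ip MC (momentum \<nu> (lift f) (\<lambda>x. lift_mat (G (horiz x)))) (grad \<psi>)"
proof -
 let ?\<chi> = "vert L \<psi>" and ?J = "\<lambda>y. grad (vert L \<psi>) y"
 note pD = grad_closureD[OF p] and la = ladyzhenskaya_D[OF p] and v = SC_vert[OF \<psi>]
 note c = SD_sq_int[OF v(1)]
 have O: "sq_int MD (\<lambda>y. outer (f y) (f y))"
  by (rule sq_int_bound[OF la(1), where C = 1])
    (simp_all add: borel_measurable_outer sq_int_measurable[OF pD(1)] norm_outer power2_eq_square)
 have lm: "sq_int MD (\<lambda>y. lift_mat (H y))" if H: "sq_int MD H" for H :: "real^2 => real^2^3"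
 proof (rule sq_int_bound[OF H, where C = 1])
  show "(\<lambda>y. lift_mat (H y)) \<in> borel_measurable MD"
   by (rule measurable_compose[OF sq_int_measurable[OF H]])
     (rule borel_measurable_continuous_onI[OF linear_continuous_on[OF bounded_linear_lift_mat]])
 qed simp
 have \<chi>: "ip MC (lift f) \<psi> = ip MD f ?\<chi>"
 proof -
  have "(\<chi> i. vert L (\<lambda>x. \<psi> x $ i) y) = ?\<chi> y" for y by (simp add: vec_eq_iff v)
  then show ?thesis using lift_ip(2)[OF pD(1) SD_SC_sq_int(1)[OF \<psi>]] by simp
 qed
 let ?B = "\<lambda>y. outer (f y) (f y) - \<nu> *\<^sub>R lift_mat (G y)"
 have "momentum \<nu> (lift f) (\<lambda>x. lift_mat (G (horiz x))) = (lift ?B)"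
  by (simp add: fun_eq_iff momentum_def flux_lift)
 then have "ip MC (momentum \<nu> (lift f) (\<lambda>x. lift_mat (G (horiz x)))) (grad \<psi>) = ip MD ?B (\<lambda>y. lift_mat (?J y))"
  using lift_jacobian_ip[OF sq_int_diff[OF O sq_int_scaleR[OF lm[OF pD(2)]]] \<psi>] by simp
 also have "\<dots> = ip MD (\<lambda>y. outer (f y) (f y)) (\<lambda>y. lift_mat (?J y)) - ip MD (\<lambda>y. \<nu> *\<^sub>R lift_mat (G y)) (\<lambda>y. lift_mat (?J y))"
  by (rule ip_diff_left[OF O sq_int_scaleR[OF lm[OF pD(2)]] lm[OF c(2)]])
 also have "\<dots> = (LINT y|MD. lift_mat (?J y) \<bullet> outer (f y) (f y)) - \<nu> * ip MD G ?J"
  by (simp add: inner_lift_mat ip_commute[of MD "\<lambda>y. outer (f y) (f y)"])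
 finally have e: "ip MC (momentum \<nu> (lift f) (\<lambda>x. lift_mat (G (horiz x)))) (grad \<psi>) =
  (LINT y|MD. lift_mat (?J y) \<bullet> outer (f y) (f y)) - \<nu> * ip MD G ?J" .
 have "(LINT y|MD. - ((\<eta>' *\<^sub>R ?\<chi> y) \<bullet> f y) - ((\<eta> *\<^sub>R ?J y) *v horiz (f y)) \<bullet> f y + \<nu> * (G y \<bullet> (\<eta> *\<^sub>R ?J y)))
   = (LINT y|MD. - \<eta>' * (f y \<bullet> ?\<chi> y) - \<eta> * (lift_mat (?J y) \<bullet> outer (f y) (f y)) + \<nu> * \<eta> * (G y \<bullet> ?J y))"
  by (rule Bochner_Integration.integral_cong[OF refl])
    (simp add: inner_outer lift_mat_horiz scaleR_matrix_vector_assoc[symmetric] inner_commute[of "?\<chi> _"] mult.assoc)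
 also have "\<dots> = - \<eta>' * ip MD f ?\<chi> - \<eta> * (LINT y|MD. lift_mat (?J y) \<bullet> outer (f y) (f y)) + \<nu> * \<eta> * ip MD G ?J"
  using sq_int_inner[OF lm[OF c(2)] O] sq_int_inner[OF pD(1) c(1)] sq_int_inner[OF pD(2) c(2)] by simp
 finally show ?thesis unfolding e \<chi> by (simp add: algebra_simps)
qed

lemma Cc_inf_time_C:
 assumes \<theta>: "\<theta> \<in> SD" and \<eta>: "smooth_on \<eta> UNIV" "\<forall>t\<ge>R. \<eta> t = 0"
 defines "\<phi> \<equiv> \<lambda>t x. \<eta> t *\<^sub>R \<theta> (horiz x)"
 shows "\<phi> \<in> Cc_inf_time D (cyl_fields L)" "div_free3 (\<phi> t)"
  "grad (\<phi> t) x = \<eta> t *\<^sub>R lift_mat (grad \<theta> (horiz x))"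
proof -
 obtain K where K: "compact K" "K \<subseteq> D" "smooth_on \<theta> UNIV" "\<And>x. x \<notin> K ==> \<theta> x = 0"
  "\<And>x. grad \<theta> x $ 1 $ 1 + grad \<theta> x $ 2 $ 2 = 0"
  by (rule SD_D[OF \<theta>]) (rule that)
 have s: "smooth_on (lift \<theta>) UNIV" by (rule smooth_lift[OF K(3)])
 have "\<phi> t \<in> cyl_fields L K" for t
  unfolding cyl_fields_def \<phi>_def
  using K(4) smooth_scaleR[OF smooth_const s, of "\<eta> t"]
  by (simp add: vec_eq_iff horiz_def axis_def)
 then show "\<phi> \<in> Cc_inf_time D (cyl_fields L)"
  unfolding Cc_inf_time_def using smooth_time_product[OF \<eta>(1) s] K(1,2) \<eta>(2) by (auto simp: \<phi>_def)
 show j: "grad (\<phi> t) x = \<eta> t *\<^sub>R lift_mat (grad \<theta> (horiz x))" for t x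
  unfolding \<phi>_def by (simp add: jacobian_scaleR[OF s] jacobian_lift[OF K(3)])
 show "div_free3 (\<phi> t)"
  unfolding div_free3_def j trace_def by (simp add: sum_3 K(5) flip: distrib_left)
qed

lemma Cc_inf_time_D:
 assumes \<theta>: "\<theta> \<in> SD" and \<eta>: "smooth_on \<eta> UNIV" "\<forall>t\<ge>R. \<eta> t = 0"
 defines "\<phi> \<equiv> \<lambda>t x. \<eta> t *\<^sub>R \<theta> x"
 shows "\<phi> \<in> Cc_inf_time D plane_fields" "div_free2 (\<phi> t)" "grad (\<phi> t) x = \<eta> t *\<^sub>R grad \<theta> x"
proof -
 obtain K where K: "compact K" "K \<subseteq> D" "smooth_on \<theta> UNIV" "\<And>x. x \<notin> K ==> \<theta> x = 0"
  "\<And>x. grad \<theta> x $ 1 $ 1 + grad \<theta> x $ 2 $ 2 = 0"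
  by (rule SD_D[OF \<theta>]) (rule that)
 have "\<phi> t \<in> plane_fields K" for t
  unfolding plane_fields_def \<phi>_def using K(4) smooth_scaleR[OF smooth_const K(3), of "\<eta> t"] by simp
 then show "\<phi> \<in> Cc_inf_time D plane_fields"
  unfolding Cc_inf_time_def using smooth_time_product[OF \<eta>(1) K(3)] K(1,2) \<eta>(2) by (auto simp: \<phi>_def)
 show j: "grad (\<phi> t) x = \<eta> t *\<^sub>R grad \<theta> x" for t x
  unfolding \<phi>_def by (rule jacobian_scaleR[OF K(3)])
 show "div_free2 (\<phi> t)"
  unfolding div_free2_def j by (simp add: K(5) flip: distrib_left)
qed

end

section \<open>Comparison of the two solutions\<close>

text \<open>Substituting y = 3 sqrt (2 a X) / (4 \<nu> X) turns the difference of the two sides into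
  2/3 \<nu> X^2 (y^4 - 4 y + 3), and y^4 - 4 y + 3 = (y - 1)^2 ((y + 1)^2 + 2). The constant is
  optimal, with equality at y = 1.\<close>

lemma young_quartic:
 fixes \<nu> X a :: real
 assumes \<nu>: "0 < \<nu>" and X: "0 \<le> X" and a: "0 \<le> a"
 shows "2 * (X * sqrt (2 * (a * X))) \<le> 2 * \<nu> * X\<^sup>2 + 27 / (32 * \<nu> ^ 3) * a\<^sup>2"
proof (cases "X = 0")
 case True
 then show ?thesis using \<nu> by simp
next
 case False
 define s where "s = sqrt (2 * (a * X))"
 define y where "y = 3 * s / (4 * \<nu> * X)"
 have s2: "s\<^sup>2 = 2 * (a * X)" using X a by (simp add: s_def)
 have s: "s = 4 / 3 * \<nu> * X * y" using False \<nu> by (simp add: y_def)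
 have aX: "a = 8 / 9 * \<nu>\<^sup>2 * X * y\<^sup>2"
 proof -
  have "2 * (a * X) = (4 / 3 * \<nu> * X * y)\<^sup>2" using s2 s by simp
  also have "\<dots> = 2 * ((8 / 9 * \<nu>\<^sup>2 * X * y\<^sup>2) * X)" by (simp add: power2_eq_square)
  finally have "a * X = (8 / 9 * \<nu>\<^sup>2 * X * y\<^sup>2) * X" by linarith
  then show ?thesis by (simp only: mult_right_cancel[OF False])
 qed
 have "27 / (32 * \<nu> ^ 3) * a\<^sup>2 = 2 / 3 * \<nu> * X\<^sup>2 * y ^ 4"
  using \<nu> unfolding aX by (simp add: field_simps power2_eq_square power3_eq_cube power4_eq_xxxx)
 moreover have "2 * (X * s) = 8 / 3 * \<nu> * X\<^sup>2 * y" unfolding s by (simp add: power2_eq_square)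
 moreover have "0 \<le> 2 / 3 * \<nu> * X\<^sup>2 * y ^ 4 - 8 / 3 * \<nu> * X\<^sup>2 * y + 2 * \<nu> * X\<^sup>2"
 proof -
  have "0 \<le> 2 / 3 * (\<nu> * X\<^sup>2) * ((y - 1)\<^sup>2 * ((y + 1)\<^sup>2 + 2))"
   using \<nu> by (intro mult_nonneg_nonneg add_nonneg_nonneg) simp_all
  also have "(y - 1)\<^sup>2 * ((y + 1)\<^sup>2 + 2) = y ^ 4 - 4 * y + 3"
   by (simp add: power2_eq_square power4_eq_xxxx algebra_simps)
  also have "2 / 3 * (\<nu> * X\<^sup>2) * (y ^ 4 - 4 * y + 3) = 2 / 3 * \<nu> * X\<^sup>2 * y ^ 4 - 8 / 3 * \<nu> * X\<^sup>2 * y + 2 * \<nu> * X\<^sup>2"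
   by (simp add: algebra_simps)
  finally show ?thesis .
 qed
 ultimately show ?thesis unfolding s_def[symmetric] by linarith
qed

section \<open>The two solutions, their regularized versions and the equations at fixed
  times\<close>

locale comparison = cyl D L for D L +
 fixes \<nu> :: real and u0 :: "real^2 => real^3" and u :: "real => real^2 => real^3"
  and v0 :: "real^3 => real^3" and v :: "real => real^3 => real^3"
 assumes \<nu>: "0 < \<nu>" and u0: "u0 \<in> H_D D" and u: "weak_solution_2half D \<nu> u0 u"
  and v0: "v0 \<in> H_C D L" and v: "leray_hopf_solution D L \<nu> v0 v" and vL: "v \<in> L2_time C {0<..} (V_C D L)"
begin

abbreviation "Ninf \<equiv> lebesgue_on {0::real<..}"

definition "fv = reg_field C SC v"
definition "gv = reg_grad C SC v"
definition "fu = reg_field D SD u"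
definition "gu = reg_grad D SD u"
definition "U t = lift (fu t)"
definition "GU t = (\<lambda>x. lift_mat (gu t (horiz x)))"
definition "K t = momentum \<nu> (fv t) (gv t)"
definition "J t = momentum \<nu> (U t) (GU t)"

lemma vL': "v \<in> L2_time C {0<..} (H1_closure C SC)" using vL by (simp add: V_C_def SC_def)

lemma uL': "u \<in> L2_time D {0<..} (H1_closure D SD)" using u by (simp add: weak_solution_2half_def V_D_def SD_def)

lemma SC_smooth_all: "\<forall>\<phi>\<in>SC. smooth_on \<phi> UNIV" and SD_smooth_all: "\<forall>\<phi>\<in>SD. smooth_on \<phi> UNIV"
 using SC_smooth SD_smooth by auto

lemmas v_reg = L2_time_regular[OF vL' SC_smooth_all SC_zero open_cylinder bounded_cylinder lmeasurable_cylinder, folded fv_def gv_def]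
lemmas u_reg = L2_time_regular[OF uL' SD_smooth_all SD_zero D lmeasurable_D, folded fu_def gu_def]

lemma v_energy: "0 < T ==> (nrm MC (v T))\<^sup>2 + 2 * \<nu> * (LINT t|lebesgue_on {0<..<T}. (nrm MC (gv t))\<^sup>2) \<le> (nrm MC v0)\<^sup>2"
 using v energy_regular[OF vL'] by (simp add: leray_hopf_solution_def gv_def)

lemma u_energy: "0 < T ==> (nrm MD (u T))\<^sup>2 + 2 * \<nu> * (LINT t|lebesgue_on {0<..<T}. (nrm MD (gu t))\<^sup>2) \<le> (nrm MD u0)\<^sup>2"
 using u energy_regular[OF uL'] by (simp add: weak_solution_2half_def gu_def)

lemma v_bound: "0 < T ==> nrm MC (v T) \<le> nrm MC v0" and u_bound: "0 < T ==> nrm MD (u T) \<le> nrm MD u0"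
proof -
 assume T: "0 < T"
 have "0 \<le> 2 * \<nu> * (LINT t|lebesgue_on {0<..<T}. (nrm MC (gv t))\<^sup>2)" "0 \<le> 2 * \<nu> * (LINT t|lebesgue_on {0<..<T}. (nrm MD (gu t))\<^sup>2)"
  using \<nu> by (intro mult_nonneg_nonneg Bochner_Integration.integral_nonneg; simp)+
 then have e: "(nrm MC (v T))\<^sup>2 \<le> (nrm MC v0)\<^sup>2" "(nrm MD (u T))\<^sup>2 \<le> (nrm MD u0)\<^sup>2"
  using v_energy[OF T] u_energy[OF T] by linarith+
 show "nrm MC (v T) \<le> nrm MC v0" by (rule power2_le_imp_le[OF e(1) nrm_nonneg])
 show "nrm MD (u T) \<le> nrm MD u0" by (rule power2_le_imp_le[OF e(2) nrm_nonneg])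
qed

lemma fv_bound: "nrm MC (fv t) \<le> nrm MC v0" and fu_bound: "nrm MD (fu t) \<le> nrm MD u0"
 using v_bound[of t] u_bound[of t] by (simp_all add: fv_def fu_def reg_field_def nrm_def)

lemma v_sq: "0 \<le> t ==> sq_int MC (v t)"
 using v L2_closure_approx(1)[of "v t" C SC] by (simp add: leray_hopf_solution_def C0_weak_def H_C_def SC_def)

lemma u_sq: "0 \<le> t ==> sq_int MD (u t)"
 using u L2_closure_approx(1)[of "u t" D SD] by (simp add: weak_solution_2half_def C0_weak_def H_D_def SD_def)

lemma v0_sq: "sq_int MC v0" and u0_sq: "sq_int MD u0"
 using v0 u0 L2_closure_approx(1) by (auto simp: H_C_def H_D_def)

lemma v_cont: "sq_int MC w ==> continuous_on {0..} (\<lambda>t. ip MC (v t) w)"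
 using v by (simp add: leray_hopf_solution_def C0_weak_def L2_iff)

lemma U_cont:
 assumes w: "sq_int MC w"
 shows "continuous_on {0..} (\<lambda>t. ip MC (lift (u t)) w)"
proof -
 let ?w = "\<lambda>y. \<chi> i. vert L (\<lambda>x. w x $ i) y"
 have "continuous_on {0..} (\<lambda>t. ip MD (u t) ?w)"
  using u lift_ip(1)[OF u0_sq w] by (simp add: weak_solution_2half_def C0_weak_def L2_iff)
 then show ?thesis by (rule continuous_on_eq) (simp add: lift_ip(2)[OF u_sq w])
qed

lemma lift_ip_vert: "sq_int MD f ==> \<psi> \<in> SC ==> ip MC (lift f) \<psi> = ip MD f (vert L \<psi>)"
proof -
 assume f: "sq_int MD f" and \<psi>: "\<psi> \<in> SC"
 have "(\<chi> i. vert L (\<lambda>x. \<psi> x $ i) y) = vert L \<psi> y" for y by (simp add: vec_eq_iff SC_vert[OF \<psi>])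
 then show ?thesis using lift_ip(2)[OF f SD_SC_sq_int(1)[OF \<psi>]] by simp
qed

lemma U_reg: "grad_closure C SC (U t) (GU t)"
 unfolding U_def GU_def by (rule grad_closure_lift[OF u_reg(2)])

lemma U_wmeas: "wmeas Ninf MC U"
 unfolding wmeas_def
proof (intro allI impI)
 fix w :: "real^3 => real^3" assume w: "sq_int MC w"
 have "(\<lambda>t. ip MD (fu t) (\<lambda>y. \<chi> i. vert L (\<lambda>x. w x $ i) y)) \<in> borel_measurable Ninf"
  by (rule wmeasD[OF u_reg(3) lift_ip(1)[OF u0_sq w]])
 then show "(\<lambda>t. ip MC (U t) w) \<in> borel_measurable Ninf"
  unfolding U_def by (simp add: lift_ip(2)[OF grad_closureD(1)[OF u_reg(2)] w])
qed

lemma U_bound: "nrm MC (U t) \<le> sqrt L * nrm MD u0"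
 unfolding U_def using nrm_lift[OF grad_closureD(1)[OF u_reg(2)], of t] fu_bound[of t] L by simp

lemma GU_nrm: "(nrm MC (GU t))\<^sup>2 = L * (nrm MD (gu t))\<^sup>2"
 unfolding GU_def by (rule lift_mat_lift(2)[OF grad_closureD(2)[OF u_reg(2)]])

lemma GU_integrable: "integrable Ninf (\<lambda>t. (nrm MC (GU t))\<^sup>2)"
 unfolding GU_nrm using u_reg(5) by simp

lemma GU_wmeas: "wmeas Ninf MC GU"
 by (rule wmeas_gradient[OF U_reg U_wmeas SC_smooth open_cylinder bounded_cylinder lmeasurable_cylinder])

lemmas K_reg = momentum_regular[OF v_reg(2,3) fv_bound v_reg(5) less_imp_le[OF \<nu>], folded K_def]
lemmas J_reg = momentum_regular[OF U_reg U_wmeas U_bound GU_integrable less_imp_le[OF \<nu>], folded J_def]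

text \<open>The test fields are lifts of plane fields, since only against these may the flux of
  \<open>v\<close> stand for v \<otimes> v. \<open>weak_time_derivative\<close> turns the weak form
  into an identity at every single time.\<close>

lemma v_weak:
 assumes \<theta>: "\<theta> \<in> SD" and T: "0 \<le> T"
 shows "ip MC (v T) (lift \<theta>) = ip MC v0 (lift \<theta>) +
  (LINT t|lebesgue_on {0<..<T}. ip MC (K t) (\<lambda>x. lift_mat (grad \<theta> (horiz x))))"
proof (rule weak_time_derivative[OF _ _ _ T])
 note t = SD_sq_int_lift[OF \<theta>]
 show "continuous_on {0..} (\<lambda>t. ip MC (v t) (lift \<theta>))" by (rule v_cont[OF t(1)])
 show "integrable (lebesgue_on {0<..<R}) (\<lambda>t. ip MC (K t) (\<lambda>x. lift_mat (grad \<theta> (horiz x))))" for R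
  by (rule momentum_integrable(2)[OF K_reg t(2)])
 fix \<eta> \<eta>' :: "real => real" and R
 assume \<eta>: "smooth_on \<eta> UNIV" "\<And>t. (\<eta> has_real_derivative \<eta>' t) (at t)" "\<And>t. R \<le> t ==> \<eta> t = 0"
 have z: "\<forall>t\<ge>R. \<eta> t = 0" using \<eta>(3) by blast
 note Cc = Cc_inf_time_C[OF \<theta> \<eta>(1) z]
 let ?\<phi> = "\<lambda>t x. \<eta> t *\<^sub>R \<theta> (horiz x)"
 let ?I = "\<lambda>t. \<integral>x. - (vector_derivative (\<lambda>s. ?\<phi> s x) (at t within {0..}) \<bullet> v t x)
      - (grad (?\<phi> t) x *v v t x) \<bullet> v t x
      + \<nu> * (weak_gradient C (v t) x \<bullet> grad (?\<phi> t) x) \<partial>MC"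
 have "weak_form_C D L \<nu> v0 v" using v by (simp add: leray_hopf_solution_def)
 then have wf: "(LINT t|Ninf. ?I t) - (LINT x|MC. v0 x \<bullet> ?\<phi> 0 x) = 0"
  unfolding weak_form_C_def by (rule ballE[where x = ?\<phi>]) (use Cc in \<open>blast+\<close>)
 have "(LINT t|Ninf. - (\<eta>' t * ip MC (v t) (lift \<theta>)) - \<eta> t * ip MC (K t) (\<lambda>x. lift_mat (grad \<theta> (horiz x))))
   = (LINT t|Ninf. ?I t)"
 proof (rule integral_lebesgue_on_cong_AE)
  have "AE t in Ninf. 0 < t" by (rule AE_I2) simp
  with v_reg(1) show "AE t in Ninf. - (\<eta>' t * ip MC (v t) (lift \<theta>)) -
    \<eta> t * ip MC (K t) (\<lambda>x. lift_mat (grad \<theta> (horiz x))) = ?I t"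
  proof eventually_elim
   case (elim t)
   then have e: "fv t = v t" "gv t = weak_gradient C (v t)" by auto
   show ?case
    using weak_form_C_integral[OF v_reg(2)[of t] \<theta>, of "\<eta>' t" "\<eta> t" \<nu>]
    unfolding vector_derivative_time_product[OF \<eta>(2) elim(2)] Cc(3) K_def e by (rule sym)
  qed
 qed simp
 also have "\<dots> = (LINT x|MC. v0 x \<bullet> ?\<phi> 0 x)" using wf by simp
 also have "\<dots> = \<eta> 0 * ip MC v0 (lift \<theta>)" by simp
 finally show "(LINT t|Ninf. - (\<eta>' t * ip MC (v t) (lift \<theta>)) - \<eta> t * ip MC (K t) (\<lambda>x. lift_mat (grad \<theta> (horiz x))))
   = \<eta> 0 * ip MC v0 (lift \<theta>)" .
qed

text \<open>Every three-dimensional \<psi> is allowed although \<open>u\<close> solves a plane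
  equation, because the vertical integral of \<psi> is an admissible plane field. This later admits
  \<open>v\<close> as a test field.\<close>

lemma u_weak:
 assumes \<psi>: "\<psi> \<in> SC" and T: "0 \<le> T"
 shows "ip MC (lift (u T)) \<psi> = ip MC (lift u0) \<psi> +
  (LINT t|lebesgue_on {0<..<T}. ip MC (J t) (grad \<psi>))"
proof (rule weak_time_derivative[OF _ _ _ T])
 note p = SD_SC_sq_int[OF \<psi>] and \<theta> = SC_vert(1)[OF \<psi>]
 show "continuous_on {0..} (\<lambda>t. ip MC (lift (u t)) \<psi>)" by (rule U_cont[OF p(1)])
 show "integrable (lebesgue_on {0<..<R}) (\<lambda>t. ip MC (J t) (grad \<psi>))" for R
  by (rule momentum_integrable(2)[OF J_reg p(2)])
 fix \<eta> \<eta>' :: "real => real" and R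
 assume \<eta>: "smooth_on \<eta> UNIV" "\<And>t. (\<eta> has_real_derivative \<eta>' t) (at t)" "\<And>t. R \<le> t ==> \<eta> t = 0"
 have z: "\<forall>t\<ge>R. \<eta> t = 0" using \<eta>(3) by blast
 note Cc = Cc_inf_time_D[OF \<theta> \<eta>(1) z]
 let ?\<phi> = "\<lambda>t y. \<eta> t *\<^sub>R vert L \<psi> y"
 let ?I = "\<lambda>t. \<integral>y. - (vector_derivative (\<lambda>s. ?\<phi> s y) (at t within {0..}) \<bullet> u t y)
      - (grad (?\<phi> t) y *v horiz (u t y)) \<bullet> u t y
      + \<nu> * (weak_gradient D (u t) y \<bullet> grad (?\<phi> t) y) \<partial>MD"
 have "weak_form_D D \<nu> u0 u" using u by (simp add: weak_solution_2half_def)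
 then have wf: "(LINT t|Ninf. ?I t) - (LINT y|MD. u0 y \<bullet> ?\<phi> 0 y) = 0"
  unfolding weak_form_D_def by (rule ballE[where x = ?\<phi>]) (use Cc in \<open>blast+\<close>)
 have "(LINT t|Ninf. - (\<eta>' t * ip MC (lift (u t)) \<psi>) - \<eta> t * ip MC (J t) (grad \<psi>)) = (LINT t|Ninf. ?I t)"
 proof (rule integral_lebesgue_on_cong_AE)
  have "AE t in Ninf. 0 < t" by (rule AE_I2) simp
  with u_reg(1) show "AE t in Ninf. - (\<eta>' t * ip MC (lift (u t)) \<psi>) - \<eta> t * ip MC (J t) (grad \<psi>) = ?I t"
  proof eventually_elim
   case (elim t)
   then have e: "fu t = u t" "gu t = weak_gradient D (u t)" by auto
   show ?case
    using weak_form_D_integral[OF u_reg(2)[of t] \<psi>, of "\<eta>' t" "\<eta> t" \<nu>]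
    unfolding vector_derivative_time_product[OF \<eta>(2) elim(2)] Cc(3) J_def U_def GU_def e by (rule sym)
  qed
 qed simp
 also have "\<dots> = (LINT y|MD. u0 y \<bullet> ?\<phi> 0 y)" using wf by simp
 also have "\<dots> = \<eta> 0 * ip MC (lift u0) \<psi>" by (simp add: lift_ip_vert[OF u0_sq \<psi>])
 finally show "(LINT t|Ninf. - (\<eta>' t * ip MC (lift (u t)) \<psi>) - \<eta> t * ip MC (J t) (grad \<psi>))
   = \<eta> 0 * ip MC (lift u0) \<psi>" .
qed

text \<open>Extends \<open>v_weak\<close> to the closure. The test field may then be the other
  solution, frozen at a time unrelated to the integration variable.\<close>

lemma v_pairing:
 assumes p: "grad_closure D SD g G" and T: "0 \<le> T"
 shows "ip MC (v T) (lift g) = ip MC v0 (lift g) +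
  (LINT t|lebesgue_on {0<..<T}. ip MC (K t) (\<lambda>x. lift_mat (G (horiz x))))"
proof -
 obtain \<phi> where \<phi>: "\<And>n::nat. \<phi> n \<in> SD" "(\<lambda>n. dst MD (\<phi> n) g) ----> 0"
  "(\<lambda>n. dst MD (grad (\<phi> n)) G) ----> 0"
  by (rule grad_closureE[OF p]) (rule that)
 note pD = grad_closureD[OF p]
 have sub: "{0<..<T} \<subseteq> {0<..}" by auto
 have d: "ip MC (\<lambda>x. v T x - v0 x) w = ip MC (v T) w - ip MC v0 w" if "sq_int MC w" for w
  by (rule ip_diff_left[OF v_sq[OF T] v0_sq that])
 have "ip MC (\<lambda>x. v T x - v0 x) (lift g) = (LINT t|lebesgue_on {0<..<T}. ip MC (K t) (\<lambda>x. lift_mat (G (horiz x))))"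
 proof (rule pairing_closure[where \<phi> = "\<lambda>n x. \<phi> n (horiz x)" and \<Phi> = "\<lambda>n x. lift_mat (grad (\<phi> n) (horiz x))"])
  show "wmeas (lebesgue_on {0<..<T}) MC K" by (rule wmeas_subset[OF K_reg(1) sub])
  show "integrable (lebesgue_on {0<..<T}) (\<lambda>t. nrm MC (K t))" by (rule momentum_integrable(1)[OF K_reg])
  show "ip MC (\<lambda>x. v T x - v0 x) (lift (\<phi> n)) =
    (LINT t|lebesgue_on {0<..<T}. ip MC (K t) (\<lambda>x. lift_mat (grad (\<phi> n) (horiz x))))" for n
   using v_weak[OF \<phi>(1) T] d[OF SD_sq_int_lift(1)[OF \<phi>(1)]] by simp
  show "(\<lambda>n. nrm MC (\<lambda>x. \<phi> n (horiz x) - g (horiz x))) ----> 0"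
   using tendsto_mult_left[OF \<phi>(2), of "sqrt L"] nrm_lift[OF sq_int_diff[OF SD_sq_int(1)[OF \<phi>(1)] pD(1)]] by simp
  have "nrm MC (\<lambda>x. lift_mat (grad (\<phi> n) (horiz x)) - lift_mat (G (horiz x))) =
    sqrt L * dst MD (grad (\<phi> n)) G" for n
   by (rule power2_eq_imp_eq)
     (use lift_mat_lift(2)[OF sq_int_diff[OF SD_sq_int(2)[OF \<phi>(1)] pD(2)], of n] L
     in \<open>simp_all add: lift_mat_diff nrm_nonneg power_mult_distrib\<close>)
  then show "(\<lambda>n. nrm MC (\<lambda>x. lift_mat (grad (\<phi> n) (horiz x)) - lift_mat (G (horiz x)))) ----> 0"
   using tendsto_mult_left[OF \<phi>(3), of "sqrt L"] by simp
 qed (intro K_reg(2) sq_int_diff v_sq[OF T] v0_sq SD_sq_int_lift \<phi>(1) lift_sq_int(1) lift_mat_lift(1) pD)+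
 then show ?thesis using d[OF lift_sq_int(1)[OF pD(1)]] by simp
qed

lemma u_pairing:
 assumes p: "grad_closure C SC f F" and T: "0 \<le> T"
 shows "ip MC (lift (u T)) f = ip MC (lift u0) f + (LINT t|lebesgue_on {0<..<T}. ip MC (J t) F)"
proof -
 obtain \<phi> where \<phi>: "\<And>n::nat. \<phi> n \<in> SC" "(\<lambda>n. dst MC (\<phi> n) f) ----> 0"
  "(\<lambda>n. dst MC (grad (\<phi> n)) F) ----> 0"
  by (rule grad_closureE[OF p]) (rule that)
 note pD = grad_closureD[OF p]
 note us = lift_sq_int(1)[OF u_sq[OF T]] lift_sq_int(1)[OF u0_sq]
 have sub: "{0<..<T} \<subseteq> {0<..}" by auto
 have d: "ip MC (\<lambda>x. u T (horiz x) - u0 (horiz x)) w = ip MC (lift (u T)) w - ip MC (lift u0) w" if "sq_int MC w" for w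
  by (rule ip_diff_left[OF us that])
 have "ip MC (\<lambda>x. u T (horiz x) - u0 (horiz x)) f = (LINT t|lebesgue_on {0<..<T}. ip MC (J t) F)"
 proof (rule pairing_closure[where \<phi> = \<phi> and \<Phi> = "\<lambda>n x. grad (\<phi> n) x"])
  show "wmeas (lebesgue_on {0<..<T}) MC J" by (rule wmeas_subset[OF J_reg(1) sub])
  show "integrable (lebesgue_on {0<..<T}) (\<lambda>t. nrm MC (J t))" by (rule momentum_integrable(1)[OF J_reg])
  show "ip MC (\<lambda>x. u T (horiz x) - u0 (horiz x)) (\<phi> n) = (LINT t|lebesgue_on {0<..<T}. ip MC (J t) (grad (\<phi> n)))" for n
   using u_weak[OF \<phi>(1) T] d[OF SD_SC_sq_int(1)[OF \<phi>(1)]] by simp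
 qed (intro J_reg(2) sq_int_diff us SD_SC_sq_int \<phi> pD)+
 then show ?thesis using d[OF pD(1)] by simp
qed

text \<open>At time 0 the weak equations only show that \<open>v 0\<close> and \<open>v0\<close>
  agree against lifts of plane fields, and the lifts of \<open>u 0\<close> and \<open>u0\<close>
  against three-dimensional ones. As \<open>u 0\<close> is a limit of the former and
  \<open>v0\<close> of the latter, the exchange takes two moves: first \<open>v0\<close> for
  \<open>v 0\<close> against \<open>u 0\<close>, then \<open>u0\<close> for \<open>u 0\<close>
  against \<open>v0\<close>.\<close>

lemma initial_pairing: "ip MC (v 0) (\<lambda>x. u 0 (horiz x)) = ip MC v0 (lift u0)"
proof -
 have int0: "(LINT t|lebesgue_on {0<..<0::real}. n t) = 0" for n :: "real => real"
  by (simp add: integral_eq_zero_AE)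
 have uH: "u 0 \<in> L2_closure D SD" using u by (simp add: weak_solution_2half_def C0_weak_def H_D_def SD_def)
 obtain \<phi> where \<phi>: "\<And>n::nat. \<phi> n \<in> SD" "(\<lambda>n. nrm MD (\<lambda>x. \<phi> n x - u 0 x)) ----> 0"
  using L2_closure_approx(2)[OF uH] by blast
 have \<phi>C: "(\<lambda>n. nrm MC (\<lambda>x. \<phi> n (horiz x) - u 0 (horiz x))) ----> 0"
  using tendsto_mult_left[OF \<phi>(2), of "sqrt L"] nrm_lift[OF sq_int_diff[OF SD_sq_int(1)[OF \<phi>(1)] u_sq]] by simp
 have z: "(\<lambda>n::nat. dst MC w w) ----> 0" for w :: "real^3 => real^3" by (simp add: nrm_def)
 note u0' = lift_sq_int(1)[OF u_sq[of 0]] lift_sq_int(1)[OF u0_sq]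
 have l1: "(\<lambda>n. ip MC w (lift (\<phi> n))) ----> ip MC w (\<lambda>x. u 0 (horiz x))" if w: "sq_int MC w" for w
  by (rule ip_tendsto[OF w w z SD_sq_int_lift(1)[OF \<phi>(1)] _ \<phi>C]) (rule u0', simp)
 have "ip MC (v 0) (lift (\<phi> n)) = ip MC v0 (lift (\<phi> n))" for n
  using v_weak[OF \<phi>(1), of 0] by (simp add: int0)
 then have "ip MC (v 0) (\<lambda>x. u 0 (horiz x)) = ip MC v0 (\<lambda>x. u 0 (horiz x))"
  using LIMSEQ_unique[OF l1[OF v_sq[of 0]]] l1[OF v0_sq] by simp
 moreover have "v0 \<in> L2_closure C SC" using v0 by (simp add: H_C_def SC_def)
 from L2_closure_approx(2)[OF this] obtain \<theta> where \<theta>: "\<And>n::nat. \<theta> n \<in> SC" "(\<lambda>n. dst MC (\<theta> n) v0) ----> 0"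
  by blast
 have l2: "(\<lambda>n. ip MC w (\<theta> n)) ----> ip MC w v0" if w: "sq_int MC w" for w
  by (rule ip_tendsto[OF w w z SD_SC_sq_int(1)[OF \<theta>(1)] v0_sq \<theta>(2)])
 have "ip MC (\<lambda>x. u 0 (horiz x)) (\<theta> n) = ip MC (lift u0) (\<theta> n)" for n
  using u_weak[OF \<theta>(1), of 0] by (simp add: int0)
 then have "ip MC (\<lambda>x. u 0 (horiz x)) v0 = ip MC (lift u0) v0"
  using LIMSEQ_unique[OF l2[OF u0'(1)]] l2[OF u0'(2)] by simp
 ultimately show ?thesis by (simp only: ip_commute[of MC v0])
qed

end

section \<open>The energy estimate for the difference\<close>

lemma ip_diag_integrable:
 fixes A B :: "'t => 'a::euclidean_space => 'b::euclidean_space"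
 assumes \<Omega>: "\<Omega> \<in> lmeasurable"
  and A: "wmeas N (lebesgue_on \<Omega>) A" "\<And>t. sq_int (lebesgue_on \<Omega>) (A t)" "integrable N (\<lambda>t. (nrm (lebesgue_on \<Omega>) (A t))\<^sup>2)"
  and B: "wmeas N (lebesgue_on \<Omega>) B" "\<And>t. sq_int (lebesgue_on \<Omega>) (B t)" "integrable N (\<lambda>t. (nrm (lebesgue_on \<Omega>) (B t))\<^sup>2)"
 shows "integrable N (\<lambda>t. ip (lebesgue_on \<Omega>) (A t) (B t))"
proof (rule Bochner_Integration.integrable_bound)
 let ?M = "lebesgue_on \<Omega>"
 show "integrable N (\<lambda>t. (nrm ?M (A t))\<^sup>2 + (nrm ?M (B t))\<^sup>2)" using A(3) B(3) by simp
 show "(\<lambda>t. ip ?M (A t) (B t)) \<in> borel_measurable N" by (rule ip_diag_measurable[OF \<Omega> A(1,2) B(1,2)])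
 show "AE t in N. norm (ip ?M (A t) (B t)) \<le> norm ((nrm ?M (A t))\<^sup>2 + (nrm ?M (B t))\<^sup>2)"
 proof (rule AE_I2)
  fix t
  have "\<bar>ip ?M (A t) (B t)\<bar> \<le> nrm ?M (A t) * nrm ?M (B t)" by (rule CS_inner[OF A(2) B(2)])
  also have "\<dots> \<le> (nrm ?M (A t))\<^sup>2 + (nrm ?M (B t))\<^sup>2"
   using sum_squares_bound[of "nrm ?M (A t)" "nrm ?M (B t)"] mult_nonneg_nonneg[OF nrm_nonneg nrm_nonneg, of ?M "A t" ?M "B t"]
   by linarith
  finally show "norm (ip ?M (A t) (B t)) \<le> norm ((nrm ?M (A t))\<^sup>2 + (nrm ?M (B t))\<^sup>2)" by simp
 qed
qed

context comparison
begin

text \<open>An instance of \<open>lions_magenes\<close>: \<open>K\<close> represents the derivative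
  of \<open>v\<close> and acts on the gradient of \<open>u\<close>, and \<open>J\<close> that of
  \<open>u\<close>, acting on the gradient of \<open>v\<close>. The two hypotheses hold for almost
  every frozen time, where the solutions agree with their regularized versions.\<close>

lemma energy_pairing:
 assumes T: "0 < T"
 shows "ip MC (v T) (lift (u T)) = ip MC v0 (lift u0) +
  (LINT t|lebesgue_on {0<..<T}. ip MC (K t) (GU t)) + (LINT t|lebesgue_on {0<..<T}. ip MC (gv t) (J t))"
proof -
 interpret ts: time_strip T "T + 1" by unfold_locales (use T in simp_all)
 \<comment> \<open>The curves are continued constantly to negative times because
   \<open>lions_magenes\<close> takes curves on the whole line. The norm bounds below include the
   value at time 0, about which the energy inequality says nothing.\<close>
 let ?f = "\<lambda>t. v (max 0 t)" and ?g = "\<lambda>t x. u (max 0 t) (horiz x)"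
 have sub: "{0<..<T + 1} \<subseteq> {0<..}" by auto
 have sets: "{0<..<T + 1} \<in> sets lebesgue" "{0::real<..} \<in> sets lebesgue" by auto
 have m: "continuous_on UNIV (\<lambda>t. h (max 0 t))" if "continuous_on {0..} h" for h :: "real => real"
  by (rule continuous_on_compose2[OF that]) (auto intro!: continuous_intros)
 have bv: "nrm MC (?f t) \<le> max (nrm MC (v 0)) (nrm MC v0)" for t
  using v_bound[of t] by (cases "0 < t") (auto simp: max_def)
 have bu: "nrm MC (?g t) \<le> max (nrm MC (\<lambda>x. u 0 (horiz x))) (sqrt L * nrm MD u0)" for t
 proof (cases "0 < t")
  case True
  have "sqrt L * nrm MD (u t) \<le> sqrt L * nrm MD u0" using u_bound[OF True] L by (intro mult_left_mono) simp_all
  then show ?thesis using True nrm_lift[OF u_sq, of t] by simp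
 next
  case False
  then show ?thesis by (simp add: max_def)
 qed
 note wm = wmeas_subset[OF _ sub] and si = integrable_lebesgue_on_subset[OF _ sub sets]
 have "ip MC (?f T) (?g T) - ip MC (?f 0) (?g 0) =
  ts.diag_int (\<lambda>p. ip MC (K (fst p)) (GU (snd p))) + ts.diag_int (\<lambda>p. ip MC (gv (fst p)) (J (snd p)))"
 proof (rule ts.lions_magenes[OF lmeasurable_cylinder])
  show "sq_int MC (?f t)" for t by (rule v_sq) simp
  show "sq_int MC (?g t)" for t by (rule lift_sq_int(1)[OF u_sq]) simp
  show "continuous_on UNIV (\<lambda>t. ip MC (?f t) w)" if "sq_int MC w" for w by (rule m[OF v_cont[OF that]])
  show "continuous_on UNIV (\<lambda>t. ip MC (?g t) w)" if "sq_int MC w" for w by (rule m[OF U_cont[OF that]])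
  show "nrm MC (?f t) \<le> max (nrm MC (v 0)) (nrm MC v0)" for t by (rule bv)
  show "nrm MC (?g t) \<le> max (nrm MC (\<lambda>x. u 0 (horiz x))) (sqrt L * nrm MD u0)" for t by (rule bu)
  show "wmeas ts.N MC K" "wmeas ts.N MC GU" "wmeas ts.N MC J" "wmeas ts.N MC gv"
   by (rule wm, rule K_reg GU_wmeas J_reg v_reg)+
  show "sq_int MC (K t)" "sq_int MC (GU t)" "sq_int MC (J t)" "sq_int MC (gv t)" for t
   by (rule K_reg grad_closureD(2)[OF U_reg] J_reg grad_closureD(2)[OF v_reg(2)])+
  show "integrable ts.N (\<lambda>t. (nrm MC (K t))\<^sup>2)" "integrable ts.N (\<lambda>t. (nrm MC (GU t))\<^sup>2)"
   "integrable ts.N (\<lambda>t. (nrm MC (J t))\<^sup>2)" "integrable ts.N (\<lambda>t. (nrm MC (gv t))\<^sup>2)"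
   by (rule si, rule K_reg GU_integrable J_reg v_reg)+
  have p: "AE t in ts.N. 0 < t" by (rule AE_I2) simp
  have "AE t in ts.N. fu t = u t \<and> gu t = weak_gradient D (u t)" by (rule AE_lebesgue_on_mono[OF u_reg(1) sub sets])
  with p show "AE t in ts.N. \<forall>a b. 0 \<le> a \<longrightarrow> a \<le> b \<longrightarrow> b < T + 1 \<longrightarrow>
   (LINT s|ts.N. indicator {a<..<b} s * ip MC (K s) (GU t)) = ip MC (?f b) (?g t) - ip MC (?f a) (?g t)"
  proof eventually_elim
   case (elim t)
   then have e: "u (max 0 t) = fu t" by simp
   show ?case
   proof (intro allI impI)
    fix a b :: real assume ab: "0 \<le> a" "a \<le> b" "b < T + 1"
    have "(LINT s|ts.N. indicator {a<..<b} s * ip MC (K s) (GU t)) =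
      (LINT s|lebesgue_on {0<..<b}. ip MC (K s) (GU t)) - (LINT s|lebesgue_on {0<..<a}. ip MC (K s) (GU t))"
     by (rule interval_integral_diff[OF momentum_integrable(2)[OF K_reg grad_closureD(2)[OF U_reg]]]) (use ab in simp_all)
    then show "(LINT s|ts.N. indicator {a<..<b} s * ip MC (K s) (GU t)) = ip MC (?f b) (?g t) - ip MC (?f a) (?g t)"
     using v_pairing[OF u_reg(2)[of t], of a] v_pairing[OF u_reg(2)[of t], of b] ab unfolding e GU_def by simp
   qed
  qed
  have "AE t in ts.N. fv t = v t \<and> gv t = weak_gradient C (v t)" by (rule AE_lebesgue_on_mono[OF v_reg(1) sub sets])
  with p show "AE s in ts.N. \<forall>a b. 0 \<le> a \<longrightarrow> a \<le> b \<longrightarrow> b < T + 1 \<longrightarrow>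
   (LINT t|ts.N. indicator {a<..<b} t * ip MC (gv s) (J t)) = ip MC (?f s) (?g b) - ip MC (?f s) (?g a)"
  proof eventually_elim
   case (elim s)
   then have e: "?f s = fv s" by simp
   show ?case
   proof (intro allI impI)
    fix a b :: real assume ab: "0 \<le> a" "a \<le> b" "b < T + 1"
    have "(LINT t|ts.N. indicator {a<..<b} t * ip MC (J t) (gv s)) =
      (LINT t|lebesgue_on {0<..<b}. ip MC (J t) (gv s)) - (LINT t|lebesgue_on {0<..<a}. ip MC (J t) (gv s))"
     by (rule interval_integral_diff[OF momentum_integrable(2)[OF J_reg grad_closureD(2)[OF v_reg(2)]]]) (use ab in simp_all)
    then show "(LINT t|ts.N. indicator {a<..<b} t * ip MC (gv s) (J t)) = ip MC (?f s) (?g b) - ip MC (?f s) (?g a)"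
     using u_pairing[OF v_reg(2)[of s], of a] u_pairing[OF v_reg(2)[of s], of b] ab
     unfolding e ip_commute[of MC "gv s"] ip_commute[of MC "fv s"] by simp
   qed
  qed
 qed
 moreover have "ts.diag_int q = (LINT s|lebesgue_on {0<..<T}. q (s, s))" for q
 proof -
  have "ts.diag_int q = (LINT s|ts.N. indicator {0<..<T} s * q (s, s))"
   unfolding ts.diag_int_def by (rule Bochner_Integration.integral_cong) (auto simp: indicator_def)
  also have "\<dots> = (LINT s|lebesgue_on {0<..<T}. q (s, s))" by (rule integral_lebesgue_on_subset) auto
  finally show ?thesis .
 qed
 ultimately show ?thesis using T initial_pairing by simp
qed

definition "W t = (\<lambda>x. v t x - u t (horiz x))"
definition "W0 = (\<lambda>x. v0 x - u0 (horiz x))"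
text \<open>The coefficient of |w|^2 left over by \<open>young_quartic\<close>, formed with the
  regularized field and gradient so that it is measurable in time.\<close>

definition "weight t = 27 / (32 * \<nu> ^ 3) * ((nrm MD (fu t))\<^sup>2 * (nrm MD (gu t))\<^sup>2)"

text \<open>The viscous parts of \<open>K\<close> and \<open>J\<close> contribute 4 \<nu> <grad v,
  grad u>, which completes the two dissipation terms to -2 \<nu> |grad w|^2. The flux parts are
  bounded by \<open>nonlinear_cancellation\<close>, and the first summand of
  \<open>young_quartic\<close> is exactly what the dissipation absorbs.\<close>

lemma dissipation_bound:
 shows "- 2 * \<nu> * (nrm MC (gv t))\<^sup>2 - 2 * \<nu> * (nrm MC (GU t))\<^sup>2 - 2 * ip MC (K t) (GU t) - 2 * ip MC (gv t) (J t)
  \<le> weight t * (dst MC (fv t) (U t))\<^sup>2"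
proof -
 note vD = grad_closureD[OF v_reg(2)[of t]] and UD = grad_closureD[OF U_reg[of t]]
 have F: "sq_int MC (flux (fv t))" "sq_int MC (flux (U t))"
  by (rule flux_sq_int(1)[OF vD(1) ladyzhenskaya(1)[OF v_reg(2)]] flux_sq_int(1)[OF UD(1) ladyzhenskaya(1)[OF U_reg]])+
 define X where "X = dst MC (gv t) (GU t)"
 define w where "w = dst MC (fv t) (U t)"
 define a where "a = nrm MD (fu t) * nrm MD (gu t)"
 define n where "n = ip MC (flux (fv t)) (GU t) + ip MC (flux (U t)) (gv t)"
 have pos: "0 \<le> X" "0 \<le> w" "0 \<le> a" by (simp_all add: X_def w_def a_def nrm_nonneg)
 have k: "ip MC (K t) (GU t) = ip MC (flux (fv t)) (GU t) - \<nu> * ip MC (gv t) (GU t)"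
  using ip_diff_left[OF F(1) sq_int_scaleR[OF vD(2)] UD(2), of \<nu>] by (simp add: K_def momentum_def)
 have j: "ip MC (gv t) (J t) = ip MC (flux (U t)) (gv t) - \<nu> * ip MC (gv t) (GU t)"
  using ip_diff_left[OF F(2) sq_int_scaleR[OF UD(2)] vD(2), of \<nu>]
  unfolding ip_commute[of MC "gv t"] by (simp add: J_def momentum_def)
 have x: "X\<^sup>2 = (nrm MC (gv t))\<^sup>2 + (nrm MC (GU t))\<^sup>2 - 2 * ip MC (gv t) (GU t)"
  unfolding X_def by (rule nrm_diff_sq[OF vD(2) UD(2)])
 have "\<bar>n\<bar> \<le> X * sqrt (2 * (w * X) * a)"
  using nonlinear_cancellation(2)[OF v_reg(2)[of t] u_reg(2)[of t]]
  by (simp only: n_def X_def w_def a_def U_def GU_def)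
 also have "2 * (w * X) * a = 2 * ((w * a) * X)" by simp
 finally have "- 2 * n \<le> 2 * (X * sqrt (2 * ((w * a) * X)))" by linarith
 also have "\<dots> \<le> 2 * \<nu> * X\<^sup>2 + 27 / (32 * \<nu> ^ 3) * (w * a)\<^sup>2"
  by (rule young_quartic[OF \<nu> pos(1)]) (use pos in simp)
 finally have "- 2 * \<nu> * X\<^sup>2 - 2 * n \<le> 27 / (32 * \<nu> ^ 3) * (w * a)\<^sup>2" by linarith
 also have "\<dots> = weight t * w\<^sup>2" by (simp add: weight_def a_def power_mult_distrib)
 finally have "- 2 * \<nu> * X\<^sup>2 - 2 * n \<le> weight t * w\<^sup>2" .
 then show ?thesis unfolding x k j n_def w_def by (simp add: algebra_simps)
qed

text \<open>At \<open>t = 0\<close> the energy inequalities say nothing, hence the value \<open>0\<close>.\<close>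

definition "y t = (if 0 < t then (nrm MC (W t))\<^sup>2 else 0)"

lemma y_reg: "AE t in lebesgue_on {0<..<T}. (dst MC (fv t) (U t))\<^sup>2 = y t"
proof (rule AE_lebesgue_on_mono[of _ "{0<..}"])
 have "AE t in Ninf. 0 < t" by (rule AE_I2) simp
 with v_reg(1) u_reg(1) show "AE t in Ninf. (dst MC (fv t) (U t))\<^sup>2 = y t"
  by eventually_elim (simp add: y_def W_def U_def)
qed auto

text \<open>As |u| stays below |u0|, the weight is dominated by a multiple of |grad u|^2; and
  \<open>y\<close> agrees almost everywhere with a measurable function that the energy bounds keep
  bounded.\<close>

lemma weight_integrable: "integrable (lebesgue_on {0<..<T}) weight" "integrable (lebesgue_on {0<..<T}) (\<lambda>t. weight t * y t)"
proof -
 let ?N = "lebesgue_on {0<..<T}"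
 have sub: "{0<..<T} \<subseteq> {0<..}" by auto
 let ?c = "27 / (32 * \<nu> ^ 3)"
 have c: "0 \<le> ?c" using \<nu> by simp
 have gi: "integrable ?N (\<lambda>t. (nrm MD (gu t))\<^sup>2)" by (rule integrable_lebesgue_on_subset[OF u_reg(5) sub]) auto
 have wm: "weight \<in> borel_measurable ?N"
  unfolding weight_def[abs_def]
  by (intro borel_measurable_times borel_measurable_const borel_measurable_power measurable_lebesgue_on_subset[OF _ sub]
    nrm_measurable[OF lmeasurable_D u_reg(3) grad_closureD(1)[OF u_reg(2)]] nrm_measurable[OF lmeasurable_D u_reg(4) grad_closureD(2)[OF u_reg(2)]])
 have wb: "0 \<le> weight t" "weight t \<le> ?c * (nrm MD u0)\<^sup>2 * (nrm MD (gu t))\<^sup>2" for t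
 proof -
  show "0 \<le> weight t" unfolding weight_def using c by (intro mult_nonneg_nonneg) simp_all
  have "(nrm MD (fu t))\<^sup>2 \<le> (nrm MD u0)\<^sup>2" by (rule power_mono[OF fu_bound nrm_nonneg])
  then have "?c * ((nrm MD (fu t))\<^sup>2 * (nrm MD (gu t))\<^sup>2) \<le> ?c * ((nrm MD u0)\<^sup>2 * (nrm MD (gu t))\<^sup>2)"
   using c by (intro mult_left_mono mult_right_mono) simp_all
  then show "weight t \<le> ?c * (nrm MD u0)\<^sup>2 * (nrm MD (gu t))\<^sup>2" by (simp only: weight_def mult.assoc)
 qed
 show i: "integrable ?N weight"
 proof (rule Bochner_Integration.integrable_bound[OF _ wm])
  show "integrable ?N (\<lambda>t. ?c * (nrm MD u0)\<^sup>2 * (nrm MD (gu t))\<^sup>2)" using gi by simp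
  show "AE t in ?N. norm (weight t) \<le> norm (?c * (nrm MD u0)\<^sup>2 * (nrm MD (gu t))\<^sup>2)"
   by (rule AE_I2) (use wb order_trans[OF wb(2) abs_ge_self] in simp)
 qed
 define z where "z t = (dst MC (fv t) (U t))\<^sup>2" for t
 have zm: "z \<in> borel_measurable ?N"
  unfolding z_def[abs_def]
  by (intro borel_measurable_power measurable_lebesgue_on_subset[OF _ sub] nrm_measurable[OF lmeasurable_cylinder]
    wmeas_diff v_reg(3) U_wmeas sq_int_diff grad_closureD(1)[OF v_reg(2)] grad_closureD(1)[OF U_reg])
 have ym: "y \<in> borel_measurable ?N"
  by (rule measurable_lebesgue_on_AE[OF zm _ y_reg[folded z_def]]) auto
 let ?B = "(nrm MC v0 + sqrt L * nrm MD u0)\<^sup>2"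
 have zB: "z t \<le> ?B" for t
  unfolding z_def
 proof (rule power_mono[OF _ nrm_nonneg])
  show "dst MC (fv t) (U t) \<le> nrm MC v0 + sqrt L * nrm MD u0"
   using nrm_triangle_diff[OF grad_closureD(1)[OF v_reg(2)] grad_closureD(1)[OF U_reg], of t t] fv_bound[of t] U_bound[of t]
   by linarith
 qed
 show "integrable ?N (\<lambda>t. weight t * y t)"
 proof (rule Bochner_Integration.integrable_bound)
  show "integrable ?N (\<lambda>t. weight t * ?B)" using i by simp
  show "(\<lambda>t. weight t * y t) \<in> borel_measurable ?N" by (intro borel_measurable_times wm ym)
  show "AE t in ?N. norm (weight t * y t) \<le> norm (weight t * ?B)"
   using y_reg[of T, folded z_def]
  proof eventually_elim
   case (elim t)
   have "0 \<le> z t" by (simp add: z_def)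
   then show ?case using zB[of t] wb(1)[of t] unfolding elim[symmetric]
    by (simp add: abs_mult mult_left_mono)
  qed
 qed
qed

text \<open>Expand |v - u|^2. The squares are controlled by the energy inequalities, that of
  \<open>u\<close> being multiplied by \<open>L\<close> to pass from \<open>D\<close> to the
  cylinder; the product, about which these inequalities say nothing, is evaluated by
  \<open>energy_pairing\<close>.\<close>

lemma energy_difference:
 assumes T: "0 < T"
 shows "(nrm MC (W T))\<^sup>2 \<le> (nrm MC W0)\<^sup>2 + (LINT t|lebesgue_on {0<..<T}. weight t * y t)"
proof -
 let ?N = "lebesgue_on {0<..<T}"
 have sub: "{0<..<T} \<subseteq> {0<..}" by auto
 have sets: "{0<..<T} \<in> sets lebesgue" "{0::real<..} \<in> sets lebesgue" by auto
 note wm = wmeas_subset[OF _ sub] and si = integrable_lebesgue_on_subset[OF _ sub sets]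
 have us: "sq_int MC (lift (u T))" "sq_int MC (lift u0)"
  using lift_sq_int(1)[OF u_sq, of T] lift_sq_int(1)[OF u0_sq] T by simp_all
 have W: "(nrm MC (W T))\<^sup>2 = (nrm MC (v T))\<^sup>2 + L * (nrm MD (u T))\<^sup>2 - 2 * ip MC (v T) (lift (u T))"
  unfolding W_def using nrm_diff_sq[OF v_sq us(1)] lift_sq_int(2)[OF u_sq, of T] T by simp
 have W0: "(nrm MC W0)\<^sup>2 = (nrm MC v0)\<^sup>2 + L * (nrm MD u0)\<^sup>2 - 2 * ip MC v0 (lift u0)"
  unfolding W0_def using nrm_diff_sq[OF v0_sq us(2)] lift_sq_int(2)[OF u0_sq] by simp
 have i1: "integrable ?N (\<lambda>t. (nrm MC (gv t))\<^sup>2)" by (rule si, rule v_reg)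
 have i2: "integrable ?N (\<lambda>t. (nrm MC (GU t))\<^sup>2)" by (rule si, rule GU_integrable)
 note gvs = grad_closureD(2)[OF v_reg(2)] and GUs = grad_closureD(2)[OF U_reg]
 have i3: "integrable ?N (\<lambda>t. ip MC (K t) (GU t))"
  by (rule ip_diag_integrable[OF lmeasurable_cylinder wm[OF K_reg(1)] K_reg(2) si[OF K_reg(3)] wm[OF GU_wmeas] GUs i2])
 have i4: "integrable ?N (\<lambda>t. ip MC (gv t) (J t))"
  by (rule ip_diag_integrable[OF lmeasurable_cylinder wm[OF v_reg(4)] gvs i1 wm[OF J_reg(1)] J_reg(2) si[OF J_reg(3)]])
 have "L * ((nrm MD (u T))\<^sup>2 + 2 * \<nu> * (LINT t|?N. (nrm MD (gu t))\<^sup>2)) \<le> L * (nrm MD u0)\<^sup>2"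
  using u_energy[OF T] L by (intro mult_left_mono) simp_all
 then have "L * (nrm MD (u T))\<^sup>2 + 2 * \<nu> * (LINT t|?N. (nrm MC (GU t))\<^sup>2) \<le> L * (nrm MD u0)\<^sup>2"
  by (simp add: GU_nrm algebra_simps)
 then have "(nrm MC (W T))\<^sup>2 \<le> (nrm MC W0)\<^sup>2 - 2 * \<nu> * (LINT t|?N. (nrm MC (gv t))\<^sup>2) - 2 * \<nu> * (LINT t|?N. (nrm MC (GU t))\<^sup>2)
   - 2 * (LINT t|?N. ip MC (K t) (GU t)) - 2 * (LINT t|?N. ip MC (gv t) (J t))"
  using v_energy[OF T] energy_pairing[OF T] W W0 by linarith
 also have "\<dots> = (nrm MC W0)\<^sup>2 + (LINT t|?N. - 2 * \<nu> * (nrm MC (gv t))\<^sup>2 - 2 * \<nu> * (nrm MC (GU t))\<^sup>2 - 2 * ip MC (K t) (GU t) - 2 * ip MC (gv t) (J t))"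
  using i1 i2 i3 i4 by simp
 also have "\<dots> \<le> (nrm MC W0)\<^sup>2 + (LINT t|?N. weight t * y t)"
 proof (rule add_left_mono, rule integral_mono_AE)
  show "integrable ?N (\<lambda>t. - 2 * \<nu> * (nrm MC (gv t))\<^sup>2 - 2 * \<nu> * (nrm MC (GU t))\<^sup>2 - 2 * ip MC (K t) (GU t) - 2 * ip MC (gv t) (J t))"
   using i1 i2 i3 i4 by simp
  show "integrable ?N (\<lambda>t. weight t * y t)" by (rule weight_integrable(2))
  show "AE t in ?N. - 2 * \<nu> * (nrm MC (gv t))\<^sup>2 - 2 * \<nu> * (nrm MC (GU t))\<^sup>2 - 2 * ip MC (K t) (GU t) - 2 * ip MC (gv t) (J t) \<le> weight t * y t"
   using y_reg[of T]
  proof eventually_elim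
   case (elim t)
   show ?case using dissipation_bound[of t] unfolding elim .
  qed
 qed
 finally show ?thesis .
qed

text \<open>The energy inequality bounds |u| by |u0| and the time integral of |grad u|^2 by |u0|^2 /
  (2 \<nu>); the constant is 27/(32 \<nu>^3) times 1/(2 \<nu>).\<close>

lemma weight_bound: "0 < T ==> (LINT t|lebesgue_on {0<..<T}. weight t) \<le> 27 / (64 * \<nu> ^ 4) * (nrm MD u0) ^ 4"
proof -
 assume T: "0 < T"
 let ?N = "lebesgue_on {0<..<T}" and ?c = "27 / (32 * \<nu> ^ 3)" and ?I = "\<integral>t. (nrm MD (gu t))\<^sup>2 \<partial>lebesgue_on {0<..<T}"
 have c: "0 \<le> ?c" using \<nu> by simp
 have sub: "{0<..<T} \<subseteq> {0<..}" by auto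
 have gi: "integrable ?N (\<lambda>t. (nrm MD (gu t))\<^sup>2)" by (rule integrable_lebesgue_on_subset[OF u_reg(5) sub]) auto
 have "(LINT t|?N. weight t) \<le> (LINT t|?N. ?c * (nrm MD u0)\<^sup>2 * (nrm MD (gu t))\<^sup>2)"
 proof (rule integral_mono[OF weight_integrable(1)])
  show "integrable ?N (\<lambda>t. ?c * (nrm MD u0)\<^sup>2 * (nrm MD (gu t))\<^sup>2)" using gi by simp
  fix t
  have "(nrm MD (fu t))\<^sup>2 \<le> (nrm MD u0)\<^sup>2" by (rule power_mono[OF fu_bound nrm_nonneg])
  then have "?c * ((nrm MD (fu t))\<^sup>2 * (nrm MD (gu t))\<^sup>2) \<le> ?c * ((nrm MD u0)\<^sup>2 * (nrm MD (gu t))\<^sup>2)"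
   using c by (intro mult_left_mono mult_right_mono) simp_all
  then show "weight t \<le> ?c * (nrm MD u0)\<^sup>2 * (nrm MD (gu t))\<^sup>2" by (simp only: weight_def mult.assoc)
 qed
 also have "\<dots> = ?c * (nrm MD u0)\<^sup>2 * ?I" by simp
 also have "\<dots> \<le> ?c * (nrm MD u0)\<^sup>2 * ((nrm MD u0)\<^sup>2 / (2 * \<nu>))"
 proof (rule mult_left_mono)
  have "0 \<le> (nrm MD (u T))\<^sup>2" by simp
  with u_energy[OF T] have "2 * \<nu> * ?I \<le> (nrm MD u0)\<^sup>2" by linarith
  then show "?I \<le> (nrm MD u0)\<^sup>2 / (2 * \<nu>)" using \<nu> by (simp add: pos_le_divide_eq mult.commute)
 qed (use c in simp)
 also have "\<dots> = 27 / (64 * \<nu> ^ 4) * (nrm MD u0) ^ 4"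
  using \<nu> by (simp add: field_simps power2_eq_square power3_eq_cube power4_eq_xxxx)
 finally show ?thesis .
qed

lemma difference_bound_pos:
 assumes T: "0 < T"
 shows "(nrm MC (W T))\<^sup>2 \<le> (nrm MC W0)\<^sup>2 * exp (27 / (64 * \<nu> ^ 4) * (nrm MD u0) ^ 4)"
proof -
 have "y T \<le> (nrm MC W0)\<^sup>2 * exp (LINT t|lebesgue_on {0<..<T}. weight t)"
 proof (rule gronwall_integral)
  show "0 \<le> weight t" for t unfolding weight_def using \<nu> by simp
  show "y t \<le> (nrm MC W0)\<^sup>2 + (LINT s|lebesgue_on {0<..<t}. weight s * y s)" if "0 \<le> t" for t
  proof (cases "0 < t")
   case True
   then show ?thesis using energy_difference[OF True] by (simp add: y_def)
  next
   case False
   then have "{0<..<t} = {}" by simp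
   then show ?thesis using False by (simp add: y_def integral_eq_zero_AE)
  qed
 qed (use T weight_integrable in \<open>simp_all add: y_def\<close>)
 also have "\<dots> \<le> (nrm MC W0)\<^sup>2 * exp (27 / (64 * \<nu> ^ 4) * (nrm MD u0) ^ 4)"
  using weight_bound[OF T] by (intro mult_left_mono) simp_all
 finally show ?thesis using T by (simp add: y_def)
qed

text \<open>At time 0 the energy inequality is silent, but the norm is weakly lower semicontinuous:
  with \<open>E\<close> the bound for positive times, |W 0|^2 is the limit of <W \<tau>_n, W 0> as
  \<tau>_n decreases to 0, hence at most sqrt E |W 0|.\<close>

lemma difference_bound:
 assumes T: "0 \<le> T"
 shows "(nrm MC (W T))\<^sup>2 \<le> (nrm MC W0)\<^sup>2 * exp (27 / (64 * \<nu> ^ 4) * (nrm MD u0) ^ 4)"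
proof (cases "0 < T")
 case True
 then show ?thesis by (rule difference_bound_pos)
next
 case False
 then have T0: "T = 0" using T by simp
 define E where "E = (nrm MC W0)\<^sup>2 * exp (27 / (64 * \<nu> ^ 4) * (nrm MD u0) ^ 4)"
 have E: "0 \<le> E" by (simp add: E_def)
 define \<tau> where "\<tau> n = 1 / real (Suc n)" for n
 have \<tau>: "0 < \<tau> n" for n by (simp add: \<tau>_def)
 have \<tau>0: "\<tau> ----> 0" unfolding \<tau>_def[abs_def] by (rule LIMSEQ_Suc[OF lim_const_over_n])
 have us: "sq_int MC (lift (u t))" if "0 \<le> t" for t by (rule lift_sq_int(1)[OF u_sq[OF that]])
 have Ws: "sq_int MC (W t)" if "0 \<le> t" for t unfolding W_def by (rule sq_int_diff[OF v_sq[OF that] us[OF that]])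
 have W0s: "sq_int MC (W 0)" by (rule Ws) simp
 have "continuous_on {0..} (\<lambda>t. ip MC (v t) (W 0) - ip MC (lift (u t)) (W 0))"
  by (intro continuous_on_diff v_cont U_cont W0s)
 then have c: "continuous_on {0..} (\<lambda>t. ip MC (W t) (W 0))"
  by (rule continuous_on_eq) (simp add: W_def ip_diff_left[OF v_sq us W0s[unfolded W_def]])
 have "(\<lambda>n. ip MC (W (\<tau> n)) (W 0)) ----> ip MC (W 0) (W 0)"
  by (rule continuous_on_tendsto_compose[OF c \<tau>0]) (use \<tau> in \<open>simp_all add: less_imp_le\<close>)
 moreover have "ip MC (W (\<tau> n)) (W 0) \<le> sqrt E * nrm MC (W 0)" for n
 proof -
  have "ip MC (W (\<tau> n)) (W 0) \<le> nrm MC (W (\<tau> n)) * nrm MC (W 0)"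
   using CS_inner[OF Ws[OF less_imp_le[OF \<tau>]] W0s, of n] by linarith
  also have "\<dots> \<le> sqrt E * nrm MC (W 0)"
   using difference_bound_pos[OF \<tau>, of n] unfolding E_def[symmetric]
   by (intro mult_right_mono real_le_rsqrt nrm_nonneg)
  finally show ?thesis .
 qed
 ultimately have "ip MC (W 0) (W 0) \<le> sqrt E * nrm MC (W 0)" by (intro LIMSEQ_le_const2) blast+
 then have "nrm MC (W 0) * nrm MC (W 0) \<le> sqrt E * nrm MC (W 0)" by (simp add: nrm_sq_ip[symmetric] power2_eq_square)
 then have "nrm MC (W 0) \<le> sqrt E"
  using nrm_nonneg[of MC "W 0"] E by (cases "nrm MC (W 0) = 0") simp_all
 from power_mono[OF this nrm_nonneg, of 2] show ?thesis using E by (simp add: T0 E_def)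
qed

end

theorem theorem3p1:
  fixes \<nu> L :: real
    and D :: "(real^2) set"
    and u0 :: "real^2 \<Rightarrow> real^3" and u :: "real \<Rightarrow> real^2 \<Rightarrow> real^3"
    and v0 :: "real^3 \<Rightarrow> real^3" and v :: "real \<Rightarrow> real^3 \<Rightarrow> real^3"
  assumes "\<nu> > 0" and "bounded_smooth_domain D"
    and "u0 \<in> H_D D" and "weak_solution_2half D \<nu> u0 u"
    and "L > 0"
    and "v0 \<in> H_C D L" and "leray_hopf_solution D L \<nu> v0 v"
    and "v \<in> L2_time (cylinder D L) {0<..} (V_C D L)"
  shows "\<forall>t\<ge>0. (L2_norm (cylinder D L) (\<lambda>x. v t x - u t (horiz x)))\<^sup>2
      \<le> (L2_norm (cylinder D L) (\<lambda>x. v0 x - u0 (horiz x)))\<^sup>2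
         * exp (27 / (64 * \<nu> ^ 4) * (L2_norm D u0) ^ 4)"
proof -
  interpret comparison D L \<nu> u0 u v0 v
    by unfold_locales (use assms in \<open>simp_all add: bounded_smooth_domain_def\<close>)
  show ?thesis using difference_bound unfolding W_def W0_def L2_norm_eq by blast
qed

end
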